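(* Let $E_h,S_h,T_h\in\mathbb V_h^k$ be the numerical solutions of the semi-discrete discontinuous Galerkin scheme on rectangular meshes described in the context, for the two-dimensional stochastic Maxwell system $$dE-T_x\,dt+S_y\,dt=f(\mathbf x,t,\boldsymbol u)\,dW_t,\qquad dS+E_y\,dt=g(\mathbf x,t,\boldsymbol u)\,dW_t,\qquad dT-E_x\,dt=r(\mathbf x,t,\boldsymbol u)\,dW_t,$$ $\boldsymbol u=(E,S,T)$, with periodic boundary conditions. Then $$\mathbb E\Big(\|E_h(x,y,t)\|^2+\|S_h(x,y,t)\|^2+\|T_h(x,y,t)\|^2\Big)=\|E_h(x,y,0)\|^2+\|S_h(x,y,0)\|^2+\|T_h(x,y,0)\|^2+\int_0^t\mathbb E\big(\|\mathcal P(f)\|^2+\|\mathcal P(g)\|^2+\|\mathcal P(r)\|^2\big)\,d\tau,$$ where $\mathcal P(f),\mathcal P(g),\mathcal P(r)$ are the $L^2$ projections onto $\mathbb V_h^k$ of $f,g,r$ evaluated at $(\cdot,\tau,\boldsymbol u_h)$, $\boldsymbol u_h=(E_h,S_h,T_h)$.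
   Context: $W_t$ is a standard one-dimensional Brownian motion on a probability space with its filtration; stochastic integrals are Itô integrals. $\mathbf x=(x,y)$. The functions $f,g,r$ are smooth, real-valued, and satisfy for some constant $C$ and all arguments $|f(\mathbf x,t,\boldsymbol u_1)-f(\mathbf x,t,\boldsymbol u_2)|+|g(\mathbf x,t,\boldsymbol u_1)-g(\mathbf x,t,\boldsymbol u_2)|+|r(\mathbf x,t,\boldsymbol u_1)-r(\mathbf x,t,\boldsymbol u_2)|\le C|\boldsymbol u_1-\boldsymbol u_2|$, $|f(\mathbf x,t,\boldsymbol u)|+|g(\mathbf x,t,\boldsymbol u)|+|r(\mathbf x,t,\boldsymbol u)|\le C(1+|E|+|S|+|T|)$. Mesh and space: the rectangle $I\times J$ is partitioned into cells $I_i\times J_j=[x_{i-\frac12},x_{i+\frac12}]\times[y_{j-\frac12},y_{j+\frac12}]$, $1\le i\le N_x$, $1\le j\le N_y$, with periodic identification of the boundary. $\mathbb V_h^k=\{w: w|_{I_i\times J_j}\in Q^k(I_i\times J_j)=P^k(I_i)\otimes P^k(J_j)\ \forall i,j\}$, where $P^k$ denotes polynomials of degree at most $k$. $\|\cdot\|$ is the $L^2(I\times J)$ norm. At a cell interface $q^+$ is the limit from the right (in $x$) or from above (in $y$), $q^-$ the limit from the left or below, $\{q\}=(q^++q^-)/2$, $[q]=q^+-q^-$. For $\alpha\in\{\pm\alpha_1,\pm\alpha_2\}\subset\mathbb R$ the numerical flux is $\widehat{q_\alpha}=\{q\}+\alpha[q]$. For $p,q\in\mathbb V_h^k$, $$\mathcal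 A_{I_i}(p,q;\alpha)=\int_{I_i}pq_x\,dx-(\widehat{p_\alpha}q^-)_{i+\frac12,y}+(\widehat{p_\alpha}q^+)_{i-\frac12,y},\qquad \mathcal A_{J_j}(p,q;\alpha)=\int_{J_j}pq_y\,dy-(\widehat{p_\alpha}q^-)_{x,j+\frac12}+(\widehat{p_\alpha}q^+)_{x,j-\frac12}.$$ Scheme: $E_h,S_h,T_h$ are adapted $\mathbb V_h^k$-valued processes with deterministic initial data such that for all $\varphi,\psi,\phi\in\mathbb V_h^k$ and all $i,j$ (in integrated Itô form, with $f,g,r$ evaluated at $(\mathbf x,t,\boldsymbol u_h)$), $$\int_{J_j}\int_{I_i}dE_h\,\varphi\,dxdy=-\int_{J_j}\mathcal A_{I_i}(T_h,\varphi;\alpha_1)\,dydt+\int_{I_i}\mathcal A_{J_j}(S_h,\varphi;-\alpha_2)\,dxdt+\int_{J_j}\int_{I_i}f\varphi\,dxdy\,dW_t,$$ $$\int_{J_j}\int_{I_i}dS_h\,\psi\,dxdy=\int_{I_i}\mathcal A_{J_j}(E_h,\psi;\alpha_2)\,dxdt+\int_{J_j}\int_{I_i}g\psi\,dxdy\,dW_t,$$ $$\int_{J_j}\int_{I_i}dT_h\,\phi\,dxdy=-\int_{J_j}\mathcal A_{I_i}(E_h,\phi;-\alpha_1)\,dydt+\int_{J_j}\int_{I_i}r\phi\,dxdy\,dW_t.$$ *)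

theory Defs
  imports "HOL-Probability.Probability"
begin

section \<open>Stochastic calculus\<close>

text \<open>The filtration is indexed by all reals; only \<open>t \<ge> 0\<close> is used.  No usual conditions are
  imposed.\<close>

definition brownian_motion ::
    "'w measure \<Rightarrow> (real \<Rightarrow> 'w measure) \<Rightarrow> (real \<Rightarrow> 'w \<Rightarrow> real) \<Rightarrow> bool" where
  "brownian_motion M F W \<longleftrightarrow>
     (\<forall>t\<ge>0. W t \<in> borel_measurable (F t)) \<and>
     (AE \<omega> in M. W 0 \<omega> = 0) \<and>
     (\<forall>s t. 0 \<le> s \<longrightarrow> s < t \<longrightarrow>
        distributed M lborel (\<lambda>\<omega>. W t \<omega> - W s \<omega>) (normal_density 0 (sqrt (t - s))) \<and>
        prob_space.indep_set M (sets (F s))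
          {(\<lambda>\<omega>. W t \<omega> - W s \<omega>) -` A \<inter> space M | A. A \<in> sets borel}) \<and>
     (AE \<omega> in M. continuous_on {0..} (\<lambda>t. W t \<omega>))"

definition measurable_adapted ::
    "'w measure \<Rightarrow> (real \<Rightarrow> 'w measure) \<Rightarrow> (real \<Rightarrow> 'w \<Rightarrow> real) \<Rightarrow> bool" where
  "measurable_adapted M F X \<longleftrightarrow>
     (\<lambda>(t, \<omega>). X t \<omega>) \<in> borel_measurable (restrict_space borel {0..} \<Otimes>\<^sub>M M) \<and>
     (\<forall>t\<ge>0. X t \<in> borel_measurable (F t))"

definition tendsto_in_prob ::
    "'w measure \<Rightarrow> (nat \<Rightarrow> 'w \<Rightarrow> real) \<Rightarrow> ('w \<Rightarrow> real) \<Rightarrow> bool" where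
  "tendsto_in_prob M X Y \<longleftrightarrow>
     (\<forall>\<epsilon>>0. (\<lambda>m. measure M {\<omega> \<in> space M. \<bar>X m \<omega> - Y \<omega>\<bar> > \<epsilon>}) \<longlonglongrightarrow> 0)"

text \<open>The data \<open>n, \<tau>, \<xi>\<close> stand for the simple process that equals \<open>\<xi> l\<close> on \<open>(\<tau> l, \<tau> (l+1)]\<close>
  for \<open>l < n\<close>, and \<open>0\<close> elsewhere.\<close>

definition simple_data ::
    "'w measure \<Rightarrow> (real \<Rightarrow> 'w measure) \<Rightarrow> nat \<Rightarrow> (nat \<Rightarrow> real) \<Rightarrow> (nat \<Rightarrow> 'w \<Rightarrow> real) \<Rightarrow> bool" where
  "simple_data M F n \<tau> \<xi> \<longleftrightarrow>
     0 \<le> \<tau> 0 \<and> (\<forall>l<n. \<tau> l \<le> \<tau> (Suc l)) \<and>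
     (\<forall>l<n. \<xi> l \<in> borel_measurable (F (\<tau> l)) \<and> (\<exists>B. \<forall>\<omega>\<in>space M. \<bar>\<xi> l \<omega>\<bar> \<le> B))"

definition simple_process ::
    "nat \<Rightarrow> (nat \<Rightarrow> real) \<Rightarrow> (nat \<Rightarrow> 'w \<Rightarrow> real) \<Rightarrow> real \<Rightarrow> 'w \<Rightarrow> real" where
  "simple_process n \<tau> \<xi> s \<omega> = (\<Sum>l<n. \<xi> l \<omega> * indicator {\<tau> l<..\<tau> (Suc l)} s)"

definition simple_integral ::
    "(real \<Rightarrow> 'w \<Rightarrow> real) \<Rightarrow> nat \<Rightarrow> (nat \<Rightarrow> real) \<Rightarrow> (nat \<Rightarrow> 'w \<Rightarrow> real) \<Rightarrow> real \<Rightarrow> 'w \<Rightarrow> real" where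
  "simple_integral W n \<tau> \<xi> t \<omega> =
     (\<Sum>l<n. \<xi> l \<omega> * (W (min t (\<tau> (Suc l))) \<omega> - W (min t (\<tau> l)) \<omega>))"

text \<open>\<open>J\<close> is a version of the Ito integral of \<open>H\<close> over \<open>[0, t]\<close>, for measurable adapted
  integrands that are almost surely (not necessarily in mean) square integrable in time.
  The limit in probability does not depend on the approximating sequence.\<close>

definition has_ito_integral ::
    "'w measure \<Rightarrow> (real \<Rightarrow> 'w measure) \<Rightarrow> (real \<Rightarrow> 'w \<Rightarrow> real) \<Rightarrow> (real \<Rightarrow> 'w \<Rightarrow> real) \<Rightarrow> real \<Rightarrow>
     ('w \<Rightarrow> real) \<Rightarrow> bool" where
  "has_ito_integral M F W H t J \<longleftrightarrow>
     measurable_adapted M F H \<and>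
     (AE \<omega> in M. set_integrable lborel {0..t} (\<lambda>s. (H s \<omega>)\<^sup>2)) \<and>
     J \<in> borel_measurable M \<and>
     (\<exists>n \<tau> \<xi>. (\<forall>m. simple_data M F (n m) (\<tau> m) (\<xi> m)) \<and>
        tendsto_in_prob M
          (\<lambda>m \<omega>. LINT s:{0..t}|lborel. (simple_process (n m) (\<tau> m) (\<xi> m) s \<omega> - H s \<omega>)\<^sup>2) (\<lambda>_. 0) \<and>
        tendsto_in_prob M (\<lambda>m. simple_integral W (n m) (\<tau> m) (\<xi> m) t) J)"

text \<open>\<open>dX = b dt + H dW\<close> in integrated form on \<open>[0, \<infinity>)\<close>.\<close>

definition ito_differential ::
    "'w measure \<Rightarrow> (real \<Rightarrow> 'w measure) \<Rightarrow> (real \<Rightarrow> 'w \<Rightarrow> real) \<Rightarrow>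
     (real \<Rightarrow> 'w \<Rightarrow> real) \<Rightarrow> (real \<Rightarrow> 'w \<Rightarrow> real) \<Rightarrow> (real \<Rightarrow> 'w \<Rightarrow> real) \<Rightarrow> bool" where
  "ito_differential M F W X b H \<longleftrightarrow>
     (\<forall>t\<ge>0. (AE \<omega> in M. set_integrable lborel {0..t} (\<lambda>s. b s \<omega>)) \<and>
        (\<exists>J. has_ito_integral M F W H t J \<and>
           (AE \<omega> in M. X t \<omega> = X 0 \<omega> + (LINT s:{0..t}|lborel. b s \<omega>) + J \<omega>)))"

section \<open>Smooth functions\<close>

primrec Cn_on :: "nat \<Rightarrow> 'a::euclidean_space set \<Rightarrow> ('a \<Rightarrow> real) \<Rightarrow> bool" where
  "Cn_on 0 U f \<longleftrightarrow> continuous_on U f"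
| "Cn_on (Suc n) U f \<longleftrightarrow>
     (\<exists>f'. (\<forall>x\<in>U. (f has_derivative f' x) (at x)) \<and> (\<forall>v. Cn_on n U (\<lambda>x. f' x v)))"

definition smooth_on :: "'a::euclidean_space set \<Rightarrow> ('a \<Rightarrow> real) \<Rightarrow> bool" where
  "smooth_on D f \<longleftrightarrow> (\<exists>U. open U \<and> D \<subseteq> U \<and> (\<forall>n. Cn_on n U f))"

section \<open>Meshes and discontinuous Galerkin spaces\<close>

text \<open>A partition of an interval into \<open>N\<close> cells is the list of its \<open>N + 1\<close> nodes:
  \<open>xs ! i\<close> is the node \<open>x\<^bsub>i+1/2\<^esub>\<close> for \<open>0 \<le> i \<le> N\<close>, and the cells are numbered \<open>1, \<dots>, N\<close>.\<close>

definition mesh :: "real list \<Rightarrow> bool" where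
  "mesh xs \<longleftrightarrow> 2 \<le> length xs \<and> sorted_wrt (<) xs"

definition cells :: "real list \<Rightarrow> nat set" where
  "cells xs = {1..length xs - 1}"

definition cell :: "real list \<Rightarrow> nat \<Rightarrow> real set" where
  "cell xs i = {xs ! (i - 1)..xs ! i}"

definition rectangle :: "real list \<Rightarrow> real list \<Rightarrow> (real \<times> real) set" where
  "rectangle xs ys = {hd xs..last xs} \<times> {hd ys..last ys}"

definition Qk :: "nat \<Rightarrow> (real \<times> real \<Rightarrow> real) set" where
  "Qk k = {q. \<exists>c. \<forall>x y. q (x, y) = (\<Sum>a\<le>k. \<Sum>b\<le>k. c a b * x ^ a * y ^ b)}"

text \<open>Only the interiors of the cells matter: on the interfaces (a null set) an element of the
  space is double valued, and requiring polynomials on the closed cells would force continuity.\<close>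

definition Vh :: "real list \<Rightarrow> real list \<Rightarrow> nat \<Rightarrow> (real \<times> real \<Rightarrow> real) set" where
  "Vh xs ys k = {w. \<forall>i\<in>cells xs. \<forall>j\<in>cells ys. \<exists>q\<in>Qk k.
     \<forall>z\<in>interior (cell xs i \<times> cell ys j). w z = q z}"

definition L2_inner ::
    "real list \<Rightarrow> real list \<Rightarrow> (real \<times> real \<Rightarrow> real) \<Rightarrow> (real \<times> real \<Rightarrow> real) \<Rightarrow> real" where
  "L2_inner xs ys v w = (LINT z:rectangle xs ys|lebesgue. v z * w z)"

definition L2_norm :: "real list \<Rightarrow> real list \<Rightarrow> (real \<times> real \<Rightarrow> real) \<Rightarrow> real" where
  "L2_norm xs ys w = sqrt (LINT z:rectangle xs ys|lebesgue. (w z)\<^sup>2)"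

definition cell_inner ::
    "real list \<Rightarrow> real list \<Rightarrow> nat \<Rightarrow> nat \<Rightarrow> (real \<times> real \<Rightarrow> real) \<Rightarrow> (real \<times> real \<Rightarrow> real) \<Rightarrow> real" where
  "cell_inner xs ys i j v w = (LINT z:cell xs i \<times> cell ys j|lebesgue. v z * w z)"

text \<open>The projection is unique only up to values on a null set, hence the choice operator.\<close>

definition L2_proj ::
    "real list \<Rightarrow> real list \<Rightarrow> nat \<Rightarrow> (real \<times> real \<Rightarrow> real) \<Rightarrow> (real \<times> real \<Rightarrow> real)" where
  "L2_proj xs ys k h =
     (SOME p. p \<in> Vh xs ys k \<and> (\<forall>\<phi>\<in>Vh xs ys k. L2_inner xs ys p \<phi> = L2_inner xs ys h \<phi>))"

text \<open>One-sided limits at node \<open>i\<close>, the first and the last node being identified.\<close>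

definition trace_right :: "real list \<Rightarrow> nat \<Rightarrow> (real \<Rightarrow> real) \<Rightarrow> real" where
  "trace_right xs i q = Lim (at_right (if i = length xs - 1 then hd xs else xs ! i)) q"

definition trace_left :: "real list \<Rightarrow> nat \<Rightarrow> (real \<Rightarrow> real) \<Rightarrow> real" where
  "trace_left xs i q = Lim (at_left (if i = 0 then last xs else xs ! i)) q"

definition flux :: "real list \<Rightarrow> real \<Rightarrow> nat \<Rightarrow> (real \<Rightarrow> real) \<Rightarrow> real" where
  "flux xs \<alpha> i q =
     (trace_right xs i q + trace_left xs i q) / 2 + \<alpha> * (trace_right xs i q - trace_left xs i q)"

definition dg_form :: "real list \<Rightarrow> nat \<Rightarrow> (real \<Rightarrow> real) \<Rightarrow> (real \<Rightarrow> real) \<Rightarrow> real \<Rightarrow> real" where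
  "dg_form xs i p q \<alpha> =
     (LINT x:cell xs i|lebesgue. p x * deriv q x)
     - flux xs \<alpha> i p * trace_left xs i q
     + flux xs \<alpha> (i - 1) p * trace_right xs (i - 1) q"

text \<open>\<open>dg_form_x\<close> is \<open>\<A>\<^bsub>I_i\<^esub>(p, q; \<alpha>)\<close> as a function of \<open>y\<close>; \<open>dg_form_y\<close> is \<open>\<A>\<^bsub>J_j\<^esub>(p, q; \<alpha>)\<close> as a
  function of \<open>x\<close>.\<close>

definition dg_form_x ::
    "real list \<Rightarrow> nat \<Rightarrow> (real \<times> real \<Rightarrow> real) \<Rightarrow> (real \<times> real \<Rightarrow> real) \<Rightarrow> real \<Rightarrow> real \<Rightarrow> real" where
  "dg_form_x xs i p q \<alpha> y = dg_form xs i (\<lambda>x. p (x, y)) (\<lambda>x. q (x, y)) \<alpha>"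

definition dg_form_y ::
    "real list \<Rightarrow> nat \<Rightarrow> (real \<times> real \<Rightarrow> real) \<Rightarrow> (real \<times> real \<Rightarrow> real) \<Rightarrow> real \<Rightarrow> real \<Rightarrow> real" where
  "dg_form_y ys j p q \<alpha> x = dg_form ys j (\<lambda>y. p (x, y)) (\<lambda>y. q (x, y)) \<alpha>"

text \<open>Measurability with respect to the Borel sets of the finite-dimensional space \<open>Vh xs ys k\<close>
  amounts to measurability of all \<open>L\<^sup>2\<close> products with its elements.\<close>

definition Vh_process ::
    "'w measure \<Rightarrow> (real \<Rightarrow> 'w measure) \<Rightarrow> real list \<Rightarrow> real list \<Rightarrow> nat \<Rightarrow>
     (real \<Rightarrow> 'w \<Rightarrow> real \<times> real \<Rightarrow> real) \<Rightarrow> bool" where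
  "Vh_process M F xs ys k X \<longleftrightarrow>
     (\<forall>t\<ge>0. \<forall>\<omega>\<in>space M. X t \<omega> \<in> Vh xs ys k) \<and>
     (\<forall>\<phi>\<in>Vh xs ys k. measurable_adapted M F (\<lambda>t \<omega>. L2_inner xs ys (X t \<omega>) \<phi>))"

text \<open>The coefficient \<open>c\<close> along the numerical solution, as a function of the space variable.\<close>

definition along ::
    "(real \<times> real \<Rightarrow> real \<Rightarrow> real \<times> real \<times> real \<Rightarrow> real) \<Rightarrow>
     (real \<Rightarrow> 'w \<Rightarrow> real \<times> real \<Rightarrow> real) \<Rightarrow> (real \<Rightarrow> 'w \<Rightarrow> real \<times> real \<Rightarrow> real) \<Rightarrow>
     (real \<Rightarrow> 'w \<Rightarrow> real \<times> real \<Rightarrow> real) \<Rightarrow> real \<Rightarrow> 'w \<Rightarrow> real \<times> real \<Rightarrow> real" where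
  "along c E S T t \<omega> z = c z t (E t \<omega> z, S t \<omega> z, T t \<omega> z)"

end

theory Submission
  imports Defs "HOL-Real_Asymp.Real_Asymp" "HOL-Computational_Algebra.Polynomial"
begin

text \<open>In an \<open>L\<^sup>2\<close>-orthonormal basis of the finite element space, the coordinates of the numerical
  solution solve a linear system \<open>dX = A X dt + H dW\<close>.  The fluxes are paired with opposite parameters,
  so integration by parts makes the cell forms, summed over the mesh, skew-symmetric, and \<open>A\<close> is
  antisymmetric.  By Parseval and Bessel the claim becomes \<open>E |X|\<^sup>2 = |X(0)|\<^sup>2 + \<integral> E |H|\<^sup>2\<close> under
  \<open>|H|\<^sup>2 \<le> C (1 + |X|\<^sup>2)\<close>.

  The balance is proved without an Ito formula.  Drift and noise are replaced by step data on a grid of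
  width \<open>h = T/N\<close>, clipped at the level \<open>N\<^bsup>1/24\<^esup>\<close>; the integrals converge in probability.  The damped
  energy \<open>|X|\<^sup>2 / (1 + e |X|\<^sup>2)\<close> is expanded to second order over each step, and its remainders add up
  to \<open>o(1)\<close>.  An exponential discount in the accumulated size of the data plays the role of a stopping
  time and permits dominated convergence as \<open>N \<rightarrow> \<infinity>\<close>; then the discount is removed, Gronwall's lemma
  bounds \<open>E |X|\<^sup>2\<close>, and \<open>e \<rightarrow> 0\<close>.\<close>

section \<open>Convergence in probability\<close>

text \<open>The obstacle is that no moment of the solution is known beforehand. Ito integrals exist
  only as limits in probability, and the coordinates are not assumed to have continuous paths, so
  convergence in probability at fixed times is all there is. Damping is the remedy: the damped
  energy is bounded by 1 / e, and its derivatives decay fast enough to absorb the factors |z| and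
  |z|^2, so every expectation in the one-step expansion exists. The step data approximate the drift
  and noise of the given solution and do not come from iterating a scheme; they lose the
  skew-symmetry, which reappears only in the limit. The rate of the approximations is bounded by the
  size of the step data, but by nothing uniform in \<open>N\<close>. The discount repairs this: a
  sum of terms x exp(-(accumulated x)) is at most 1 whatever the terms are. It is known at the start
  of each step, and its decrements telescope, so removing it costs a constant times one minus its
  mean, which vanishes with the discount rate \<open>\<kappa>\<close>.\<close>

abbreviation null_seq :: "(nat \<Rightarrow> real) \<Rightarrow> bool" where
  "null_seq f \<equiv> f \<longlonglongrightarrow> 0"

context prob_space
begin

abbreviation expected_value ("\<E>") where "\<E> \<equiv> expectation"

text \<open>The usual truncated distance to zero for convergence in probability. It is subadditive,
  so errors can be added like norms; it is not homogeneous, whence the care with constant factors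
  below.\<close>

definition L0 :: "('a \<Rightarrow> real) \<Rightarrow> real" where
  "L0 Y = \<E> (\<lambda>y. min 1 \<bar>Y y\<bar>)"

lemma integrable_min_one:
  fixes Y :: "'a \<Rightarrow> real"
  assumes [measurable]: "Y \<in> borel_measurable M"
  shows "integrable M (\<lambda>y. min 1 \<bar>Y y\<bar>)"
  by (rule integrable_const_bound[where B=1]) auto

lemma L0_nonneg: "0 \<le> L0 Y"
  unfolding L0_def by (rule integral_nonneg_AE) auto

lemma L0_le_1: "L0 Y \<le> 1"
proof (cases "integrable M (\<lambda>y. min 1 \<bar>Y y\<bar>)")
  case True
  then have "L0 Y \<le> \<E> (\<lambda>_. 1)"
    unfolding L0_def by (intro integral_mono) auto
  then show ?thesis by (simp add: prob_space)
qed (simp add: L0_def not_integrable_integral_eq)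

lemma L0_mono:
  assumes "X \<in> borel_measurable M" "Y \<in> borel_measurable M" "AE y in M. \<bar>X y\<bar> \<le> \<bar>Y y\<bar>"
  shows "L0 X \<le> L0 Y"
  unfolding L0_def using assms(3)
  by (intro integral_mono_AE integrable_min_one assms(1,2)) (auto simp: min_def)

lemma L0_minus_commute: "L0 (\<lambda>y. X y - Y y) = L0 (\<lambda>y. Y y - X y)"
  by (simp add: L0_def abs_minus_commute)

lemma L0_add:
  assumes "X \<in> borel_measurable M" "Y \<in> borel_measurable M"
  shows "L0 (\<lambda>y. X y + Y y) \<le> L0 X + L0 Y"
proof -
  have "L0 (\<lambda>y. X y + Y y) \<le> \<E> (\<lambda>y. min 1 \<bar>X y\<bar> + min 1 \<bar>Y y\<bar>)"
    unfolding L0_def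
    by (intro integral_mono integrable_min_one borel_measurable_add Bochner_Integration.integrable_add assms)
      (auto simp: min_def)
  also have "\<dots> = L0 X + L0 Y"
    unfolding L0_def by (intro Bochner_Integration.integral_add integrable_min_one assms)
  finally show ?thesis .
qed

lemma L0_le_add:
  assumes [measurable]: "X \<in> borel_measurable M" "Y \<in> borel_measurable M" "Z \<in> borel_measurable M"
    and "AE y in M. \<bar>X y\<bar> \<le> \<bar>Y y\<bar> + \<bar>Z y\<bar>"
  shows "L0 X \<le> L0 Y + L0 Z"
proof -
  have "L0 X \<le> L0 (\<lambda>y. \<bar>Y y\<bar> + \<bar>Z y\<bar>)"
    using assms(4) by (intro L0_mono) auto
  also have "\<dots> \<le> L0 (\<lambda>y. \<bar>Y y\<bar>) + L0 (\<lambda>y. \<bar>Z y\<bar>)" by (intro L0_add) auto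
  finally show ?thesis by (simp add: L0_def)
qed

lemma L0_triangle:
  assumes "X \<in> borel_measurable M" "Y \<in> borel_measurable M" "Z \<in> borel_measurable M"
  shows "L0 (\<lambda>y. X y - Z y) \<le> L0 (\<lambda>y. X y - Y y) + L0 (\<lambda>y. Y y - Z y)"
  by (rule L0_le_add) (use assms in auto)

lemma L0_sum:
  assumes "finite I" "\<And>i. i \<in> I \<Longrightarrow> X i \<in> borel_measurable M"
  shows "L0 (\<lambda>y. \<Sum>i\<in>I. X i y) \<le> (\<Sum>i\<in>I. L0 (X i))"
  using assms
proof (induction I rule: finite_induct)
  case (insert i I)
  have "L0 (\<lambda>y. X i y + (\<Sum>i\<in>I. X i y)) \<le> L0 (X i) + L0 (\<lambda>y. \<Sum>i\<in>I. X i y)"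
    by (intro L0_add) (use insert in auto)
  then show ?case using insert by auto
qed (simp add: L0_def)

text \<open>Truncation at 1 can only gain when a factor of at least 1 is pulled out; for a factor
  below 1 the inequality would fail for large values of \<open>X\<close>.\<close>

lemma L0_cmult:
  assumes "X \<in> borel_measurable M" "1 \<le> c"
  shows "L0 (\<lambda>y. c * X y) \<le> c * L0 X"
proof -
  have "L0 (\<lambda>y. c * X y) \<le> \<E> (\<lambda>y. c * min 1 \<bar>X y\<bar>)"
    unfolding L0_def
  proof (intro integral_mono integrable_min_one integrable_mult_right)
    fix y
    show "min 1 \<bar>c * X y\<bar> \<le> c * min 1 \<bar>X y\<bar>"
    proof (cases "1 \<le> \<bar>X y\<bar>")
      case False
      then show ?thesis using assms(2) by (simp add: abs_mult)
    qed (use assms(2) in simp)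
  qed (use assms in auto)
  then show ?thesis by (simp add: L0_def)
qed

lemma L0_le_expectation:
  assumes "integrable M X"
  shows "L0 X \<le> \<E> (\<lambda>y. \<bar>X y\<bar>)"
  unfolding L0_def using assms
  by (intro integral_mono integrable_min_one) auto

lemma expectation_abs_le_sqrt:
  fixes X :: "'a \<Rightarrow> real"
  assumes "X \<in> borel_measurable M" "integrable M (\<lambda>y. (X y)\<^sup>2)"
  shows "\<E> (\<lambda>y. \<bar>X y\<bar>) \<le> sqrt (\<E> (\<lambda>y. (X y)\<^sup>2))"
proof -
  have "(\<E> (\<lambda>y. \<bar>X y\<bar>))\<^sup>2 \<le> \<E> (\<lambda>y. \<bar>X y\<bar>\<^sup>2)"
  proof -
    have i: "integrable M (\<lambda>y. \<bar>X y\<bar>)"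
      using square_integrable_imp_integrable[of X] assms by auto
    have "0 \<le> variance (\<lambda>y. \<bar>X y\<bar>)" by (rule variance_positive)
    also have "\<dots> = \<E> (\<lambda>y. \<bar>X y\<bar>\<^sup>2) - (\<E> (\<lambda>y. \<bar>X y\<bar>))\<^sup>2"
      by (rule variance_eq) (use i assms in auto)
    finally show ?thesis by simp
  qed
  then show ?thesis by (intro real_le_rsqrt) simp
qed

lemma L0_le_sqrt:
  fixes X :: "'a \<Rightarrow> real"
  assumes "X \<in> borel_measurable M" "integrable M (\<lambda>y. (X y)\<^sup>2)"
  shows "L0 X \<le> sqrt (\<E> (\<lambda>y. (X y)\<^sup>2))"
  using L0_le_expectation[of X] expectation_abs_le_sqrt[OF assms] square_integrable_imp_integrable[OF assms]
  by linarith

text \<open>Markov's inequality. The restriction of \<delta> to at most 1 keeps the threshold below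
  the truncation level.\<close>

lemma prob_gt_le_L0:
  assumes [measurable]: "X \<in> borel_measurable M" and "0 < \<delta>" "\<delta> \<le> 1"
  shows "\<P>(y in M. \<delta> < \<bar>X y\<bar>) \<le> L0 X / \<delta>"
proof -
  have "\<delta> * \<P>(y in M. \<delta> < \<bar>X y\<bar>) = \<E> (\<lambda>y. \<delta> * indicator {y\<in>space M. \<delta> < \<bar>X y\<bar>} y)"
    by simp
  also have "\<dots> \<le> L0 X"
    unfolding L0_def
  proof (rule integral_mono)
    show "\<delta> * indicator {y\<in>space M. \<delta> < \<bar>X y\<bar>} y \<le> min 1 \<bar>X y\<bar>" for y
      using assms(2,3) by (auto simp: indicator_def min_def)
    show "integrable M (\<lambda>y. \<delta> * indicator {y\<in>space M. \<delta> < \<bar>X y\<bar>} y)"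
      using assms(2) by (intro integrable_const_bound[where B=\<delta>]) (auto simp: indicator_def)
  qed (auto intro!: integrable_min_one)
  finally show ?thesis using assms(2) by (simp add: field_simps)
qed

lemma L0_le_prob:
  assumes [measurable]: "X \<in> borel_measurable M" and "0 \<le> \<delta>"
  shows "L0 X \<le> \<delta> + \<P>(y in M. \<delta> < \<bar>X y\<bar>)"
proof -
  have "L0 X \<le> \<E> (\<lambda>y. \<delta> + indicator {y\<in>space M. \<delta> < \<bar>X y\<bar>} y)"
    unfolding L0_def
  proof (rule integral_mono)
    show "min 1 \<bar>X y\<bar> \<le> \<delta> + indicator {y\<in>space M. \<delta> < \<bar>X y\<bar>} y" if "y \<in> space M" for y
      using assms(2) that by (auto simp: indicator_def min_def)
    show "integrable M (\<lambda>y. \<delta> + indicator {y\<in>space M. \<delta> < \<bar>X y\<bar>} y)"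
      using assms(2) by (intro integrable_const_bound[where B="\<delta>+1"]) (auto simp: indicator_def)
  qed (auto intro!: integrable_min_one)
  also have "\<dots> = \<delta> + \<P>(y in M. \<delta> < \<bar>X y\<bar>)"
  proof -
    have "integrable M (indicat_real {y \<in> space M. \<delta> < \<bar>X y\<bar>})"
      by (intro integrable_const_bound[where B=1]) auto
    then show ?thesis by (subst Bochner_Integration.integral_add) (auto simp: prob_space)
  qed
  finally show ?thesis .
qed

lemma L0_tendsto_0_iff:
  assumes [measurable]: "\<And>n. X n \<in> borel_measurable M"
  shows "(\<lambda>n. L0 (X n)) \<longlonglongrightarrow> 0 \<longleftrightarrow> (\<forall>e>0. (\<lambda>n. \<P>(y in M. e < \<bar>X n y\<bar>)) \<longlonglongrightarrow> 0)"
proof safe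
  fix e :: real assume lim: "null_seq (\<lambda>n. L0 (X n))" and "e > 0"
  define \<delta> where "\<delta> = min 1 e"
  have \<delta>: "0 < \<delta>" "\<delta> \<le> 1" "\<delta> \<le> e" using \<open>e > 0\<close> by (auto simp: \<delta>_def)
  show "null_seq (\<lambda>n. \<P>(y in M. e < \<bar>X n y\<bar>))"
  proof (rule tendsto_sandwich[of "\<lambda>_. 0" _ _ "\<lambda>n. L0 (X n) / \<delta>"])
    have "\<P>(y in M. e < \<bar>X n y\<bar>) \<le> L0 (X n) / \<delta>" for n
    proof -
      have "\<P>(y in M. e < \<bar>X n y\<bar>) \<le> \<P>(y in M. \<delta> < \<bar>X n y\<bar>)"
        using \<delta> by (intro finite_measure_mono) auto
      then show ?thesis using prob_gt_le_L0[OF assms \<delta>(1,2), of n] by linarith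
    qed
    then show "\<forall>\<^sub>F n in sequentially. \<P>(y in M. e < \<bar>X n y\<bar>) \<le> L0 (X n) / \<delta>"
      by simp
  qed (auto intro!: tendsto_divide_zero lim)
next
  assume lim: "\<forall>e>0. (\<lambda>n. \<P>(y in M. e < \<bar>X n y\<bar>)) \<longlonglongrightarrow> 0"
  show "null_seq (\<lambda>n. L0 (X n))"
  proof (rule LIMSEQ_I)
    fix e :: real assume "e > 0"
    have "\<forall>\<^sub>F n in sequentially. \<P>(y in M. e/2 < \<bar>X n y\<bar>) < e/2"
      by (rule order_tendstoD(2)[OF lim[rule_format]]) (use \<open>e > 0\<close> in simp_all)
    then obtain n0 where "\<And>n. n \<ge> n0 \<Longrightarrow> \<P>(y in M. e/2 < \<bar>X n y\<bar>) < e/2"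
      by (auto simp: eventually_sequentially)
    then have "L0 (X n) < e" if "n \<ge> n0" for n
      using L0_le_prob[OF assms, of "e/2" n] that \<open>e > 0\<close> by force
    then show "\<exists>no. \<forall>n\<ge>no. norm (L0 (X n) - 0) < e"
      using L0_nonneg by (auto simp: abs_of_nonneg)
  qed
qed

lemma tendsto_in_prob_iff_L0:
  assumes "\<And>n. X n \<in> borel_measurable M" "Y \<in> borel_measurable M"
  shows "tendsto_in_prob M X Y \<longleftrightarrow> (\<lambda>n. L0 (\<lambda>y. X n y - Y y)) \<longlonglongrightarrow> 0"
  unfolding tendsto_in_prob_def
  by (subst L0_tendsto_0_iff) (use assms in auto)

lemma L0_tendsto_0_AE:
  assumes [measurable]: "\<And>n. X n \<in> borel_measurable M"
    and "AE y in M. (\<lambda>n. X n y) \<longlonglongrightarrow> 0"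
  shows "null_seq (\<lambda>n. L0 (X n))"
proof -
  have "(\<lambda>n. L0 (X n)) \<longlonglongrightarrow> \<E> (\<lambda>_. 0)"
    unfolding L0_def
  proof (rule integral_dominated_convergence[where w="\<lambda>_. 1"])
    show "AE y in M. (\<lambda>n. min 1 \<bar>X n y\<bar>) \<longlonglongrightarrow> 0"
      using assms(2)
    proof eventually_elim
      fix y assume "null_seq (\<lambda>n. X n y)"
      then have "(\<lambda>n. min 1 \<bar>X n y\<bar>) \<longlonglongrightarrow> min 1 \<bar>0\<bar>"
        by (intro tendsto_intros)
      then show "null_seq (\<lambda>n. min 1 \<bar>X n y\<bar>)" by simp
    qed
  qed auto
  then show ?thesis by simp
qed

text \<open>Convergence of the truncated means is convergence in L1 of the truncations, so a
  subsequence of these converges almost everywhere; near zero the truncation has no effect.\<close>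

lemma L0_subseq_AE:
  assumes [measurable]: "\<And>n. X n \<in> borel_measurable M" and "null_seq (\<lambda>n. L0 (X n))"
  obtains r :: "nat \<Rightarrow> nat" where "strict_mono r" "AE y in M. (\<lambda>n. X (r n) y) \<longlonglongrightarrow> 0"
proof -
  obtain r where r: "strict_mono r" "AE y in M. (\<lambda>n. min 1 \<bar>X (r n) y\<bar>) \<longlonglongrightarrow> 0"
    using tendsto_L1_AE_subseq[of M "\<lambda>n y. min 1 \<bar>X n y\<bar>"] assms integrable_min_one
    by (auto simp: L0_def)
  from r(2) have "AE y in M. (\<lambda>n. X (r n) y) \<longlonglongrightarrow> 0"
  proof eventually_elim
    fix y assume a: "null_seq (\<lambda>n. min 1 \<bar>X (r n) y\<bar>)"
    have "\<forall>\<^sub>F n in sequentially. min 1 \<bar>X (r n) y\<bar> < 1"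
      by (rule order_tendstoD[OF a]) simp
    then have "\<forall>\<^sub>F n in sequentially. min 1 \<bar>X (r n) y\<bar> = \<bar>X (r n) y\<bar>"
      by eventually_elim auto
    from Lim_transform_eventually[OF a this] show "null_seq (\<lambda>n. X (r n) y)"
      by (simp add: tendsto_rabs_zero_iff)
  qed
  then show ?thesis using r that by blast
qed

text \<open>For uniformly bounded variables convergence in probability is convergence in mean, with
  the bound as the price.\<close>

lemma expectation_le_L0:
  assumes [measurable]: "X \<in> borel_measurable M" and "AE y in M. \<bar>X y\<bar> \<le> K" "1 \<le> K"
  shows "\<E> (\<lambda>y. \<bar>X y\<bar>) \<le> K * L0 X"
proof -
  have "\<E> (\<lambda>y. \<bar>X y\<bar>) \<le> \<E> (\<lambda>y. K * min 1 \<bar>X y\<bar>)"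
  proof (rule integral_mono_AE)
    show "integrable M (\<lambda>y. \<bar>X y\<bar>)"
      by (rule integrable_const_bound[where B=K]) (use assms in auto)
    show "integrable M (\<lambda>y. K * min 1 \<bar>X y\<bar>)"
      by (intro integrable_mult_right integrable_min_one) auto
    show "AE y in M. \<bar>X y\<bar> \<le> K * min 1 \<bar>X y\<bar>"
      using assms(2) by eventually_elim (use assms(3) in \<open>auto simp: min_def mult_le_cancel_right1\<close>)
  qed
  then show ?thesis by (simp add: L0_def)
qed

text \<open>Choosing for each \<open>N\<close> a near-minimiser of \<open>d N\<close> merges
  approximations that are available for each fixed tolerance into a single sequence, without any
  explicit diagonal indexing.\<close>

lemma diagonal_choice:
  fixes d :: "nat \<Rightarrow> 'x \<Rightarrow> real"
  assumes ex: "\<And>N. \<exists>x. P N x" and nonneg: "\<And>N x. P N x \<Longrightarrow> 0 \<le> d N x"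
    and small: "\<And>e. e > 0 \<Longrightarrow> \<forall>\<^sub>F N in sequentially. \<exists>x. P N x \<and> d N x < e"
  obtains x where "\<And>N. P N (x N)" "null_seq (\<lambda>N. d N (x N))"
proof -
  \<comment> \<open>The infimum need not be attained; a slack that vanishes with \<open>N\<close> is
    enough.\<close>
  have "\<exists>x. P N x \<and> (\<forall>y. P N y \<longrightarrow> d N x \<le> d N y + 1 / real (Suc N))" for N
  proof -
    define D where "D = d N ` {x. P N x}"
    have D: "D \<noteq> {}" "bdd_below D" using ex[of N] nonneg by (auto simp: D_def intro!: bdd_belowI[of _ 0])
    then have "\<exists>z\<in>D. z < Inf D + 1 / real (Suc N)"
      using cInf_lessD[OF D(1), of "Inf D + 1 / real (Suc N)"] by auto
    then obtain x where x: "P N x" "d N x < Inf D + 1 / real (Suc N)" by (auto simp: D_def)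
    have "d N x \<le> d N y + 1 / real (Suc N)" if "P N y" for y
      using x cInf_lower[OF _ D(2), of "d N y"] that by (force simp: D_def)
    then show ?thesis using x by blast
  qed
  then obtain x where x: "\<And>N. P N (x N)" "\<And>N y. P N y \<Longrightarrow> d N (x N) \<le> d N y + 1 / real (Suc N)"
    by metis
  have "null_seq (\<lambda>N. d N (x N))"
  proof (rule LIMSEQ_I)
    fix e :: real assume "e > 0"
    have "null_seq (\<lambda>N. 1 / real (Suc N))" by real_asymp
    from order_tendstoD(2)[OF this, of "e/2"] \<open>e > 0\<close>
    have "\<forall>\<^sub>F N in sequentially. 1 / real (Suc N) < e/2" by simp
    moreover have "\<forall>\<^sub>F N in sequentially. \<exists>x. P N x \<and> d N x < e/2"
      by (rule small) (use \<open>e > 0\<close> in simp)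
    ultimately have "\<forall>\<^sub>F N in sequentially. d N (x N) < e"
      by eventually_elim (use x(2) in force)
    then show "\<exists>no. \<forall>n\<ge>no. norm (d n (x n) - 0) < e"
      using nonneg[OF x(1)] by (auto simp: eventually_sequentially)
  qed
  with x(1) that show ?thesis by blast
qed

end

section \<open>Elementary stochastic integrals\<close>

locale brownian = prob_space M for M :: "'w measure" +
  fixes F :: "real \<Rightarrow> 'w measure" and W :: "real \<Rightarrow> 'w \<Rightarrow> real"
  assumes filt: "filtration (space M) F" and sets_F: "\<And>t. sets (F t) \<subseteq> sets M"
    and bm: "brownian_motion M F W"
begin

lemma space_F: "space (F t) = space M"
  using filt by (simp add: filtration_def)

lemma measurable_F_M: "Y \<in> borel_measurable (F s) \<Longrightarrow> Y \<in> borel_measurable M"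
  by (rule measurable_from_subalg[of M "F s"]) (auto simp: subalgebra_def space_F sets_F)

lemma measurable_F_mono: "Y \<in> borel_measurable (F s) \<Longrightarrow> s \<le> t \<Longrightarrow> Y \<in> borel_measurable (F t)"
  by (rule measurable_from_subalg[of "F t" "F s"])
    (use filt in \<open>auto simp: subalgebra_def space_F filtration_def subset_iff\<close>)

lemma W_measurable_F: "0 \<le> t \<Longrightarrow> W t \<in> borel_measurable (F t)"
  using bm by (simp add: brownian_motion_def)

lemma W_measurable: "0 \<le> t \<Longrightarrow> W t \<in> borel_measurable M"
  using W_measurable_F measurable_F_M by blast

lemma increment_distributed:
  assumes "0 \<le> s" "s < t"
  shows "distributed M lborel (\<lambda>y. W t y - W s y) (normal_density 0 (sqrt (t - s)))"
  using bm assms by (simp add: brownian_motion_def)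

text \<open>The assumption on \<open>W\<close> speaks of independent families of events. The
  preimages under \<open>Y\<close> form a subfamily of \<open>F s\<close>, both families are stable
  under intersection, and so the generated sigma-algebras are independent too.\<close>

lemma increment_indep:
  assumes "0 \<le> s" "s < t" and Y: "Y \<in> borel_measurable (F s)"
  shows "indep_var borel Y borel (\<lambda>y. W t y - W s y)"
proof -
  let ?G = "\<lambda>y. W t y - W s y"
  let ?A = "{Y -` A \<inter> space M | A. A \<in> sets borel}" and ?B = "{?G -` A \<inter> space M | A. A \<in> sets borel}"
  have ind: "indep_set (sets (F s)) ?B"
    using bm assms by (simp add: brownian_motion_def)
  have Ym: "random_variable borel Y" by (rule measurable_F_M[OF Y])
  have Gm: "random_variable borel ?G" using assms W_measurable by auto
  have "indep_set ?A ?B"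
    unfolding indep_set_def
    by (rule indep_sets_mono_sets[OF ind[unfolded indep_set_def]])
      (use Y in \<open>auto simp: measurable_def space_F split: bool.splits\<close>)
  then have "indep_set (sigma_sets (space M) ?A) (sigma_sets (space M) ?B)"
    using Ym Gm by (intro indep_set_sigma_sets Int_stableI)
      (auto simp: vimage_Int[symmetric] Int_ac intro: exI[of _ "_ \<inter> _"])
  then show ?thesis using Ym Gm by (simp add: indep_var_eq)
qed

lemma increment_mult:
  fixes \<phi> :: "real \<Rightarrow> real"
  assumes "0 \<le> s" "s < t" and "Y \<in> borel_measurable (F s)" "integrable M Y"
    and [measurable]: "\<phi> \<in> borel_measurable borel" and "integrable M (\<lambda>y. \<phi> (W t y - W s y))"
  shows "integrable M (\<lambda>y. Y y * \<phi> (W t y - W s y))"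
    and "\<E> (\<lambda>y. Y y * \<phi> (W t y - W s y))
      = \<E> Y * \<E> (\<lambda>y. \<phi> (W t y - W s y))"
proof -
  have "indep_var borel (id \<circ> Y) borel (\<phi> \<circ> (\<lambda>y. W t y - W s y))"
    by (rule indep_var_compose[OF increment_indep[OF assms(1-3)]]) auto
  then have i: "indep_var borel Y borel (\<lambda>y. \<phi> (W t y - W s y))"
    by (simp add: comp_def)
  show "integrable M (\<lambda>y. Y y * \<phi> (W t y - W s y))"
    by (rule indep_var_integrable[OF i]) (use assms in auto)
  show "\<E> (\<lambda>y. Y y * \<phi> (W t y - W s y))
      = \<E> Y * \<E> (\<lambda>y. \<phi> (W t y - W s y))"
    by (rule indep_var_lebesgue_integral[OF i]) (use assms in auto)
qed

text \<open>The sixth moment is the highest power of an increment that occurs in the one-step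
  remainder below; 15 = 1 * 3 * 5.\<close>

lemma increment_moments:
  assumes "0 \<le> s" "s < t"
  shows "integrable M (\<lambda>y. (W t y - W s y) ^ k)"
    and "\<E> (\<lambda>y. W t y - W s y) = 0"
    and "\<E> (\<lambda>y. (W t y - W s y)\<^sup>2) = t - s"
    and "\<E> (\<lambda>y. (W t y - W s y) ^ 6) = 15 * (t - s) ^ 3"
proof -
  note d = increment_distributed[OF assms]
  have pos: "0 < sqrt (t - s)" using assms by simp
  show "integrable M (\<lambda>y. (W t y - W s y) ^ k)"
    using distributed_integrable[OF d, of "\<lambda>x. x ^ k"] integrable_normal_moment[OF pos, of 0 k] by simp
  show "\<E> (\<lambda>y. W t y - W s y) = 0"
    using distributed_integral[OF d, of "\<lambda>x. x"] integral_normal_moment_odd[OF pos, of 0 0] by simp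
  show "\<E> (\<lambda>y. (W t y - W s y)\<^sup>2) = t - s"
    using distributed_integral[OF d, of "\<lambda>x. x\<^sup>2"] integral_normal_moment_even[OF pos, of 0 1] assms
    by simp
  show "\<E> (\<lambda>y. (W t y - W s y) ^ 6) = 15 * (t - s) ^ 3"
    using distributed_integral[OF d, of "\<lambda>x. x ^ 6"] integral_normal_moment_even[OF pos, of 0 3] assms
    by (simp add: fact_numeral field_simps)
qed

text \<open>The degenerate case \<open>s = t\<close> is included because clamping grid nodes to a
  time interval makes consecutive nodes coincide.\<close>

lemma increment_mult_le:
  fixes \<phi> :: "real \<Rightarrow> real"
  assumes "0 \<le> s" "s \<le> t" and Y: "Y \<in> borel_measurable (F s)" "integrable M Y"
  shows "integrable M (\<lambda>y. Y y * (W t y - W s y) ^ k)"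
    and "\<E> (\<lambda>y. Y y * (W t y - W s y)) = 0"
    and "\<E> (\<lambda>y. Y y * (W t y - W s y)\<^sup>2) = (t - s) * \<E> Y"
proof -
  have "integrable M (\<lambda>y. Y y * (W t y - W s y) ^ k)
     \<and> \<E> (\<lambda>y. Y y * (W t y - W s y)) = 0
     \<and> \<E> (\<lambda>y. Y y * (W t y - W s y)\<^sup>2) = (t - s) * \<E> Y"
  proof (cases "s = t")
    case True
    then show ?thesis using Y by (cases k) auto
  next
    case False
    then have st: "s < t" using assms by simp
    note m = increment_moments[OF assms(1) st]
    show ?thesis
      using increment_mult[OF assms(1) st Y, of "\<lambda>x. x ^ k"]
        increment_mult[OF assms(1) st Y, of "\<lambda>x. x"] increment_mult[OF assms(1) st Y, of "\<lambda>x. x\<^sup>2"]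
        m m(1)[of 1] m(1)[of 2] m(1)[of k]
      by simp
  qed
  then show "integrable M (\<lambda>y. Y y * (W t y - W s y) ^ k)"
    and "\<E> (\<lambda>y. Y y * (W t y - W s y)) = 0"
    and "\<E> (\<lambda>y. Y y * (W t y - W s y)\<^sup>2) = (t - s) * \<E> Y"
    by auto
qed

text \<open>The Ito isometry, by induction on the number of steps: the past integral times the next
  integrand is known at time \<open>\<tau> N\<close>, so its product with the next increment has
  mean zero.\<close>

lemma elementary_isometry:
  fixes \<tau> :: "nat \<Rightarrow> real" and \<eta> :: "nat \<Rightarrow> 'w \<Rightarrow> real"
  defines "I \<equiv> \<lambda>N y. \<Sum>j<N. \<eta> j y * (W (\<tau> (Suc j)) y - W (\<tau> j) y)"
  assumes \<tau>: "0 \<le> \<tau> 0" "\<And>j. \<tau> j \<le> \<tau> (Suc j)"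
    and \<eta>: "\<And>j. \<eta> j \<in> borel_measurable (F (\<tau> j))" "\<And>j. \<exists>B. \<forall>y\<in>space M. \<bar>\<eta> j y\<bar> \<le> B"
  shows "I N \<in> borel_measurable (F (\<tau> N))" (is ?A)
    and "integrable M (\<lambda>y. (I N y)\<^sup>2)" (is ?B)
    and "\<E> (\<lambda>y. (I N y)\<^sup>2) = (\<Sum>j<N. (\<tau> (Suc j) - \<tau> j) * \<E> (\<lambda>y. (\<eta> j y)\<^sup>2))" (is ?C)
proof -
  have "mono \<tau>" using \<tau>(2) by (simp add: mono_iff_le_Suc)
  then have \<tau>0: "0 \<le> \<tau> j" for j using \<tau>(1) by (meson le0 monoD order.trans)
  have "?A \<and> ?B \<and> ?C"
  proof (induction N)
    case 0
    show ?case by (simp add: I_def)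
  next
    case (Suc N)
    define G where "G y = W (\<tau> (Suc N)) y - W (\<tau> N) y" for y
    have IS: "I (Suc N) y = I N y + \<eta> N y * G y" for y by (simp add: I_def G_def)
    have IN: "I N \<in> borel_measurable (F (\<tau> N))" and I2: "integrable M (\<lambda>y. (I N y)\<^sup>2)"
      and EI: "\<E> (\<lambda>y. (I N y)\<^sup>2) = (\<Sum>j<N. (\<tau> (Suc j) - \<tau> j) * \<E> (\<lambda>y. (\<eta> j y)\<^sup>2))"
      using Suc by auto
    note [measurable] = measurable_F_mono[OF IN \<tau>(2)] measurable_F_mono[OF \<eta>(1) \<tau>(2)]
      W_measurable_F[OF \<tau>0] measurable_F_mono[OF W_measurable_F[OF \<tau>0] \<tau>(2)]
    have A: "I (Suc N) \<in> borel_measurable (F (\<tau> (Suc N)))"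
    proof -
      have "(\<lambda>y. I N y + \<eta> N y * G y) \<in> borel_measurable (F (\<tau> (Suc N)))"
        unfolding G_def by measurable
      then show ?thesis by (simp add: IS[abs_def])
    qed
    obtain B where B: "\<And>y. y \<in> space M \<Longrightarrow> \<bar>\<eta> N y\<bar> \<le> B" using \<eta>(2)[of N] by auto
    have I1: "integrable M (I N)"
      by (rule square_integrable_imp_integrable[OF measurable_F_M[OF IN] I2])
    have \<eta>M: "\<eta> N \<in> borel_measurable M" by (rule measurable_F_M[OF \<eta>(1)])
    have i\<eta>2: "integrable M (\<lambda>y. (\<eta> N y)\<^sup>2)"
    proof (rule integrable_const_bound[where B="B\<^sup>2"])
      show "AE y in M. norm ((\<eta> N y)\<^sup>2) \<le> B\<^sup>2"
        using B by (auto intro!: AE_I2 simp: abs_le_square_iff[symmetric] intro: order.trans[OF _ abs_ge_self])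
    qed (use \<eta>M in measurable)
    \<comment> \<open>The past integral is only square integrable; it is the boundedness of the
      integrand that makes the product integrable.\<close>
    have iI\<eta>: "integrable M (\<lambda>y. 2 * (I N y * \<eta> N y))"
    proof (intro integrable_mult_right Bochner_Integration.integrable_bound[OF integrable_mult_left[OF integrable_abs[OF I1], of B]])
      show "AE y in M. norm (I N y * \<eta> N y) \<le> norm (\<bar>I N y\<bar> * B)"
      proof (rule AE_I2)
        fix y assume "y \<in> space M"
        then have "\<bar>\<eta> N y\<bar> \<le> \<bar>B\<bar>" using B[of y] by linarith
        then show "norm (I N y * \<eta> N y) \<le> norm (\<bar>I N y\<bar> * B)"
          by (simp add: abs_mult mult_left_mono)
      qed
    qed (use \<eta>M measurable_F_M[OF IN] in measurable)
    have m1: "(\<lambda>y. 2 * (I N y * \<eta> N y)) \<in> borel_measurable (F (\<tau> N))"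
      using IN \<eta>(1)[of N] by measurable
    have m2: "(\<lambda>y. (\<eta> N y)\<^sup>2) \<in> borel_measurable (F (\<tau> N))"
      using \<eta>(1)[of N] by measurable
    note c = increment_mult_le[OF \<tau>0 \<tau>(2) m1 iI\<eta>, folded G_def]
    note q = increment_mult_le[OF \<tau>0 \<tau>(2) m2 i\<eta>2, folded G_def]
    have eq: "(I (Suc N) y)\<^sup>2 = (I N y)\<^sup>2 + 2 * (I N y * \<eta> N y) * G y + (\<eta> N y)\<^sup>2 * (G y)\<^sup>2" for y
      by (simp add: IS power2_sum power_mult_distrib)
    have i: "integrable M (\<lambda>y. 2 * (I N y * \<eta> N y) * G y)" using c(1)[of 1] by simp
    have B: "integrable M (\<lambda>y. (I (Suc N) y)\<^sup>2)"
      unfolding eq by (intro Bochner_Integration.integrable_add I2 i q(1)[of 2])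
    have C: "\<E> (\<lambda>y. (I (Suc N) y)\<^sup>2) = (\<Sum>j<Suc N. (\<tau> (Suc j) - \<tau> j) * \<E> (\<lambda>y. (\<eta> j y)\<^sup>2))"
      unfolding eq using I2 i q(1)[of 2] c(2) q(3) EI by simp
    show ?case using A B C by blast
  qed
  then show ?A ?B ?C by auto
qed

text \<open>The integrand is switched off as soon as its accumulated square exceeds \<open>\<delta>\<close>.\<close>

lemma elementary_L0_le:
  fixes \<tau> :: "nat \<Rightarrow> real" and \<eta> :: "nat \<Rightarrow> 'w \<Rightarrow> real"
  assumes \<tau>: "0 \<le> \<tau> 0" "\<And>j. \<tau> j \<le> \<tau> (Suc j)"
    and \<eta>: "\<And>j. \<eta> j \<in> borel_measurable (F (\<tau> j))" "\<And>j. \<exists>B. \<forall>y\<in>space M. \<bar>\<eta> j y\<bar> \<le> B"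
    and \<delta>: "0 < \<delta>" "\<delta> \<le> 1"
  shows "L0 (\<lambda>y. \<Sum>j<N. \<eta> j y * (W (\<tau> (Suc j)) y - W (\<tau> j) y))
     \<le> sqrt \<delta> + L0 (\<lambda>y. \<Sum>j<N. (\<tau> (Suc j) - \<tau> j) * (\<eta> j y)\<^sup>2) / \<delta>"
proof -
  define I where "I = (\<lambda>y. \<Sum>j<N. \<eta> j y * (W (\<tau> (Suc j)) y - W (\<tau> j) y))"
  define A where "A = (\<lambda>n y. \<Sum>j<n. (\<tau> (Suc j) - \<tau> j) * (\<eta> j y)\<^sup>2)"
  \<comment> \<open>\<open>A (Suc j)\<close> involves the integrand up to index \<open>j\<close>
    only, so the decision to switch off step \<open>j\<close> is known at time
    \<open>\<tau> j\<close> and adaptedness survives.\<close>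
  define \<eta>' where "\<eta>' = (\<lambda>j y. if A (Suc j) y \<le> \<delta> then \<eta> j y else 0)"
  define I' where "I' y = (\<Sum>j<N. \<eta>' j y * (W (\<tau> (Suc j)) y - W (\<tau> j) y))" for y
  have "mono \<tau>" using \<tau>(2) by (simp add: mono_iff_le_Suc)
  then have \<tau>0: "0 \<le> \<tau> j" for j using \<tau>(1) by (meson le0 monoD order.trans)
  have \<eta>F: "\<eta> i \<in> borel_measurable (F (\<tau> j))" if "i \<le> j" for i j
    using measurable_F_mono[OF \<eta>(1)] \<open>mono \<tau>\<close> that by (auto simp: mono_def)
  have \<eta>'F: "\<eta>' j \<in> borel_measurable (F (\<tau> j))" for j
  proof -
    have [measurable]: "A (Suc j) \<in> borel_measurable (F (\<tau> j))"
      unfolding A_def by (intro borel_measurable_sum borel_measurable_times borel_measurable_const borel_measurable_power \<eta>F) auto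
    note [measurable] = \<eta>(1)[of j]
    show ?thesis unfolding \<eta>'_def by measurable
  qed
  have \<eta>'B: "\<exists>B. \<forall>y\<in>space M. \<bar>\<eta>' j y\<bar> \<le> B" for j
  proof -
    obtain B where "\<forall>y\<in>space M. \<bar>\<eta> j y\<bar> \<le> B" using \<eta>(2) by blast
    then have "\<forall>y\<in>space M. \<bar>\<eta>' j y\<bar> \<le> max 0 B" by (auto simp: \<eta>'_def)
    then show ?thesis by blast
  qed
  have Amono: "A m y \<le> A n y" if "m \<le> n" for m n y
    unfolding A_def using that \<tau>(2) by (intro sum_mono2) auto
  note [measurable] = measurable_F_M[OF \<eta>(1)] measurable_F_M[OF \<eta>'F] W_measurable[OF \<tau>0]
  \<comment> \<open>Either the last step is still on, and the switched sum is below the full one,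
    which is at most \<delta>, or the last step contributes nothing.\<close>
  have le\<delta>: "(\<Sum>j<n. (\<tau> (Suc j) - \<tau> j) * (\<eta>' j y)\<^sup>2) \<le> \<delta>" for n y
  proof (induction n)
    case (Suc n)
    show ?case
    proof (cases "A (Suc n) y \<le> \<delta>")
      case True
      have "(\<Sum>j<Suc n. (\<tau> (Suc j) - \<tau> j) * (\<eta>' j y)\<^sup>2) \<le> A (Suc n) y"
        unfolding A_def using \<tau>(2) by (intro sum_mono mult_left_mono) (auto simp: \<eta>'_def)
      then show ?thesis using True by linarith
    qed (use Suc in \<open>simp add: \<eta>'_def\<close>)
  qed (use \<delta> in simp)
  note iso = elementary_isometry[OF \<tau> \<eta>'F \<eta>'B, of N, folded I'_def]
  have int: "integrable M (\<lambda>y. (\<tau> (Suc j) - \<tau> j) * (\<eta>' j y)\<^sup>2)" for j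
  proof -
    obtain B where B: "\<forall>y\<in>space M. \<bar>\<eta>' j y\<bar> \<le> B" using \<eta>'B by blast
    show ?thesis
    proof (intro integrable_mult_right integrable_const_bound[where B="B\<^sup>2"])
      show "AE y in M. norm ((\<eta>' j y)\<^sup>2) \<le> B\<^sup>2"
        using B by (auto intro!: AE_I2 simp: abs_le_square_iff[symmetric] intro: order.trans[OF _ abs_ge_self])
    qed measurable
  qed
  have "\<E> (\<lambda>y. (I' y)\<^sup>2) = \<E> (\<lambda>y. \<Sum>j<N. (\<tau> (Suc j) - \<tau> j) * (\<eta>' j y)\<^sup>2)"
    using int by (subst iso(3)) (simp add: Bochner_Integration.integral_sum)
  also have "\<dots> \<le> \<E> (\<lambda>_. \<delta>)"
    using int le\<delta> by (intro integral_mono) auto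
  finally have "\<E> (\<lambda>y. (I' y)\<^sup>2) \<le> \<delta>" by (simp add: prob_space)
  then have L0I': "L0 I' \<le> sqrt \<delta>"
    using L0_le_sqrt[OF measurable_F_M[OF iso(1)] iso(2)] by (meson order.trans real_sqrt_le_iff)
  have [measurable]: "I \<in> borel_measurable M" "I' \<in> borel_measurable M" "A N \<in> borel_measurable M"
    by (auto simp: I_def I'_def[abs_def] A_def)
  define C where "C = {y\<in>space M. \<delta> < \<bar>A N y\<bar>}"
  have [measurable]: "C \<in> sets M" unfolding C_def by measurable
  \<comment> \<open>Outside \<open>C\<close> the accumulated square stays below \<delta> at every
    step, because it grows with the step; hence nothing was switched off there and both integrals
    agree.\<close>
  have "L0 I \<le> L0 I' + L0 (indicator C)"
  proof -
    have "min 1 \<bar>I y\<bar> \<le> min 1 \<bar>I' y\<bar> + min 1 \<bar>indicator C y\<bar>" if "y \<in> space M" for y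
    proof (cases "y \<in> C")
      case False
      then have "A N y \<le> \<delta>" using that by (auto simp: C_def)
      then have "\<eta>' j y = \<eta> j y" if "j < N" for j
        using Amono[of "Suc j" N y] that by (auto simp: \<eta>'_def)
      then have "I y = I' y" by (simp add: I_def I'_def)
      then show ?thesis by simp
    qed simp
    then have "L0 I \<le> \<E> (\<lambda>y. min 1 \<bar>I' y\<bar> + min 1 \<bar>indicator C y\<bar>)"
      unfolding L0_def
      by (intro integral_mono Bochner_Integration.integrable_add integrable_min_one) auto
    also have "\<dots> = L0 I' + L0 (indicator C)"
      unfolding L0_def by (intro Bochner_Integration.integral_add integrable_min_one) auto
    finally show ?thesis .
  qed
  also have "L0 (indicator C) = prob C"
  proof -
    have "(\<lambda>y. min 1 \<bar>indicator C y\<bar>) = (indicator C :: 'w \<Rightarrow> real)" by (auto simp: indicator_def)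
    then show ?thesis by (simp add: L0_def)
  qed
  also have "prob C \<le> L0 (A N) / \<delta>"
    unfolding C_def using \<delta> by (intro prob_gt_le_L0) auto
  finally show ?thesis using L0I' unfolding I_def A_def by linarith
qed

end

section \<open>Integrands on uniform grids\<close>

text \<open>The \<open>j\<close> with \<open>j h < u \<le> (j + 1) h\<close>, for \<open>u > 0\<close>; it is \<open>0\<close> for \<open>u \<le> 0\<close>.\<close>

definition grid_index :: "real \<Rightarrow> real \<Rightarrow> nat" where
  "grid_index h u = nat (\<lceil>u / h\<rceil> - 1)"

lemma grid_index_eqI:
  assumes "h > 0" "real j * h < u" "u \<le> real (Suc j) * h"
  shows "grid_index h u = j"
proof -
  have "\<lceil>u / h\<rceil> = int (Suc j)"
    using assms by (intro ceiling_unique) (auto simp: field_simps)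
  then show ?thesis by (simp add: grid_index_def)
qed

lemma grid_index_bounds:
  assumes "h > 0" "u > 0"
  shows "real (grid_index h u) * h < u" "u \<le> real (Suc (grid_index h u)) * h"
proof -
  have c: "(real_of_int \<lceil>u / h\<rceil> - 1) * h < u" "u \<le> real_of_int \<lceil>u / h\<rceil> * h"
    using assms(1) by (simp_all add: pos_less_divide_eq[symmetric] pos_divide_le_eq[symmetric]) linarith
  have "\<lceil>u / h\<rceil> \<ge> 1" using assms by simp
  then have r: "real (grid_index h u) = real_of_int \<lceil>u / h\<rceil> - 1" by (simp add: grid_index_def)
  show "real (grid_index h u) * h < u" "u \<le> real (Suc (grid_index h u)) * h"
    using c unfolding of_nat_Suc r by simp_all
qed

lemma grid_index_less:
  assumes "h > 0" "0 < N" "u \<le> real N * h"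
  shows "grid_index h u < N"
proof (cases "u > 0")
  case True
  then have "real (grid_index h u) * h < real N * h" using grid_index_bounds[of h u] assms by linarith
  then show ?thesis using assms by simp
next
  case False
  then have "u / h \<le> 0" using assms by (simp add: divide_le_0_iff)
  then have "\<lceil>u / h\<rceil> \<le> 0" by linarith
  then have "grid_index h u = 0" unfolding grid_index_def by linarith
  then show ?thesis using assms by simp
qed

lemma measurable_grid_index [measurable]: "grid_index h \<in> borel \<rightarrow>\<^sub>M count_space UNIV"
  unfolding grid_index_def by measurable

lemma grid_set_integral:
  fixes c :: "nat \<Rightarrow> real"
  assumes h: "h > 0" and rs: "0 \<le> r" "r \<le> s" "s \<le> real N * h"
  shows "set_integrable lborel {r..s} (\<lambda>u. c (grid_index h u))"
    and "(LBINT u:{r..s}. c (grid_index h u))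
      = (\<Sum>j<N. c j * (max r (min s (real (Suc j) * h)) - max r (min s (real j * h))))"
proof -
  \<comment> \<open>Clamping the nodes to the interval replaces each half-open cell by its part
    inside; cells outside collapse to the empty set.\<close>
  define cl where "cl = (\<lambda>j::nat. max r (min s (real j * h)))"
  have clm: "cl j \<le> cl (Suc j)" for j
    unfolding cl_def using h by (intro max.mono min.mono mult_right_mono order_refl) auto
  define f where "f = (\<lambda>u. \<Sum>j<N. c j * indicator {cl j<..cl (Suc j)} u)"
  \<comment> \<open>The end point \<open>r\<close> belongs to the closed interval but to no clamped
    half-open cell, so the two integrands agree only almost everywhere.\<close>
  have eq: "indicator {r..s} u *\<^sub>R c (grid_index h u) = f u" if "u \<noteq> 0" "u \<noteq> r" for u
  proof (cases "u \<in> {r..s}")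
    case True
    define k where "k = grid_index h u"
    have u: "u > 0" "u > r" "u \<le> s" using True that rs by auto
    have k: "real k * h < u" "u \<le> real (Suc k) * h" and kN: "k < N"
    proof -
      have "0 < real N * h" using u rs by linarith
      then have "0 < N" by (cases N) auto
      then show "k < N" unfolding k_def by (rule grid_index_less[OF h _ order.trans[OF u(3) rs(3)]])
    qed (use grid_index_bounds[OF h u(1)] in \<open>simp_all add: k_def\<close>)
    have "f u = (\<Sum>j<N. if j = k then c k else 0)"
      unfolding f_def
    proof (rule sum.cong[OF refl])
      fix j
      show "c j * indicator {cl j<..cl (Suc j)} u = (if j = k then c k else 0)"
      proof (cases "j = k")
        case True
        then show ?thesis using k u by (auto simp: cl_def)
      next
        case False
        have "u \<notin> {cl j<..cl (Suc j)}"
        proof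
          assume "u \<in> {cl j<..cl (Suc j)}"
          then have "real j * h < u" "u \<le> real (Suc j) * h" using u by (auto simp: cl_def)
          then have "k = j" unfolding k_def by (rule grid_index_eqI[OF h])
          then show False using False by simp
        qed
        then show ?thesis using False by simp
      qed
    qed
    then show ?thesis using True kN by (simp add: k_def)
  next
    case False
    have "u \<notin> {cl j<..cl (Suc j)}" for j using False rs by (auto simp: cl_def)
    then have "f u = 0" unfolding f_def by (intro sum.neutral) auto
    then show ?thesis using False by simp
  qed
  have "AE u in lborel. u \<noteq> (0::real)" "AE u in lborel. u \<noteq> r"
    by (rule AE_lborel_singleton)+
  then have ae: "AE u in lborel. f u = indicator {r..s} u *\<^sub>R c (grid_index h u)"
    by eventually_elim (use eq in auto)
  have int: "integrable lborel (\<lambda>u. c j * indicator {cl j<..cl (Suc j)} u)" for j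
    by (intro integrable_mult_right integrable_real_indicator) (use clm in auto)
  then have fi: "integrable lborel f" unfolding f_def by (intro Bochner_Integration.integrable_sum)
  have m: "(\<lambda>u. indicator {r..s} u *\<^sub>R c (grid_index h u)) \<in> borel_measurable lborel" by measurable
  show "set_integrable lborel {r..s} (\<lambda>u. c (grid_index h u))"
    unfolding set_integrable_def by (rule integrable_cong_AE_imp[OF fi m ae])
  have "(LBINT u:{r..s}. c (grid_index h u)) = integral\<^sup>L lborel f"
    unfolding set_lebesgue_integral_def using ae fi m by (intro integral_cong_AE) auto
  also have "\<dots> = (\<Sum>j<N. c j * (cl (Suc j) - cl j))"
    unfolding f_def using int clm by (subst Bochner_Integration.integral_sum) auto
  finally show "(LBINT u:{r..s}. c (grid_index h u))
      = (\<Sum>j<N. c j * (max r (min s (real (Suc j) * h)) - max r (min s (real j * h))))"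
    by (simp add: cl_def)
qed

lemma grid_set_integral_full:
  fixes c :: "nat \<Rightarrow> real"
  assumes h: "h > 0"
  shows "(LBINT u:{0..real j * h}. c (grid_index h u)) = (\<Sum>l<j. h * c l)"
proof -
  have "(LBINT u:{0..real j * h}. c (grid_index h u))
    = (\<Sum>l<j. c l * (max 0 (min (real j * h) (real (Suc l) * h)) - max 0 (min (real j * h) (real l * h))))"
    using h by (intro grid_set_integral(2)) auto
  also have "\<dots> = (\<Sum>l<j. h * c l)"
  proof (rule sum.cong[OF refl])
    fix l assume "l \<in> {..<j}"
    then have "real (Suc l) \<le> real j" "real l \<le> real j" by auto
    then have "real (Suc l) * h \<le> real j * h" "real l * h \<le> real j * h"
      using h by (auto intro: mult_right_mono)
    moreover have "0 \<le> real (Suc l) * h" "0 \<le> real l * h" using h by auto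
    ultimately have "max 0 (min (real j * h) (real (Suc l) * h)) = real (Suc l) * h"
      "max 0 (min (real j * h) (real l * h)) = real l * h" by linarith+
    then show "c l * (max 0 (min (real j * h) (real (Suc l) * h)) - max 0 (min (real j * h) (real l * h))) = h * c l"
      by (simp add: algebra_simps)
  qed
  finally show ?thesis .
qed

lemma set_integrable_bounded:
  fixes f :: "real \<Rightarrow> real"
  assumes "f \<in> borel_measurable borel" "\<And>u. r \<le> u \<Longrightarrow> u \<le> s \<Longrightarrow> \<bar>f u\<bar> \<le> B"
  shows "set_integrable lborel {r..s} f"
proof -
  have "set_integrable lborel {r..s} (\<lambda>u. B)"
    unfolding set_integrable_def by (cases "r \<le> s") auto
  then show ?thesis
    by (rule set_integrable_bound) (use assms in \<open>auto simp: set_borel_measurable_def intro: order.trans[OF _ abs_ge_self]\<close>)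
qed

lemma square_add_le: "((x::real) + y)\<^sup>2 \<le> 2 * x\<^sup>2 + 2 * y\<^sup>2"
  by (smt (verit, best) sum_squares_bound power2_sum)

lemma set_square_integrable_add:
  fixes f g :: "real \<Rightarrow> real"
  assumes [measurable]: "f \<in> borel_measurable borel" "g \<in> borel_measurable borel"
    and "set_integrable lborel {r..s} (\<lambda>u. (f u)\<^sup>2)" "set_integrable lborel {r..s} (\<lambda>u. (g u)\<^sup>2)"
  shows "set_integrable lborel {r..s} (\<lambda>u. (f u + g u)\<^sup>2)"
    and "(LBINT u:{r..s}. (f u + g u)\<^sup>2)
      \<le> 2 * (LBINT u:{r..s}. (f u)\<^sup>2) + 2 * (LBINT u:{r..s}. (g u)\<^sup>2)"
proof -
  have i: "set_integrable lborel {r..s} (\<lambda>u. 2 * (f u)\<^sup>2 + 2 * (g u)\<^sup>2)"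
    using assms by (intro set_integral_add set_integrable_mult_right)
  show 1: "set_integrable lborel {r..s} (\<lambda>u. (f u + g u)\<^sup>2)"
    by (rule set_integrable_bound[OF i]) (auto simp: set_borel_measurable_def square_add_le intro!: AE_I2 order.trans[OF square_add_le])
  have "(LBINT u:{r..s}. (f u + g u)\<^sup>2) \<le> (LBINT u:{r..s}. 2 * (f u)\<^sup>2 + 2 * (g u)\<^sup>2)"
    by (intro set_integral_mono 1 i square_add_le)
  then show "(LBINT u:{r..s}. (f u + g u)\<^sup>2)
      \<le> 2 * (LBINT u:{r..s}. (f u)\<^sup>2) + 2 * (LBINT u:{r..s}. (g u)\<^sup>2)"
    using assms(3,4) by (simp add: set_integral_add)
qed

lemma set_square_integrable_diff:
  fixes f g :: "real \<Rightarrow> real"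
  assumes "f \<in> borel_measurable borel" "g \<in> borel_measurable borel"
    and "set_integrable lborel {r..s} (\<lambda>u. (f u)\<^sup>2)" "set_integrable lborel {r..s} (\<lambda>u. (g u)\<^sup>2)"
  shows "set_integrable lborel {r..s} (\<lambda>u. (f u - g u)\<^sup>2)"
    and "(LBINT u:{r..s}. (f u - g u)\<^sup>2)
      \<le> 2 * (LBINT u:{r..s}. (f u)\<^sup>2) + 2 * (LBINT u:{r..s}. (g u)\<^sup>2)"
  using set_square_integrable_add[of f "\<lambda>u. - g u" r s] assms by auto

lemma set_integral_subset_mono:
  fixes f :: "real \<Rightarrow> real"
  assumes "set_integrable lborel {a..b} f" "{r..s} \<subseteq> {a..b}" "\<And>u. 0 \<le> f u"
  shows "(LBINT u:{r..s}. f u) \<le> (LBINT u:{a..b}. f u)"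
    and "set_integrable lborel {r..s} f"
proof -
  show 1: "set_integrable lborel {r..s} f"
    by (rule set_integrable_subset[OF assms(1)]) (use assms(2) in auto)
  show "(LBINT u:{r..s}. f u) \<le> (LBINT u:{a..b}. f u)"
    unfolding set_lebesgue_integral_def
    using 1 assms by (intro integral_mono) (auto simp: set_integrable_def indicator_def)
qed

lemma set_integral_nonneg_all:
  fixes f :: "'a \<Rightarrow> real"
  shows "(\<And>u. 0 \<le> f u) \<Longrightarrow> 0 \<le> (LINT u:A|M. f u)"
  unfolding set_lebesgue_integral_def by (intro integral_nonneg_AE) auto

section \<open>Ito integrals as limits of grid integrals\<close>

text \<open>Joint measurability over all real times, not only the nonnegative ones, so that Fubini's
  theorem applies with \<open>lborel\<close> as the measure on time.\<close>

definition jointly_measurable :: "'w measure \<Rightarrow> (real \<Rightarrow> 'w \<Rightarrow> real) \<Rightarrow> bool" where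
  "jointly_measurable M X \<longleftrightarrow> (\<lambda>(u, y). X u y) \<in> borel_measurable (lborel \<Otimes>\<^sub>M M)"

lemma jointly_measurable_path: "jointly_measurable M X \<Longrightarrow> y \<in> space M \<Longrightarrow> (\<lambda>u. X u y) \<in> borel_measurable borel"
  unfolding jointly_measurable_def by (drule measurable_Pair1[of _ _ _ _ y]) auto

lemma jointly_measurable_at: "jointly_measurable M X \<Longrightarrow> X u \<in> borel_measurable M"
  unfolding jointly_measurable_def by (drule measurable_Pair2[of _ _ _ _ u]) auto

lemma jointly_measurable_comp:
  assumes "jointly_measurable M X" "\<phi> \<in> borel_measurable borel"
  shows "jointly_measurable M (\<lambda>u y. \<phi> (X u y))"
  using assms unfolding jointly_measurable_def split_beta' by measurable

lemma jointly_measurable_add: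
  assumes "jointly_measurable M X" "jointly_measurable M Y"
  shows "jointly_measurable M (\<lambda>u y. X u y + Y u y)"
  using assms unfolding jointly_measurable_def split_beta' by measurable

lemma jointly_measurable_diff:
  assumes "jointly_measurable M X" "jointly_measurable M Y"
  shows "jointly_measurable M (\<lambda>u y. X u y - Y u y)"
  using assms unfolding jointly_measurable_def split_beta' by measurable

lemma jointly_measurable_mult:
  assumes "jointly_measurable M X" "jointly_measurable M Y"
  shows "jointly_measurable M (\<lambda>u y. X u y * Y u y)"
  using assms unfolding jointly_measurable_def split_beta' by measurable

lemma jointly_measurable_sum:
  assumes "\<And>i. i \<in> I \<Longrightarrow> jointly_measurable M (X i)"
  shows "jointly_measurable M (\<lambda>u y. \<Sum>i\<in>I. X i u y)"
  using assms unfolding jointly_measurable_def split_beta' by (intro borel_measurable_sum)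

lemma jointly_measurable_grid:
  assumes "\<And>j. \<xi> j \<in> borel_measurable M"
  shows "jointly_measurable M (\<lambda>u y. \<xi> (grid_index h u) y)"
proof -
  have "(\<lambda>z. \<xi> (grid_index h (fst z)) (snd z)) \<in> borel_measurable (lborel \<Otimes>\<^sub>M M)"
    by (rule measurable_compose_countable[where f="\<lambda>j z. \<xi> j (snd z)" and g="\<lambda>z. grid_index h (fst z)"])
      (use assms in measurable)
  then show ?thesis by (simp add: jointly_measurable_def split_beta')
qed

context prob_space
begin

lemma measurable_set_integral:
  assumes "jointly_measurable M X"
  shows "(\<lambda>y. LBINT u:{r..s}. X u y) \<in> borel_measurable M"
proof -
  have "(\<lambda>(u, y). X u y) \<in> borel_measurable (lborel \<Otimes>\<^sub>M M)"
    using assms by (simp add: jointly_measurable_def)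
  from measurable_pair_swap[OF this]
  have [measurable]: "(\<lambda>z. X (snd z) (fst z)) \<in> borel_measurable (M \<Otimes>\<^sub>M lborel)"
    by (simp add: split_beta')
  have "(\<lambda>(y, u). indicator {r..s} u *\<^sub>R X u y) \<in> borel_measurable (M \<Otimes>\<^sub>M lborel)"
    unfolding split_beta' by measurable
  then show ?thesis
    unfolding set_lebesgue_integral_def by (rule lborel.borel_measurable_lebesgue_integral)
qed

end

context brownian
begin

definition grid_adapted :: "real \<Rightarrow> (nat \<Rightarrow> 'w \<Rightarrow> real) \<Rightarrow> bool" where
  "grid_adapted h \<xi> \<longleftrightarrow>
    (\<forall>j. \<xi> j \<in> borel_measurable (F (real j * h)) \<and> (\<exists>B. \<forall>y\<in>space M. \<bar>\<xi> j y\<bar> \<le> B))"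

definition grid_integral :: "real \<Rightarrow> nat \<Rightarrow> (nat \<Rightarrow> 'w \<Rightarrow> real) \<Rightarrow> real \<Rightarrow> 'w \<Rightarrow> real" where
  "grid_integral h N \<xi> s y =
    (\<Sum>j<N. \<xi> j y * (W (min s (real (Suc j) * h)) y - W (min s (real j * h)) y))"

lemma grid_adapted_measurable: "grid_adapted h \<xi> \<Longrightarrow> \<xi> j \<in> borel_measurable M"
  unfolding grid_adapted_def using measurable_F_M by blast

lemma grid_adapted_0: "grid_adapted h (\<lambda>_ _. 0)"
  unfolding grid_adapted_def by (auto intro: exI[of _ 0])

lemma grid_adapted_add:
  assumes "grid_adapted h \<xi>" "grid_adapted h \<eta>"
  shows "grid_adapted h (\<lambda>j y. \<xi> j y + \<eta> j y)"
  unfolding grid_adapted_def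
proof (intro allI conjI)
  fix j
  obtain B C where "\<forall>y\<in>space M. \<bar>\<xi> j y\<bar> \<le> B" "\<forall>y\<in>space M. \<bar>\<eta> j y\<bar> \<le> C"
    using assms unfolding grid_adapted_def by meson
  then have "\<forall>y\<in>space M. \<bar>\<xi> j y + \<eta> j y\<bar> \<le> B + C" by (meson abs_triangle_ineq add_mono order.trans)
  then show "\<exists>B. \<forall>y\<in>space M. \<bar>\<xi> j y + \<eta> j y\<bar> \<le> B" by blast
qed (use assms in \<open>auto simp: grid_adapted_def intro!: borel_measurable_add\<close>)

lemma grid_adapted_uminus: "grid_adapted h \<xi> \<Longrightarrow> grid_adapted h (\<lambda>j y. - \<xi> j y)"
  unfolding grid_adapted_def by auto

lemma grid_adapted_diff:
  "grid_adapted h \<xi> \<Longrightarrow> grid_adapted h \<eta> \<Longrightarrow> grid_adapted h (\<lambda>j y. \<xi> j y - \<eta> j y)"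
  using grid_adapted_add[of h \<xi> "\<lambda>j y. - \<eta> j y"] grid_adapted_uminus[of h \<eta>] by simp

lemma grid_integral_measurable:
  "grid_adapted h \<xi> \<Longrightarrow> 0 \<le> h \<Longrightarrow> 0 \<le> s \<Longrightarrow> grid_integral h N \<xi> s \<in> borel_measurable M"
  unfolding grid_integral_def[abs_def]
  by (intro borel_measurable_sum borel_measurable_times borel_measurable_diff W_measurable grid_adapted_measurable)
    auto

lemma grid_integral_diff:
  "grid_integral h N (\<lambda>j y. \<xi> j y - \<eta> j y) s y = grid_integral h N \<xi> s y - grid_integral h N \<eta> s y"
  unfolding grid_integral_def by (simp add: sum_subtractf left_diff_distrib)

lemma grid_integral_0: "0 \<le> h \<Longrightarrow> grid_integral h N \<xi> 0 y = 0"
  unfolding grid_integral_def by (simp add: min_absorb1)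

text \<open>The integral between \<open>r\<close> and \<open>s\<close> is an elementary integral
  along the nodes clamped to that interval, so \<open>elementary_L0_le\<close> applies, and the
  accumulated square becomes a time integral.\<close>

lemma grid_integral_L0_le:
  assumes h: "h > 0" and \<xi>: "grid_adapted h \<xi>" and rs: "0 \<le> r" "r \<le> s" "s \<le> real N * h"
    and \<delta>: "0 < \<delta>" "\<delta> \<le> 1"
  shows "L0 (\<lambda>y. grid_integral h N \<xi> s y - grid_integral h N \<xi> r y)
    \<le> sqrt \<delta> + L0 (\<lambda>y. LBINT u:{r..s}. (\<xi> (grid_index h u) y)\<^sup>2) / \<delta>"
proof -
  define \<tau> where "\<tau> = (\<lambda>j::nat. max r (min s (real j * h)))"
  \<comment> \<open>Beyond \<open>s\<close> the clamped node precedes the grid node, so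
    \<open>\<xi> j\<close> need not be known there; the clamped increment is zero, and so the
    integrand may be set to zero.\<close>
  define \<eta> where "\<eta> = (\<lambda>j. if real j * h < s then \<xi> j else (\<lambda>_. 0))"
  have \<tau>0: "0 \<le> \<tau> 0" using rs by (simp add: \<tau>_def)
  have \<tau>m: "\<tau> j \<le> \<tau> (Suc j)" for j
    unfolding \<tau>_def using h by (intro max.mono min.mono mult_right_mono order_refl) auto
  have \<eta>F: "\<eta> j \<in> borel_measurable (F (\<tau> j))" for j
  proof (cases "real j * h < s")
    case True
    have "\<xi> j \<in> borel_measurable (F (real j * h))" using \<xi> by (simp add: grid_adapted_def)
    then show ?thesis using True by (auto simp: \<eta>_def \<tau>_def intro: measurable_F_mono)
  qed (simp add: \<eta>_def)
  have \<eta>B: "\<exists>B. \<forall>y\<in>space M. \<bar>\<eta> j y\<bar> \<le> B" for j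
    using \<xi> by (auto simp: grid_adapted_def \<eta>_def intro: exI[of _ 0])
  \<comment> \<open>This form of the clamped value makes the difference of the grid integrals at
    \<open>s\<close> and at \<open>r\<close> appear term by term.\<close>
  have clip: "W (\<tau> j) y = W r y + W (min s (real j * h)) y - W (min r (real j * h)) y" for j y
  proof (cases "r \<le> real j * h")
    case True
    then have "\<tau> j = min s (real j * h)" "min r (real j * h) = r" using rs by (auto simp: \<tau>_def)
    then show ?thesis by simp
  next
    case False
    then have "\<tau> j = r" "min r (real j * h) = min s (real j * h)" using rs by (auto simp: \<tau>_def)
    then show ?thesis by simp
  qed
  have 1: "(\<Sum>j<N. \<eta> j y * (W (\<tau> (Suc j)) y - W (\<tau> j) y))
      = grid_integral h N \<xi> s y - grid_integral h N \<xi> r y" for y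
    unfolding grid_integral_def sum_subtractf[symmetric]
  proof (rule sum.cong[OF refl])
    fix j
    show "\<eta> j y * (W (\<tau> (Suc j)) y - W (\<tau> j) y) =
         \<xi> j y * (W (min s (real (Suc j) * h)) y - W (min s (real j * h)) y) -
         \<xi> j y * (W (min r (real (Suc j) * h)) y - W (min r (real j * h)) y)"
    proof (cases "real j * h < s")
      case True
      then show ?thesis unfolding clip by (simp add: \<eta>_def algebra_simps)
    next
      case False
      then have "min s (real j * h) = s" "min s (real (Suc j) * h) = s"
          "min r (real j * h) = r" "min r (real (Suc j) * h) = r"
        using h rs by (auto simp: min_def algebra_simps)
      then show ?thesis using False by (simp add: \<eta>_def)
    qed
  qed
  have 2: "(\<Sum>j<N. (\<tau> (Suc j) - \<tau> j) * (\<eta> j y)\<^sup>2) = (LBINT u:{r..s}. (\<xi> (grid_index h u) y)\<^sup>2)" for y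
    unfolding grid_set_integral(2)[OF h rs, of "\<lambda>j. (\<xi> j y)\<^sup>2"]
  proof (rule sum.cong[OF refl])
    fix j
    show "(\<tau> (Suc j) - \<tau> j) * (\<eta> j y)\<^sup>2
      = (\<xi> j y)\<^sup>2 * (max r (min s (real (Suc j) * h)) - max r (min s (real j * h)))"
    proof (cases "real j * h < s")
      case False
      then have "\<tau> j = s" "\<tau> (Suc j) = s" using h rs by (auto simp: \<tau>_def min_def algebra_simps)
      then show ?thesis using False by (simp add: \<tau>_def)
    qed (simp add: \<eta>_def \<tau>_def)
  qed
  show ?thesis
    using elementary_L0_le[OF \<tau>0 \<tau>m \<eta>F \<eta>B \<delta>, of N] by (simp add: 1 2)
qed

text \<open>The approximants live on the uniform grids of [0, T], for every horizon
  \<open>T\<close>, so that different integrands and different times \<open>s\<close> can share one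
  grid. Which approximating sequence is taken does not matter, as
  \<open>ito_limit_of_approximation\<close> shows.\<close>

definition ito_limit :: "(real \<Rightarrow> 'w \<Rightarrow> real) \<Rightarrow> real \<Rightarrow> ('w \<Rightarrow> real) \<Rightarrow> bool" where
  "ito_limit H s J \<longleftrightarrow> J \<in> borel_measurable M \<and>
    (\<forall>T>0. s \<le> T \<longrightarrow> (\<exists>\<xi>. (\<forall>N. grid_adapted (T / real (Suc N)) (\<xi> N)) \<and>
      (\<lambda>N. L0 (\<lambda>y. LBINT u:{0..s}. (\<xi> N (grid_index (T / real (Suc N)) u) y - H u y)\<^sup>2)) \<longlonglongrightarrow> 0 \<and>
      (\<lambda>N. L0 (\<lambda>y. grid_integral (T / real (Suc N)) (Suc N) (\<xi> N) s y - J y)) \<longlonglongrightarrow> 0))"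

end

section \<open>Simple processes sampled on uniform grids\<close>

context brownian
begin

lemma simple_process_jointly_measurable:
  assumes "simple_data M F n \<tau> \<xi>"
  shows "jointly_measurable M (simple_process n \<tau> \<xi>)"
proof -
  have [measurable]: "\<xi> l \<in> borel_measurable M" if "l < n" for l
    using assms that measurable_F_M by (auto simp: simple_data_def)
  have "(\<lambda>z. \<Sum>l<n. \<xi> l (snd z) * indicator {\<tau> l<..\<tau> (Suc l)} (fst z)) \<in> borel_measurable (lborel \<Otimes>\<^sub>M M)"
    by (intro borel_measurable_sum) measurable
  then show ?thesis by (simp add: jointly_measurable_def simple_process_def split_beta')
qed

lemma simple_integral_measurable:
  assumes "simple_data M F n \<tau> \<xi>" "0 \<le> s"
  shows "simple_integral W n \<tau> \<xi> s \<in> borel_measurable M"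
proof -
  have \<tau>: "0 \<le> \<tau> l" if "l \<le> n" for l
    using that
  proof (induction l)
    case (Suc l)
    then have "\<tau> l \<le> \<tau> (Suc l)" using assms(1) by (simp add: simple_data_def)
    then show ?case using Suc by simp
  qed (use assms in \<open>simp add: simple_data_def\<close>)
  have "\<xi> l \<in> borel_measurable M" if "l < n" for l
    using assms that measurable_F_M by (auto simp: simple_data_def)
  moreover have "W (min s (\<tau> l)) \<in> borel_measurable M" if "l \<le> n" for l
    using \<tau>[OF that] assms(2) by (intro W_measurable) auto
  ultimately show ?thesis
    unfolding simple_integral_def[abs_def]
    by (intro borel_measurable_sum borel_measurable_times borel_measurable_diff) auto
qed

text \<open>Telescoping over a block of consecutive indices that may reach beyond the range of
  summation.\<close>

lemma sum_indicator_telescope: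
  fixes w :: "nat \<Rightarrow> real"
  shows "p \<le> q \<Longrightarrow> (\<Sum>j<n. (if p \<le> j \<and> j < q then w (Suc j) - w j else 0)) = w (min q n) - w (min p n)"
proof (induction n)
  case (Suc n)
  then show ?case by (cases "n < p"; cases "n < q") (auto simp: min_def not_less le_Suc_eq)
qed simp

text \<open>The simple process is sampled at the left end point of each grid interval.\<close>

lemma simple_data_on_grid:
  assumes sd: "simple_data M F n \<tau> \<xi>" and T: "0 < T" and s: "0 \<le> s" "s \<le> T"
  shows "\<exists>x. (\<forall>N. grid_adapted (T / real (Suc N)) (x N)) \<and>
    (\<lambda>N. L0 (\<lambda>y. LBINT u:{0..s}. (x N (grid_index (T / real (Suc N)) u) y - simple_process n \<tau> \<xi> u y)\<^sup>2)) \<longlonglongrightarrow> 0 \<and>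
    (\<lambda>N. L0 (\<lambda>y. grid_integral (T / real (Suc N)) (Suc N) (x N) s y - simple_integral W n \<tau> \<xi> s y)) \<longlonglongrightarrow> 0"
proof -
  define h where "h = (\<lambda>N. T / real (Suc N))"
  have h: "h N > 0" and hT: "real (Suc N) * h N = T" for N using T by (auto simp: h_def)
  have h0: "null_seq h" unfolding h_def by real_asymp
  \<comment> \<open>Half-open on the other side than the simple process: a node at
    \<open>\<tau> l\<close> already knows \<open>\<xi> l\<close>. The left node of the cell of
    \<open>u\<close> is strictly below \<open>u\<close> and tends to \<open>u\<close>, so its
    membership eventually agrees with that of \<open>u\<close> in the original interval.\<close>
  define in_cell where "in_cell = (\<lambda>l v. \<tau> l \<le> v \<and> v < \<tau> (Suc l))"
  define x where "x = (\<lambda>N j y. \<Sum>l<n. if in_cell l (real j * h N) then \<xi> l y else 0)"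
  let ?d = "\<lambda>N u y. (x N (grid_index (h N) u) y - simple_process n \<tau> \<xi> u y)"
  have \<xi>F: "\<xi> l \<in> borel_measurable (F (\<tau> l))" if "l < n" for l using sd that by (simp add: simple_data_def)
  have "\<forall>l. \<exists>B. l < n \<longrightarrow> (\<forall>y\<in>space M. \<bar>\<xi> l y\<bar> \<le> B)" using sd by (auto simp: simple_data_def)
  then obtain B where B: "\<And>l y. l < n \<Longrightarrow> y \<in> space M \<Longrightarrow> \<bar>\<xi> l y\<bar> \<le> B l" by metis
  have \<tau>0: "0 \<le> \<tau> l" if "l \<le> n" for l
    using that
  proof (induction l)
    case (Suc l)
    then have "\<tau> l \<le> \<tau> (Suc l)" using sd by (simp add: simple_data_def)
    then show ?case using Suc by simp
  qed (use sd in \<open>simp add: simple_data_def\<close>)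
  have \<tau>m: "\<tau> l \<le> \<tau> (Suc l)" if "l < n" for l using sd that by (simp add: simple_data_def)
  define C where "C = (\<Sum>l<n. \<bar>B l\<bar>)"
  have C0: "0 \<le> C" by (simp add: C_def sum_nonneg)
  have xB: "\<bar>x N j y\<bar> \<le> C" if "y \<in> space M" for N j y
    unfolding x_def C_def
  proof (rule order.trans[OF sum_abs], rule sum_mono)
    fix l assume "l \<in> {..<n}"
    then show "\<bar>if in_cell l (real j * h N) then \<xi> l y else 0\<bar> \<le> \<bar>B l\<bar>"
      using B[of l y] that by auto
  qed
  have spB: "\<bar>simple_process n \<tau> \<xi> u y\<bar> \<le> C" if "y \<in> space M" for u y
    unfolding simple_process_def C_def
  proof (rule order.trans[OF sum_abs], rule sum_mono)
    fix l assume "l \<in> {..<n}"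
    then show "\<bar>\<xi> l y * indicator {\<tau> l<..\<tau> (Suc l)} u\<bar> \<le> \<bar>B l\<bar>"
      using B[of l y] that by (auto simp: indicator_def)
  qed
  have xa: "grid_adapted (h N) (x N)" for N
    unfolding grid_adapted_def
  proof (intro allI conjI)
    fix j
    show "x N j \<in> borel_measurable (F (real j * h N))"
      unfolding x_def
    proof (rule borel_measurable_sum)
      fix l assume l: "l \<in> {..<n}"
      show "(\<lambda>y. if in_cell l (real j * h N) then \<xi> l y else 0) \<in> borel_measurable (F (real j * h N))"
      proof (cases "in_cell l (real j * h N)")
        case True
        then have "\<xi> l \<in> borel_measurable (F (real j * h N))"
          using measurable_F_mono[OF \<xi>F] l by (auto simp: in_cell_def)
        then show ?thesis using True by simp
      qed simp
    qed
    show "\<exists>B. \<forall>y\<in>space M. \<bar>x N j y\<bar> \<le> B" using xB by blast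
  qed
  have xjm: "jointly_measurable M (\<lambda>u y. x N (grid_index (h N) u) y)" for N
    by (rule jointly_measurable_grid) (use xa grid_adapted_measurable in blast)
  note sjm = simple_process_jointly_measurable[OF sd]
  have pt: "null_seq (\<lambda>N. x N (grid_index (h N) u) y - simple_process n \<tau> \<xi> u y)" if u: "u > 0" for u y
  proof -
    define g where "g = (\<lambda>N. real (grid_index (h N) u) * h N)"
    have g: "g N < u" "u - h N \<le> g N" for N
      using grid_index_bounds[OF h u, of N] by (auto simp: g_def algebra_simps)
    have "(\<lambda>N. u - h N) \<longlonglongrightarrow> u" using tendsto_diff[OF tendsto_const h0] by simp
    have gl: "g \<longlonglongrightarrow> u"
      by (rule tendsto_sandwich[OF _ _ \<open>(\<lambda>N. u - h N) \<longlonglongrightarrow> u\<close> tendsto_const])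
        (use g in \<open>auto intro!: always_eventually less_imp_le\<close>)
    have "(\<lambda>N. if in_cell l (g N) then \<xi> l y else 0) \<longlonglongrightarrow> \<xi> l y * indicator {\<tau> l<..\<tau> (Suc l)} u" for l
    proof -
      have "\<forall>\<^sub>F N in sequentially. in_cell l (g N) \<longleftrightarrow> u \<in> {\<tau> l<..\<tau> (Suc l)}"
      proof -
        consider "u \<le> \<tau> l" | "\<tau> l < u" "u \<le> \<tau> (Suc l)" | "\<tau> (Suc l) < u" by linarith
        then show ?thesis
        proof cases
          case 1
          have "in_cell l (g N) \<longleftrightarrow> u \<in> {\<tau> l<..\<tau> (Suc l)}" for N
            using g(1)[of N] 1 by (auto simp: in_cell_def)
          then show ?thesis by simp
        next
          case 2
          have "\<forall>\<^sub>F N in sequentially. \<tau> l < g N" using order_tendstoD(1)[OF gl 2(1)] .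
          then show ?thesis
          proof eventually_elim
            case (elim N)
            then show ?case using g(1)[of N] 2 by (auto simp: in_cell_def)
          qed
        next
          case 3
          have "\<forall>\<^sub>F N in sequentially. \<tau> (Suc l) < g N" using order_tendstoD(1)[OF gl 3] .
          then show ?thesis
          proof eventually_elim
            case (elim N)
            then show ?case using g(1)[of N] 3 by (auto simp: in_cell_def)
          qed
        qed
      qed
      then have "\<forall>\<^sub>F N in sequentially. \<xi> l y * indicator {\<tau> l<..\<tau> (Suc l)} u = (if in_cell l (g N) then \<xi> l y else 0)"
        by eventually_elim auto
      then show ?thesis by (rule Lim_transform_eventually[OF tendsto_const])
    qed
    then have "(\<lambda>N. \<Sum>l<n. if in_cell l (g N) then \<xi> l y else 0) \<longlonglongrightarrow> simple_process n \<tau> \<xi> u y"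
      unfolding simple_process_def by (rule tendsto_sum)
    then show ?thesis unfolding x_def g_def by (rule LIM_zero)
  qed
  have b: "null_seq (\<lambda>N. L0 (\<lambda>y. LBINT u:{0..s}. (?d N u y)\<^sup>2))"
  proof (rule L0_tendsto_0_AE)
    fix N
    show "(\<lambda>y. LBINT u:{0..s}. (?d N u y)\<^sup>2) \<in> borel_measurable M"
      by (intro measurable_set_integral jointly_measurable_comp[OF jointly_measurable_diff[OF xjm sjm]]) measurable
  next
    show "AE y in M. (\<lambda>N. LBINT u:{0..s}. (?d N u y)\<^sup>2) \<longlonglongrightarrow> 0"
    proof (rule AE_I2)
      fix y assume y: "y \<in> space M"
      note [measurable] = jointly_measurable_path[OF xjm y] jointly_measurable_path[OF sjm y]
      have "(\<lambda>N. LBINT u:{0..s}. (?d N u y)\<^sup>2)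
        \<longlonglongrightarrow> (LINT (u::real)|lborel. 0)"
        unfolding set_lebesgue_integral_def
      proof (rule integral_dominated_convergence[where w="\<lambda>u. indicator {0..s} u * (2 * C)\<^sup>2"])
        show "integrable lborel (\<lambda>u. indicator {0..s} u * (2 * C)\<^sup>2)" using s by simp
        have "AE u in lborel. u \<noteq> (0::real)" by (rule AE_lborel_singleton)
        then show "AE u in lborel. (\<lambda>N. indicator {0..s} u *\<^sub>R (?d N u y)\<^sup>2) \<longlonglongrightarrow> 0"
        proof eventually_elim
          fix u :: real assume "u \<noteq> 0"
          show "null_seq (\<lambda>N. indicator {0..s} u *\<^sub>R (?d N u y)\<^sup>2)"
          proof (cases "u \<in> {0..s}")
            case True
            then have "null_seq (\<lambda>N. x N (grid_index (h N) u) y - simple_process n \<tau> \<xi> u y)"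
              using \<open>u \<noteq> 0\<close> by (intro pt) auto
            from tendsto_power[OF this, of 2] show ?thesis using True by simp
          qed simp
        qed
        fix N
        show "AE u in lborel. norm (indicator {0..s} u *\<^sub>R (?d N u y)\<^sup>2)
            \<le> indicator {0..s} u * (2 * C)\<^sup>2"
        proof (rule AE_I2)
          fix u
          have "\<bar>x N (grid_index (h N) u) y - simple_process n \<tau> \<xi> u y\<bar> \<le> \<bar>2 * C\<bar>"
            using xB[OF y, of N "grid_index (h N) u"] spB[OF y, of u] by linarith
          then have "(?d N u y)\<^sup>2 \<le> (2 * C)\<^sup>2"
            by (simp add: abs_le_square_iff)
          then show "norm (indicator {0..s} u *\<^sub>R (?d N u y)\<^sup>2)
            \<le> indicator {0..s} u * (2 * C)\<^sup>2"
            by (auto simp: indicator_def)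
        qed
      qed measurable
      then show "null_seq (\<lambda>N. LBINT u:{0..s}. (?d N u y)\<^sup>2)"
        by simp
    qed
  qed
  have cont: "AE y in M. continuous_on {0..} (\<lambda>t. W t y)" using bm by (simp add: brownian_motion_def)
  have c: "null_seq (\<lambda>N. L0 (\<lambda>y. grid_integral (h N) (Suc N) (x N) s y - simple_integral W n \<tau> \<xi> s y))"
  proof (rule L0_tendsto_0_AE)
    fix N
    show "(\<lambda>y. grid_integral (h N) (Suc N) (x N) s y - simple_integral W n \<tau> \<xi> s y) \<in> borel_measurable M"
      using grid_integral_measurable[OF xa] simple_integral_measurable[OF sd s(1)] s h[of N]
      by (intro borel_measurable_diff) auto
  next
    show "AE y in M. (\<lambda>N. grid_integral (h N) (Suc N) (x N) s y - simple_integral W n \<tau> \<xi> s y) \<longlonglongrightarrow> 0"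
      using cont
    proof eventually_elim
      fix y assume cont: "continuous_on {0..} (\<lambda>t. W t y)"
      \<comment> \<open>The first grid node not before \<open>\<tau> l\<close>. The value
        \<open>\<xi> l\<close> is sampled at the indices from \<open>p N l\<close> up to, but
        excluding, \<open>p N (Suc l)\<close>, so the grid integral telescopes to increments between
        these nodes, and path continuity gives the limit.\<close>
      define p where "p = (\<lambda>N l. nat \<lceil>\<tau> l / h N\<rceil>)"
      have p: "\<tau> l \<le> real (p N l) * h N" "real (p N l) * h N < \<tau> l + h N" if "l \<le> n" for N l
      proof -
        have r: "real (p N l) = real_of_int \<lceil>\<tau> l / h N\<rceil>"
          using \<tau>0[OF that] h[of N] by (simp add: p_def)
        have "\<tau> l / h N \<le> real (p N l)" "real (p N l) < \<tau> l / h N + 1" unfolding r by linarith+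
        then show "\<tau> l \<le> real (p N l) * h N" "real (p N l) * h N < \<tau> l + h N"
          using h[of N] by (auto simp: field_simps)
      qed
      have pj: "\<tau> l \<le> real j * h N \<longleftrightarrow> p N l \<le> j" for N l j
      proof -
        have "\<tau> l \<le> real j * h N \<longleftrightarrow> \<tau> l / h N \<le> real_of_int (int j)" using h[of N] by (simp add: field_simps)
        also have "\<dots> \<longleftrightarrow> \<lceil>\<tau> l / h N\<rceil> \<le> int j" by (simp only: ceiling_le_iff)
        also have "\<dots> \<longleftrightarrow> p N l \<le> j" by (simp add: p_def nat_le_iff)
        finally show ?thesis .
      qed
      have pm: "p N l \<le> p N (Suc l)" if "l < n" for N l
        using \<tau>m[OF that] h[of N] unfolding p_def by (intro nat_mono ceiling_mono divide_right_mono) auto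
      have gi: "grid_integral (h N) (Suc N) (x N) s y
        = (\<Sum>l<n. \<xi> l y * (W (min s (real (p N (Suc l)) * h N)) y - W (min s (real (p N l) * h N)) y))" for N
      proof -
        define w where "w = (\<lambda>j. W (min s (real j * h N)) y)"
        \<comment> \<open>Nodes past the horizon lie past \<open>s\<close>, where the path is
          stopped, so truncating the index at \<open>Suc N\<close> changes nothing.\<close>
        have wm: "w (min q (Suc N)) = w q" for q
        proof (cases "q \<le> Suc N")
          case False
          then have "real (Suc N) * h N \<le> real q * h N" using h[of N] by (intro mult_right_mono) auto
          then have "s \<le> real q * h N" "s \<le> real (Suc N) * h N" using s hT[of N] by linarith+
          then have "w q = w (Suc N)" unfolding w_def by (simp only: min_absorb1)
          then show ?thesis using False by (simp add: min_def)
        qed (simp add: min_def)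
        have "grid_integral (h N) (Suc N) (x N) s y
          = (\<Sum>j<Suc N. \<Sum>l<n. \<xi> l y * (if p N l \<le> j \<and> j < p N (Suc l) then w (Suc j) - w j else 0))"
          unfolding grid_integral_def x_def sum_distrib_right
          by (intro sum.cong refl) (simp add: w_def in_cell_def pj not_le[symmetric])
        also have "\<dots> = (\<Sum>l<n. \<xi> l y * (\<Sum>j<Suc N. if p N l \<le> j \<and> j < p N (Suc l) then w (Suc j) - w j else 0))"
          by (subst sum.swap) (simp only: sum_distrib_left)
        also have "\<dots> = (\<Sum>l<n. \<xi> l y * (w (p N (Suc l)) - w (p N l)))"
          using pm by (intro sum.cong refl) (simp only: sum_indicator_telescope wm lessThan_iff)
        finally show ?thesis by (simp add: w_def)
      qed
      have Wl: "(\<lambda>N. W (min s (real (p N l) * h N)) y) \<longlonglongrightarrow> W (min s (\<tau> l)) y" if l: "l \<le> n" for l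
      proof -
        have "(\<lambda>N. \<tau> l + h N) \<longlonglongrightarrow> \<tau> l" using tendsto_add[OF tendsto_const h0] by simp
        then have "(\<lambda>N. real (p N l) * h N) \<longlonglongrightarrow> \<tau> l"
          by (rule tendsto_sandwich[OF _ _ tendsto_const, rotated 2])
              (use p[OF l] in \<open>auto intro!: always_eventually less_imp_le\<close>)
        then have "(\<lambda>N. min s (real (p N l) * h N)) \<longlonglongrightarrow> min s (\<tau> l)" by (intro tendsto_intros)
        then show ?thesis
          by (rule continuous_on_tendsto_compose[OF cont]) (use s \<tau>0[OF l] h in \<open>auto simp: less_imp_le\<close>)
      qed
      have "(\<lambda>N. grid_integral (h N) (Suc N) (x N) s y) \<longlonglongrightarrow> simple_integral W n \<tau> \<xi> s y"
        unfolding gi simple_integral_def by (intro tendsto_intros Wl) auto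
      then show "null_seq (\<lambda>N. grid_integral (h N) (Suc N) (x N) s y - simple_integral W n \<tau> \<xi> s y)"
        by (rule LIM_zero)
    qed
  qed
  show ?thesis using xa b c unfolding h_def by blast
qed

section \<open>Square integrable integrands and their Ito limits\<close>

definition square_integrable_on :: "real \<Rightarrow> real \<Rightarrow> (real \<Rightarrow> 'w \<Rightarrow> real) \<Rightarrow> bool" where
  "square_integrable_on r s X \<longleftrightarrow> jointly_measurable M X \<and> (AE y in M. set_integrable lborel {r..s} (\<lambda>u. (X u y)\<^sup>2))"

lemma square_integrable_on_subset:
  assumes "square_integrable_on r s X" "r \<le> r'" "s' \<le> s"
  shows "square_integrable_on r' s' X"
  unfolding square_integrable_on_def
proof
  have "AE y in M. set_integrable lborel {r..s} (\<lambda>u. (X u y)\<^sup>2)"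
    using assms(1) by (simp add: square_integrable_on_def)
  then show "AE y in M. set_integrable lborel {r'..s'} (\<lambda>u. (X u y)\<^sup>2)"
    by eventually_elim (erule set_integrable_subset, use assms in auto)
qed (use assms(1) in \<open>simp add: square_integrable_on_def\<close>)

lemma square_integrable_on_diff:
  assumes "square_integrable_on r s X" "square_integrable_on r s Y"
  shows "square_integrable_on r s (\<lambda>u y. X u y - Y u y)"
  unfolding square_integrable_on_def
proof
  have j: "jointly_measurable M X" "jointly_measurable M Y"
    using assms by (auto simp: square_integrable_on_def)
  then show "jointly_measurable M (\<lambda>u y. X u y - Y u y)" by (rule jointly_measurable_diff)
  have "AE y in M. set_integrable lborel {r..s} (\<lambda>u. (X u y)\<^sup>2)"
    "AE y in M. set_integrable lborel {r..s} (\<lambda>u. (Y u y)\<^sup>2)"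
    using assms by (auto simp: square_integrable_on_def)
  then show "AE y in M. set_integrable lborel {r..s} (\<lambda>u. (X u y - Y u y)\<^sup>2)"
    using AE_space
    by eventually_elim (rule set_square_integrable_diff(1), auto intro: jointly_measurable_path[OF j(1)] jointly_measurable_path[OF j(2)])
qed

lemma square_integrable_on_add:
  assumes "square_integrable_on r s X" "square_integrable_on r s Y"
  shows "square_integrable_on r s (\<lambda>u y. X u y + Y u y)"
proof -
  have "square_integrable_on r s (\<lambda>u y. - Y u y)"
    using assms(2) jointly_measurable_comp[of M Y uminus] by (simp add: square_integrable_on_def)
  from square_integrable_on_diff[OF assms(1) this] show ?thesis by simp
qed

lemma square_integral_measurable:
  assumes "square_integrable_on r s X"
  shows "(\<lambda>y. LBINT u:{a..b}. (X u y)\<^sup>2) \<in> borel_measurable M"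
  using assms unfolding square_integrable_on_def
  by (intro measurable_set_integral jointly_measurable_comp[where \<phi>="\<lambda>x. x\<^sup>2"]) auto

lemma square_integrable_on_grid:
  assumes "grid_adapted h \<xi>" "h > 0" "0 \<le> r" "r \<le> s"
  shows "square_integrable_on r s (\<lambda>u y. \<xi> (grid_index h u) y)"
  unfolding square_integrable_on_def
proof
  show "jointly_measurable M (\<lambda>u y. \<xi> (grid_index h u) y)"
    by (rule jointly_measurable_grid) (use assms grid_adapted_measurable in blast)
  obtain N where "s / h < real N" using reals_Archimedean2 by blast
  then have N: "s \<le> real N * h" using assms by (simp add: field_simps)
  show "AE y in M. set_integrable lborel {r..s} (\<lambda>u. (\<xi> (grid_index h u) y)\<^sup>2)"
    by (intro AE_I2 grid_set_integral(1)[OF assms(2-4) N])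
qed

lemma L0_square_add:
  assumes X: "square_integrable_on r s X" and Y: "square_integrable_on r s Y"
  shows "L0 (\<lambda>y. LBINT u:{r..s}. (X u y + Y u y)\<^sup>2)
    \<le> 2 * L0 (\<lambda>y. LBINT u:{r..s}. (X u y)\<^sup>2) + 2 * L0 (\<lambda>y. LBINT u:{r..s}. (Y u y)\<^sup>2)"
proof -
  let ?I = "\<lambda>X y. LBINT u:{r..s}. (X u y)\<^sup>2"
  have j: "jointly_measurable M X" "jointly_measurable M Y"
    using assms by (auto simp: square_integrable_on_def)
  have m: "?I X \<in> borel_measurable M" "?I Y \<in> borel_measurable M"
    using X Y by (auto intro: square_integral_measurable)
  have "AE y in M. set_integrable lborel {r..s} (\<lambda>u. (X u y)\<^sup>2)"
    "AE y in M. set_integrable lborel {r..s} (\<lambda>u. (Y u y)\<^sup>2)"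
    using assms by (auto simp: square_integrable_on_def)
  then have "AE y in M. ?I (\<lambda>u y. X u y + Y u y) y \<le> 2 * ?I X y + 2 * ?I Y y"
    using AE_space
    by eventually_elim (rule set_square_integrable_add(2), auto intro: jointly_measurable_path[OF j(1)] jointly_measurable_path[OF j(2)])
  then have "L0 (?I (\<lambda>u y. X u y + Y u y)) \<le> L0 (\<lambda>y. 2 * ?I X y) + L0 (\<lambda>y. 2 * ?I Y y)"
  proof (intro L0_le_add square_integral_measurable[OF square_integrable_on_add[OF X Y]])
    assume "AE y in M. ?I (\<lambda>u y. X u y + Y u y) y \<le> 2 * ?I X y + 2 * ?I Y y"
    then show "AE y in M. \<bar>?I (\<lambda>u y. X u y + Y u y) y\<bar> \<le> \<bar>2 * ?I X y\<bar> + \<bar>2 * ?I Y y\<bar>"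
    proof eventually_elim
      fix y assume "?I (\<lambda>u y. X u y + Y u y) y \<le> 2 * ?I X y + 2 * ?I Y y"
      moreover have "0 \<le> ?I (\<lambda>u y. X u y + Y u y) y" by (rule set_integral_nonneg_all) simp
      ultimately show "\<bar>?I (\<lambda>u y. X u y + Y u y) y\<bar> \<le> \<bar>2 * ?I X y\<bar> + \<bar>2 * ?I Y y\<bar>" by linarith
    qed
  qed (use m in measurable)
  also have "\<dots> \<le> 2 * L0 (?I X) + 2 * L0 (?I Y)"
    using m by (intro add_mono L0_cmult) auto
  finally show ?thesis .
qed

lemma L0_square_triangle:
  assumes "square_integrable_on r s X" "square_integrable_on r s Y" "square_integrable_on r s Z"
  shows "L0 (\<lambda>y. LBINT u:{r..s}. (X u y - Z u y)\<^sup>2)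
    \<le> 2 * L0 (\<lambda>y. LBINT u:{r..s}. (X u y - Y u y)\<^sup>2)
      + 2 * L0 (\<lambda>y. LBINT u:{r..s}. (Y u y - Z u y)\<^sup>2)"
  using L0_square_add[OF square_integrable_on_diff[OF assms(1,2)] square_integrable_on_diff[OF assms(2,3)]]
  by simp

lemma L0_square_mono:
  assumes "square_integrable_on r s X" "r \<le> r'" "s' \<le> s"
  shows "L0 (\<lambda>y. LBINT u:{r'..s'}. (X u y)\<^sup>2) \<le> L0 (\<lambda>y. LBINT u:{r..s}. (X u y)\<^sup>2)"
proof (rule L0_mono)
  have "AE y in M. set_integrable lborel {r..s} (\<lambda>u. (X u y)\<^sup>2)"
    using assms by (auto simp: square_integrable_on_def)
  then show "AE y in M. \<bar>LBINT u:{r'..s'}. (X u y)\<^sup>2\<bar> \<le> \<bar>LBINT u:{r..s}. (X u y)\<^sup>2\<bar>"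
  proof eventually_elim
    fix y assume "set_integrable lborel {r..s} (\<lambda>u. (X u y)\<^sup>2)"
    then have "(LBINT u:{r'..s'}. (X u y)\<^sup>2) \<le> (LBINT u:{r..s}. (X u y)\<^sup>2)"
      using assms by (intro set_integral_subset_mono(1)) auto
    moreover have "0 \<le> (LBINT u:{r'..s'}. (X u y)\<^sup>2)" by (rule set_integral_nonneg_all) simp
    ultimately show "\<bar>LBINT u:{r'..s'}. (X u y)\<^sup>2\<bar> \<le> \<bar>LBINT u:{r..s}. (X u y)\<^sup>2\<bar>" by linarith
  qed
qed (use assms square_integral_measurable in blast)+

text \<open>Two nested limits: first a simple process close to the integrand whose integral is close
  to \<open>J\<close>, then a grid fine enough for that simple process. \<open>H'\<close> continues
  \<open>H\<close> to negative times, about which \<open>measurable_adapted\<close> says nothing, in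
  a measurable way.\<close>

lemma has_ito_integral_imp_ito_limit:
  assumes J: "has_ito_integral M F W H s J" and s: "0 \<le> s"
    and H': "jointly_measurable M H'" "\<And>u y. 0 \<le> u \<Longrightarrow> H' u y = H u y"
  shows "ito_limit H' s J" "square_integrable_on 0 s H'"
proof -
  have sq: "AE y in M. set_integrable lborel {0..s} (\<lambda>u. (H u y)\<^sup>2)"
    and Jm: "J \<in> borel_measurable M" using J by (auto simp: has_ito_integral_def)
  have "set_integrable lborel {0..s} (\<lambda>u. (H' u y)\<^sup>2) \<longleftrightarrow> set_integrable lborel {0..s} (\<lambda>u. (H u y)\<^sup>2)" for y
    by (rule set_integrable_cong) (use H'(2) in auto)
  then show sqH: "square_integrable_on 0 s H'" using sq H'(1) by (simp add: square_integrable_on_def)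
  obtain n \<tau> \<xi> where sd: "\<And>m. simple_data M F (n m) (\<tau> m) (\<xi> m)"
    and l1: "tendsto_in_prob M
          (\<lambda>m y. LBINT u:{0..s}. (simple_process (n m) (\<tau> m) (\<xi> m) u y - H u y)\<^sup>2) (\<lambda>_. 0)"
    and l2: "tendsto_in_prob M (\<lambda>m. simple_integral W (n m) (\<tau> m) (\<xi> m) s) J"
    using J unfolding has_ito_integral_def by blast
  let ?sp = "\<lambda>m. simple_process (n m) (\<tau> m) (\<xi> m)"
  have "(LBINT u:{0..s}. (?sp m u y - H u y)\<^sup>2) = (LBINT u:{0..s}. (?sp m u y - H' u y)\<^sup>2)" for m y
    by (rule set_lebesgue_integral_cong) (use H'(2) in auto)
  note l1 = l1[unfolded this]
  have sqs: "square_integrable_on 0 s (?sp m)" for m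
    unfolding square_integrable_on_def
  proof
    show j: "jointly_measurable M (?sp m)" by (rule simple_process_jointly_measurable[OF sd])
    have "\<forall>l. \<exists>B. l < n m \<longrightarrow> (\<forall>y\<in>space M. \<bar>\<xi> m l y\<bar> \<le> B)" using sd by (auto simp: simple_data_def)
    then obtain B where B: "\<And>l y. l < n m \<Longrightarrow> y \<in> space M \<Longrightarrow> \<bar>\<xi> m l y\<bar> \<le> B l" by metis
    show "AE y in M. set_integrable lborel {0..s} (\<lambda>u. (?sp m u y)\<^sup>2)"
    proof (rule AE_I2)
      fix y assume y: "y \<in> space M"
      show "set_integrable lborel {0..s} (\<lambda>u. (?sp m u y)\<^sup>2)"
      proof (rule set_integrable_bounded[where B="(\<Sum>l<n m. \<bar>B l\<bar>)\<^sup>2"])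
        show "(\<lambda>u. (?sp m u y)\<^sup>2) \<in> borel_measurable borel"
          using jointly_measurable_path[OF j y] by measurable
        fix u
        have "\<bar>?sp m u y\<bar> \<le> (\<Sum>l<n m. \<bar>B l\<bar>)"
          unfolding simple_process_def
        proof (rule order.trans[OF sum_abs], rule sum_mono)
          fix l assume "l \<in> {..<n m}"
          then show "\<bar>\<xi> m l y * indicator {\<tau> m l<..\<tau> m (Suc l)} u\<bar> \<le> \<bar>B l\<bar>"
            using B[of l y] y by (auto simp: indicator_def)
        qed
        then show "\<bar>(?sp m u y)\<^sup>2\<bar> \<le> (\<Sum>l<n m. \<bar>B l\<bar>)\<^sup>2"
          by (simp add: abs_le_square_iff[symmetric])
      qed
    qed
  qed
  have L1: "null_seq (\<lambda>m. L0 (\<lambda>y. LBINT u:{0..s}. (?sp m u y - H' u y)\<^sup>2))"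
    using l1 by (subst (asm) tendsto_in_prob_iff_L0)
      (auto intro!: square_integral_measurable[OF square_integrable_on_diff[OF sqs sqH]])
  have L2: "null_seq (\<lambda>m. L0 (\<lambda>y. simple_integral W (n m) (\<tau> m) (\<xi> m) s y - J y))"
    using l2 by (subst (asm) tendsto_in_prob_iff_L0) (auto intro!: simple_integral_measurable sd s Jm)
  show "ito_limit H' s J"
    unfolding ito_limit_def
  proof (intro conjI Jm allI impI)
    fix T :: real assume T: "0 < T" "s \<le> T"
    define h where "h = (\<lambda>N. T / real (Suc N))"
    have h: "h N > 0" for N using T by (simp add: h_def)
    let ?d1 = "\<lambda>N x. L0 (\<lambda>y. LBINT u:{0..s}. (x (grid_index (h N) u) y - H' u y)\<^sup>2)"
    let ?d2 = "\<lambda>N x. L0 (\<lambda>y. grid_integral (h N) (Suc N) x s y - J y)"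
    have "\<forall>\<^sub>F N in sequentially. \<exists>x. grid_adapted (h N) x \<and> ?d1 N x + ?d2 N x < e" if "e > 0" for e
    proof -
      have "\<forall>\<^sub>F m in sequentially. L0 (\<lambda>y. LBINT u:{0..s}. (?sp m u y - H' u y)\<^sup>2) < e/8"
        by (rule order_tendstoD(2)[OF L1]) (use that in simp)
      moreover have "\<forall>\<^sub>F m in sequentially. L0 (\<lambda>y. simple_integral W (n m) (\<tau> m) (\<xi> m) s y - J y) < e/4"
        by (rule order_tendstoD(2)[OF L2]) (use that in simp)
      ultimately have "\<forall>\<^sub>F m in sequentially. L0 (\<lambda>y. LBINT u:{0..s}. (?sp m u y - H' u y)\<^sup>2) < e/8
          \<and> L0 (\<lambda>y. simple_integral W (n m) (\<tau> m) (\<xi> m) s y - J y) < e/4"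
        by eventually_elim auto
      then obtain m where m1: "L0 (\<lambda>y. LBINT u:{0..s}. (?sp m u y - H' u y)\<^sup>2) < e/8"
          and m2: "L0 (\<lambda>y. simple_integral W (n m) (\<tau> m) (\<xi> m) s y - J y) < e/4"
        by (auto simp: eventually_sequentially)
      obtain x where x: "\<And>N. grid_adapted (h N) (x N)"
        and x1: "null_seq (\<lambda>N. L0 (\<lambda>y. LBINT u:{0..s}. (x N (grid_index (h N) u) y - ?sp m u y)\<^sup>2))"
        and x2: "null_seq (\<lambda>N. L0 (\<lambda>y. grid_integral (h N) (Suc N) (x N) s y - simple_integral W (n m) (\<tau> m) (\<xi> m) s y))"
        using simple_data_on_grid[OF sd T(1) s T(2), of m] unfolding h_def by blast
      have "\<forall>\<^sub>F N in sequentially. L0 (\<lambda>y. LBINT u:{0..s}. (x N (grid_index (h N) u) y - ?sp m u y)\<^sup>2) < e/8"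
        by (rule order_tendstoD(2)[OF x1]) (use that in simp)
      moreover have "\<forall>\<^sub>F N in sequentially. L0 (\<lambda>y. grid_integral (h N) (Suc N) (x N) s y - simple_integral W (n m) (\<tau> m) (\<xi> m) s y) < e/4"
        by (rule order_tendstoD(2)[OF x2]) (use that in simp)
      ultimately show ?thesis
      proof eventually_elim
        fix N
        assume 1: "L0 (\<lambda>y. LBINT u:{0..s}. (x N (grid_index (h N) u) y - ?sp m u y)\<^sup>2) < e/8"
          and 2: "L0 (\<lambda>y. grid_integral (h N) (Suc N) (x N) s y - simple_integral W (n m) (\<tau> m) (\<xi> m) s y) < e/4"
        have "?d1 N (x N) \<le> 2 * L0 (\<lambda>y. LBINT u:{0..s}. (x N (grid_index (h N) u) y - ?sp m u y)\<^sup>2)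
            + 2 * L0 (\<lambda>y. LBINT u:{0..s}. (?sp m u y - H' u y)\<^sup>2)"
          by (rule L0_square_triangle[OF square_integrable_on_grid[OF x h order_refl s] sqs sqH])
        moreover have "?d2 N (x N) \<le> L0 (\<lambda>y. grid_integral (h N) (Suc N) (x N) s y - simple_integral W (n m) (\<tau> m) (\<xi> m) s y)
            + L0 (\<lambda>y. simple_integral W (n m) (\<tau> m) (\<xi> m) s y - J y)"
          using h[of N] s by (intro L0_triangle grid_integral_measurable x simple_integral_measurable sd Jm) auto
        ultimately have "?d1 N (x N) + ?d2 N (x N) < e" using m1 m2 1 2 by linarith
        then show "\<exists>x. grid_adapted (h N) x \<and> ?d1 N x + ?d2 N x < e" using x by blast
      qed
    qed
    then obtain x where x: "\<And>N. grid_adapted (h N) (x N)" "null_seq (\<lambda>N. ?d1 N (x N) + ?d2 N (x N))"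
      by (rule diagonal_choice[rotated 2]) (auto intro: grid_adapted_0 add_nonneg_nonneg L0_nonneg)
    have "null_seq (\<lambda>N. ?d1 N (x N))" "null_seq (\<lambda>N. ?d2 N (x N))"
      by (rule tendsto_sandwich[OF _ _ tendsto_const x(2)]; simp add: L0_nonneg)+
    then show "\<exists>\<xi>. (\<forall>N. grid_adapted (T / real (Suc N)) (\<xi> N)) \<and>
      (\<lambda>N. L0 (\<lambda>y. LBINT u:{0..s}. (\<xi> N (grid_index (T / real (Suc N)) u) y - H' u y)\<^sup>2)) \<longlonglongrightarrow> 0 \<and>
      (\<lambda>N. L0 (\<lambda>y. grid_integral (T / real (Suc N)) (Suc N) (\<xi> N) s y - J y)) \<longlonglongrightarrow> 0"
      using x(1) unfolding h_def by blast
  qed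
qed

text \<open>Turns the two-term estimate of \<open>elementary_L0_le\<close> into a limit: \<delta> is
  fixed first, small enough for the square root, and then large \<open>N\<close> beats the factor 1
  / \<delta>.\<close>

lemma tendsto_0_of_sqrt_bound:
  fixes a b :: "nat \<Rightarrow> real"
  assumes a: "\<And>N. 0 \<le> a N" and b: "null_seq b"
    and le: "\<And>N \<delta>. 0 < \<delta> \<Longrightarrow> \<delta> \<le> 1 \<Longrightarrow> a N \<le> sqrt \<delta> + b N / \<delta>"
  shows "null_seq a"
proof (rule LIMSEQ_I)
  fix e :: real assume e: "e > 0"
  define \<delta> where "\<delta> = min 1 ((e/2)\<^sup>2)"
  have \<delta>: "0 < \<delta>" "\<delta> \<le> 1" using e by (auto simp: \<delta>_def)
  have "sqrt \<delta> \<le> sqrt ((e/2)\<^sup>2)" by (simp add: \<delta>_def del: real_sqrt_abs)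
  then have \<delta>3: "sqrt \<delta> \<le> e/2" using e by simp
  have "\<forall>\<^sub>F N in sequentially. b N < \<delta> * (e/2)"
    by (rule order_tendstoD(2)[OF b]) (use \<delta> e in simp)
  then have "\<forall>\<^sub>F N in sequentially. norm (a N - 0) < e"
  proof eventually_elim
    fix N assume "b N < \<delta> * (e/2)"
    then have "b N / \<delta> < e/2" using \<delta> by (simp add: pos_divide_less_eq mult.commute)
    then have "a N < e" using le[OF \<delta>(1,2), of N] \<delta>3 by linarith
    then show "norm (a N - 0) < e" using a[of N] by simp
  qed
  then show "\<exists>no. \<forall>n\<ge>no. norm (a n - 0) < e" by (simp add: eventually_sequentially)
qed

text \<open>The Ito integral does not depend on the approximating sequence: two grid approximations
  of one integrand differ by little in the square mean over time, and hence so do their integrals.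
  This is what permits clipping the data later.\<close>

lemma ito_limit_of_approximation:
  assumes J: "ito_limit H s J" and T: "0 < T" "0 \<le> s" "s \<le> T" and H: "square_integrable_on 0 s H"
    and \<eta>: "\<And>N. grid_adapted (T / real (Suc N)) (\<eta> N)"
    and lim: "null_seq (\<lambda>N. L0 (\<lambda>y. LBINT u:{0..s}. (\<eta> N (grid_index (T / real (Suc N)) u) y - H u y)\<^sup>2))"
  shows "null_seq (\<lambda>N. L0 (\<lambda>y. grid_integral (T / real (Suc N)) (Suc N) (\<eta> N) s y - J y))"
proof -
  define h where "h = (\<lambda>N. T / real (Suc N))"
  have h: "h N > 0" "s \<le> real (Suc N) * h N" for N using T by (simp_all add: h_def)
  let ?d = "\<lambda>x N. L0 (\<lambda>y. LBINT u:{0..s}. (x N (grid_index (h N) u) y - H u y)\<^sup>2)"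
  let ?g = "\<lambda>x N. grid_integral (h N) (Suc N) (x N) s"
  obtain \<xi> where \<xi>: "\<And>N. grid_adapted (h N) (\<xi> N)" and \<xi>1: "?d \<xi> \<longlonglongrightarrow> 0"
    and \<xi>2: "null_seq (\<lambda>N. L0 (\<lambda>y. ?g \<xi> N y - J y))"
    using J T unfolding ito_limit_def h_def by meson
  have \<eta>: "grid_adapted (h N) (\<eta> N)" for N using \<eta> by (simp add: h_def)
  have lim: "?d \<eta> \<longlonglongrightarrow> 0" using lim by (simp add: h_def)
  have Jm: "J \<in> borel_measurable M" using J by (simp add: ito_limit_def)
  have gm: "?g x N \<in> borel_measurable M" if "\<And>N. grid_adapted (h N) (x N)" for x N
    using that h(1)[of N] T by (intro grid_integral_measurable) auto
  have "null_seq (\<lambda>N. L0 (\<lambda>y. ?g \<eta> N y - ?g \<xi> N y))"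
  proof (rule tendsto_0_of_sqrt_bound)
    show "null_seq (\<lambda>N. 2 * ?d \<eta> N + 2 * ?d \<xi> N)"
      using tendsto_add[OF tendsto_mult_left[OF lim, of 2] tendsto_mult_left[OF \<xi>1, of 2]] by simp
    fix N and \<delta> :: real assume \<delta>: "0 < \<delta>" "\<delta> \<le> 1"
    have "L0 (\<lambda>y. ?g \<eta> N y - ?g \<xi> N y)
        \<le> sqrt \<delta> + L0 (\<lambda>y. LBINT u:{0..s}. (\<eta> N (grid_index (h N) u) y - \<xi> N (grid_index (h N) u) y)\<^sup>2) / \<delta>"
      using grid_integral_L0_le[OF h(1) grid_adapted_diff[OF \<eta> \<xi>] order_refl T(2) h(2) \<delta>]
      by (simp add: grid_integral_diff grid_integral_0[OF less_imp_le[OF h(1)]])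
    also have "L0 (\<lambda>y. LBINT u:{0..s}. (\<eta> N (grid_index (h N) u) y - \<xi> N (grid_index (h N) u) y)\<^sup>2)
        \<le> 2 * ?d \<eta> N + 2 * L0 (\<lambda>y. LBINT u:{0..s}. (H u y - \<xi> N (grid_index (h N) u) y)\<^sup>2)"
      by (rule L0_square_triangle[OF square_integrable_on_grid[OF \<eta> h(1) order_refl T(2)] H
          square_integrable_on_grid[OF \<xi> h(1) order_refl T(2)]])
    also have "L0 (\<lambda>y. LBINT u:{0..s}. (H u y - \<xi> N (grid_index (h N) u) y)\<^sup>2) = ?d \<xi> N"
      by (simp add: power2_commute)
    finally show "L0 (\<lambda>y. ?g \<eta> N y - ?g \<xi> N y) \<le> sqrt \<delta> + (2 * ?d \<eta> N + 2 * ?d \<xi> N) / \<delta>"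
      using \<delta> by (simp add: divide_right_mono)
  qed (rule L0_nonneg)
  from tendsto_add[OF this \<xi>2]
  have "null_seq (\<lambda>N. L0 (\<lambda>y. ?g \<eta> N y - ?g \<xi> N y) + L0 (\<lambda>y. ?g \<xi> N y - J y))" by simp
  then have "null_seq (\<lambda>N. L0 (\<lambda>y. ?g \<eta> N y - J y))"
    by (rule tendsto_sandwich[OF _ _ tendsto_const, rotated 2])
      (intro always_eventually allI L0_nonneg L0_triangle gm \<eta> \<xi> Jm)+
  then show ?thesis by (simp add: h_def)
qed

text \<open>Continuity of the Ito integral in its upper limit, in probability: the approximants for
  \<open>s\<close> also serve for \<open>r\<close>, and the estimate for grid integrals passes to
  the limit.\<close>

lemma ito_limit_L0_le:
  assumes J: "ito_limit H s J" "ito_limit H r I" and rs: "0 \<le> r" "r \<le> s"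
    and H: "square_integrable_on 0 s H" and \<delta>: "0 < \<delta>" "\<delta> \<le> 1"
  shows "L0 (\<lambda>y. J y - I y) \<le> sqrt \<delta> + 2 * L0 (\<lambda>y. LBINT u:{r..s}. (H u y)\<^sup>2) / \<delta>"
proof -
  \<comment> \<open>The horizon of a grid must be positive, also when \<open>s = 0\<close>.\<close>
  define T where "T = s + 1"
  have T: "0 < T" "s \<le> T" "r \<le> T" using rs by (auto simp: T_def)
  define h where "h = (\<lambda>N. T / real (Suc N))"
  have h: "h N > 0" "s \<le> real (Suc N) * h N" for N using T by (simp_all add: h_def)
  let ?g = "\<lambda>x N s. grid_integral (h N) (Suc N) (x N) s"
  have s: "0 \<le> s" using rs by simp
  have H0r: "square_integrable_on 0 r H" and Hrs: "square_integrable_on r s H"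
    using H rs by (auto intro: square_integrable_on_subset)
  obtain \<xi> where \<xi>: "\<And>N. grid_adapted (h N) (\<xi> N)"
    and \<xi>1: "null_seq (\<lambda>N. L0 (\<lambda>y. LBINT u:{0..s}. (\<xi> N (grid_index (h N) u) y - H u y)\<^sup>2))"
    and \<xi>2: "null_seq (\<lambda>N. L0 (\<lambda>y. ?g \<xi> N s y - J y))"
    using J(1) T unfolding ito_limit_def h_def by meson
  let ?D = "\<lambda>N u y. \<xi> N (grid_index (h N) u) y - H u y"
  have D: "square_integrable_on 0 s (?D N)" for N
    by (rule square_integrable_on_diff[OF square_integrable_on_grid[OF \<xi> h(1) order_refl s] H])
  have lim: "null_seq (\<lambda>N. L0 (\<lambda>y. LBINT u:{a..b}. (?D N u y)\<^sup>2))" if "0 \<le> a" "b \<le> s" for a b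
    by (rule tendsto_sandwich[OF _ _ tendsto_const \<xi>1])
      (auto simp: L0_nonneg that intro!: always_eventually L0_square_mono[OF D])
  have \<xi>3: "null_seq (\<lambda>N. L0 (\<lambda>y. ?g \<xi> N r y - I y))"
    using ito_limit_of_approximation[OF J(2) T(1) rs(1) T(3) H0r, of \<xi>] \<xi> lim[of 0 r] rs
    by (simp add: h_def)
  have Jm: "J \<in> borel_measurable M" "I \<in> borel_measurable M" using J by (auto simp: ito_limit_def)
  have gm: "?g \<xi> N t \<in> borel_measurable M" if "0 \<le> t" for N t
    using that h(1)[of N] \<xi> by (intro grid_integral_measurable) auto
  let ?R = "\<lambda>N. L0 (\<lambda>y. ?g \<xi> N s y - J y) + (sqrt \<delta> + (2 * L0 (\<lambda>y. LBINT u:{r..s}. (?D N u y)\<^sup>2)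
      + 2 * L0 (\<lambda>y. LBINT u:{r..s}. (H u y)\<^sup>2)) / \<delta>) + L0 (\<lambda>y. ?g \<xi> N r y - I y)"
  have "L0 (\<lambda>y. J y - I y) \<le> ?R N" for N
  proof -
    have 1: "L0 (\<lambda>y. J y - I y) \<le> L0 (\<lambda>y. J y - ?g \<xi> N s y) + L0 (\<lambda>y. ?g \<xi> N s y - I y)"
      by (intro L0_triangle Jm gm s)
    have 2: "L0 (\<lambda>y. ?g \<xi> N s y - I y) \<le> L0 (\<lambda>y. ?g \<xi> N s y - ?g \<xi> N r y) + L0 (\<lambda>y. ?g \<xi> N r y - I y)"
      by (intro L0_triangle Jm gm s rs)
    have 3: "L0 (\<lambda>y. ?g \<xi> N s y - ?g \<xi> N r y)
        \<le> sqrt \<delta> + L0 (\<lambda>y. LBINT u:{r..s}. (\<xi> N (grid_index (h N) u) y)\<^sup>2) / \<delta>"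
      by (rule grid_integral_L0_le[OF h(1) \<xi> rs h(2) \<delta>])
    have 4: "L0 (\<lambda>y. LBINT u:{r..s}. (\<xi> N (grid_index (h N) u) y)\<^sup>2)
        \<le> 2 * L0 (\<lambda>y. LBINT u:{r..s}. (?D N u y)\<^sup>2) + 2 * L0 (\<lambda>y. LBINT u:{r..s}. (H u y)\<^sup>2)"
      using L0_square_add[OF square_integrable_on_subset[OF D rs(1) order_refl] Hrs, of N] by simp
    from divide_right_mono[OF this, of \<delta>] \<delta> 1 2 3 show ?thesis
      using L0_minus_commute[of J "?g \<xi> N s"] by simp
  qed
  moreover have "?R \<longlonglongrightarrow> 0 + (sqrt \<delta> + (2 * 0 + 2 * L0 (\<lambda>y. LBINT u:{r..s}. (H u y)\<^sup>2)) / \<delta>) + 0"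
    using \<delta> rs by (intro tendsto_intros \<xi>2 \<xi>3 lim) auto
  ultimately have "L0 (\<lambda>y. J y - I y) \<le> 0 + (sqrt \<delta> + (2 * 0 + 2 * L0 (\<lambda>y. LBINT u:{r..s}. (H u y)\<^sup>2)) / \<delta>) + 0"
    by (intro LIMSEQ_le_const) auto
  then show ?thesis by simp
qed

lemma ito_limit_0: "0 \<le> s \<Longrightarrow> ito_limit (\<lambda>_ _. 0) s (\<lambda>_. 0)"
  unfolding ito_limit_def
  by (intro conjI allI impI exI[of _ "\<lambda>_ _ _. 0"])
    (auto simp: grid_adapted_0 grid_integral_def L0_def set_lebesgue_integral_def)

lemma grid_integral_add:
  "grid_integral h N (\<lambda>j y. \<xi> j y + \<eta> j y) s y = grid_integral h N \<xi> s y + grid_integral h N \<eta> s y"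
  unfolding grid_integral_def by (simp add: sum.distrib distrib_right)

lemma ito_limit_add:
  assumes "ito_limit H s J" "ito_limit G s I" "0 \<le> s"
    and H: "square_integrable_on 0 s H" and G: "square_integrable_on 0 s G"
  shows "ito_limit (\<lambda>u y. H u y + G u y) s (\<lambda>y. J y + I y)"
  unfolding ito_limit_def
proof (intro conjI allI impI)
  have Jm: "J \<in> borel_measurable M" "I \<in> borel_measurable M" using assms by (auto simp: ito_limit_def)
  then show "(\<lambda>y. J y + I y) \<in> borel_measurable M" by measurable
  fix T :: real assume T: "0 < T" "s \<le> T"
  define h where "h = (\<lambda>N. T / real (Suc N))"
  have h: "h N > 0" for N using T by (simp_all add: h_def)
  let ?d = "\<lambda>x H N. L0 (\<lambda>y. LBINT u:{0..s}. (x N (grid_index (h N) u) y - H u y)\<^sup>2)"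
  let ?g = "\<lambda>x N. grid_integral (h N) (Suc N) (x N) s"
  obtain \<xi> where \<xi>: "\<And>N. grid_adapted (h N) (\<xi> N)" and \<xi>1: "?d \<xi> H \<longlonglongrightarrow> 0"
    and \<xi>2: "null_seq (\<lambda>N. L0 (\<lambda>y. ?g \<xi> N y - J y))"
    using assms(1) T unfolding ito_limit_def h_def by meson
  obtain \<eta> where \<eta>: "\<And>N. grid_adapted (h N) (\<eta> N)" and \<eta>1: "?d \<eta> G \<longlonglongrightarrow> 0"
    and \<eta>2: "null_seq (\<lambda>N. L0 (\<lambda>y. ?g \<eta> N y - I y))"
    using assms(2) T unfolding ito_limit_def h_def by meson
  define \<zeta> where "\<zeta> = (\<lambda>N j y. \<xi> N j y + \<eta> N j y)"
  have \<zeta>: "grid_adapted (h N) (\<zeta> N)" for N unfolding \<zeta>_def by (intro grid_adapted_add \<xi> \<eta>)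
  have "?d \<zeta> (\<lambda>u y. H u y + G u y) \<longlonglongrightarrow> 0"
  proof (rule tendsto_sandwich[OF _ _ tendsto_const])
    show "null_seq (\<lambda>N. 2 * ?d \<xi> H N + 2 * ?d \<eta> G N)"
      using tendsto_add[OF tendsto_mult_left[OF \<xi>1, of 2] tendsto_mult_left[OF \<eta>1, of 2]] by simp
    have "?d \<zeta> (\<lambda>u y. H u y + G u y) N \<le> 2 * ?d \<xi> H N + 2 * ?d \<eta> G N" for N
      using L0_square_add[OF square_integrable_on_diff[OF square_integrable_on_grid[OF \<xi> h order_refl assms(3)] H]
          square_integrable_on_diff[OF square_integrable_on_grid[OF \<eta> h order_refl assms(3)] G], of N N]
      by (simp add: \<zeta>_def algebra_simps)
    then show "\<forall>\<^sub>F N in sequentially. ?d \<zeta> (\<lambda>u y. H u y + G u y) N \<le> 2 * ?d \<xi> H N + 2 * ?d \<eta> G N" by simp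
  qed (simp add: L0_nonneg)
  moreover have "null_seq (\<lambda>N. L0 (\<lambda>y. ?g \<zeta> N y - (J y + I y)))"
  proof (rule tendsto_sandwich[OF _ _ tendsto_const])
    show "null_seq (\<lambda>N. L0 (\<lambda>y. ?g \<xi> N y - J y) + L0 (\<lambda>y. ?g \<eta> N y - I y))"
      using tendsto_add[OF \<xi>2 \<eta>2] by simp
    have gm: "?g x N \<in> borel_measurable M" if "\<And>N. grid_adapted (h N) (x N)" for x N
      using that h[of N] assms(3) by (intro grid_integral_measurable) auto
    have "L0 (\<lambda>y. ?g \<zeta> N y - (J y + I y)) \<le> L0 (\<lambda>y. ?g \<xi> N y - J y) + L0 (\<lambda>y. ?g \<eta> N y - I y)" for N
    proof (rule L0_le_add)
      show "AE y in M. \<bar>?g \<zeta> N y - (J y + I y)\<bar> \<le> \<bar>?g \<xi> N y - J y\<bar> + \<bar>?g \<eta> N y - I y\<bar>"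
        by (rule AE_I2) (simp add: \<zeta>_def grid_integral_add)
    qed (intro borel_measurable_diff borel_measurable_add gm \<xi> \<eta> \<zeta> Jm)+
    then show "\<forall>\<^sub>F N in sequentially. L0 (\<lambda>y. ?g \<zeta> N y - (J y + I y)) \<le> L0 (\<lambda>y. ?g \<xi> N y - J y) + L0 (\<lambda>y. ?g \<eta> N y - I y)"
      by simp
  qed (simp add: L0_nonneg)
  ultimately show "\<exists>\<xi>. (\<forall>N. grid_adapted (T / real (Suc N)) (\<xi> N)) \<and>
      (\<lambda>N. L0 (\<lambda>y. LBINT u:{0..s}. (\<xi> N (grid_index (T / real (Suc N)) u) y - (H u y + G u y))\<^sup>2)) \<longlonglongrightarrow> 0 \<and>
      (\<lambda>N. L0 (\<lambda>y. grid_integral (T / real (Suc N)) (Suc N) (\<xi> N) s y - (J y + I y))) \<longlonglongrightarrow> 0"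
    using \<zeta> unfolding h_def by blast
qed

lemma square_integrable_on_sum:
  assumes "finite A" "\<And>a. a \<in> A \<Longrightarrow> square_integrable_on r s (H a)"
  shows "square_integrable_on r s (\<lambda>u y. \<Sum>a\<in>A. H a u y)"
  using assms
proof (induction A rule: finite_induct)
  case empty
  then show ?case by (simp add: square_integrable_on_def jointly_measurable_def split_beta' set_integrable_def)
next
  case (insert a A)
  then show ?case using square_integrable_on_add[of r s "H a" "\<lambda>u y. \<Sum>a\<in>A. H a u y"] by simp
qed

lemma ito_limit_sum:
  assumes "finite A" "0 \<le> s" "\<And>a. a \<in> A \<Longrightarrow> ito_limit (H a) s (J a)"
    "\<And>a. a \<in> A \<Longrightarrow> square_integrable_on 0 s (H a)"
  shows "ito_limit (\<lambda>u y. \<Sum>a\<in>A. H a u y) s (\<lambda>y. \<Sum>a\<in>A. J a y)"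
  using assms
proof (induction A rule: finite_induct)
  case (insert a A)
  have "ito_limit (\<lambda>u y. H a u y + (\<Sum>a\<in>A. H a u y)) s (\<lambda>y. J a y + (\<Sum>a\<in>A. J a y))"
    by (rule ito_limit_add) (use insert square_integrable_on_sum[of A 0 s H] in auto)
  then show ?case using insert by simp
qed (simp add: ito_limit_0)

end

section \<open>Time integrals\<close>

definition clip :: "real \<Rightarrow> real \<Rightarrow> real" where
  "clip L x = max (- L) (min L x)"

lemma clip_measurable [measurable]: "clip L \<in> borel_measurable borel"
  unfolding clip_def[abs_def] by measurable

lemma abs_clip_le: "0 \<le> L \<Longrightarrow> \<bar>clip L x\<bar> \<le> L"
  by (auto simp: clip_def)

lemma abs_clip_diff_le: "\<bar>clip L x - clip L y\<bar> \<le> \<bar>x - y\<bar>"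
  by (auto simp: clip_def)

lemma abs_clip_diff_self_le: "0 \<le> L \<Longrightarrow> \<bar>clip L x - x\<bar> \<le> \<bar>x\<bar>"
  by (auto simp: clip_def)

lemma clip_tendsto:
  assumes "filterlim L at_top F"
  shows "((\<lambda>N. clip (L N) x) \<longlongrightarrow> x) F"
proof -
  have "\<forall>\<^sub>F N in F. \<bar>x\<bar> \<le> L N" using assms by (simp add: filterlim_at_top)
  then have "\<forall>\<^sub>F N in F. x = clip (L N) x" by eventually_elim (auto simp: clip_def)
  then show ?thesis by (rule Lim_transform_eventually[OF tendsto_const])
qed

lemma set_integral_shrinking:
  fixes f :: "real \<Rightarrow> real"
  assumes f: "set_integrable lborel {0..s} f" "f \<in> borel_measurable borel"
    and g: "g \<longlonglongrightarrow> s" "\<And>N. 0 \<le> g N"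
  shows "null_seq (\<lambda>N. LBINT u:{g N..s}. f u)"
proof -
  have "(\<lambda>N. LBINT u:{g N..s}. f u) \<longlonglongrightarrow> (LINT (u::real)|lborel. 0)"
    unfolding set_lebesgue_integral_def
  proof (rule integral_dominated_convergence[where w="\<lambda>u. norm (indicator {0..s} u *\<^sub>R f u)"])
    show "integrable lborel (\<lambda>u. norm (indicator {0..s} u *\<^sub>R f u))"
      using f by (intro integrable_norm) (simp add: set_integrable_def)
    have "AE u in lborel. u \<noteq> s" by (rule AE_lborel_singleton)
    then show "AE u in lborel. (\<lambda>N. indicator {g N..s} u *\<^sub>R f u) \<longlonglongrightarrow> 0"
    proof eventually_elim
      fix u assume "u \<noteq> s"
      have "\<forall>\<^sub>F N in sequentially. 0 = indicator {g N..s} u *\<^sub>R f u"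
      proof (cases "u < s")
        case True
        have "\<forall>\<^sub>F N in sequentially. u < g N" by (rule order_tendstoD(1)[OF g(1) True])
        then show ?thesis by eventually_elim simp
      qed (use \<open>u \<noteq> s\<close> in simp)
      then show "null_seq (\<lambda>N. indicator {g N..s} u *\<^sub>R f u)"
        by (rule Lim_transform_eventually[OF tendsto_const])
    qed
    fix N
    show "AE u in lborel. norm (indicator {g N..s} u *\<^sub>R f u) \<le> norm (indicator {0..s} u *\<^sub>R f u)"
      using g(2)[of N] by (intro AE_I2) (auto simp: indicator_def)
  qed (use f in measurable)
  then show ?thesis by simp
qed

text \<open>Clipping never moves a value by more than its modulus, so |f|^p itself is the dominating
  function.\<close>

lemma set_integral_clip_tendsto:
  fixes f :: "real \<Rightarrow> real"
  assumes f: "set_integrable lborel {r..s} (\<lambda>u. \<bar>f u\<bar> ^ p)" "f \<in> borel_measurable borel" and p: "0 < p"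
    and L: "filterlim L at_top sequentially" "\<And>N. 0 \<le> L N"
  shows "null_seq (\<lambda>N. LBINT u:{r..s}. \<bar>clip (L N) (f u) - f u\<bar> ^ p)"
proof -
  have "(\<lambda>N. LBINT u:{r..s}. \<bar>clip (L N) (f u) - f u\<bar> ^ p) \<longlonglongrightarrow> (LINT (u::real)|lborel. 0)"
    unfolding set_lebesgue_integral_def
  proof (rule integral_dominated_convergence[where w="\<lambda>u. indicator {r..s} u *\<^sub>R \<bar>f u\<bar> ^ p"])
    show "integrable lborel (\<lambda>u. indicator {r..s} u *\<^sub>R \<bar>f u\<bar> ^ p)"
      using f by (simp add: set_integrable_def)
    show "AE u in lborel. (\<lambda>N. indicator {r..s} u *\<^sub>R \<bar>clip (L N) (f u) - f u\<bar> ^ p) \<longlonglongrightarrow> 0"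
    proof (rule AE_I2)
      fix u
      have "(\<lambda>N. indicator {r..s} u *\<^sub>R \<bar>clip (L N) (f u) - f u\<bar> ^ p) \<longlonglongrightarrow> indicator {r..s} u *\<^sub>R \<bar>f u - f u\<bar> ^ p"
        by (intro tendsto_intros clip_tendsto L)
      then show "null_seq (\<lambda>N. indicator {r..s} u *\<^sub>R \<bar>clip (L N) (f u) - f u\<bar> ^ p)"
        using p by (simp add: zero_power)
    qed
    fix N
    show "AE u in lborel. norm (indicator {r..s} u *\<^sub>R \<bar>clip (L N) (f u) - f u\<bar> ^ p) \<le> indicator {r..s} u *\<^sub>R \<bar>f u\<bar> ^ p"
      using abs_clip_diff_self_le[OF L(2)] by (intro AE_I2) (auto simp: indicator_def power_mono)
  qed (use f in measurable)
  then show ?thesis by simp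
qed

lemma set_integral_split:
  fixes f :: "real \<Rightarrow> real"
  assumes f: "set_integrable lborel {r..s} f" and t: "r \<le> t" "t \<le> s"
  shows "(LBINT u:{r..s}. f u) = (LBINT u:{r..t}. f u) + (LBINT u:{t..s}. f u)"
proof -
  have i: "set_integrable lborel {r..t} f" "set_integrable lborel {t..s} f"
    using t by (auto intro: set_integrable_subset[OF f])
  have ne: "AE u in lborel. u \<noteq> t" by (rule AE_lborel_singleton)
  have "(LBINT u:{r..s}. f u) = (LINT u|lborel. indicator {r..t} u *\<^sub>R f u + indicator {t..s} u *\<^sub>R f u)"
    unfolding set_lebesgue_integral_def
  proof (rule integral_cong_AE)
    show "AE u in lborel. indicator {r..s} u *\<^sub>R f u = indicator {r..t} u *\<^sub>R f u + indicator {t..s} u *\<^sub>R f u"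
      using ne by eventually_elim (use t in \<open>auto simp: indicator_def\<close>)
  qed (use f i in \<open>auto simp: set_integrable_def intro!: borel_measurable_add\<close>)
  also have "\<dots> = (LBINT u:{r..t}. f u) + (LBINT u:{t..s}. f u)"
    using i unfolding set_lebesgue_integral_def set_integrable_def by (rule Bochner_Integration.integral_add)
  finally show ?thesis .
qed

context prob_space
begin

lemma L0_cmult_le:
  assumes "X \<in> borel_measurable M"
  shows "L0 (\<lambda>y. c * X y) \<le> (1 + \<bar>c\<bar>) * L0 X"
proof -
  have "L0 (\<lambda>y. c * X y) \<le> L0 (\<lambda>y. (1 + \<bar>c\<bar>) * X y)"
    by (rule L0_mono) (use assms in \<open>auto simp: abs_mult mult_right_mono\<close>)
  also have "\<dots> \<le> (1 + \<bar>c\<bar>) * L0 X" by (rule L0_cmult) (use assms in auto)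
  finally show ?thesis .
qed

lemma fubini_time:
  assumes Y: "jointly_measurable M Y" "\<And>u. u \<in> {r..s} \<Longrightarrow> integrable M (Y u)"
    and B: "set_integrable lborel {r..s} (\<lambda>u. \<E> (\<lambda>y. \<bar>Y u y\<bar>))"
  shows "set_integrable lborel {r..s} (\<lambda>u. \<E> (Y u))"
    and "integrable M (\<lambda>y. LBINT u:{r..s}. Y u y)"
    and "AE y in M. set_integrable lborel {r..s} (\<lambda>u. Y u y)"
    and "\<E> (\<lambda>y. LBINT u:{r..s}. Y u y) = (LBINT u:{r..s}. \<E> (Y u))"
proof -
  interpret P: pair_sigma_finite "lborel :: real measure" M
    by (intro pair_sigma_finite.intro sigma_finite_lborel) unfold_locales
  define f where "f = (\<lambda>u y. indicator {r..s} u *\<^sub>R Y u y)"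
  have fm: "case_prod f \<in> borel_measurable (lborel \<Otimes>\<^sub>M M)"
    using Y(1) unfolding jointly_measurable_def f_def split_beta' by measurable
  have int: "integrable (lborel \<Otimes>\<^sub>M M) (case_prod f)"
  proof (rule P.Fubini_integrable[OF fm])
    have "(\<lambda>u. \<E> (\<lambda>y. norm (case_prod f (u, y)))) = (\<lambda>u. indicator {r..s} u *\<^sub>R \<E> (\<lambda>y. \<bar>Y u y\<bar>))"
      by (auto simp: f_def indicator_def)
    then show "integrable lborel (\<lambda>u. \<E> (\<lambda>y. norm (case_prod f (u, y))))"
      using B by (simp add: set_integrable_def)
    show "AE u in lborel. integrable M (\<lambda>y. case_prod f (u, y))"
      using Y(2) by (intro AE_I2) (auto simp: f_def indicator_def)
  qed
  have e: "indicator {r..s} u *\<^sub>R \<E> (Y u) = \<E> (f u)" for u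
    by (simp add: f_def)
  show "set_integrable lborel {r..s} (\<lambda>u. \<E> (Y u))"
    unfolding set_integrable_def e by (rule P.integrable_fst[OF int])
  show "integrable M (\<lambda>y. LBINT u:{r..s}. Y u y)"
    using P.integrable_snd[OF int] by (simp add: f_def set_lebesgue_integral_def)
  show "AE y in M. set_integrable lborel {r..s} (\<lambda>u. Y u y)"
    using P.AE_integrable_snd[OF int] by (simp add: f_def set_integrable_def)
  show "\<E> (\<lambda>y. LBINT u:{r..s}. Y u y) = (LBINT u:{r..s}. \<E> (Y u))"
    using P.Fubini_integral[OF int] by (simp add: f_def set_lebesgue_integral_def)
qed

lemma fubini_time_bounded:
  assumes Y: "jointly_measurable M Y" "\<And>u y. u \<in> {r..s} \<Longrightarrow> y \<in> space M \<Longrightarrow> \<bar>Y u y\<bar> \<le> B"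
  shows "set_integrable lborel {r..s} (\<lambda>u. \<E> (Y u))"
    and "integrable M (\<lambda>y. LBINT u:{r..s}. Y u y)"
    and "AE y in M. set_integrable lborel {r..s} (\<lambda>u. Y u y)"
    and "\<E> (\<lambda>y. LBINT u:{r..s}. Y u y) = (LBINT u:{r..s}. \<E> (Y u))"
proof -
  have i: "integrable M (Y u)" if "u \<in> {r..s}" for u
    by (rule integrable_const_bound[where B=B])
      (use Y(2)[OF that] jointly_measurable_at[OF Y(1)] in auto)
  have "set_integrable lborel {r..s} (\<lambda>u. \<E> (\<lambda>y. \<bar>Y u y\<bar>))"
  proof (rule set_integrable_bounded[where B=B])
    have "(\<lambda>(u, y). \<bar>Y u y\<bar>) \<in> borel_measurable (lborel \<Otimes>\<^sub>M M)"
      using Y(1) unfolding jointly_measurable_def split_beta' by measurable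
    then have "(\<lambda>u. \<E> (\<lambda>y. \<bar>Y u y\<bar>)) \<in> borel_measurable lborel"
      by (rule borel_measurable_lebesgue_integral)
    then show "(\<lambda>u. \<E> (\<lambda>y. \<bar>Y u y\<bar>)) \<in> borel_measurable borel" by simp
    fix u assume u: "r \<le> u" "u \<le> s"
    have "\<E> (\<lambda>y. \<bar>Y u y\<bar>) \<le> \<E> (\<lambda>_. B)"
      using i u Y(2) by (intro integral_mono) auto
    moreover have "0 \<le> \<E> (\<lambda>y. \<bar>Y u y\<bar>)" by (rule integral_nonneg_AE) auto
    ultimately show "\<bar>\<E> (\<lambda>y. \<bar>Y u y\<bar>)\<bar> \<le> B" by (simp add: prob_space)
  qed
  from fubini_time[OF Y(1) i this]
  show "set_integrable lborel {r..s} (\<lambda>u. \<E> (Y u))"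
    and "integrable M (\<lambda>y. LBINT u:{r..s}. Y u y)"
    and "AE y in M. set_integrable lborel {r..s} (\<lambda>u. Y u y)"
    and "\<E> (\<lambda>y. LBINT u:{r..s}. Y u y) = (LBINT u:{r..s}. \<E> (Y u))"
    by auto
qed

end

section \<open>Bounded grid approximations\<close>

context brownian
begin

lemma grid_adapted_clip:
  assumes "grid_adapted h \<xi>" "0 \<le> L"
  shows "grid_adapted h (\<lambda>j y. clip L (\<xi> j y))"
  using assms unfolding grid_adapted_def
  by (auto intro!: measurable_compose[OF _ clip_measurable] exI[of _ L] abs_clip_le)

text \<open>Clipping does not increase differences, so only the clipping error of the limit itself matters.\<close>

lemma clipped_approximation:
  assumes Y: "jointly_measurable M Y" "AE y in M. set_integrable lborel {0..T} (\<lambda>u. \<bar>Y u y\<bar> ^ p)" and p: "0 < p"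
    and T: "0 < T" and L: "filterlim L at_top sequentially" "\<And>N. 0 \<le> L N"
    and \<xi>: "\<And>N. grid_adapted (T / real (Suc N)) (\<xi> N)"
    and lim: "null_seq (\<lambda>N. L0 (\<lambda>y. LBINT u:{0..T}. \<bar>\<xi> N (grid_index (T / real (Suc N)) u) y - Y u y\<bar> ^ p))"
  shows "null_seq (\<lambda>N. L0 (\<lambda>y. LBINT u:{0..T}. \<bar>clip (L N) (\<xi> N (grid_index (T / real (Suc N)) u) y) - Y u y\<bar> ^ p))"
proof -
  define Z where "Z = (\<lambda>N u y. \<xi> N (grid_index (T / real (Suc N)) u) y)"
  have Zj: "jointly_measurable M (Z N)" for N
    unfolding Z_def by (rule jointly_measurable_grid) (use \<xi> grid_adapted_measurable in blast)
  have cj: "jointly_measurable M (\<lambda>u y. clip l (V u y))" if "jointly_measurable M V" for l V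
    by (rule jointly_measurable_comp[OF that]) measurable
  have pj: "jointly_measurable M (\<lambda>u y. \<bar>V u y\<bar> ^ p)" if "jointly_measurable M V" for V
    by (rule jointly_measurable_comp[OF that, where \<phi>="\<lambda>x. \<bar>x\<bar> ^ p"]) measurable
  let ?A = "\<lambda>N y. LBINT u:{0..T}. \<bar>Z N u y - Y u y\<bar> ^ p"
  let ?B = "\<lambda>N y. LBINT u:{0..T}. \<bar>clip (L N) (Y u y) - Y u y\<bar> ^ p"
  let ?C = "\<lambda>N y. LBINT u:{0..T}. \<bar>clip (L N) (Z N u y) - Y u y\<bar> ^ p"
  have Am: "?A N \<in> borel_measurable M" and Bm: "?B N \<in> borel_measurable M" and Cm: "?C N \<in> borel_measurable M" for N
    by (intro measurable_set_integral pj jointly_measurable_diff cj Zj Y(1))+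
  have B0: "null_seq (\<lambda>N. L0 (?B N))"
  proof (rule L0_tendsto_0_AE[OF Bm])
    show "AE y in M. (\<lambda>N. ?B N y) \<longlonglongrightarrow> 0"
      using Y(2) AE_space
      by eventually_elim (rule set_integral_clip_tendsto[OF _ jointly_measurable_path[OF Y(1)] p L], auto)
  qed
  \<comment> \<open>A crude constant in place of convexity, so that one lemma serves
    \<open>p = 1\<close> for the drift and \<open>p = 2\<close> for the noise.\<close>
  have pw: "\<bar>a + b\<bar> ^ p \<le> 2 ^ p * (\<bar>a\<bar> ^ p + \<bar>b\<bar> ^ p)" for a b :: real
  proof -
    have "\<bar>a + b\<bar> \<le> 2 * max \<bar>a\<bar> \<bar>b\<bar>" by linarith
    then have "\<bar>a + b\<bar> ^ p \<le> (2 * max \<bar>a\<bar> \<bar>b\<bar>) ^ p" by (rule power_mono) simp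
    also have "\<dots> = 2 ^ p * max \<bar>a\<bar> \<bar>b\<bar> ^ p" by (simp add: power_mult_distrib)
    also have "\<dots> \<le> 2 ^ p * (\<bar>a\<bar> ^ p + \<bar>b\<bar> ^ p)" by (simp add: max_def)
    finally show ?thesis .
  qed
  have le: "AE y in M. ?C N y \<le> 2 ^ p * ?A N y + 2 ^ p * ?B N y" for N
    using Y(2) AE_space
  proof eventually_elim
    fix y assume iY: "set_integrable lborel {0..T} (\<lambda>u. \<bar>Y u y\<bar> ^ p)" and y: "y \<in> space M"
    note [measurable] = jointly_measurable_path[OF Y(1) y] jointly_measurable_path[OF Zj y]
    have h: "0 < T / real (Suc N)" and hT: "T \<le> real (Suc N) * (T / real (Suc N))" using T by simp_all
    have iZ: "set_integrable lborel {0..T} (\<lambda>u. \<bar>Z N u y\<bar> ^ p)"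
      unfolding Z_def using T by (intro grid_set_integral(1)[OF h order_refl _ hT]) auto
    have iA: "set_integrable lborel {0..T} (\<lambda>u. \<bar>Z N u y - Y u y\<bar> ^ p)"
    proof (rule set_integrable_bound)
      show "set_integrable lborel {0..T} (\<lambda>u. 2 ^ p * (\<bar>Z N u y\<bar> ^ p + \<bar>Y u y\<bar> ^ p))"
        using iY iZ by (intro set_integrable_mult_right set_integral_add)
      show "AE u in lborel. u \<in> {0..T} \<longrightarrow> norm (\<bar>Z N u y - Y u y\<bar> ^ p) \<le> norm (2 ^ p * (\<bar>Z N u y\<bar> ^ p + \<bar>Y u y\<bar> ^ p))"
        using pw[of "Z N u y" "- Y u y" for u] by (auto intro!: AE_I2)
    qed (simp add: set_borel_measurable_def)
    have iB: "set_integrable lborel {0..T} (\<lambda>u. \<bar>clip (L N) (Y u y) - Y u y\<bar> ^ p)"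
      by (rule set_integrable_bound[OF iY])
        (auto simp: set_borel_measurable_def intro!: AE_I2 power_mono abs_clip_diff_self_le L)
    have ptw: "\<bar>clip (L N) (Z N u y) - Y u y\<bar> ^ p
        \<le> 2 ^ p * \<bar>Z N u y - Y u y\<bar> ^ p + 2 ^ p * \<bar>clip (L N) (Y u y) - Y u y\<bar> ^ p" for u
    proof -
      have "\<bar>clip (L N) (Z N u y) - clip (L N) (Y u y)\<bar> ^ p \<le> \<bar>Z N u y - Y u y\<bar> ^ p"
        by (intro power_mono abs_clip_diff_le) simp
      then have "2 ^ p * \<bar>clip (L N) (Z N u y) - clip (L N) (Y u y)\<bar> ^ p \<le> 2 ^ p * \<bar>Z N u y - Y u y\<bar> ^ p"
        by (rule mult_left_mono) simp
      moreover have "\<bar>clip (L N) (Z N u y) - Y u y\<bar> ^ p \<le> 2 ^ p * \<bar>clip (L N) (Z N u y) - clip (L N) (Y u y)\<bar> ^ p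
          + 2 ^ p * \<bar>clip (L N) (Y u y) - Y u y\<bar> ^ p"
        using pw[of "clip (L N) (Z N u y) - clip (L N) (Y u y)" "clip (L N) (Y u y) - Y u y"]
        by (simp add: distrib_left)
      ultimately show ?thesis by linarith
    qed
    have i2: "set_integrable lborel {0..T} (\<lambda>u. 2 ^ p * \<bar>Z N u y - Y u y\<bar> ^ p + 2 ^ p * \<bar>clip (L N) (Y u y) - Y u y\<bar> ^ p)"
      using iA iB by (intro set_integral_add set_integrable_mult_right)
    have iC: "set_integrable lborel {0..T} (\<lambda>u. \<bar>clip (L N) (Z N u y) - Y u y\<bar> ^ p)"
      by (rule set_integrable_bound[OF i2])
        (auto simp: set_borel_measurable_def intro!: AE_I2 order.trans[OF ptw])
    show "?C N y \<le> 2 ^ p * ?A N y + 2 ^ p * ?B N y"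
      using set_integral_mono[OF iC i2 ptw] iA iB by (simp add: set_integral_add)
  qed
  have "L0 (?C N) \<le> 2 ^ p * L0 (?A N) + 2 ^ p * L0 (?B N)" for N
  proof -
    have "L0 (?C N) \<le> L0 (\<lambda>y. 2 ^ p * ?A N y) + L0 (\<lambda>y. 2 ^ p * ?B N y)"
    proof (rule L0_le_add)
      show "AE y in M. \<bar>?C N y\<bar> \<le> \<bar>2 ^ p * ?A N y\<bar> + \<bar>2 ^ p * ?B N y\<bar>"
        using le[of N]
      proof eventually_elim
        fix y assume "?C N y \<le> 2 ^ p * ?A N y + 2 ^ p * ?B N y"
        moreover have "0 \<le> ?C N y" by (rule set_integral_nonneg_all) simp
        ultimately show "\<bar>?C N y\<bar> \<le> \<bar>2 ^ p * ?A N y\<bar> + \<bar>2 ^ p * ?B N y\<bar>" by linarith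
      qed
    qed (use Am Bm Cm in measurable)
    also have "\<dots> \<le> 2 ^ p * L0 (?A N) + 2 ^ p * L0 (?B N)"
      using Am Bm by (intro add_mono L0_cmult) auto
    finally show ?thesis .
  qed
  then have up: "\<forall>\<^sub>F N in sequentially. L0 (?C N) \<le> 2 ^ p * L0 (?A N) + 2 ^ p * L0 (?B N)" by (rule always_eventually[OF allI])
  have "(\<lambda>N. 2 ^ p * L0 (?A N) + 2 ^ p * L0 (?B N)) \<longlonglongrightarrow> 2 ^ p * 0 + 2 ^ p * 0"
    using lim B0 unfolding Z_def by (intro tendsto_intros)
  then have lim2: "null_seq (\<lambda>N. 2 ^ p * L0 (?A N) + 2 ^ p * L0 (?B N))" by simp
  have "null_seq (\<lambda>N. L0 (?C N))"
    by (rule tendsto_sandwich[OF always_eventually[OF allI] up tendsto_const lim2]) (rule L0_nonneg)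
  then show ?thesis by (simp add: Z_def)
qed

end

context prob_space
begin

lemma L0_squeeze:
  assumes "\<And>N. L0 (Y N) \<le> B N" "null_seq B"
  shows "null_seq (\<lambda>N. L0 (Y N))"
  by (rule tendsto_sandwich[OF _ _ tendsto_const assms(2)]) (simp_all add: L0_nonneg assms(1))

end

section \<open>Linear systems with conservative drift\<close>

text \<open>The equation is required at each fixed time only, almost surely; neither continuity nor
  moments of \<open>X\<close> are assumed, and integrability of the drift along paths is an
  assumption of its own. \<open>skew\<close> says that the drift is orthogonal to the state, hence
  conserves energy, and the growth bound is what closes the Gronwall argument.\<close>

locale conservative_system = brownian M F W
  for M :: "'w measure" and F :: "real \<Rightarrow> 'w measure" and W :: "real \<Rightarrow> 'w \<Rightarrow> real" +
  fixes I :: "'i set" and X H :: "'i \<Rightarrow> real \<Rightarrow> 'w \<Rightarrow> real" and x0 :: "'i \<Rightarrow> real"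
    and a :: "'i \<Rightarrow> 'i \<Rightarrow> real" and C :: real
    and b :: "'i \<Rightarrow> real \<Rightarrow> 'w \<Rightarrow> real"
  defines "b \<equiv> \<lambda>i s y. \<Sum>k\<in>I. a i k * X k s y"
  assumes fin: "finite I"
    and X_jm: "i \<in> I \<Longrightarrow> jointly_measurable M (X i)"
    and X_adapted: "i \<in> I \<Longrightarrow> 0 \<le> s \<Longrightarrow> X i s \<in> borel_measurable (F s)"
    and H_square: "i \<in> I \<Longrightarrow> 0 \<le> s \<Longrightarrow> square_integrable_on 0 s (H i)"
    and skew: "0 \<le> s \<Longrightarrow> y \<in> space M \<Longrightarrow> (\<Sum>i\<in>I. X i s y * b i s y) = 0"
    and b_integrable: "i \<in> I \<Longrightarrow> 0 \<le> s \<Longrightarrow> AE y in M. set_integrable lborel {0..s} (\<lambda>u. b i u y)"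
    and equation: "i \<in> I \<Longrightarrow> 0 \<le> s \<Longrightarrow>
      \<exists>J. ito_limit (H i) s J \<and> (AE y in M. X i s y = x0 i + (LBINT u:{0..s}. b i u y) + J y)"
    and growth: "0 \<le> s \<Longrightarrow> y \<in> space M \<Longrightarrow> (\<Sum>i\<in>I. (H i s y)\<^sup>2) \<le> C * (1 + (\<Sum>i\<in>I. (X i s y)\<^sup>2))"
    and C_nonneg: "0 \<le> C"
begin

lemma H_jm: "i \<in> I \<Longrightarrow> jointly_measurable M (H i)"
  using H_square[of i 0] by (simp add: square_integrable_on_def)

lemma b_jm: "jointly_measurable M (b i)"
  unfolding b_def by (intro jointly_measurable_sum jointly_measurable_comp[OF X_jm, where \<phi>="\<lambda>x. _ * x"]) auto

lemma X_measurable: "i \<in> I \<Longrightarrow> X i s \<in> borel_measurable M"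
  by (rule jointly_measurable_at[OF X_jm])

lemma b_measurable: "b i s \<in> borel_measurable M"
  by (rule jointly_measurable_at[OF b_jm])

lemma b_adapted: "0 \<le> s \<Longrightarrow> b i s \<in> borel_measurable (F s)"
  unfolding b_def using X_adapted by (intro borel_measurable_sum borel_measurable_times) auto

text \<open>Over a short interval the drift integral is small path by path, and the noise integral
  is small in probability by \<open>ito_limit_L0_le\<close>. Continuity from the left is the
  direction that matters, because step data are sampled at left nodes.\<close>

lemma X_continuous_in_probability:
  assumes i: "i \<in> I" and s: "0 \<le> s" and g: "g \<longlonglongrightarrow> s" "\<And>N. 0 \<le> g N" "\<And>N. g N \<le> s"
  shows "null_seq (\<lambda>N. L0 (\<lambda>y. X i s y - X i (g N) y))"
proof -
  have "\<forall>t. \<exists>J. 0 \<le> t \<longrightarrow> ito_limit (H i) t J \<and> (AE y in M. X i t y = x0 i + (LBINT u:{0..t}. b i u y) + J y)"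
    using equation[OF i] by blast
  then obtain J where J: "\<And>t. 0 \<le> t \<Longrightarrow> ito_limit (H i) t (J t)"
    and eq: "\<And>t. 0 \<le> t \<Longrightarrow> AE y in M. X i t y = x0 i + (LBINT u:{0..t}. b i u y) + J t y"
    by metis
  have Jm: "J t \<in> borel_measurable M" if "0 \<le> t" for t using J[OF that] by (simp add: ito_limit_def)
  have bm: "(\<lambda>y. LBINT u:{p..q}. b i u y) \<in> borel_measurable M" for p q
    by (rule measurable_set_integral[OF b_jm])
  have Jlim: "null_seq (\<lambda>N. L0 (\<lambda>y. J s y - J (g N) y))"
  proof (rule tendsto_0_of_sqrt_bound)
    have "null_seq (\<lambda>N. L0 (\<lambda>y. LBINT u:{g N..s}. (H i u y)\<^sup>2))"
    proof (rule L0_tendsto_0_AE)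
      show "AE y in M. (\<lambda>N. LBINT u:{g N..s}. (H i u y)\<^sup>2) \<longlonglongrightarrow> 0"
      proof -
        have "AE y in M. set_integrable lborel {0..s} (\<lambda>u. (H i u y)\<^sup>2)"
          using H_square[OF i s] by (simp add: square_integrable_on_def)
        then show ?thesis using AE_space
        proof eventually_elim
          case (elim y)
          have "(\<lambda>u. (H i u y)\<^sup>2) \<in> borel_measurable borel"
            using jointly_measurable_path[OF H_jm[OF i] elim(2)] by measurable
          then show ?case by (intro set_integral_shrinking elim(1) g(1,2))
        qed
      qed
    qed (use square_integral_measurable[OF H_square[OF i s]] in blast)
    from tendsto_mult_left[OF this, of 2]
    show "null_seq (\<lambda>N. 2 * L0 (\<lambda>y. LBINT u:{g N..s}. (H i u y)\<^sup>2))" by simp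
  qed (rule L0_nonneg, rule ito_limit_L0_le[OF J[OF s] J[OF g(2)] g(2,3) H_square[OF i s]])
  have blim: "null_seq (\<lambda>N. L0 (\<lambda>y. LBINT u:{g N..s}. b i u y))"
  proof (rule L0_tendsto_0_AE[OF bm])
    show "AE y in M. (\<lambda>N. LBINT u:{g N..s}. b i u y) \<longlonglongrightarrow> 0"
      using b_integrable[OF i s] AE_space
      by eventually_elim (rule set_integral_shrinking[OF _ jointly_measurable_path[OF b_jm] g(1,2)], auto)
  qed
  have "L0 (\<lambda>y. X i s y - X i (g N) y)
      \<le> L0 (\<lambda>y. LBINT u:{g N..s}. b i u y) + L0 (\<lambda>y. J s y - J (g N) y)" for N
  proof (rule L0_le_add)
    show "AE y in M. \<bar>X i s y - X i (g N) y\<bar> \<le> \<bar>LBINT u:{g N..s}. b i u y\<bar> + \<bar>J s y - J (g N) y\<bar>"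
      using eq[OF s] eq[OF g(2)[of N]] b_integrable[OF i s]
    proof eventually_elim
      case (elim y)
      have "(LBINT u:{0..s}. b i u y) = (LBINT u:{0..g N}. b i u y) + (LBINT u:{g N..s}. b i u y)"
        by (rule set_integral_split) (use elim(3) g in auto)
      then show ?case using elim(1,2) by simp
    qed
  qed (use X_measurable[OF i] bm Jm[OF s] Jm[OF g(2)] in measurable)
  then show ?thesis by (rule L0_squeeze[OF _ tendsto_add_zero[OF blim Jlim]])
qed

lemma b_continuous_in_probability:
  assumes s: "0 \<le> s" and g: "g \<longlonglongrightarrow> s" "\<And>N. 0 \<le> g N" "\<And>N. g N \<le> s"
  shows "null_seq (\<lambda>N. L0 (\<lambda>y. b i (g N) y - b i s y))"
proof -
  have m: "(\<lambda>y. X k s y - X k (g N) y) \<in> borel_measurable M" if "k \<in> I" for k N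
    using X_measurable[OF that] by measurable
  have "L0 (\<lambda>y. b i (g N) y - b i s y) \<le> (\<Sum>k\<in>I. (1 + \<bar>a i k\<bar>) * L0 (\<lambda>y. X k s y - X k (g N) y))" for N
  proof -
    have "L0 (\<lambda>y. b i (g N) y - b i s y) = L0 (\<lambda>y. \<Sum>k\<in>I. a i k * (X k s y - X k (g N) y))"
      by (subst L0_minus_commute) (simp add: b_def right_diff_distrib sum_subtractf)
    also have "\<dots> \<le> (\<Sum>k\<in>I. L0 (\<lambda>y. a i k * (X k s y - X k (g N) y)))"
      by (rule L0_sum[OF fin]) (intro borel_measurable_times borel_measurable_const m)
    also have "\<dots> \<le> (\<Sum>k\<in>I. (1 + \<bar>a i k\<bar>) * L0 (\<lambda>y. X k s y - X k (g N) y))"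
      by (intro sum_mono L0_cmult_le m)
    finally show ?thesis .
  qed
  note le = this
  have "(\<lambda>N. \<Sum>k\<in>I. (1 + \<bar>a i k\<bar>) * L0 (\<lambda>y. X k s y - X k (g N) y)) \<longlonglongrightarrow> (\<Sum>k\<in>I. (1 + \<bar>a i k\<bar>) * 0)"
    by (intro tendsto_intros X_continuous_in_probability s g)
  then have "null_seq (\<lambda>N. \<Sum>k\<in>I. (1 + \<bar>a i k\<bar>) * L0 (\<lambda>y. X k s y - X k (g N) y))" by simp
  with le show ?thesis by (rule L0_squeeze)
qed

text \<open>At each fixed time the drift at the left node converges to the drift in probability.
  Integrating this over time needs a bound, so the drift is first clipped at a fixed level
  \<open>K\<close>; then the grid is refined, then \<open>K\<close> grows, and
  \<open>diagonal_choice\<close> merges the two limits.\<close>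

lemma drift_approximation:
  assumes i: "i \<in> I" and T: "0 < T"
  shows "\<exists>\<beta>. (\<forall>N. grid_adapted (T / real (Suc N)) (\<beta> N)) \<and>
    (\<lambda>N. L0 (\<lambda>y. LBINT u:{0..T}. \<bar>\<beta> N (grid_index (T / real (Suc N)) u) y - b i u y\<bar>)) \<longlonglongrightarrow> 0"
proof -
  define h where "h = (\<lambda>N. T / real (Suc N))"
  have h: "h N > 0" and hT: "T \<le> real (Suc N) * h N" for N using T by (auto simp: h_def)
  have h0: "null_seq h" unfolding h_def by real_asymp
  define g where "g = (\<lambda>N u. real (grid_index (h N) u) * h N)"
  have g: "0 \<le> g N u" "g N u \<le> u" "u - h N \<le> g N u" if "0 < u" for N u
    using grid_index_bounds[OF h that, of N] h[of N] by (auto simp: g_def algebra_simps)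
  have gl: "(\<lambda>N. g N u) \<longlonglongrightarrow> u" if u: "0 < u" for u
  proof -
    have "(\<lambda>N. u - h N) \<longlonglongrightarrow> u" using tendsto_diff[OF tendsto_const h0] by simp
    then show ?thesis
      by (rule tendsto_sandwich[OF _ _ _ tendsto_const, rotated 2]) (use g[OF u] in simp_all)
  qed
  define \<beta> where "\<beta> = (\<lambda>K N j y. clip (real K) (b i (real j * h N) y))"
  have \<beta>a: "grid_adapted (h N) (\<beta> K N)" for K N
    unfolding grid_adapted_def
  proof (intro allI conjI)
    fix j
    have "b i (real j * h N) \<in> borel_measurable (F (real j * h N))"
      using h[of N] by (intro b_adapted) simp
    then show "\<beta> K N j \<in> borel_measurable (F (real j * h N))"
      unfolding \<beta>_def by measurable
    show "\<exists>B. \<forall>y\<in>space M. \<bar>\<beta> K N j y\<bar> \<le> B"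
      by (rule exI[of _ "real K"]) (simp add: \<beta>_def abs_clip_le)
  qed
  have \<beta>j: "jointly_measurable M (\<lambda>u y. \<beta> K N (grid_index (h N) u) y)" for K N
    by (rule jointly_measurable_grid) (use \<beta>a grid_adapted_measurable in blast)
  have cj: "jointly_measurable M (\<lambda>u y. clip (real K) (b i u y))" for K
    by (rule jointly_measurable_comp[OF b_jm]) measurable
  have aj: "jointly_measurable M (\<lambda>u y. \<bar>Y u y - Z u y\<bar>)" if "jointly_measurable M Y" "jointly_measurable M Z" for Y Z
    by (rule jointly_measurable_comp[OF jointly_measurable_diff[OF that], where \<phi>=abs]) measurable
  define Y where "Y = (\<lambda>K N u y. \<bar>\<beta> K N (grid_index (h N) u) y - clip (real K) (b i u y)\<bar>)"
  have Yj: "jointly_measurable M (Y K N)" for K N unfolding Y_def by (rule aj[OF \<beta>j cj])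
  have YB: "\<bar>Y K N u y\<bar> \<le> 1 + 2 * real K" for K N u y
    using abs_clip_le[of "real K" "b i (real (grid_index (h N) u) * h N) y"] abs_clip_le[of "real K" "b i u y"]
    by (auto simp: Y_def \<beta>_def)
  \<comment> \<open>Boundedness by the clipping level turns convergence in probability into
    convergence of means.\<close>
  have EY: "null_seq (\<lambda>N. \<E> (Y K N u))" if u: "0 < u" for K u
  proof -
    have up: "\<E> (Y K N u) \<le> (1 + 2 * real K) * L0 (\<lambda>y. b i (g N u) y - b i u y)" for N
    proof -
      have "\<E> (Y K N u) = \<E> (\<lambda>y. \<bar>Y K N u y\<bar>)" by (simp add: Y_def)
      also have "\<dots> \<le> (1 + 2 * real K) * L0 (Y K N u)"
        using YB by (intro expectation_le_L0 jointly_measurable_at[OF Yj]) auto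
      also have "L0 (Y K N u) \<le> L0 (\<lambda>y. b i (g N u) y - b i u y)"
        by (intro L0_mono jointly_measurable_at[OF Yj] borel_measurable_diff b_measurable)
          (auto simp: Y_def \<beta>_def g_def abs_clip_diff_le)
      finally show ?thesis by (simp add: mult_left_mono)
    qed
    have "(\<lambda>N. (1 + 2 * real K) * L0 (\<lambda>y. b i (g N u) y - b i u y)) \<longlonglongrightarrow> (1 + 2 * real K) * 0"
      using u g[OF u] by (intro tendsto_intros b_continuous_in_probability gl) auto
    then have "null_seq (\<lambda>N. (1 + 2 * real K) * L0 (\<lambda>y. b i (g N u) y - b i u y))" by simp
    then show ?thesis
      by (rule tendsto_sandwich[OF _ _ tendsto_const, rotated 2])
        (rule always_eventually[OF allI], rule integral_nonneg_AE, simp add: Y_def, rule always_eventually[OF allI], rule up)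
  qed
  have first: "null_seq (\<lambda>N. L0 (\<lambda>y. LBINT u:{0..T}. Y K N u y))" for K
  proof -
    have fub: "integrable M (\<lambda>y. LBINT u:{0..T}. Y K N u y)"
      "\<E> (\<lambda>y. LBINT u:{0..T}. Y K N u y) = (LBINT u:{0..T}. \<E> (Y K N u))"
      "set_integrable lborel {0..T} (\<lambda>u. \<E> (Y K N u))" for N
      using fubini_time_bounded[OF Yj YB] by auto
    have le: "L0 (\<lambda>y. LBINT u:{0..T}. Y K N u y) \<le> (LBINT u:{0..T}. \<E> (Y K N u))" for N
    proof -
      have "\<bar>LBINT u:{0..T}. Y K N u y\<bar> = (LBINT u:{0..T}. Y K N u y)" for y
        by (intro abs_of_nonneg set_integral_nonneg_all) (simp add: Y_def)
      then show ?thesis using L0_le_expectation[OF fub(1)[of N]] fub(2)[of N] by simp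
    qed
    have "(\<lambda>N. LBINT u:{0..T}. \<E> (Y K N u)) \<longlonglongrightarrow> (LINT (u::real)|lborel. 0)"
      unfolding set_lebesgue_integral_def
    proof (rule integral_dominated_convergence[where w="\<lambda>u. indicator {0..T} u * (1 + 2 * real K)"])
      show "integrable lborel (\<lambda>u. indicator {0..T} u * (1 + 2 * real K))" using T by simp
      show "(\<lambda>u. indicator {0..T} u *\<^sub>R \<E> (Y K N u)) \<in> borel_measurable lborel" for N
        using fub(3)[of N] by (auto simp: set_integrable_def)
      have "AE u in lborel. u \<noteq> (0::real)" by (rule AE_lborel_singleton)
      then show "AE u in lborel. (\<lambda>N. indicator {0..T} u *\<^sub>R \<E> (Y K N u)) \<longlonglongrightarrow> 0"
      proof eventually_elim
        case (elim u)
        show ?case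
        proof (cases "u \<in> {0..T}")
          case True
          then show ?thesis using EY[of u K] elim by auto
        qed simp
      qed
      fix N
      have "norm (\<E> (Y K N u)) \<le> 1 + 2 * real K" for u
      proof -
        have "norm (\<E> (Y K N u)) \<le> \<E> (\<lambda>y. \<bar>Y K N u y\<bar>)"
          using integral_norm_bound[of M "Y K N u"] by simp
        also have "\<dots> \<le> \<E> (\<lambda>_. 1 + 2 * real K)"
        proof (rule integral_mono)
          show "integrable M (\<lambda>y. \<bar>Y K N u y\<bar>)"
            by (rule integrable_const_bound[where B="1 + 2 * real K"])
              (use YB jointly_measurable_at[OF Yj] in auto)
        qed (use YB in auto)
        finally show ?thesis by (simp add: prob_space)
      qed
      then show "AE u in lborel. norm (indicator {0..T} u *\<^sub>R \<E> (Y K N u)) \<le> indicator {0..T} u * (1 + 2 * real K)"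
        by (intro AE_I2) (auto simp: indicator_def)
    qed simp
    then have "null_seq (\<lambda>N. LBINT u:{0..T}. \<E> (Y K N u))" by simp
    with le show ?thesis by (rule L0_squeeze)
  qed
  let ?B = "\<lambda>K y. LBINT u:{0..T}. \<bar>clip (real K) (b i u y) - b i u y\<bar>"
  have Bm: "?B K \<in> borel_measurable M" for K by (intro measurable_set_integral aj cj b_jm)
  have second: "null_seq (\<lambda>K. L0 (?B K))"
  proof (rule L0_tendsto_0_AE[OF Bm])
    show "AE y in M. (\<lambda>K. ?B K y) \<longlonglongrightarrow> 0"
      using b_integrable[OF i less_imp_le[OF T]] AE_space
    proof eventually_elim
      case (elim y)
      have "set_integrable lborel {0..T} (\<lambda>u. \<bar>b i u y\<bar> ^ 1)" using elim(1) by (simp add: set_integrable_abs)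
      from set_integral_clip_tendsto[OF this jointly_measurable_path[OF b_jm elim(2)], of real]
      show ?case using filterlim_real_sequentially by simp
    qed
  qed
  let ?d = "\<lambda>N x. L0 (\<lambda>y. LBINT u:{0..T}. \<bar>x (grid_index (h N) u) y - b i u y\<bar>)"
  have "\<forall>\<^sub>F N in sequentially. \<exists>x. grid_adapted (h N) x \<and> ?d N x < e" if e: "e > 0" for e
  proof -
    have "\<forall>\<^sub>F K in sequentially. L0 (?B K) < e/2" by (rule order_tendstoD(2)[OF second]) (use e in simp)
    then obtain K where K: "L0 (?B K) < e/2" by (auto simp: eventually_sequentially)
    have "\<forall>\<^sub>F N in sequentially. L0 (\<lambda>y. LBINT u:{0..T}. Y K N u y) < e/2"
      by (rule order_tendstoD(2)[OF first]) (use e in simp)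
    then show ?thesis
    proof eventually_elim
      case (elim N)
      have "?d N (\<beta> K N) \<le> L0 (\<lambda>y. LBINT u:{0..T}. Y K N u y) + L0 (?B K)"
      proof (rule L0_le_add)
        show "AE y in M. \<bar>LBINT u:{0..T}. \<bar>\<beta> K N (grid_index (h N) u) y - b i u y\<bar>\<bar>
          \<le> \<bar>LBINT u:{0..T}. Y K N u y\<bar> + \<bar>?B K y\<bar>"
          using b_integrable[OF i less_imp_le[OF T]] AE_space
        proof eventually_elim
          fix y assume bi: "set_integrable lborel {0..T} (\<lambda>u. b i u y)" and y: "y \<in> space M"
          note [measurable] = jointly_measurable_path[OF \<beta>j y] jointly_measurable_path[OF b_jm y]
            jointly_measurable_path[OF Yj y]
          have iY: "set_integrable lborel {0..T} (\<lambda>u. Y K N u y)"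
            by (rule set_integrable_bounded[OF _ YB]) measurable
          have iB: "set_integrable lborel {0..T} (\<lambda>u. \<bar>clip (real K) (b i u y) - b i u y\<bar>)"
            by (rule set_integrable_bound[OF bi])
              (auto simp: set_borel_measurable_def intro!: AE_I2 abs_clip_diff_self_le)
          have ptw: "\<bar>\<beta> K N (grid_index (h N) u) y - b i u y\<bar> \<le> Y K N u y + \<bar>clip (real K) (b i u y) - b i u y\<bar>" for u
            unfolding Y_def by linarith
          have iS: "set_integrable lborel {0..T} (\<lambda>u. Y K N u y + \<bar>clip (real K) (b i u y) - b i u y\<bar>)"
            using iY iB by (rule set_integral_add)
          have iC: "set_integrable lborel {0..T} (\<lambda>u. \<bar>\<beta> K N (grid_index (h N) u) y - b i u y\<bar>)"
            by (rule set_integrable_bound[OF iS])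
              (auto simp: set_borel_measurable_def intro!: AE_I2 order.trans[OF ptw])
          have "(LBINT u:{0..T}. \<bar>\<beta> K N (grid_index (h N) u) y - b i u y\<bar>) \<le> (LBINT u:{0..T}. Y K N u y) + ?B K y"
            using set_integral_mono[OF iC iS ptw] iY iB by (simp add: set_integral_add)
          moreover have "0 \<le> (LBINT u:{0..T}. \<bar>\<beta> K N (grid_index (h N) u) y - b i u y\<bar>)"
            by (rule set_integral_nonneg_all) simp
          ultimately show "\<bar>LBINT u:{0..T}. \<bar>\<beta> K N (grid_index (h N) u) y - b i u y\<bar>\<bar>
            \<le> \<bar>LBINT u:{0..T}. Y K N u y\<bar> + \<bar>?B K y\<bar>" by linarith
        qed
      qed (intro measurable_set_integral aj \<beta>j cj b_jm Yj)+
      then have "?d N (\<beta> K N) < e" using elim K by linarith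
      then show ?case using \<beta>a by blast
    qed
  qed
  then obtain x where "\<And>N. grid_adapted (h N) (x N)" "null_seq (\<lambda>N. ?d N (x N))"
    by (rule diagonal_choice[rotated 2]) (auto intro: grid_adapted_0 L0_nonneg)
  then show ?thesis unfolding h_def by blast
qed

text \<open>Not a recursion: \<open>\<beta>\<close> and \<open>\<xi>\<close> will approximate the
  drift and the noise of the given solution, and the sum merely integrates these step data.
  Convergence therefore needs no stability argument.\<close>

definition euler :: "real \<Rightarrow> ('i \<Rightarrow> nat \<Rightarrow> 'w \<Rightarrow> real) \<Rightarrow> ('i \<Rightarrow> nat \<Rightarrow> 'w \<Rightarrow> real) \<Rightarrow> 'i \<Rightarrow> nat \<Rightarrow> 'w \<Rightarrow> real" where
  "euler h \<beta> \<xi> i j y = x0 i + (\<Sum>l<j. h * \<beta> i l y + \<xi> i l y * (W (real (Suc l) * h) y - W (real l * h) y))"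

lemma euler_Suc:
  "euler h \<beta> \<xi> i (Suc j) y = euler h \<beta> \<xi> i j y + (h * \<beta> i j y + \<xi> i j y * (W (real (Suc j) * h) y - W (real j * h) y))"
  by (simp add: euler_def)

lemma euler_eq:
  assumes h: "0 < h" and j: "j \<le> N"
  shows "euler h \<beta> \<xi> i j y = x0 i + (LBINT u:{0..real j * h}. \<beta> i (grid_index h u) y)
    + grid_integral h N (\<xi> i) (real j * h) y"
proof -
  have 1: "(LBINT u:{0..real j * h}. \<beta> i (grid_index h u) y) = (\<Sum>l<j. h * \<beta> i l y)"
    using grid_set_integral_full[OF h, of j "\<lambda>l. \<beta> i l y"] .
  have 2: "grid_integral h N (\<xi> i) (real j * h) y = (\<Sum>l<j. \<xi> i l y * (W (real (Suc l) * h) y - W (real l * h) y))"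
    unfolding grid_integral_def
  proof (rule sum.mono_neutral_cong_right)
    show "\<forall>l\<in>{..<N} - {..<j}. \<xi> i l y * (W (min (real j * h) (real (Suc l) * h)) y - W (min (real j * h) (real l * h)) y) = 0"
    proof
      fix l assume "l \<in> {..<N} - {..<j}"
      then have "real j * h \<le> real l * h" "real j * h \<le> real (Suc l) * h"
        using h by (auto intro!: mult_right_mono)
      then have "min (real j * h) (real l * h) = real j * h" "min (real j * h) (real (Suc l) * h) = real j * h" by linarith+
      then show "\<xi> i l y * (W (min (real j * h) (real (Suc l) * h)) y - W (min (real j * h) (real l * h)) y) = 0" by simp
    qed
    fix l assume "l \<in> {..<j}"
    then have "real (Suc l) * h \<le> real j * h" "real l * h \<le> real j * h"
      using h by (auto intro!: mult_right_mono)
    then have "min (real j * h) (real l * h) = real l * h" "min (real j * h) (real (Suc l) * h) = real (Suc l) * h" by linarith+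
    then show "\<xi> i l y * (W (min (real j * h) (real (Suc l) * h)) y - W (min (real j * h) (real l * h)) y)
      = \<xi> i l y * (W (real (Suc l) * h) y - W (real l * h) y)" by simp
  qed (use j in auto)
  show ?thesis by (simp add: euler_def 1 2 sum.distrib)
qed

lemma euler_measurable:
  assumes "\<And>l. \<beta> i l \<in> borel_measurable M" "\<And>l. \<xi> i l \<in> borel_measurable M" "0 \<le> h"
  shows "euler h \<beta> \<xi> i j \<in> borel_measurable M"
  unfolding euler_def[abs_def] using assms
  by (intro borel_measurable_add borel_measurable_sum borel_measurable_times borel_measurable_diff W_measurable
      borel_measurable_const) auto

text \<open>Four errors: the drift after the last node before \<open>s\<close>, the drift
  approximation, the noise integral after that node, and the noise approximation. The first and the
  third are controlled by (L N)^2 times the step width, so the bound on the data may grow, but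
  slowly.\<close>

lemma euler_tendsto:
  assumes i: "i \<in> I" and T: "0 < T" "0 \<le> s" "s \<le> T"
    and \<beta>: "\<And>N. grid_adapted (T / real (Suc N)) (\<beta> N i)" and \<xi>: "\<And>N. grid_adapted (T / real (Suc N)) (\<xi> N i)"
    and \<beta>L: "\<And>N j y. y \<in> space M \<Longrightarrow> \<bar>\<beta> N i j y\<bar> \<le> L N" and \<xi>L: "\<And>N j y. y \<in> space M \<Longrightarrow> \<bar>\<xi> N i j y\<bar> \<le> L N"
    and L: "\<And>N. 1 \<le> L N" "null_seq (\<lambda>N. (L N)\<^sup>2 / real (Suc N))"
    and \<beta>lim: "null_seq (\<lambda>N. L0 (\<lambda>y. LBINT u:{0..T}. \<bar>\<beta> N i (grid_index (T / real (Suc N)) u) y - b i u y\<bar>))"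
    and \<xi>lim: "null_seq (\<lambda>N. L0 (\<lambda>y. LBINT u:{0..T}. (\<xi> N i (grid_index (T / real (Suc N)) u) y - H i u y)\<^sup>2))"
    and j: "\<And>N. j N \<le> Suc N" "\<And>N. real (j N) * (T / real (Suc N)) \<le> s"
      "\<And>N. s \<le> real (j N) * (T / real (Suc N)) + T / real (Suc N)"
  shows "null_seq (\<lambda>N. L0 (\<lambda>y. euler (T / real (Suc N)) (\<beta> N) (\<xi> N) i (j N) y - X i s y))"
proof -
  define h where "h = (\<lambda>N. T / real (Suc N))"
  have h: "h N > 0" and hT: "s \<le> real (Suc N) * h N" for N using T by (auto simp: h_def)
  note \<beta> = \<beta>[folded h_def[THEN fun_cong]] and \<xi> = \<xi>[folded h_def[THEN fun_cong]]
  note folds = h_def[THEN fun_cong, symmetric]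
  note \<beta>lim = \<beta>lim[unfolded folds] and \<xi>lim = \<xi>lim[unfolded folds] and j = j[unfolded folds]
  define t where "t = (\<lambda>N. real (j N) * h N)"
  have t: "0 \<le> t N" "t N \<le> s" "s - t N \<le> h N" "t N \<le> T" for N
    using j(2,3)[of N] h[of N] T by (auto simp: t_def)
  have L2h: "null_seq (\<lambda>N. (L N)\<^sup>2 * h N)"
    using tendsto_mult_left[OF L(2), of T] by (simp add: h_def mult.commute)
  obtain J where J: "ito_limit (H i) s J"
    and eq: "AE y in M. X i s y = x0 i + (LBINT u:{0..s}. b i u y) + J y"
    using equation[OF i T(2)] by blast
  have Jm: "J \<in> borel_measurable M" using J by (simp add: ito_limit_def)
  let ?G = "\<lambda>N r. grid_integral (h N) (Suc N) (\<xi> N i) r"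
  let ?b = "\<lambda>N u y. \<beta> N i (grid_index (h N) u) y"
  have bj: "jointly_measurable M (?b N)" for N
    by (rule jointly_measurable_grid) (use \<beta> grid_adapted_measurable in blast)
  have aj: "jointly_measurable M (\<lambda>u y. \<bar>?b N u y - b i u y\<bar>)" for N
    by (rule jointly_measurable_comp[OF jointly_measurable_diff[OF bj b_jm], where \<phi>=abs]) measurable
  let ?E1 = "\<lambda>N y. LBINT u:{t N..s}. ?b N u y"
  let ?E2 = "\<lambda>N y. LBINT u:{0..T}. \<bar>?b N u y - b i u y\<bar>"
  let ?E3 = "\<lambda>N y. ?G N s y - ?G N (t N) y"
  let ?E4 = "\<lambda>N y. ?G N s y - J y"
  have Gm: "?G N r \<in> borel_measurable M" if "0 \<le> r" for N r
    using \<xi> h[of N] that by (intro grid_integral_measurable) auto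
  have E1m: "?E1 N \<in> borel_measurable M" and E2m: "?E2 N \<in> borel_measurable M" for N
    by (intro measurable_set_integral bj aj)+
  have E3m: "?E3 N \<in> borel_measurable M" and E4m: "?E4 N \<in> borel_measurable M" for N
    by (intro borel_measurable_diff Gm Jm t T)+
  have int_le: "\<bar>LBINT u:{t N..s}. f u\<bar> \<le> B * h N"
    if "f \<in> borel_measurable borel" "\<And>u. \<bar>f u\<bar> \<le> B" for f B N
  proof -
    have B: "0 \<le> B" using that(2)[of 0] by linarith
    have i: "set_integrable lborel {t N..s} f" by (rule set_integrable_bounded[OF that])
    have "\<bar>LBINT u:{t N..s}. f u\<bar> \<le> (LBINT u:{t N..s}. \<bar>f u\<bar>)"
      using set_integral_norm_bound[OF i] by simp
    also have "\<dots> \<le> (LBINT u:{t N..s}. B)"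
      using i that t B by (intro set_integral_mono set_integrable_abs set_integrable_bounded[where B=B]) auto
    also have "\<dots> = B * (s - t N)" using t by (simp add: set_lebesgue_integral_def)
    finally show ?thesis using t(3)[of N] B by (meson mult_left_mono order.trans)
  qed
  have E1: "null_seq (\<lambda>N. L0 (?E1 N))"
  proof (rule L0_tendsto_0_AE[OF E1m], rule AE_I2)
    fix y assume y: "y \<in> space M"
    have "\<bar>?E1 N y\<bar> \<le> (L N)\<^sup>2 * h N" for N
    proof -
      have "L N * 1 \<le> L N * L N" using L(1)[of N] by (intro mult_left_mono) auto
      then have "L N \<le> (L N)\<^sup>2" by (simp add: power2_eq_square)
      then have "L N * h N \<le> (L N)\<^sup>2 * h N" using h[of N] by (intro mult_right_mono) auto
      moreover have "\<bar>?E1 N y\<bar> \<le> L N * h N"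
        by (intro int_le jointly_measurable_path[OF bj] y \<beta>L)
      ultimately show ?thesis by linarith
    qed
    then show "null_seq (\<lambda>N. ?E1 N y)"
      by (intro Lim_null_comparison[OF always_eventually[OF allI] L2h]) simp
  qed
  have E3: "null_seq (\<lambda>N. L0 (?E3 N))"
  \<comment> \<open>The squared data are at most (L N)^2, on an interval no longer than one
    step.\<close>
  proof (rule tendsto_0_of_sqrt_bound[OF L0_nonneg L2h])
    fix N and \<delta> :: real assume \<delta>: "0 < \<delta>" "\<delta> \<le> 1"
    have "L0 (\<lambda>y. LBINT u:{t N..s}. (\<xi> N i (grid_index (h N) u) y)\<^sup>2) \<le> (L N)\<^sup>2 * h N"
    proof -
      have m: "(\<lambda>y. LBINT u:{t N..s}. (\<xi> N i (grid_index (h N) u) y)\<^sup>2) \<in> borel_measurable M"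
        by (rule square_integral_measurable[OF square_integrable_on_grid[OF \<xi> h t(1) t(2)]])
      have bd: "\<bar>LBINT u:{t N..s}. (\<xi> N i (grid_index (h N) u) y)\<^sup>2\<bar> \<le> (L N)\<^sup>2 * h N" if "y \<in> space M" for y
      proof (rule int_le)
        have "jointly_measurable M (\<lambda>u y. \<xi> N i (grid_index (h N) u) y)"
          by (rule jointly_measurable_grid) (use \<xi> grid_adapted_measurable in blast)
        from jointly_measurable_path[OF this that]
        show "(\<lambda>u. (\<xi> N i (grid_index (h N) u) y)\<^sup>2) \<in> borel_measurable borel" by measurable
        show "\<bar>(\<xi> N i (grid_index (h N) u) y)\<^sup>2\<bar> \<le> (L N)\<^sup>2" for u
          using \<xi>L[OF that, of N "grid_index (h N) u"] L(1)[of N] by (simp add: abs_le_square_iff[symmetric])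
      qed
      then have i: "integrable M (\<lambda>y. LBINT u:{t N..s}. (\<xi> N i (grid_index (h N) u) y)\<^sup>2)"
        using m by (intro integrable_const_bound[where B="(L N)\<^sup>2 * h N"]) auto
      have "L0 (\<lambda>y. LBINT u:{t N..s}. (\<xi> N i (grid_index (h N) u) y)\<^sup>2)
          \<le> \<E> (\<lambda>y. \<bar>LBINT u:{t N..s}. (\<xi> N i (grid_index (h N) u) y)\<^sup>2\<bar>)"
        by (rule L0_le_expectation[OF i])
      also have "\<dots> \<le> \<E> (\<lambda>_. (L N)\<^sup>2 * h N)"
        using i bd by (intro integral_mono) auto
      finally show ?thesis by (simp add: prob_space)
    qed
    from divide_right_mono[OF this, of \<delta>] grid_integral_L0_le[OF h[of N] \<xi>[of N] t(1)[of N] t(2)[of N] hT[of N] \<delta>] \<delta>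
    show "L0 (?E3 N) \<le> sqrt \<delta> + (L N)\<^sup>2 * h N / \<delta>" by simp
  qed
  have E4: "null_seq (\<lambda>N. L0 (?E4 N))"
  proof -
    have sq: "square_integrable_on 0 T (\<lambda>u y. \<xi> N i (grid_index (h N) u) y - H i u y)" for N
      using T by (intro square_integrable_on_diff square_integrable_on_grid[OF \<xi> h] H_square[OF i]) auto
    have "null_seq (\<lambda>N. L0 (\<lambda>y. LBINT u:{0..s}. (\<xi> N i (grid_index (h N) u) y - H i u y)\<^sup>2))"
      by (rule L0_squeeze[OF L0_square_mono[OF sq] \<xi>lim]) (use T in auto)
    from ito_limit_of_approximation[OF J T H_square[OF i T(2)], of "\<lambda>N. \<xi> N i", unfolded folds, OF \<xi> this]
    show ?thesis .
  qed
  have "L0 (\<lambda>y. euler (h N) (\<beta> N) (\<xi> N) i (j N) y - X i s y)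
    \<le> L0 (?E1 N) + (L0 (?E2 N) + (L0 (?E3 N) + L0 (?E4 N)))" for N
  proof -
    let ?S3 = "\<lambda>y. \<bar>?E3 N y\<bar> + \<bar>?E4 N y\<bar>"
    let ?S2 = "\<lambda>y. \<bar>?E2 N y\<bar> + \<bar>?S3 y\<bar>"
    have em: "(\<lambda>y. euler (h N) (\<beta> N) (\<xi> N) i (j N) y - X i s y) \<in> borel_measurable M"
      using \<beta> \<xi> h[of N] grid_adapted_measurable
      by (intro borel_measurable_diff euler_measurable X_measurable[OF i]) (blast, blast, simp)
    have "L0 (\<lambda>y. euler (h N) (\<beta> N) (\<xi> N) i (j N) y - X i s y) \<le> L0 (?E1 N) + L0 ?S2"
    proof (rule L0_le_add[OF em E1m])
      show "?S2 \<in> borel_measurable M"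
        by (intro borel_measurable_add borel_measurable_abs E2m E3m E4m)
      show "AE y in M. \<bar>euler (h N) (\<beta> N) (\<xi> N) i (j N) y - X i s y\<bar> \<le> \<bar>?E1 N y\<bar> + \<bar>?S2 y\<bar>"
        using eq b_integrable[OF i less_imp_le[OF T(1)]] AE_space
      proof eventually_elim
        fix y assume X: "X i s y = x0 i + (LBINT u:{0..s}. b i u y) + J y"
          and bi: "set_integrable lborel {0..T} (\<lambda>u. b i u y)" and y: "y \<in> space M"
        have \<beta>i: "set_integrable lborel {0..T} (\<lambda>u. ?b N u y)"
          by (rule set_integrable_bounded[OF jointly_measurable_path[OF bj y] \<beta>L[OF y]])
        have s0: "set_integrable lborel {0..s} (\<lambda>u. ?b N u y)" "set_integrable lborel {0..s} (\<lambda>u. b i u y)"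
          using T by (auto intro: set_integrable_subset[OF \<beta>i] set_integrable_subset[OF bi])
        have sp: "(LBINT u:{0..s}. ?b N u y) = (LBINT u:{0..t N}. ?b N u y) + ?E1 N y"
          by (rule set_integral_split[OF s0(1) t(1) t(2)])
        have "(LBINT u:{0..s}. ?b N u y) - (LBINT u:{0..s}. b i u y) = (LBINT u:{0..s}. ?b N u y - b i u y)"
          using s0 by (simp add: set_integral_diff)
        moreover have "\<bar>LBINT u:{0..s}. ?b N u y - b i u y\<bar> \<le> (LBINT u:{0..s}. \<bar>?b N u y - b i u y\<bar>)"
          using set_integral_norm_bound[OF set_integral_diff(1)[OF s0]] by simp
        moreover have "(LBINT u:{0..s}. \<bar>?b N u y - b i u y\<bar>) \<le> ?E2 N y"
          using T by (intro set_integral_subset_mono(1) set_integrable_abs set_integral_diff(1) \<beta>i bi) auto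
        ultimately have E2: "\<bar>(LBINT u:{0..s}. ?b N u y) - (LBINT u:{0..s}. b i u y)\<bar> \<le> \<bar>?E2 N y\<bar>"
          by linarith
        have "euler (h N) (\<beta> N) (\<xi> N) i (j N) y = x0 i + (LBINT u:{0..t N}. ?b N u y) + ?G N (t N) y"
          unfolding t_def by (rule euler_eq[OF h j(1)])
        then have "euler (h N) (\<beta> N) (\<xi> N) i (j N) y - X i s y
          = - ?E1 N y + ((LBINT u:{0..s}. ?b N u y) - (LBINT u:{0..s}. b i u y)) - ?E3 N y + ?E4 N y"
          using X sp by simp
        then show "\<bar>euler (h N) (\<beta> N) (\<xi> N) i (j N) y - X i s y\<bar> \<le> \<bar>?E1 N y\<bar> + \<bar>?S2 y\<bar>"
          using E2 by linarith
      qed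
    qed
    also have "L0 ?S2 \<le> L0 (?E2 N) + L0 ?S3"
      by (rule L0_le_add) (intro borel_measurable_add borel_measurable_abs E2m E3m E4m | simp)+
    also have "L0 ?S3 \<le> L0 (?E3 N) + L0 (?E4 N)"
      by (rule L0_le_add) (intro borel_measurable_add borel_measurable_abs E2m E3m E4m | simp)+
    finally show ?thesis by simp
  qed
  note le = this
  have "null_seq (\<lambda>N. L0 (?E1 N) + (L0 (?E2 N) + (L0 (?E3 N) + L0 (?E4 N))))"
    by (intro tendsto_add_zero E1 \<beta>lim E3 E4)
  with le have "null_seq (\<lambda>N. L0 (\<lambda>y. euler (h N) (\<beta> N) (\<xi> N) i (j N) y - X i s y))"
    by (rule L0_squeeze)
  then show ?thesis unfolding h_def .
qed

end

section \<open>One step of the energy balance\<close>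

text \<open>Bounded by 1 / e and increasing to \<open>v\<close> as \<open>e\<close> decreases to
  zero. With w = 1 + e v its derivative is 1 / w^2 and its second derivative -2 e / w^3; these
  weights recur below.\<close>

definition damped :: "real \<Rightarrow> real \<Rightarrow> real" where
  "damped e v = v / (1 + e * v)"

lemma damped_nonneg: "0 \<le> e \<Longrightarrow> 0 \<le> v \<Longrightarrow> 0 \<le> damped e v"
  by (simp add: damped_def)

lemma damped_le: "0 < e \<Longrightarrow> 0 \<le> v \<Longrightarrow> damped e v \<le> 1 / e"
  by (simp add: damped_def field_simps add_pos_nonneg)

text \<open>A second-order Taylor expansion with exact remainder: the difference is d / (w w') with
  w' = w + e d, and 1 / w' is expanded twice in powers of e d / w.\<close>

lemma damped_diff:
  assumes "0 \<le> e" "0 \<le> v" "0 \<le> v'"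
  defines "d \<equiv> v' - v" and "w \<equiv> 1 + e * v" and "w' \<equiv> 1 + e * v'"
  shows "damped e v' - damped e v = d / w\<^sup>2 - e * d\<^sup>2 / w ^ 3 + e\<^sup>2 * d ^ 3 / (w ^ 3 * w')"
proof -
  have "0 < w" "0 < w'" using assms by (auto simp: add_pos_nonneg)
  then have nz: "w \<noteq> 0" "w' \<noteq> 0" by auto
  have w': "w' = w + e * d" by (simp add: w_def w'_def d_def algebra_simps)
  have v: "v' = d + v" by (simp add: d_def)
  have "damped e v' - damped e v = v' / w' - v / w" by (simp add: damped_def w_def w'_def)
  also have "\<dots> = d / (w * w')"
    using nz by (simp add: field_simps) (simp add: w_def w'_def d_def algebra_simps)
  also have "\<dots> = (d * w * w' - e * d\<^sup>2 * w' + e\<^sup>2 * d ^ 3) / (w ^ 3 * w')"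
  proof -
    have "d * w\<^sup>2 = d * w * w' - e * d\<^sup>2 * w' + e\<^sup>2 * d ^ 3"
      unfolding w' by (simp add: algebra_simps power2_eq_square power3_eq_cube)
    moreover have "d / (w * w') = d * w\<^sup>2 / (w ^ 3 * w')"
      using nz by (simp add: field_simps power2_eq_square power3_eq_cube)
    ultimately show ?thesis by simp
  qed
  also have "\<dots> = d / w\<^sup>2 - e * d\<^sup>2 / w ^ 3 + e\<^sup>2 * d ^ 3 / (w ^ 3 * w')"
    using nz by (simp add: add_divide_distrib diff_divide_distrib power2_eq_square power3_eq_cube)
  finally show ?thesis .
qed

text \<open>Here \<open>q\<close> is the square root of the step width and \<open>y\<close> is one
  plus the normalised increment. In the change of the squared norm, \<open>p\<close> is the part of
  order \<open>q\<close> and \<open>r\<close> the part of order q^2; \<open>s\<close> is the squared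
  drift contribution. What remains beyond second order carries at least q^3, and the growth of
  \<open>p\<close> and \<open>r\<close> with the state is compensated by the powers of
  \<open>w\<close> in the denominators.\<close>

lemma remainder_bound:
  fixes w w' L q y m e p r s :: real
  assumes w: "1 \<le> w" "1 \<le> w'" and L: "1 \<le> L" and q: "0 \<le> q" "q \<le> 1" and y: "1 \<le> y" and m: "0 \<le> m"
    and e: "0 \<le> e" "e \<le> 1" and p: "\<bar>p\<bar> \<le> 2 * m * (L * q * y) * w" and r: "\<bar>r\<bar> \<le> 3 * m * (L * q * y)\<^sup>2 * w"
    and s: "0 \<le> s" "s \<le> m * L\<^sup>2 * q ^ 4"
  shows "\<bar>s / w\<^sup>2 - e * (2 * p * r + r\<^sup>2) / w ^ 3 + e\<^sup>2 * (p + r) ^ 3 / (w ^ 3 * w')\<bar>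
    \<le> (m + 21 * m\<^sup>2 + 125 * m ^ 3) * (L ^ 6 * q ^ 3 * y ^ 6)"
proof -
  define t where "t = L * q * y"
  \<comment> \<open>The common majorant: the cube of \<open>p + r\<close> needs t^3 (L y)^3, and
    this dominates the other terms because \<open>L\<close> and \<open>y\<close> are at least 1 and
    \<open>q\<close> is at most 1.\<close>
  define B where "B = L ^ 6 * q ^ 3 * y ^ 6"
  have t0: "0 \<le> t" using L q y by (simp add: t_def)
  have Ly: "1 \<le> L * y" using mult_mono[of 1 L 1 y] L y by simp
  have tLy: "t \<le> L * y" using q L y mult_left_mono[of q 1 "L * y"] by (simp add: t_def algebra_simps)
  have B0: "0 \<le> B" using L q y by (simp add: B_def)
  have B_eq: "B = t ^ 3 * (L * y) ^ 3" by (simp add: B_def t_def power_mult_distrib power3_eq_cube eval_nat_numeral algebra_simps)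
  have t3B: "t ^ 3 \<le> B" using mult_left_mono[OF one_le_power[OF Ly, of 3], of "t ^ 3"] t0 by (simp add: B_eq)
  have t4B: "t ^ 4 \<le> B"
  proof -
    have "t ^ 4 = t ^ 3 * t" by (simp add: eval_nat_numeral)
    also have "\<dots> \<le> t ^ 3 * (L * y) ^ 3"
    proof (rule mult_left_mono)
      have "t \<le> (L * y) ^ 1" using tLy by simp
      also have "\<dots> \<le> (L * y) ^ 3" using Ly by (rule power_increasing[rotated]) simp
      finally show "t \<le> (L * y) ^ 3" .
    qed (use t0 in simp)
    finally show ?thesis by (simp add: B_eq)
  qed
  have q4B: "L\<^sup>2 * q ^ 4 \<le> B"
  proof -
    have "L\<^sup>2 * q ^ 4 = L\<^sup>2 * q ^ 3 * q" by (simp add: eval_nat_numeral)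
    also have "\<dots> \<le> L\<^sup>2 * q ^ 3 * 1" using q L by (intro mult_left_mono) auto
    also have "\<dots> \<le> L ^ 6 * q ^ 3 * 1" using L q by (intro mult_right_mono power_increasing) auto
    also have "\<dots> \<le> L ^ 6 * q ^ 3 * y ^ 6" using L q y by (intro mult_left_mono) auto
    finally show ?thesis by (simp add: B_def)
  qed
  have w0: "0 < w" "0 < w'" using w by auto
  have pw: "w ^ 2 \<le> w ^ 3" using w by (intro power_increasing) auto
  have w1: "1 \<le> w ^ 2" "1 \<le> w ^ 3" using w by auto
  have 1: "\<bar>s / w\<^sup>2\<bar> \<le> m * B"
  proof -
    have "\<bar>s / w\<^sup>2\<bar> = s / w\<^sup>2" using s by simp
    also have "\<dots> \<le> s / 1" using s w1 by (intro divide_left_mono) auto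
    also have "\<dots> \<le> m * (L\<^sup>2 * q ^ 4)" using s by (simp add: mult.assoc)
    also have "\<dots> \<le> m * B" using m q4B by (rule mult_left_mono[rotated])
    finally show ?thesis .
  qed
  \<comment> \<open>21 = 12 + 9, with 12 = 2 * 2 * 3 from the mixed term and 9 = 3^2 from the square
    of \<open>r\<close>.\<close>
  have 2: "\<bar>e * (2 * p * r + r\<^sup>2) / w ^ 3\<bar> \<le> 21 * m\<^sup>2 * B"
  proof -
    have pr: "\<bar>p * r\<bar> \<le> (2 * m * t * w) * (3 * m * t\<^sup>2 * w)"
      unfolding abs_mult by (rule mult_mono) (use p r m t0 w0 in \<open>auto simp: t_def\<close>)
    have rr: "r\<^sup>2 \<le> (3 * m * t\<^sup>2 * w)\<^sup>2"
      by (rule abs_le_square_iff[THEN iffD1]) (use r m w0 in \<open>auto simp: t_def\<close>)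
    have "\<bar>e * (2 * p * r + r\<^sup>2)\<bar> \<le> 1 * (2 * \<bar>p * r\<bar> + r\<^sup>2)"
      unfolding abs_mult[of e]
      by (rule mult_mono) (use e in \<open>auto simp: abs_mult intro!: order.trans[OF abs_triangle_ineq]\<close>)
    also have "\<dots> \<le> 12 * m\<^sup>2 * t ^ 3 * w ^ 2 + 9 * m\<^sup>2 * t ^ 4 * w ^ 2"
      using pr rr by (simp add: power_mult_distrib eval_nat_numeral algebra_simps)
    also have "\<dots> = (12 * m\<^sup>2 * t ^ 3 + 9 * m\<^sup>2 * t ^ 4) * w ^ 2" by (simp add: algebra_simps)
    also have "\<dots> \<le> (12 * m\<^sup>2 * B + 9 * m\<^sup>2 * B) * w ^ 3"
      using t3B t4B pw m B0 by (intro mult_mono add_mono mult_left_mono) auto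
    finally have "\<bar>e * (2 * p * r + r\<^sup>2)\<bar> \<le> 21 * m\<^sup>2 * B * w ^ 3" by (simp add: algebra_simps)
    then show ?thesis using w0 by (simp add: abs_divide pos_divide_le_eq)
  qed
  \<comment> \<open>The bound 2 + 3 t \<le> 5 L y, cubed, gives 125.\<close>
  have 3: "\<bar>e\<^sup>2 * (p + r) ^ 3 / (w ^ 3 * w')\<bar> \<le> 125 * m ^ 3 * B"
  proof -
    have "\<bar>p + r\<bar> \<le> 2 * m * t * w + 3 * m * t\<^sup>2 * w" using p r unfolding t_def by linarith
    also have "\<dots> = m * t * w * (2 + 3 * t)" by (simp add: algebra_simps power2_eq_square)
    also have "\<dots> \<le> m * t * w * (5 * (L * y))"
      using tLy Ly m t0 w0 by (intro mult_left_mono) auto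
    finally have "\<bar>p + r\<bar> ^ 3 \<le> (m * t * w * (5 * (L * y))) ^ 3" by (rule power_mono) simp
    also have "\<dots> = 125 * m ^ 3 * B * w ^ 3" by (simp add: B_eq power_mult_distrib)
    finally have c: "\<bar>p + r\<bar> ^ 3 \<le> 125 * m ^ 3 * B * w ^ 3" .
    have "\<bar>e\<^sup>2 * (p + r) ^ 3\<bar> \<le> 1 * \<bar>p + r\<bar> ^ 3"
      unfolding abs_mult power_abs by (rule mult_right_mono) (use e in \<open>auto simp: power_le_one\<close>)
    also have "\<dots> \<le> 125 * m ^ 3 * B * w ^ 3" using c by simp
    also have "\<dots> \<le> 125 * m ^ 3 * B * w ^ 3 * w'"
      using mult_left_mono[OF w(2), of "125 * m ^ 3 * B * w ^ 3"] m B0 w0 by simp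
    finally show ?thesis using w0 by (simp add: abs_divide pos_divide_le_eq abs_mult mult.assoc)
  qed
  have "\<bar>s / w\<^sup>2 - e * (2 * p * r + r\<^sup>2) / w ^ 3 + e\<^sup>2 * (p + r) ^ 3 / (w ^ 3 * w')\<bar>
    \<le> m * B + 21 * m\<^sup>2 * B + 125 * m ^ 3 * B" using 1 2 3 by linarith
  then show ?thesis by (simp add: B_def algebra_simps)
qed

text \<open>The Ito drift of \<open>damped e |z|\<^sup>2\<close> when \<open>dz = \<beta> dt + \<xi> dW\<close>.\<close>

definition energy_rate :: "'i set \<Rightarrow> real \<Rightarrow> ('i \<Rightarrow> real) \<Rightarrow> ('i \<Rightarrow> real) \<Rightarrow> ('i \<Rightarrow> real) \<Rightarrow> real" where
  "energy_rate I e z \<beta> \<xi> = (2 * (\<Sum>i\<in>I. z i * \<beta> i) + (\<Sum>i\<in>I. (\<xi> i)\<^sup>2)) / (1 + e * (\<Sum>i\<in>I. (z i)\<^sup>2))\<^sup>2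
    - 4 * e * (\<Sum>i\<in>I. z i * \<xi> i)\<^sup>2 / (1 + e * (\<Sum>i\<in>I. (z i)\<^sup>2)) ^ 3"

text \<open>The polynomial factors of the remainder are absorbed by the weight: each coordinate is at most \<open>1 + |z|\<^sup>2\<close>,
  hence at most a multiple of \<open>1 + e |z|\<^sup>2\<close>.\<close>

lemma coordinate_le_weight:
  fixes z :: "'i \<Rightarrow> real"
  assumes "finite I" "i \<in> I" "0 < e" "e \<le> 1"
  shows "\<bar>z i\<bar> \<le> (1 + e * (\<Sum>i\<in>I. (z i)\<^sup>2)) / e"
proof -
  have "(z i)\<^sup>2 \<le> (\<Sum>i\<in>I. (z i)\<^sup>2)" by (rule member_le_sum) (use assms in auto)
  moreover have "\<bar>z i\<bar> \<le> 1 + (z i)\<^sup>2"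
    using sum_squares_bound[of 1 "\<bar>z i\<bar>"] by (simp add: power2_eq_square)
  moreover have "1 \<le> 1 / e" using assms by simp
  ultimately have "\<bar>z i\<bar> \<le> 1 / e + (\<Sum>i\<in>I. (z i)\<^sup>2)" by linarith
  then show ?thesis using assms by (simp add: add_divide_distrib)
qed

text \<open>The main terms are ordered by powers of the increment \<open>G\<close>. The contribution
  of \<beta>\<xi> to the linear coefficient is of order h^(3/2) after multiplication by
  \<open>G\<close>, yet it is kept: its mean will be zero, so it need not be estimated. The constant
  \<open>m\<close> comes from |z i| \<le> w / e, summed over the coordinates.\<close>

lemma one_step_expansion:
  fixes z \<beta> \<xi> :: "'i \<Rightarrow> real" and G :: real
  assumes fin: "finite I" and e: "0 < e" "e \<le> 1" and L: "1 \<le> L" and h: "0 < h" "h \<le> 1"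
    and \<beta>: "\<And>i. i \<in> I \<Longrightarrow> \<bar>\<beta> i\<bar> \<le> L" and \<xi>: "\<And>i. i \<in> I \<Longrightarrow> \<bar>\<xi> i\<bar> \<le> L"
  defines "V \<equiv> \<Sum>i\<in>I. (z i)\<^sup>2" and "V' \<equiv> \<Sum>i\<in>I. (z i + (h * \<beta> i + \<xi> i * G))\<^sup>2" and "m \<equiv> real (card I) / e"
  defines "w \<equiv> 1 + e * V"
  shows "\<bar>damped e V' - damped e V
      - (h * (2 * (\<Sum>i\<in>I. z i * \<beta> i) / w\<^sup>2) + (2 * (\<Sum>i\<in>I. z i * \<xi> i) + 2 * h * (\<Sum>i\<in>I. \<beta> i * \<xi> i)) / w\<^sup>2 * G
        + ((\<Sum>i\<in>I. (\<xi> i)\<^sup>2) / w\<^sup>2 - 4 * e * (\<Sum>i\<in>I. z i * \<xi> i)\<^sup>2 / w ^ 3) * G\<^sup>2)\<bar>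
    \<le> (m + 21 * m\<^sup>2 + 125 * m ^ 3) * (L ^ 6 * sqrt h ^ 3 * (1 + \<bar>G\<bar> / sqrt h) ^ 6)"
proof -
  define n where "n = real (card I)"
  define zb where "zb = (\<Sum>i\<in>I. z i * \<beta> i)"
  define zx where "zx = (\<Sum>i\<in>I. z i * \<xi> i)"
  define bx where "bx = (\<Sum>i\<in>I. \<beta> i * \<xi> i)"
  define bb where "bb = (\<Sum>i\<in>I. (\<beta> i)\<^sup>2)"
  define xx where "xx = (\<Sum>i\<in>I. (\<xi> i)\<^sup>2)"
  define dd where "dd = (\<Sum>i\<in>I. (h * \<beta> i + \<xi> i * G)\<^sup>2)"
  define w' where "w' = 1 + e * V'"
  define q where "q = sqrt h"
  define y where "y = 1 + \<bar>G\<bar> / q"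
  define p where "p = 2 * zx * G"
  define r where "r = 2 * h * zb + dd"
  have V0: "0 \<le> V" "0 \<le> V'" by (simp_all add: V_def V'_def sum_nonneg)
  have w: "1 \<le> w" "1 \<le> w'" using V0 e by (auto simp: w_def w'_def)
  have q: "0 < q" "q \<le> 1" "q\<^sup>2 = h" using h by (auto simp: q_def)
  have y: "1 \<le> y" using q by (simp add: y_def)
  have n0: "0 \<le> n" by (simp add: n_def)
  have nm: "n \<le> m"
    using n0 e mult_left_mono[of 1 "1/e" n] by (simp add: m_def n_def)
  have m0: "0 \<le> m" using nm n0 by linarith
  have hq: "h \<le> q"
  proof -
    have "q * q \<le> q * 1" using q by (intro mult_left_mono) auto
    then show ?thesis using q(3) by (simp add: power2_eq_square)
  qed
  have Gq: "\<bar>G\<bar> \<le> q * y" using q by (simp add: y_def distrib_left)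
  have zc: "\<bar>z i\<bar> \<le> w / e" if "i \<in> I" for i
    unfolding w_def V_def by (rule coordinate_le_weight[OF fin that e])
  have sum_le: "\<bar>\<Sum>i\<in>I. f i\<bar> \<le> n * B" if "\<And>i. i \<in> I \<Longrightarrow> \<bar>f i\<bar> \<le> B" for f B
    unfolding n_def by (rule order.trans[OF sum_abs sum_bounded_above[OF that]])
  have wm: "n * (w / e * L) = m * L * w" by (simp add: m_def n_def)
  have zb_le: "\<bar>zb\<bar> \<le> m * L * w" and zx_le: "\<bar>zx\<bar> \<le> m * L * w"
  proof -
    have "\<bar>z i * \<beta> i\<bar> \<le> w / e * L" "\<bar>z i * \<xi> i\<bar> \<le> w / e * L" if "i \<in> I" for i
      unfolding abs_mult using zc[OF that] \<beta>[OF that] \<xi>[OF that] e w by (auto intro!: mult_mono simp del: times_divide_eq_left)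
    then show "\<bar>zb\<bar> \<le> m * L * w" "\<bar>zx\<bar> \<le> m * L * w"
      unfolding wm[symmetric] zb_def zx_def by (auto intro: sum_le simp del: times_divide_eq_left)
  qed
  have bb: "0 \<le> bb" "bb \<le> m * L\<^sup>2"
  proof -
    show "0 \<le> bb" by (simp add: bb_def sum_nonneg)
    have "\<bar>bb\<bar> \<le> n * L\<^sup>2"
      unfolding bb_def using \<beta> L by (intro sum_le) (auto simp: abs_le_square_iff[symmetric])
    also have "\<dots> \<le> m * L\<^sup>2" using nm by (rule mult_right_mono) simp
    finally show "bb \<le> m * L\<^sup>2" by simp
  qed
  have dd: "0 \<le> dd" "dd \<le> n * (L * q * y)\<^sup>2"
  proof -
    show "0 \<le> dd" by (simp add: dd_def sum_nonneg)
    have "\<bar>h * \<beta> i + \<xi> i * G\<bar> \<le> L * q * y" if "i \<in> I" for i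
    proof -
      have "\<bar>h * \<beta> i + \<xi> i * G\<bar> \<le> h * \<bar>\<beta> i\<bar> + \<bar>\<xi> i\<bar> * \<bar>G\<bar>"
        using abs_triangle_ineq[of "h * \<beta> i" "\<xi> i * G"] h by (simp add: abs_mult)
      also have "\<dots> \<le> q * L + L * \<bar>G\<bar>"
        using \<beta>[OF that] \<xi>[OF that] hq h q L by (intro add_mono mult_mono) auto
      also have "\<dots> = L * q * y" using q by (simp add: y_def algebra_simps)
      finally show ?thesis .
    qed
    then have "\<bar>dd\<bar> \<le> n * (L * q * y)\<^sup>2"
      unfolding dd_def using L q y by (intro sum_le) (auto simp: abs_le_square_iff[symmetric])
    then show "dd \<le> n * (L * q * y)\<^sup>2" by simp
  qed
  have p_le: "\<bar>p\<bar> \<le> 2 * m * (L * q * y) * w"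
  proof -
    have "\<bar>p\<bar> = 2 * \<bar>zx\<bar> * \<bar>G\<bar>" by (simp add: p_def abs_mult)
    also have "\<dots> \<le> 2 * (m * L * w) * (q * y)"
      using zx_le Gq m0 L w by (intro mult_mono) auto
    finally show ?thesis by (simp add: algebra_simps)
  qed
  have r_le: "\<bar>r\<bar> \<le> 3 * m * (L * q * y)\<^sup>2 * w"
  proof -
    have "\<bar>r\<bar> \<le> 2 * h * \<bar>zb\<bar> + dd"
      unfolding r_def using abs_triangle_ineq[of "2 * h * zb" dd] h dd(1) by (simp add: abs_mult)
    also have "2 * h * \<bar>zb\<bar> \<le> 2 * h * (m * L * w)" using zb_le h by (intro mult_left_mono) auto
    also have "\<dots> \<le> 2 * m * (L * q * y)\<^sup>2 * w"
    proof -
      have "L * 1 \<le> L\<^sup>2 * y\<^sup>2"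
        using L y self_le_power[of L 2] one_le_power[of y 2] by (intro mult_mono) auto
      then have "h * L \<le> h * (L\<^sup>2 * y\<^sup>2)" using h by simp
      then have "h * L \<le> (L * q * y)\<^sup>2" by (simp add: power_mult_distrib q(3) algebra_simps)
      then have "2 * m * w * (h * L) \<le> 2 * m * w * (L * q * y)\<^sup>2" using m0 w by (intro mult_left_mono) auto
      then show ?thesis by (simp add: algebra_simps)
    qed
    also have "dd \<le> m * (L * q * y)\<^sup>2 * w"
    proof -
      have "n * (L * q * y)\<^sup>2 \<le> m * (L * q * y)\<^sup>2" using nm by (rule mult_right_mono) simp
      also have "\<dots> \<le> m * (L * q * y)\<^sup>2 * w" using w m0 mult_left_mono[OF w(1), of "m * (L * q * y)\<^sup>2"] by simp
      finally show ?thesis using dd(2) by linarith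
    qed
    finally show ?thesis by (simp add: algebra_simps)
  qed
  have s: "0 \<le> h\<^sup>2 * bb" "h\<^sup>2 * bb \<le> m * L\<^sup>2 * q ^ 4"
  proof -
    show "0 \<le> h\<^sup>2 * bb" using bb by simp
    have h4: "h\<^sup>2 = q ^ 4" unfolding q(3)[symmetric] by (simp add: power_mult[symmetric])
    have "h\<^sup>2 * bb \<le> h\<^sup>2 * (m * L\<^sup>2)" using bb by (intro mult_left_mono) auto
    then show "h\<^sup>2 * bb \<le> m * L\<^sup>2 * q ^ 4" unfolding h4 by (simp add: algebra_simps)
  qed
  have dd_eq: "dd = h\<^sup>2 * bb + 2 * h * G * bx + G\<^sup>2 * xx"
    unfolding dd_def bb_def bx_def xx_def
    by (simp add: power2_sum power_mult_distrib sum.distrib sum_distrib_left algebra_simps)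
  have d: "V' - V = p + r"
    unfolding V'_def V_def p_def r_def zx_def zb_def dd_def
    by (simp add: power2_sum sum.distrib sum_distrib_left sum_distrib_right algebra_simps)
  have wnz: "w \<noteq> 0" using w by auto
  have "damped e V' - damped e V = (p + r) / w\<^sup>2 - e * (p + r)\<^sup>2 / w ^ 3 + e\<^sup>2 * (p + r) ^ 3 / (w ^ 3 * w')"
    using damped_diff[OF less_imp_le[OF e(1)] V0] unfolding d w_def w'_def .
  moreover have "h * (2 * zb / w\<^sup>2) + (2 * zx + 2 * h * bx) / w\<^sup>2 * G + (xx / w\<^sup>2 - 4 * e * zx\<^sup>2 / w ^ 3) * G\<^sup>2
      = (p + r) / w\<^sup>2 - e * p\<^sup>2 / w ^ 3 - h\<^sup>2 * bb / w\<^sup>2"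
    unfolding p_def r_def dd_eq
    by (simp add: add_divide_distrib diff_divide_distrib power_mult_distrib algebra_simps)
  moreover have "e * (p + r)\<^sup>2 / w ^ 3 = e * p\<^sup>2 / w ^ 3 + e * (2 * p * r + r\<^sup>2) / w ^ 3"
    by (simp add: power2_sum add_divide_distrib distrib_left)
  ultimately have "damped e V' - damped e V - (h * (2 * zb / w\<^sup>2) + (2 * zx + 2 * h * bx) / w\<^sup>2 * G + (xx / w\<^sup>2 - 4 * e * zx\<^sup>2 / w ^ 3) * G\<^sup>2)
    = h\<^sup>2 * bb / w\<^sup>2 - e * (2 * p * r + r\<^sup>2) / w ^ 3 + e\<^sup>2 * (p + r) ^ 3 / (w ^ 3 * w')" by simp
  moreover have "\<bar>h\<^sup>2 * bb / w\<^sup>2 - e * (2 * p * r + r\<^sup>2) / w ^ 3 + e\<^sup>2 * (p + r) ^ 3 / (w ^ 3 * w')\<bar>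
    \<le> (m + 21 * m\<^sup>2 + 125 * m ^ 3) * (L ^ 6 * q ^ 3 * y ^ 6)"
    by (rule remainder_bound[OF w L _ _ y m0 _ _ p_le r_le s]) (use q e in auto)
  ultimately show ?thesis
    unfolding zb_def zx_def bx_def xx_def q_def y_def by simp
qed

text \<open>The factor 1024 = 64 * (1 + 15) bounds the mean of (1 + |G| / sqrt h)^6, with 15 from
  the sixth moment and 64 = 2^6 from separating the two summands.\<close>

definition step_constant :: "'i set \<Rightarrow> real \<Rightarrow> real" where
  "step_constant I e = (let m = real (card I) / e in 1024 * (m + 21 * m\<^sup>2 + 125 * m ^ 3))"

context brownian
begin

text \<open>The coefficients of 1, G and G^2 are known at time \<open>t\<close> and bounded thanks
  to the damping, so no moment of \<open>z\<close> enters. The linear term has mean zero, and the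
  quadratic one yields \<open>h\<close> times the mean of its coefficient. The weight
  \<open>D\<close> makes room for the discount.\<close>

lemma one_step_expectation:
  fixes z \<beta> \<xi> :: "'i \<Rightarrow> 'w \<Rightarrow> real" and D :: "'w \<Rightarrow> real"
  assumes fin: "finite I" and e: "0 < e" "e \<le> 1" and L: "1 \<le> L" and h: "0 < h" "h \<le> 1" and t: "0 \<le> t"
    and F: "\<And>i. i \<in> I \<Longrightarrow> z i \<in> borel_measurable (F t)" "\<And>i. i \<in> I \<Longrightarrow> \<beta> i \<in> borel_measurable (F t)"
      "\<And>i. i \<in> I \<Longrightarrow> \<xi> i \<in> borel_measurable (F t)" "D \<in> borel_measurable (F t)"
    and \<beta>: "\<And>i y. i \<in> I \<Longrightarrow> y \<in> space M \<Longrightarrow> \<bar>\<beta> i y\<bar> \<le> L"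
    and \<xi>: "\<And>i y. i \<in> I \<Longrightarrow> y \<in> space M \<Longrightarrow> \<bar>\<xi> i y\<bar> \<le> L"
    and D: "\<And>y. y \<in> space M \<Longrightarrow> 0 \<le> D y \<and> D y \<le> 1"
  defines "V \<equiv> \<lambda>y. \<Sum>i\<in>I. (z i y)\<^sup>2"
    and "V' \<equiv> \<lambda>y. \<Sum>i\<in>I. (z i y + (h * \<beta> i y + \<xi> i y * (W (t + h) y - W t y)))\<^sup>2"
    and "rate \<equiv> \<lambda>y. energy_rate I e (\<lambda>i. z i y) (\<lambda>i. \<beta> i y) (\<lambda>i. \<xi> i y)"
  shows "integrable M (\<lambda>y. D y * rate y)"
    and "\<bar>\<E> (\<lambda>y. D y * (damped e (V' y) - damped e (V y))) - h * \<E> (\<lambda>y. D y * rate y)\<bar>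
      \<le> step_constant I e * (L ^ 6 * sqrt h ^ 3)"
proof -
  let ?J = "\<lambda>y. D y * (damped e (V' y) - damped e (V y))"
  let ?bx = "\<lambda>y. (\<Sum>i\<in>I. \<beta> i y * \<xi> i y)"
  let ?zx = "\<lambda>y. (\<Sum>i\<in>I. z i y * \<xi> i y)"
  define n where "n = real (card I)"
  define m where "m = n / e"
  define w where "w = (\<lambda>y. 1 + e * V y)"
  define G where "G = (\<lambda>y. W (t + h) y - W t y)"
  define c0 where "c0 = (\<lambda>y. D y * (2 * (\<Sum>i\<in>I. z i y * \<beta> i y) / (w y)\<^sup>2))"
  define c1 where "c1 = (\<lambda>y. D y * ((2 * ?zx y + 2 * h * ?bx y) / (w y)\<^sup>2))"
  define c2 where "c2 = (\<lambda>y. D y * ((\<Sum>i\<in>I. (\<xi> i y)\<^sup>2) / (w y)\<^sup>2 - 4 * e * (?zx y)\<^sup>2 / (w y) ^ 3))"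
  have n0: "0 \<le> n" by (simp add: n_def)
  have w1: "1 \<le> w y" for y using e by (simp add: w_def V_def sum_nonneg)
  have wF: "w \<in> borel_measurable (F t)"
    unfolding w_def V_def by (intro borel_measurable_add borel_measurable_times borel_measurable_const borel_measurable_sum borel_measurable_power F)
  have c0F: "c0 \<in> borel_measurable (F t)" and c1F: "c1 \<in> borel_measurable (F t)" and c2F: "c2 \<in> borel_measurable (F t)"
    unfolding c0_def c1_def c2_def
    by ((intro borel_measurable_add borel_measurable_diff borel_measurable_times borel_measurable_divide borel_measurable_const
        borel_measurable_sum borel_measurable_power F wF; assumption))+
  have sum_le: "\<bar>\<Sum>i\<in>I. f i\<bar> \<le> n * B" if "\<And>i. i \<in> I \<Longrightarrow> \<bar>f i\<bar> \<le> B" for f B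
    unfolding n_def by (rule order.trans[OF sum_abs sum_bounded_above[OF that]])
  have zx: "\<bar>\<Sum>i\<in>I. z i y * x i\<bar> \<le> m * L * w y" if "\<And>i. i \<in> I \<Longrightarrow> \<bar>x i\<bar> \<le> L" for x y
  proof -
    have "\<bar>z i y * x i\<bar> \<le> w y / e * L" if "i \<in> I" for i
      unfolding abs_mult w_def V_def
      by (rule mult_mono) (use coordinate_le_weight[OF fin \<open>i \<in> I\<close> e, of "\<lambda>i. z i y"]
          \<open>i \<in> I \<Longrightarrow> \<bar>x i\<bar> \<le> L\<close> that e in \<open>auto simp: sum_nonneg\<close>)
    then have "\<bar>\<Sum>i\<in>I. z i y * x i\<bar> \<le> n * (w y / e * L)" by (rule sum_le)
    then show ?thesis by (simp add: m_def algebra_simps)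
  qed
  have zb_le: "\<bar>\<Sum>i\<in>I. z i y * \<beta> i y\<bar> \<le> m * L * w y"
    and zx_le: "\<bar>\<Sum>i\<in>I. z i y * \<xi> i y\<bar> \<le> m * L * w y" if "y \<in> space M" for y
    using that by (auto intro!: zx \<beta> \<xi>)
  have m0: "0 \<le> m" using n0 e by (simp add: m_def)
  have wp: "w y \<le> (w y)\<^sup>2" "(w y)\<^sup>2 \<le> (w y) ^ 3" "1 \<le> (w y)\<^sup>2" "1 \<le> w y ^ 3" for y
    using w1[of y] power_increasing[of 1 2 "w y"] power_increasing[of 2 3 "w y"] by auto
  have quot: "\<bar>x / q\<bar> \<le> B" if "\<bar>x\<bar> \<le> B * d" "d \<le> q" "0 < q" "0 \<le> B" for x q d B :: real
  proof -
    have "\<bar>x\<bar> \<le> B * q" using that mult_left_mono[of d q B] by linarith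
    then show ?thesis using that by (simp add: abs_divide pos_divide_le_eq)
  qed
  have Dm: "\<bar>D y * x\<bar> \<le> B" if "y \<in> space M" "\<bar>x\<bar> \<le> B" for y x B
    using mult_mono[of "\<bar>D y\<bar>" 1 "\<bar>x\<bar>" B] D[OF that(1)] that(2) by (simp add: abs_mult)
  have b0: "\<bar>c0 y\<bar> \<le> 2 * m * L" if y: "y \<in> space M" for y
    unfolding c0_def
    by (rule Dm[OF y], rule quot[of _ _ "w y"])
      (use zb_le[OF y] wp[of y] w1[of y] m0 L in \<open>auto simp: abs_mult\<close>)
  have b1: "\<bar>c1 y\<bar> \<le> 2 * m * L + 2 * n * L\<^sup>2" if y: "y \<in> space M" for y
  proof -
    have "\<bar>\<beta> i y * \<xi> i y\<bar> \<le> L\<^sup>2" if "i \<in> I" for i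
      unfolding abs_mult power2_eq_square using \<beta>[OF that y] \<xi>[OF that y] L by (intro mult_mono) auto
    then have bx: "\<bar>\<Sum>i\<in>I. \<beta> i y * \<xi> i y\<bar> \<le> n * L\<^sup>2" by (rule sum_le)
    have "\<bar>2 * ?zx y + 2 * h * ?bx y\<bar>
        \<le> 2 * \<bar>\<Sum>i\<in>I. z i y * \<xi> i y\<bar> + 2 * h * \<bar>\<Sum>i\<in>I. \<beta> i y * \<xi> i y\<bar>"
      using abs_triangle_ineq[of "2 * ?zx y" "2 * h * ?bx y"] h
      by (simp add: abs_mult)
    also have "\<dots> \<le> 2 * (m * L * w y) + 2 * 1 * (n * L\<^sup>2 * w y)"
    proof (intro add_mono mult_mono)
      show "\<bar>\<Sum>i\<in>I. z i y * \<xi> i y\<bar> \<le> m * L * w y" by (rule zx_le[OF y])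
      have "n * L\<^sup>2 * 1 \<le> n * L\<^sup>2 * w y" using n0 w1 by (intro mult_left_mono) auto
      then show "\<bar>\<Sum>i\<in>I. \<beta> i y * \<xi> i y\<bar> \<le> n * L\<^sup>2 * w y" using bx by simp
    qed (use h in auto)
    finally have "\<bar>2 * ?zx y + 2 * h * ?bx y\<bar> \<le> (2 * m * L + 2 * n * L\<^sup>2) * w y"
      by (simp add: algebra_simps)
    then show ?thesis
      unfolding c1_def by (intro Dm[OF y] quot[of _ _ "w y"]) (use wp[of y] w1[of y] m0 n0 L in auto)
  qed
  have b2: "\<bar>c2 y\<bar> \<le> n * L\<^sup>2 + 4 * (m * L)\<^sup>2" if y: "y \<in> space M" for y
  proof -
    have "\<bar>(\<xi> i y)\<^sup>2\<bar> \<le> L\<^sup>2" if "i \<in> I" for i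
      using \<xi>[OF that y] L by (simp add: abs_le_square_iff[symmetric])
    then have "\<bar>\<Sum>i\<in>I. (\<xi> i y)\<^sup>2\<bar> \<le> n * L\<^sup>2" by (rule sum_le)
    then have 1: "\<bar>(\<Sum>i\<in>I. (\<xi> i y)\<^sup>2) / (w y)\<^sup>2\<bar> \<le> n * L\<^sup>2"
      by (intro quot[of _ _ 1]) (use wp[of y] w1[of y] n0 in auto)
    have "(?zx y)\<^sup>2 \<le> (m * L * w y)\<^sup>2"
      by (rule abs_le_square_iff[THEN iffD1]) (use zx_le[OF y] m0 L w1[of y] in auto)
    then have "4 * e * (?zx y)\<^sup>2 \<le> 4 * 1 * (m * L * w y)\<^sup>2"
      using e by (intro mult_mono) auto
    then have "\<bar>4 * e * (?zx y)\<^sup>2\<bar> \<le> 4 * (m * L)\<^sup>2 * (w y)\<^sup>2"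
      using e by (simp add: abs_mult power_mult_distrib algebra_simps)
    then have 2: "\<bar>4 * e * (?zx y)\<^sup>2 / (w y) ^ 3\<bar> \<le> 4 * (m * L)\<^sup>2"
      by (intro quot[of _ _ "(w y)\<^sup>2"]) (use wp[of y] w1[of y] in auto)
    show ?thesis unfolding c2_def by (rule Dm[OF y]) (use 1 2 in linarith)
  qed
  have bint: "integrable M c" if "c \<in> borel_measurable (F t)" "\<And>y. y \<in> space M \<Longrightarrow> \<bar>c y\<bar> \<le> B" for c :: "'w \<Rightarrow> real" and B
    by (rule integrable_const_bound[where B=B]) (use measurable_F_M[OF that(1)] that(2) in auto)
  have i0: "integrable M c0" and i1: "integrable M c1" and i2: "integrable M c2"
    using bint[OF c0F b0] bint[OF c1F b1] bint[OF c2F b2] by auto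
  have rate_eq: "D y * rate y = c0 y + c2 y" for y
    unfolding rate_def energy_rate_def c0_def c2_def w_def V_def
    by (simp add: add_divide_distrib distrib_left right_diff_distrib)
  show "integrable M (\<lambda>y. D y * rate y)" unfolding rate_eq using i0 i2 by (rule Bochner_Integration.integrable_add)
  have th: "t \<le> t + h" using h by simp
  note m1 = increment_mult_le[OF t th c1F i1, folded G_def]
  note m2 = increment_mult_le[OF t th c2F i2, folded G_def]
  have iG1: "integrable M (\<lambda>y. c1 y * G y)" using m1(1)[of 1] by (simp add: G_def)
  have iG2: "integrable M (\<lambda>y. c2 y * (G y)\<^sup>2)" using m2(1)[of 2] by (simp add: G_def)
  define P where "P = (\<lambda>y. h * c0 y + c1 y * G y + c2 y * (G y)\<^sup>2)"
  have iP: "integrable M P" unfolding P_def using i0 iG1 iG2 by auto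
  have EP: "\<E> P = h * \<E> (\<lambda>y. D y * rate y)"
  proof -
    have "\<E> P = h * \<E> c0 + \<E> (\<lambda>y. c1 y * G y) + \<E> (\<lambda>y. c2 y * (G y)\<^sup>2)"
      unfolding P_def using i0 iG1 iG2 by simp
    also have "\<dots> = h * \<E> c0 + h * \<E> c2"
      using m1(2) m2(3) by (simp add: G_def)
    also have "\<dots> = h * \<E> (\<lambda>y. D y * rate y)"
      unfolding rate_eq using i0 i2 by (simp add: distrib_left)
    finally show ?thesis .
  qed
  have [measurable]: "G \<in> borel_measurable M" unfolding G_def using t h by (intro borel_measurable_diff W_measurable) auto
  note [measurable] = F[THEN measurable_F_M]
  have Dd: "(\<lambda>y. ?J y) \<in> borel_measurable M"
    unfolding V_def V'_def damped_def G_def[symmetric, THEN fun_cong]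
    by (intro borel_measurable_add borel_measurable_diff borel_measurable_times borel_measurable_divide borel_measurable_const
        borel_measurable_sum borel_measurable_power measurable_F_M[OF F(1)] measurable_F_M[OF F(2)] measurable_F_M[OF F(3)] measurable_F_M[OF F(4)])
      measurable
  have V0: "0 \<le> V y" "0 \<le> V' y" for y by (simp_all add: V_def V'_def sum_nonneg)
  have iDd: "integrable M (\<lambda>y. ?J y)"
  proof (rule integrable_const_bound[where B="1 / e"])
    show "AE y in M. norm (?J y) \<le> 1 / e"
    proof (rule AE_I2)
      fix y assume y: "y \<in> space M"
      have "\<bar>damped e (V' y) - damped e (V y)\<bar> \<le> 1 / e"
        using damped_le[OF e(1) V0(1)[of y]] damped_le[OF e(1) V0(2)[of y]]
          damped_nonneg[of e "V y"] damped_nonneg[of e "V' y"] V0[of y] e by linarith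
      from Dm[OF y this] show "norm (?J y) \<le> 1 / e" by simp
    qed
  qed (rule Dd)
  define K where "K = m + 21 * m\<^sup>2 + 125 * m ^ 3"
  have K0: "0 \<le> K" using m0 by (simp add: K_def)
  have cK: "step_constant I e = 1024 * K" by (simp add: step_constant_def K_def m_def n_def Let_def)
  define U where "U = (\<lambda>y. 64 * (1 + (G y) ^ 6 / h ^ 3))"
  have iU: "integrable M U" and EU: "\<E> U = 1024"
  proof -
    have th': "t < t + h" using h by simp
    have i6: "integrable M (\<lambda>y. (G y) ^ 6)" using increment_moments(1)[OF t th', of 6] by (simp add: G_def)
    then show "integrable M U" unfolding U_def by simp
    have "\<E> (\<lambda>y. (G y) ^ 6) = 15 * h ^ 3" using increment_moments(4)[OF t th'] by (simp add: G_def)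
    then show "\<E> U = 1024" unfolding U_def using i6 h by (simp add: prob_space)
  qed
  have U: "(1 + \<bar>G y\<bar> / sqrt h) ^ 6 \<le> U y" for y
  proof -
    define u where "u = \<bar>G y\<bar> / sqrt h"
    have u0: "0 \<le> u" using h by (simp add: u_def)
    have s6: "sqrt h ^ 6 = h ^ 3"
    proof -
      have "sqrt h ^ 6 = (sqrt h ^ 2) ^ 3" by (simp add: power_mult[symmetric])
      then show ?thesis using h by simp
    qed
    have u6: "u ^ 6 = (G y) ^ 6 / h ^ 3" by (simp add: u_def power_divide s6 power_even_abs)
    have "(1 + u) ^ 6 \<le> (2 * max 1 u) ^ 6" using u0 by (intro power_mono) auto
    also have "\<dots> = 64 * max 1 u ^ 6" by (simp add: power_mult_distrib)
    also have "\<dots> \<le> 64 * (1 + u ^ 6)" using u0 by (auto simp: max_def)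
    finally show ?thesis unfolding u6 U_def u_def[symmetric] .
  qed
  \<comment> \<open>Multiplication by \<open>D\<close>, which lies between 0 and 1, preserves the
    pointwise bound of the expansion.\<close>
  have ptw: "\<bar>?J y - P y\<bar> \<le> K * (L ^ 6 * sqrt h ^ 3) * U y" if y: "y \<in> space M" for y
  proof -
    have "\<bar>damped e (V' y) - damped e (V y)
      - (h * (2 * (\<Sum>i\<in>I. z i y * \<beta> i y) / (w y)\<^sup>2)
        + (2 * ?zx y + 2 * h * ?bx y) / (w y)\<^sup>2 * G y
        + ((\<Sum>i\<in>I. (\<xi> i y)\<^sup>2) / (w y)\<^sup>2 - 4 * e * (?zx y)\<^sup>2 / (w y) ^ 3) * (G y)\<^sup>2)\<bar>
      \<le> K * (L ^ 6 * sqrt h ^ 3 * (1 + \<bar>G y\<bar> / sqrt h) ^ 6)" (is "\<bar>?d\<bar> \<le> ?r")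
      using one_step_expansion[OF fin e L h, of "\<lambda>i. \<beta> i y" "\<lambda>i. \<xi> i y" "\<lambda>i. z i y" "G y"] \<beta>[OF _ y] \<xi>[OF _ y]
      unfolding K_def m_def n_def w_def V_def V'_def G_def by simp
    also have "?r \<le> K * (L ^ 6 * sqrt h ^ 3 * U y)"
      using U[of y] K0 L h by (intro mult_left_mono) auto
    finally have "\<bar>?d\<bar> \<le> K * (L ^ 6 * sqrt h ^ 3) * U y" by (simp add: mult.assoc)
    from Dm[OF y this]
    show ?thesis unfolding P_def c0_def c1_def c2_def by (simp add: algebra_simps)
  qed
  have "\<bar>\<E> (\<lambda>y. ?J y) - \<E> P\<bar>
    = \<bar>\<E> (\<lambda>y. ?J y - P y)\<bar>"
    using iDd iP by simp
  also have "\<dots> \<le> \<E> (\<lambda>y. \<bar>?J y - P y\<bar>)"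
    by (rule integral_abs_bound)
  also have "\<dots> \<le> \<E> (\<lambda>y. K * (L ^ 6 * sqrt h ^ 3) * U y)"
    using iDd iP iU ptw by (intro integral_mono) auto
  also have "\<dots> = step_constant I e * (L ^ 6 * sqrt h ^ 3)"
    by (simp add: EU cK)
  finally show "\<bar>\<E> (\<lambda>y. ?J y) - h * \<E> (\<lambda>y. D y * rate y)\<bar>
      \<le> step_constant I e * (L ^ 6 * sqrt h ^ 3)"
    by (simp add: EP)
qed

end

section \<open>The discounted energy inequality on a grid\<close>

text \<open>A lower Riemann sum of exp(-s). The exponent already contains the current term, so the
  bound by 1 holds for every nonnegative sequence, however large its terms.\<close>

lemma sum_mult_exp_le:
  fixes x :: "nat \<Rightarrow> real"
  assumes "\<And>l. 0 \<le> x l"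
  shows "(\<Sum>j<n. x j * exp (- (\<Sum>l<Suc j. x l))) \<le> 1 - exp (- (\<Sum>l<n. x l))"
proof (induction n)
  case (Suc n)
  define A where "A = (\<Sum>l<n. x l)"
  have "1 + x n \<le> exp (x n)" by (rule exp_ge_add_one_self)
  then have "x n \<le> exp (x n) - 1" by linarith
  then have "x n * exp (- (A + x n)) \<le> (exp (x n) - 1) * exp (- (A + x n))"
    by (rule mult_right_mono) simp
  also have "\<dots> = exp (- A) - exp (- (A + x n))"
    by (simp add: left_diff_distrib exp_add[symmetric])
  finally show ?case using Suc by (simp add: A_def)
qed simp

context conservative_system
begin

definition activity :: "('i \<Rightarrow> nat \<Rightarrow> 'w \<Rightarrow> real) \<Rightarrow> ('i \<Rightarrow> nat \<Rightarrow> 'w \<Rightarrow> real) \<Rightarrow> nat \<Rightarrow> 'w \<Rightarrow> real" where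
  "activity \<beta> \<xi> l y = (\<Sum>i\<in>I. (\<xi> i l y)\<^sup>2 + \<bar>\<beta> i l y\<bar>)"

text \<open>With this factor the total rate is bounded by a constant, whatever the size of the step data.\<close>

definition discount :: "real \<Rightarrow> real \<Rightarrow> ('i \<Rightarrow> nat \<Rightarrow> 'w \<Rightarrow> real) \<Rightarrow> ('i \<Rightarrow> nat \<Rightarrow> 'w \<Rightarrow> real) \<Rightarrow> nat \<Rightarrow> 'w \<Rightarrow> real" where
  "discount \<kappa> h \<beta> \<xi> j y = exp (- (\<Sum>l<j. \<kappa> * h * activity \<beta> \<xi> l y))"

definition euler_energy :: "real \<Rightarrow> ('i \<Rightarrow> nat \<Rightarrow> 'w \<Rightarrow> real) \<Rightarrow> ('i \<Rightarrow> nat \<Rightarrow> 'w \<Rightarrow> real) \<Rightarrow> nat \<Rightarrow> 'w \<Rightarrow> real" where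
  "euler_energy h \<beta> \<xi> j y = (\<Sum>i\<in>I. (euler h \<beta> \<xi> i j y)\<^sup>2)"

definition euler_rate :: "real \<Rightarrow> real \<Rightarrow> ('i \<Rightarrow> nat \<Rightarrow> 'w \<Rightarrow> real) \<Rightarrow> ('i \<Rightarrow> nat \<Rightarrow> 'w \<Rightarrow> real) \<Rightarrow> nat \<Rightarrow> 'w \<Rightarrow> real" where
  "euler_rate e h \<beta> \<xi> j y = energy_rate I e (\<lambda>i. euler h \<beta> \<xi> i j y) (\<lambda>i. \<beta> i j y) (\<lambda>i. \<xi> i j y)"

lemma activity_nonneg: "0 \<le> activity \<beta> \<xi> l y"
  unfolding activity_def by (intro sum_nonneg) auto

lemma discount_bounds:
  assumes "0 \<le> \<kappa>" "0 \<le> h"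
  shows "0 < discount \<kappa> h \<beta> \<xi> j y" "discount \<kappa> h \<beta> \<xi> j y \<le> 1"
    and "i \<le> j \<Longrightarrow> discount \<kappa> h \<beta> \<xi> j y \<le> discount \<kappa> h \<beta> \<xi> i y"
  using assms activity_nonneg unfolding discount_def
  by (auto intro!: sum_nonneg sum_mono2 simp del: sum.lessThan_Suc)

lemma euler_adapted:
  assumes h: "0 \<le> h" and \<beta>: "grid_adapted h (\<beta> i)" and \<xi>: "grid_adapted h (\<xi> i)"
  shows "euler h \<beta> \<xi> i j \<in> borel_measurable (F (real j * h))"
proof -
  have le: "real l * h \<le> real j * h" if "l \<le> j" for l using that h by (intro mult_right_mono) auto
  have "\<beta> i l \<in> borel_measurable (F (real j * h))" "\<xi> i l \<in> borel_measurable (F (real j * h))" if "l < j" for l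
    using \<beta> \<xi> le[of l] that unfolding grid_adapted_def by (auto intro: measurable_F_mono)
  moreover have "W (real l * h) \<in> borel_measurable (F (real j * h))" if "l \<le> j" for l
    using le[OF that] h by (intro measurable_F_mono[OF W_measurable_F]) auto
  ultimately show ?thesis
    unfolding euler_def[abs_def]
    by (intro borel_measurable_add borel_measurable_sum borel_measurable_times borel_measurable_diff borel_measurable_const)
      (auto simp del: of_nat_Suc)
qed

lemma activity_adapted:
  assumes h: "0 \<le> h" and \<beta>: "\<And>i. i \<in> I \<Longrightarrow> grid_adapted h (\<beta> i)" and \<xi>: "\<And>i. i \<in> I \<Longrightarrow> grid_adapted h (\<xi> i)" and l: "l \<le> j"
  shows "activity \<beta> \<xi> l \<in> borel_measurable (F (real j * h))"
proof -
  have "real l * h \<le> real j * h" using l h by (intro mult_right_mono) auto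
  then have "\<beta> i l \<in> borel_measurable (F (real j * h))" "\<xi> i l \<in> borel_measurable (F (real j * h))" if "i \<in> I" for i
    using \<beta>[OF that] \<xi>[OF that] unfolding grid_adapted_def by (auto intro: measurable_F_mono)
  then show ?thesis
    unfolding activity_def[abs_def] by (intro borel_measurable_sum borel_measurable_add borel_measurable_power borel_measurable_abs)
qed

text \<open>The activity of step \<open>j\<close> is known when that step begins, so the discount
  with index \<open>Suc j\<close>, which already charges the step, is an admissible weight for
  it.\<close>

lemma discount_adapted:
  assumes h: "0 \<le> h" and \<beta>: "\<And>i. i \<in> I \<Longrightarrow> grid_adapted h (\<beta> i)" and \<xi>: "\<And>i. i \<in> I \<Longrightarrow> grid_adapted h (\<xi> i)"
  shows "discount \<kappa> h \<beta> \<xi> (Suc j) \<in> borel_measurable (F (real j * h))"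
proof -
  have "(\<lambda>y. \<Sum>l<Suc j. \<kappa> * h * activity \<beta> \<xi> l y) \<in> borel_measurable (F (real j * h))"
    by (intro borel_measurable_sum borel_measurable_times borel_measurable_const activity_adapted assms) auto
  then show ?thesis unfolding discount_def[abs_def] by measurable
qed

lemma discount_measurable:
  assumes h: "0 \<le> h" and \<beta>: "\<And>i. i \<in> I \<Longrightarrow> grid_adapted h (\<beta> i)" and \<xi>: "\<And>i. i \<in> I \<Longrightarrow> grid_adapted h (\<xi> i)"
  shows "discount \<kappa> h \<beta> \<xi> j \<in> borel_measurable M"
proof (cases j)
  case 0
  then show ?thesis by (simp add: discount_def[abs_def])
next
  case (Suc k)
  then show ?thesis using measurable_F_M[OF discount_adapted[OF assms]] by simp
qed

lemma euler_energy_measurable: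
  assumes h: "0 \<le> h" and \<beta>: "\<And>i. i \<in> I \<Longrightarrow> grid_adapted h (\<beta> i)" and \<xi>: "\<And>i. i \<in> I \<Longrightarrow> grid_adapted h (\<xi> i)"
  shows "euler_energy h \<beta> \<xi> j \<in> borel_measurable M"
  unfolding euler_energy_def[abs_def]
  by (intro borel_measurable_sum borel_measurable_power measurable_F_M[OF euler_adapted] assms)

text \<open>Summation by parts: in each step the discounted energy changes by the new discount times
  the change of the damped energy, minus a loss of at most 1 / e times the decrease of the discount.
  The losses telescope to one minus the mean of the final discount.\<close>

lemma discounted_energy_inequality:
  assumes e: "0 < e" "e \<le> 1" and L: "1 \<le> L" and h: "0 < h" "h \<le> 1" and \<kappa>: "0 \<le> \<kappa>"
    and \<beta>: "\<And>i. i \<in> I \<Longrightarrow> grid_adapted h (\<beta> i)" and \<xi>: "\<And>i. i \<in> I \<Longrightarrow> grid_adapted h (\<xi> i)"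
    and \<beta>L: "\<And>i j y. i \<in> I \<Longrightarrow> y \<in> space M \<Longrightarrow> \<bar>\<beta> i j y\<bar> \<le> L"
    and \<xi>L: "\<And>i j y. i \<in> I \<Longrightarrow> y \<in> space M \<Longrightarrow> \<bar>\<xi> i j y\<bar> \<le> L"
  shows "integrable M (\<lambda>y. LBINT u:{0..real N * h}.
      discount \<kappa> h \<beta> \<xi> (Suc (grid_index h u)) y * euler_rate e h \<beta> \<xi> (grid_index h u) y)" (is ?A)
    and "\<bar>\<E> (\<lambda>y. discount \<kappa> h \<beta> \<xi> N y * damped e (euler_energy h \<beta> \<xi> N y))
        - damped e (\<Sum>i\<in>I. (x0 i)\<^sup>2)
        - \<E> (\<lambda>y. LBINT u:{0..real N * h}.
            discount \<kappa> h \<beta> \<xi> (Suc (grid_index h u)) y * euler_rate e h \<beta> \<xi> (grid_index h u) y)\<bar>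
      \<le> (1 - \<E> (discount \<kappa> h \<beta> \<xi> N)) / e + real N * (step_constant I e * (L ^ 6 * sqrt h ^ 3))" (is ?B)
proof -
  define D where "D = discount \<kappa> h \<beta> \<xi>"
  define V where "V = euler_energy h \<beta> \<xi>"
  define q where "q = euler_rate e h \<beta> \<xi>"
  define K where "K = step_constant I e * (L ^ 6 * sqrt h ^ 3)"
  have h0: "0 \<le> h" using h by simp
  have V0: "0 \<le> V j y" for j y by (simp add: V_def euler_energy_def sum_nonneg)
  have Db: "0 < D j y" "D j y \<le> 1" "D (Suc j) y \<le> D j y" for j y
    using discount_bounds[OF \<kappa> h0] by (auto simp: D_def)
  have Dm: "D j \<in> borel_measurable M" for j
    unfolding D_def by (intro discount_measurable[OF h0 \<beta> \<xi>])
  have Vm: "V j \<in> borel_measurable M" for j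
    unfolding V_def by (intro euler_energy_measurable[OF h0 \<beta> \<xi>])
  have dm: "(\<lambda>y. damped e (V j y)) \<in> borel_measurable M" for j
    unfolding damped_def using Vm by measurable
  have db: "0 \<le> damped e (V j y)" "damped e (V j y) \<le> 1 / e" for j y
    using damped_nonneg[OF less_imp_le[OF e(1)] V0] damped_le[OF e(1) V0] by auto
  have iD: "integrable M (D j)" for j
    by (rule integrable_const_bound[where B=1]) (use Dm Db in \<open>auto simp: less_imp_le\<close>)
  have iDd: "integrable M (\<lambda>y. D k y * damped e (V j y))" for j k
  proof (rule integrable_const_bound[where B="1/e"])
    show "AE y in M. norm (D k y * damped e (V j y)) \<le> 1 / e"
    proof (rule AE_I2)
      fix y
      have "D k y * damped e (V j y) \<le> 1 * (1 / e)"
        using Db db e by (intro mult_mono) auto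
      then show "norm (D k y * damped e (V j y)) \<le> 1 / e"
        using db(1)[of j y] Db(1)[of k y] by (simp add: abs_mult)
    qed
  qed (use Dm dm in measurable)
  have step: "integrable M (\<lambda>y. D (Suc j) y * q j y)
      \<and> \<bar>\<E> (\<lambda>y. D (Suc j) y * (damped e (V (Suc j) y) - damped e (V j y)))
        - h * \<E> (\<lambda>y. D (Suc j) y * q j y)\<bar> \<le> K" for j
  proof -
    have t: "0 \<le> real j * h" using h0 by simp
    have zF: "euler h \<beta> \<xi> i j \<in> borel_measurable (F (real j * h))" if "i \<in> I" for i
      by (rule euler_adapted[where \<beta>=\<beta> and \<xi>=\<xi> and i=i, OF h0 \<beta>[OF that] \<xi>[OF that]])
    have bF: "\<beta> i j \<in> borel_measurable (F (real j * h))" "\<xi> i j \<in> borel_measurable (F (real j * h))" if "i \<in> I" for i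
      using \<beta>[OF that] \<xi>[OF that] by (auto simp: grid_adapted_def)
    have dF: "D (Suc j) \<in> borel_measurable (F (real j * h))"
      unfolding D_def by (rule discount_adapted[OF h0 \<beta> \<xi>])
    have Db': "0 \<le> D (Suc j) y \<and> D (Suc j) y \<le> 1" for y using Db(1,2)[of "Suc j" y] by simp
    note s = one_step_expectation[where z="\<lambda>i. euler h \<beta> \<xi> i j" and \<beta>="\<lambda>i. \<beta> i j" and \<xi>="\<lambda>i. \<xi> i j",
        OF fin e L h t zF bF dF \<beta>L \<xi>L Db']
    have "real j * h + h = real (Suc j) * h" by (simp add: algebra_simps)
    then have V': "(\<Sum>i\<in>I. (euler h \<beta> \<xi> i j y + (h * \<beta> i j y + \<xi> i j y * (W (real j * h + h) y - W (real j * h) y)))\<^sup>2) = V (Suc j) y" for y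
      by (simp only: V_def euler_energy_def euler_Suc)
    have V: "(\<Sum>i\<in>I. (euler h \<beta> \<xi> i j y)\<^sup>2) = V j y" for y by (simp add: V_def euler_energy_def)
    have q: "energy_rate I e (\<lambda>i. euler h \<beta> \<xi> i j y) (\<lambda>i. \<beta> i j y) (\<lambda>i. \<xi> i j y) = q j y" for y
      by (simp add: q_def euler_rate_def)
    show ?thesis using s unfolding V' V q K_def by blast
  qed
  have Req: "(LBINT u:{0..real N * h}. D (Suc (grid_index h u)) y * q (grid_index h u) y)
      = (\<Sum>j<N. h * (D (Suc j) y * q j y))" for y
    using grid_set_integral_full[OF h(1), of N "\<lambda>j. D (Suc j) y * q j y"] .
  have iR: "integrable M (\<lambda>y. LBINT u:{0..real N * h}. D (Suc (grid_index h u)) y * q (grid_index h u) y)"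
    unfolding Req by (intro Bochner_Integration.integrable_sum integrable_mult_right) (use step in blast)
  then show ?A by (simp add: D_def q_def)
  have ER: "\<E> (\<lambda>y. LBINT u:{0..real N * h}. D (Suc (grid_index h u)) y * q (grid_index h u) y)
      = (\<Sum>j<N. h * \<E> (\<lambda>y. D (Suc j) y * q j y))"
    unfolding Req using step by (subst Bochner_Integration.integral_sum) auto
  define a where "a j = \<E> (\<lambda>y. D j y * damped e (V j y))" for j
  have a0: "a 0 = damped e (\<Sum>i\<in>I. (x0 i)\<^sup>2)"
    by (simp add: a_def D_def V_def discount_def euler_energy_def euler_def prob_space)
  have inc: "\<bar>a (Suc j) - a j - h * \<E> (\<lambda>y. D (Suc j) y * q j y)\<bar>
      \<le> K + (\<E> (D j) - \<E> (D (Suc j))) / e" for j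
  proof -
    have "a (Suc j) - a j = \<E> (\<lambda>y. D (Suc j) y * (damped e (V (Suc j) y) - damped e (V j y)))
        - \<E> (\<lambda>y. D j y * damped e (V j y) - D (Suc j) y * damped e (V j y))"
      unfolding a_def using iDd by (simp add: right_diff_distrib)
    moreover have "\<bar>\<E> (\<lambda>y. D j y * damped e (V j y) - D (Suc j) y * damped e (V j y))\<bar>
        \<le> (\<E> (D j) - \<E> (D (Suc j))) / e"
    proof -
      have "\<bar>\<E> (\<lambda>y. D j y * damped e (V j y) - D (Suc j) y * damped e (V j y))\<bar>
        \<le> \<E> (\<lambda>y. \<bar>D j y * damped e (V j y) - D (Suc j) y * damped e (V j y)\<bar>)"
        by (rule integral_abs_bound)
      also have "\<dots> \<le> \<E> (\<lambda>y. (D j y - D (Suc j) y) * (1 / e))"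
      proof (rule integral_mono)
        show "\<bar>D j y * damped e (V j y) - D (Suc j) y * damped e (V j y)\<bar> \<le> (D j y - D (Suc j) y) * (1 / e)" for y
        proof -
          have "\<bar>(D j y - D (Suc j) y) * damped e (V j y)\<bar> \<le> (D j y - D (Suc j) y) * (1 / e)"
            unfolding abs_mult using Db(3)[of j y] db[of j y] by (intro mult_mono) auto
          then show ?thesis by (simp add: left_diff_distrib)
        qed
      qed (use iDd iD in auto)
      also have "\<dots> = (\<E> (D j) - \<E> (D (Suc j))) / e" using iD by simp
      finally show ?thesis .
    qed
    ultimately show ?thesis using step[of j] by linarith
  qed
  have "\<bar>a n - a 0 - (\<Sum>j<n. h * \<E> (\<lambda>y. D (Suc j) y * q j y))\<bar>
      \<le> real n * K + (\<E> (D 0) - \<E> (D n)) / e" for n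
  proof (induction n)
    case (Suc n)
    have "real (Suc n) * K + (\<E> (D 0) - \<E> (D (Suc n))) / e
      = (real n * K + (\<E> (D 0) - \<E> (D n)) / e) + (K + (\<E> (D n) - \<E> (D (Suc n))) / e)"
      by (simp add: algebra_simps diff_divide_distrib)
    then show ?case using Suc inc[of n] by simp
  qed simp
  note telescoped = this[of N]
  have ED0: "\<E> (D 0) = 1" by (simp add: D_def discount_def[abs_def] prob_space)
  have "\<bar>a N - damped e (\<Sum>i\<in>I. (x0 i)\<^sup>2)
      - \<E> (\<lambda>y. LBINT u:{0..real N * h}. D (Suc (grid_index h u)) y * q (grid_index h u) y)\<bar>
    \<le> (1 - \<E> (D N)) / e + real N * K"
    using telescoped unfolding ER a0 ED0 by linarith
  then show ?B unfolding a_def D_def V_def q_def K_def .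
qed

end

section \<open>Mean convergence in time\<close>

definition mean_convergent :: "real \<Rightarrow> (nat \<Rightarrow> real \<Rightarrow> real) \<Rightarrow> (real \<Rightarrow> real) \<Rightarrow> bool" where
  "mean_convergent T f g \<longleftrightarrow> (\<forall>N. set_integrable lborel {0..T} (f N)) \<and> set_integrable lborel {0..T} g
    \<and> (\<lambda>N. LBINT u:{0..T}. \<bar>f N u - g u\<bar>) \<longlonglongrightarrow> 0"

lemma mean_convergent_0: "mean_convergent T (\<lambda>_ _. 0) (\<lambda>_. 0)"
  by (simp add: mean_convergent_def set_integrable_def set_lebesgue_integral_def)

lemma mean_convergent_add:
  assumes "mean_convergent T f g" "mean_convergent T f' g'"
  shows "mean_convergent T (\<lambda>N u. f N u + f' N u) (\<lambda>u. g u + g' u)"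
proof -
  have i: "set_integrable lborel {0..T} (f N)" "set_integrable lborel {0..T} g"
    "set_integrable lborel {0..T} (f' N)" "set_integrable lborel {0..T} g'" for N
    using assms by (auto simp: mean_convergent_def)
  have a: "set_integrable lborel {0..T} (\<lambda>u. \<bar>f N u - g u\<bar>)" "set_integrable lborel {0..T} (\<lambda>u. \<bar>f' N u - g' u\<bar>)" for N
    by (intro set_integrable_abs set_integral_diff(1) i)+
  have "null_seq (\<lambda>N. LBINT u:{0..T}. \<bar>f N u + f' N u - (g u + g' u)\<bar>)"
  proof (rule tendsto_sandwich[OF _ _ tendsto_const])
    show "null_seq (\<lambda>N. (LBINT u:{0..T}. \<bar>f N u - g u\<bar>) + (LBINT u:{0..T}. \<bar>f' N u - g' u\<bar>))"
      using assms by (intro tendsto_add_zero) (auto simp: mean_convergent_def)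
    have "(LBINT u:{0..T}. \<bar>f N u + f' N u - (g u + g' u)\<bar>)
      \<le> (LBINT u:{0..T}. \<bar>f N u - g u\<bar> + \<bar>f' N u - g' u\<bar>)" for N
      by (intro set_integral_mono set_integrable_abs set_integral_diff(1) set_integral_add(1) i a) linarith
    then show "\<forall>\<^sub>F N in sequentially. (LBINT u:{0..T}. \<bar>f N u + f' N u - (g u + g' u)\<bar>)
      \<le> (LBINT u:{0..T}. \<bar>f N u - g u\<bar>) + (LBINT u:{0..T}. \<bar>f' N u - g' u\<bar>)"
      using a by (simp add: set_integral_add(2))
  qed (simp add: set_integral_nonneg_all)
  then show ?thesis
    unfolding mean_convergent_def using i by (auto intro!: set_integral_add(1))
qed

lemma mean_convergent_sum:
  assumes "finite A" "\<And>a. a \<in> A \<Longrightarrow> mean_convergent T (f a) (g a)"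
  shows "mean_convergent T (\<lambda>N u. \<Sum>a\<in>A. f a N u) (\<lambda>u. \<Sum>a\<in>A. g a u)"
  using assms
proof (induction A rule: finite_induct)
  case (insert a A)
  have "mean_convergent T (\<lambda>N u. f a N u + (\<Sum>a\<in>A. f a N u)) (\<lambda>u. g a u + (\<Sum>a\<in>A. g a u))"
    by (intro mean_convergent_add) (use insert in auto)
  then show ?case using insert by simp
qed (simp add: mean_convergent_0)

text \<open>The error splits into \<open>c\<close> times the error of \<open>f\<close>, small
  because \<open>c\<close> is bounded, and the error of \<open>c\<close> times \<open>g\<close>,
  small by dominated convergence.\<close>

lemma mean_convergent_bounded_mult:
  assumes f: "mean_convergent T f g"
    and [measurable]: "\<And>N. c N \<in> borel_measurable borel" "c' \<in> borel_measurable borel"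
      "\<And>N. f N \<in> borel_measurable borel" "g \<in> borel_measurable borel"
    and K: "\<And>N u. \<bar>c N u\<bar> \<le> K" "\<And>u. \<bar>c' u\<bar> \<le> K"
    and lim: "AE u in lborel. u \<in> {0..T} \<longrightarrow> (\<lambda>N. c N u) \<longlonglongrightarrow> c' u"
  shows "mean_convergent T (\<lambda>N u. c N u * f N u) (\<lambda>u. c' u * g u)"
proof -
  let ?k = "\<lambda>N u. \<bar>c N u - c' u\<bar> * \<bar>g u\<bar>"
  have i: "set_integrable lborel {0..T} (f N)" "set_integrable lborel {0..T} g" for N
    using f by (auto simp: mean_convergent_def)
  have K0: "0 \<le> K" using K(2)[of 0] by linarith
  have bd: "set_integrable lborel {0..T} (\<lambda>u. d u * k u)"
    if "set_integrable lborel {0..T} k" "d \<in> borel_measurable borel" "k \<in> borel_measurable borel" "\<And>u. \<bar>d u\<bar> \<le> B" for d k :: "real \<Rightarrow> real" and B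
  proof -
    have "set_integrable lborel {0..T} (\<lambda>u. B * k u)" using that(1) by (rule set_integrable_mult_right)
    then show ?thesis
    proof (rule set_integrable_bound)
      have "\<bar>d u * k u\<bar> \<le> \<bar>B * k u\<bar>" for u
        unfolding abs_mult using that(4)[of u] by (intro mult_right_mono) auto
      then show "AE u in lborel. u \<in> {0..T} \<longrightarrow> norm (d u * k u) \<le> norm (B * k u)" by simp
    qed (use that(2,3) in \<open>simp add: set_borel_measurable_def\<close>)
  qed
  have i1: "set_integrable lborel {0..T} (\<lambda>u. c N u * f N u)" "set_integrable lborel {0..T} (\<lambda>u. c' u * g u)" for N
    by (rule bd[OF i(1) _ _ K(1)]; measurable) (rule bd[OF i(2) _ _ K(2)]; measurable)
  have i2: "set_integrable lborel {0..T} (\<lambda>u. ?k N u)" for N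
  proof (rule bd)
    show "\<bar>\<bar>c N u - c' u\<bar>\<bar> \<le> 2 * K" for u using K(1)[of N u] K(2)[of u] by linarith
  qed (use i in \<open>auto intro: set_integrable_abs\<close>)
  have i3: "set_integrable lborel {0..T} (\<lambda>u. \<bar>f N u - g u\<bar>)" for N
    by (intro set_integrable_abs set_integral_diff(1) i)
  have "(\<lambda>N. LBINT u:{0..T}. ?k N u) \<longlonglongrightarrow> (LINT (u::real)|lborel. 0)"
    unfolding set_lebesgue_integral_def
  proof (rule integral_dominated_convergence[where w="\<lambda>u. indicator {0..T} u *\<^sub>R (2 * K * \<bar>g u\<bar>)"])
    show "integrable lborel (\<lambda>u. indicator {0..T} u *\<^sub>R (2 * K * \<bar>g u\<bar>))"
      using set_integrable_mult_right[of "2 * K" lborel "{0..T}" "\<lambda>u. \<bar>g u\<bar>"] i set_integrable_abs[of lborel "{0..T}" g]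
      by (simp add: set_integrable_def)
    show "AE u in lborel. (\<lambda>N. indicator {0..T} u *\<^sub>R (?k N u)) \<longlonglongrightarrow> 0"
      using lim
    proof eventually_elim
      case (elim u)
      show ?case
      proof (cases "u \<in> {0..T}")
        case True
        then have "(\<lambda>N. ?k N u) \<longlonglongrightarrow> \<bar>c' u - c' u\<bar> * \<bar>g u\<bar>"
          using elim by (intro tendsto_intros) auto
        then show ?thesis using True by simp
      qed simp
    qed
    fix N
    show "AE u in lborel. norm (indicator {0..T} u *\<^sub>R (?k N u)) \<le> indicator {0..T} u *\<^sub>R (2 * K * \<bar>g u\<bar>)"
    proof (rule AE_I2)
      fix u
      have "?k N u \<le> 2 * K * \<bar>g u\<bar>"
        using K(1)[of N u] K(2)[of u] by (intro mult_right_mono) linarith+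
      then show "norm (indicator {0..T} u *\<^sub>R (?k N u)) \<le> indicator {0..T} u *\<^sub>R (2 * K * \<bar>g u\<bar>)"
        by (auto simp: indicator_def)
    qed
  qed measurable
  then have l2: "null_seq (\<lambda>N. LBINT u:{0..T}. ?k N u)" by simp
  have l1: "null_seq (\<lambda>N. K * (LBINT u:{0..T}. \<bar>f N u - g u\<bar>))"
    using tendsto_mult_left[of _ 0 _ K] f by (force simp: mean_convergent_def)
  have "null_seq (\<lambda>N. LBINT u:{0..T}. \<bar>c N u * f N u - c' u * g u\<bar>)"
  proof (rule tendsto_sandwich[OF _ _ tendsto_const tendsto_add_zero[OF l1 l2]])
    have ptw: "\<bar>c N u * f N u - c' u * g u\<bar> \<le> K * \<bar>f N u - g u\<bar> + ?k N u" for N u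
    proof -
      have "c N u * f N u - c' u * g u = c N u * (f N u - g u) + (c N u - c' u) * g u" by (simp add: algebra_simps)
      then have "\<bar>c N u * f N u - c' u * g u\<bar> \<le> \<bar>c N u\<bar> * \<bar>f N u - g u\<bar> + ?k N u"
        by (simp add: abs_mult[symmetric])
      also have "\<bar>c N u\<bar> * \<bar>f N u - g u\<bar> \<le> K * \<bar>f N u - g u\<bar>" by (intro mult_right_mono K) simp
      finally show ?thesis by simp
    qed
    have "(LBINT u:{0..T}. \<bar>c N u * f N u - c' u * g u\<bar>)
      \<le> (LBINT u:{0..T}. K * \<bar>f N u - g u\<bar> + ?k N u)" for N
      by (intro set_integral_mono set_integrable_abs set_integral_diff(1) i1 set_integral_add(1) set_integrable_mult_right i2 i3 ptw)
    then show "\<forall>\<^sub>F N in sequentially. (LBINT u:{0..T}. \<bar>c N u * f N u - c' u * g u\<bar>)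
      \<le> K * (LBINT u:{0..T}. \<bar>f N u - g u\<bar>) + (LBINT u:{0..T}. ?k N u)"
      using i2 i3 by (simp add: set_integral_add(2))
  qed (simp add: set_integral_nonneg_all)
  then show ?thesis unfolding mean_convergent_def using i1 by blast
qed

lemma abs_mult_le_squares: "\<bar>x * y\<bar> \<le> x\<^sup>2 + (y::real)\<^sup>2"
proof -
  have "2 * (\<bar>x\<bar> * \<bar>y\<bar>) \<le> x\<^sup>2 + y\<^sup>2"
    using sum_squares_bound[of "\<bar>x\<bar>" "\<bar>y\<bar>"] by (simp add: mult.assoc)
  moreover have "0 \<le> \<bar>x\<bar> * \<bar>y\<bar>" by simp
  ultimately show ?thesis unfolding abs_mult by linarith
qed

lemma set_integrable_product:
  fixes f g :: "real \<Rightarrow> real"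
  assumes [measurable]: "f \<in> borel_measurable borel" "g \<in> borel_measurable borel"
    and "set_integrable lborel A (\<lambda>u. (f u)\<^sup>2)" "set_integrable lborel A (\<lambda>u. (g u)\<^sup>2)" "A \<in> sets borel"
  shows "set_integrable lborel A (\<lambda>u. f u * g u)"
proof (rule set_integrable_bound)
  show "set_integrable lborel A (\<lambda>u. (f u)\<^sup>2 + (g u)\<^sup>2)" using assms by (intro set_integral_add(1))
  show "AE u in lborel. u \<in> A \<longrightarrow> norm (f u * g u) \<le> norm ((f u)\<^sup>2 + (g u)\<^sup>2)"
    using abs_mult_le_squares by (auto intro!: AE_I2)
qed (use assms in \<open>simp add: set_borel_measurable_def\<close>)

text \<open>Products of two sequences that converge in the square mean converge in the mean; Young's
  inequality with a parameter \<delta> takes the place of Cauchy-Schwarz.\<close>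

lemma mean_convergent_product:
  assumes [measurable]: "\<And>N. f N \<in> borel_measurable borel" "\<And>N. f' N \<in> borel_measurable borel"
      "g \<in> borel_measurable borel" "g' \<in> borel_measurable borel"
    and sq: "\<And>N. set_integrable lborel {0..T} (\<lambda>u. (f N u)\<^sup>2)" "\<And>N. set_integrable lborel {0..T} (\<lambda>u. (f' N u)\<^sup>2)"
      "set_integrable lborel {0..T} (\<lambda>u. (g u)\<^sup>2)" "set_integrable lborel {0..T} (\<lambda>u. (g' u)\<^sup>2)"
    and lim: "null_seq (\<lambda>N. LBINT u:{0..T}. (f N u - g u)\<^sup>2)" "null_seq (\<lambda>N. LBINT u:{0..T}. (f' N u - g' u)\<^sup>2)"
  shows "mean_convergent T (\<lambda>N u. f N u * f' N u) (\<lambda>u. g u * g' u)"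
proof -
  let ?k = "\<lambda>N u. \<bar>f N u * f' N u - g u * g' u\<bar>"
  have i: "set_integrable lborel {0..T} (\<lambda>u. f N u * f' N u)" "set_integrable lborel {0..T} (\<lambda>u. g u * g' u)" for N
    by (auto intro!: set_integrable_product sq)
  define a where "a N = (LBINT u:{0..T}. (f N u - g u)\<^sup>2)" for N
  define a' where "a' N = (LBINT u:{0..T}. (f' N u - g' u)\<^sup>2)" for N
  define B where "B = (LBINT u:{0..T}. (g u)\<^sup>2) + (LBINT u:{0..T}. (g' u)\<^sup>2)"
  have B0: "0 \<le> B" unfolding B_def by (intro add_nonneg_nonneg set_integral_nonneg_all) auto
  have sd: "set_integrable lborel {0..T} (\<lambda>u. (f N u - g u)\<^sup>2)" "set_integrable lborel {0..T} (\<lambda>u. (f' N u - g' u)\<^sup>2)" for N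
    by (intro set_square_integrable_diff(1) sq; measurable)+
  have le: "(LBINT u:{0..T}. ?k N u) \<le> \<delta> * B + (1 / \<delta> + 1) * (a N + a' N)"
    if \<delta>: "0 < \<delta>" for \<delta> N
  proof -
    have am: "\<bar>x\<bar> * \<bar>y\<bar> \<le> \<delta> * x\<^sup>2 + (1 / \<delta>) * y\<^sup>2" for x y :: real
    proof -
      have "0 \<le> (sqrt \<delta> * \<bar>x\<bar> - \<bar>y\<bar> / sqrt \<delta>)\<^sup>2" by simp
      also have "\<dots> = \<delta> * x\<^sup>2 + y\<^sup>2 / \<delta> - 2 * (\<bar>x\<bar> * \<bar>y\<bar>)"
        using \<delta> by (simp add: power2_diff power_mult_distrib power_divide)
      finally have "2 * (\<bar>x\<bar> * \<bar>y\<bar>) \<le> \<delta> * x\<^sup>2 + y\<^sup>2 / \<delta>" by simp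
      moreover have "0 \<le> \<bar>x\<bar> * \<bar>y\<bar>" by simp
      ultimately have "\<bar>x\<bar> * \<bar>y\<bar> \<le> \<delta> * x\<^sup>2 + y\<^sup>2 / \<delta>" by linarith
      then show ?thesis by simp
    qed
    have ptw: "?k N u \<le> \<delta> * ((g u)\<^sup>2 + (g' u)\<^sup>2) + (1 / \<delta> + 1) * ((f N u - g u)\<^sup>2 + (f' N u - g' u)\<^sup>2)" for u
    proof -
      define x where "x = f N u - g u"
      define y where "y = f' N u - g' u"
      have "f N u * f' N u - g u * g' u = x * y + (g u * y + g' u * x)" by (simp add: x_def y_def algebra_simps)
      then have "?k N u \<le> \<bar>x\<bar> * \<bar>y\<bar> + (\<bar>g u\<bar> * \<bar>y\<bar> + \<bar>g' u\<bar> * \<bar>x\<bar>)"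
        unfolding abs_mult[symmetric] by linarith
      moreover have "\<bar>x\<bar> * \<bar>y\<bar> \<le> x\<^sup>2 + y\<^sup>2"
        using abs_mult_le_squares[of x y] by (simp add: abs_mult)
      ultimately have "?k N u
        \<le> (x\<^sup>2 + y\<^sup>2) + ((\<delta> * (g u)\<^sup>2 + (1 / \<delta>) * y\<^sup>2) + (\<delta> * (g' u)\<^sup>2 + (1 / \<delta>) * x\<^sup>2))"
        using am[of "g u" y] am[of "g' u" x] by linarith
      also have "\<dots> = \<delta> * ((g u)\<^sup>2 + (g' u)\<^sup>2) + (1 / \<delta> + 1) * (x\<^sup>2 + y\<^sup>2)" by (simp add: algebra_simps)
      finally show ?thesis unfolding x_def y_def .
    qed
    have ii: "set_integrable lborel {0..T} (\<lambda>u. (g u)\<^sup>2 + (g' u)\<^sup>2)" "set_integrable lborel {0..T} (\<lambda>u. (f N u - g u)\<^sup>2 + (f' N u - g' u)\<^sup>2)"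
      by (intro set_integral_add(1) sq sd)+
    have "(LBINT u:{0..T}. ?k N u)
      \<le> (LBINT u:{0..T}. \<delta> * ((g u)\<^sup>2 + (g' u)\<^sup>2) + (1 / \<delta> + 1) * ((f N u - g u)\<^sup>2 + (f' N u - g' u)\<^sup>2))"
      by (intro set_integral_mono set_integrable_abs set_integral_diff(1) i ptw set_integral_add(1) set_integrable_mult_right ii)
    also have "\<dots> = (LBINT u:{0..T}. \<delta> * ((g u)\<^sup>2 + (g' u)\<^sup>2)) + (LBINT u:{0..T}. (1 / \<delta> + 1) * ((f N u - g u)\<^sup>2 + (f' N u - g' u)\<^sup>2))"
      by (intro set_integral_add(2) set_integrable_mult_right ii)
    also have "\<dots> = \<delta> * B + (1 / \<delta> + 1) * (a N + a' N)"
      unfolding set_integral_mult_right B_def a_def a'_def by (simp only: set_integral_add(2) sq sd)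
    finally show ?thesis .
  qed
  have aa: "null_seq (\<lambda>N. a N + a' N)" using lim unfolding a_def a'_def by (rule tendsto_add_zero)
  have "null_seq (\<lambda>N. LBINT u:{0..T}. ?k N u)"
  proof (rule LIMSEQ_I)
    fix e :: real assume e: "e > 0"
    \<comment> \<open>The denominator \<open>B + 1\<close>, rather than \<open>B\<close>, covers the
      case that both limits vanish.\<close>
    define \<delta> where "\<delta> = e / 2 / (B + 1)"
    have \<delta>1: "0 < \<delta>" using e B0 by (simp add: \<delta>_def)
    have "B + 1 \<noteq> 0" using B0 by simp
    then have "\<delta> * (B + 1) = e / 2" unfolding \<delta>_def by (metis nonzero_divide_eq_eq)
    then have \<delta>2: "\<delta> * B < e / 2" using \<delta>1 by (simp add: distrib_left)
    have "null_seq (\<lambda>N. (1 / \<delta> + 1) * (a N + a' N))" using tendsto_mult_left[OF aa, of "1 / \<delta> + 1"] by simp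
    from order_tendstoD(2)[OF this, of "e / 4"] e
    have "\<forall>\<^sub>F N in sequentially. (1 / \<delta> + 1) * (a N + a' N) < e / 4" by simp
    then have "\<forall>\<^sub>F N in sequentially. norm ((LBINT u:{0..T}. ?k N u) - 0) < e"
    proof eventually_elim
      case (elim N)
      have "(LBINT u:{0..T}. ?k N u) < e" using le[OF \<delta>1, of N] elim \<delta>2 e by linarith
      moreover have "0 \<le> (LBINT u:{0..T}. ?k N u)" by (rule set_integral_nonneg_all) simp
      ultimately show ?case by simp
    qed
    then show "\<exists>no. \<forall>n\<ge>no. norm ((LBINT u:{0..T}. \<bar>f n u * f' n u - g u * g' u\<bar>) - 0) < e"
      by (simp add: eventually_sequentially)
  qed
  then show ?thesis unfolding mean_convergent_def using i by blast
qed

text \<open>The partial derivative of the damped squared norm in direction \<open>i\<close>.\<close>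

definition drift_weight :: "'i set \<Rightarrow> real \<Rightarrow> 'i \<Rightarrow> ('i \<Rightarrow> real) \<Rightarrow> real" where
  "drift_weight I e i z = 2 * z i / (1 + e * (\<Sum>i\<in>I. (z i)\<^sup>2))\<^sup>2"

text \<open>Half of the second partial derivative of the damped squared norm in directions
  \<open>i\<close> and \<open>j\<close>.\<close>

definition noise_weight :: "'i set \<Rightarrow> real \<Rightarrow> 'i \<Rightarrow> 'i \<Rightarrow> ('i \<Rightarrow> real) \<Rightarrow> real" where
  "noise_weight I e i j z = (if i = j then 1 else 0) / (1 + e * (\<Sum>i\<in>I. (z i)\<^sup>2))\<^sup>2
    - 4 * e * (z i * z j) / (1 + e * (\<Sum>i\<in>I. (z i)\<^sup>2)) ^ 3"

text \<open>Separates the weights, which are bounded functions of the state, from the data, which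
  converge in mean; each product can then be passed to the limit.\<close>

lemma energy_rate_eq:
  assumes "finite I"
  shows "energy_rate I e z \<beta> \<xi>
    = (\<Sum>i\<in>I. drift_weight I e i z * \<beta> i) + (\<Sum>i\<in>I. \<Sum>j\<in>I. noise_weight I e i j z * (\<xi> i * \<xi> j))"
proof -
  define w where "w = 1 + e * (\<Sum>i\<in>I. (z i)\<^sup>2)"
  have 1: "(\<Sum>i\<in>I. drift_weight I e i z * \<beta> i) = 2 * (\<Sum>i\<in>I. z i * \<beta> i) / w\<^sup>2"
    by (simp add: drift_weight_def w_def sum_distrib_left sum_divide_distrib algebra_simps)
  define c where "c = 4 * e / w ^ 3"
  have "(\<Sum>i\<in>I. \<Sum>j\<in>I. noise_weight I e i j z * (\<xi> i * \<xi> j))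
    = (\<Sum>i\<in>I. \<Sum>j\<in>I. (if i = j then (\<xi> j)\<^sup>2 / w\<^sup>2 else 0) - c * ((z i * \<xi> i) * (z j * \<xi> j)))"
    by (intro sum.cong refl) (auto simp: noise_weight_def w_def c_def algebra_simps power2_eq_square)
  also have "\<dots> = (\<Sum>i\<in>I. (\<xi> i)\<^sup>2 / w\<^sup>2) - c * ((\<Sum>i\<in>I. z i * \<xi> i) * (\<Sum>j\<in>I. z j * \<xi> j))"
  proof -
    have "(\<Sum>i\<in>I. \<Sum>j\<in>I. c * ((z i * \<xi> i) * (z j * \<xi> j))) = c * ((\<Sum>i\<in>I. z i * \<xi> i) * (\<Sum>j\<in>I. z j * \<xi> j))"
      by (subst sum_product) (simp only: sum_distrib_left)
    moreover have "(\<Sum>i\<in>I. \<Sum>j\<in>I. if i = j then (\<xi> j)\<^sup>2 / w\<^sup>2 else 0) = (\<Sum>i\<in>I. (\<xi> i)\<^sup>2 / w\<^sup>2)"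
      using assms by (intro sum.cong refl) (simp add: sum.delta)
    ultimately show ?thesis by (simp only: sum_subtractf)
  qed
  finally show ?thesis
    unfolding 1 energy_rate_def w_def[symmetric] by (simp add: c_def add_divide_distrib sum_divide_distrib power2_eq_square)
qed

text \<open>2 / e would do for the drift; the noise gives 1 + 4 / e, which is at most 5 / e as
  \<open>e\<close> is at most 1. One constant for both keeps the later estimates short.\<close>

lemma rate_weight_bounds:
  assumes fin: "finite I" and e: "0 < e" "e \<le> 1" and i: "i \<in> I" and j: "j \<in> I"
  shows "\<bar>drift_weight I e i z\<bar> \<le> 5 / e" "\<bar>noise_weight I e i j z\<bar> \<le> 5 / e"
proof -
  define w where "w = 1 + e * (\<Sum>i\<in>I. (z i)\<^sup>2)"
  have w1: "1 \<le> w" using e by (simp add: w_def sum_nonneg)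
  have zi: "\<bar>z k\<bar> \<le> w / e" if "k \<in> I" for k
    unfolding w_def by (rule coordinate_le_weight[OF fin that e])
  have wp: "w \<le> w\<^sup>2" "w\<^sup>2 \<le> w ^ 3" "1 \<le> w\<^sup>2" "0 < w ^ 3"
    using w1 power_increasing[of 1 2 w] power_increasing[of 2 3 w] by auto
  have "\<bar>drift_weight I e i z\<bar> = 2 * \<bar>z i\<bar> / w\<^sup>2"
    by (simp add: drift_weight_def w_def abs_mult abs_divide)
  also have "\<dots> \<le> 2 * (w\<^sup>2 / e) / w\<^sup>2"
  proof (intro divide_right_mono mult_left_mono)
    have "w / e \<le> w\<^sup>2 / e" using wp e by (intro divide_right_mono) auto
    then show "\<bar>z i\<bar> \<le> w\<^sup>2 / e" using zi[OF i] by linarith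
  qed auto
  also have "\<dots> \<le> 5 / e" using wp e w1 by (simp add: field_simps)
  finally show "\<bar>drift_weight I e i z\<bar> \<le> 5 / e" .
  have "\<bar>4 * e * (z i * z j) / w ^ 3\<bar> = 4 * e * (\<bar>z i\<bar> * \<bar>z j\<bar>) / w ^ 3"
    using e wp by (simp add: abs_mult abs_divide)
  also have "\<dots> \<le> 4 * e * ((w / e) * (w / e)) / w ^ 3"
    using zi[OF i] zi[OF j] e wp w1 by (intro divide_right_mono mult_left_mono mult_mono) auto
  also have "\<dots> = 4 / e * (w\<^sup>2 / w ^ 3)" using e by (simp add: power2_eq_square)
  also have "\<dots> \<le> 4 / e * 1" using wp e by (intro mult_left_mono) auto
  finally have 1: "\<bar>4 * e * (z i * z j) / w ^ 3\<bar> \<le> 4 / e" by simp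
  have 2: "\<bar>(if i = j then 1 else 0) / w\<^sup>2\<bar> \<le> 1" using wp by auto
  have 3: "1 \<le> 1 / e" using e by simp
  have "\<bar>noise_weight I e i j z\<bar> \<le> \<bar>(if i = j then 1 else 0) / w\<^sup>2\<bar> + \<bar>4 * e * (z i * z j) / w ^ 3\<bar>"
    unfolding noise_weight_def w_def by (rule abs_triangle_ineq4)
  then have "\<bar>noise_weight I e i j z\<bar> \<le> 1 / e + 4 / e" using 1 2 3 by linarith
  then show "\<bar>noise_weight I e i j z\<bar> \<le> 5 / e" using e by (simp add: field_simps)
qed

text \<open>The state enters through bounded weights, so convergence almost everywhere in time
  suffices for it; drift data converge in mean and noise data in square mean, in accordance with
  their degrees one and two in the rate.\<close>

lemma mean_convergent_energy_rate:
  assumes fin: "finite I" and e: "0 < e" "e \<le> 1"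
    and m: "\<And>N i. i \<in> I \<Longrightarrow> Z N i \<in> borel_measurable borel" "\<And>i. i \<in> I \<Longrightarrow> X i \<in> borel_measurable borel"
      "\<And>N i. i \<in> I \<Longrightarrow> \<beta> N i \<in> borel_measurable borel" "\<And>i. i \<in> I \<Longrightarrow> b i \<in> borel_measurable borel"
      "\<And>N i. i \<in> I \<Longrightarrow> \<xi> N i \<in> borel_measurable borel" "\<And>i. i \<in> I \<Longrightarrow> H i \<in> borel_measurable borel"
    and lim: "AE u in lborel. u \<in> {0..T} \<longrightarrow> (\<forall>i\<in>I. (\<lambda>N. Z N i u) \<longlonglongrightarrow> X i u)"
    and \<beta>: "\<And>i. i \<in> I \<Longrightarrow> mean_convergent T (\<lambda>N. \<beta> N i) (b i)"
    and \<xi>: "\<And>i N. i \<in> I \<Longrightarrow> set_integrable lborel {0..T} (\<lambda>u. (\<xi> N i u)\<^sup>2)"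
      "\<And>i. i \<in> I \<Longrightarrow> set_integrable lborel {0..T} (\<lambda>u. (H i u)\<^sup>2)"
      "\<And>i. i \<in> I \<Longrightarrow> (\<lambda>N. LBINT u:{0..T}. (\<xi> N i u - H i u)\<^sup>2) \<longlonglongrightarrow> 0"
  shows "mean_convergent T (\<lambda>N u. energy_rate I e (\<lambda>i. Z N i u) (\<lambda>i. \<beta> N i u) (\<lambda>i. \<xi> N i u))
    (\<lambda>u. energy_rate I e (\<lambda>i. X i u) (\<lambda>i. b i u) (\<lambda>i. H i u))"
proof -
  have sm: "(\<lambda>u. \<Sum>i\<in>I. (Y i u)\<^sup>2) \<in> borel_measurable borel" if "\<And>i. i \<in> I \<Longrightarrow> Y i \<in> borel_measurable borel" for Y :: "'a \<Rightarrow> real \<Rightarrow> real"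
    using that by (intro borel_measurable_sum borel_measurable_power)
  have wm: "(\<lambda>u. drift_weight I e i (\<lambda>i. Y i u)) \<in> borel_measurable borel"
      "(\<lambda>u. noise_weight I e i j (\<lambda>i. Y i u)) \<in> borel_measurable borel"
    if "\<And>i. i \<in> I \<Longrightarrow> Y i \<in> borel_measurable borel" "i \<in> I" "j \<in> I" for Y :: "'a \<Rightarrow> real \<Rightarrow> real" and i j
    unfolding drift_weight_def noise_weight_def using that(2,3)
    by (auto intro!: borel_measurable_diff borel_measurable_divide borel_measurable_times borel_measurable_power
        borel_measurable_add borel_measurable_const sm that(1))
  have wnz: "1 + e * (\<Sum>i\<in>I. (x i)\<^sup>2) \<noteq> 0" for x :: "'a \<Rightarrow> real"
  proof -
    have "0 \<le> e * (\<Sum>i\<in>I. (x i)\<^sup>2)" using e by (intro mult_nonneg_nonneg sum_nonneg) auto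
    then show ?thesis by linarith
  qed
  have lim1: "AE u in lborel. u \<in> {0..T} \<longrightarrow> (\<lambda>N. drift_weight I e i (\<lambda>i. Z N i u)) \<longlonglongrightarrow> drift_weight I e i (\<lambda>i. X i u)"
    if "i \<in> I" for i
    using lim by eventually_elim (use that wnz in \<open>auto simp: drift_weight_def intro!: tendsto_intros\<close>)
  have lim2: "AE u in lborel. u \<in> {0..T} \<longrightarrow> (\<lambda>N. noise_weight I e i j (\<lambda>i. Z N i u)) \<longlonglongrightarrow> noise_weight I e i j (\<lambda>i. X i u)"
    if "i \<in> I" "j \<in> I" for i j
    using lim by eventually_elim (use that wnz in \<open>auto simp: noise_weight_def intro!: tendsto_intros\<close>)
  show ?thesis
    unfolding energy_rate_eq[OF fin]
  proof (intro mean_convergent_add mean_convergent_sum fin)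
    fix i assume i: "i \<in> I"
    show "mean_convergent T (\<lambda>N u. drift_weight I e i (\<lambda>i. Z N i u) * \<beta> N i u) (\<lambda>u. drift_weight I e i (\<lambda>i. X i u) * b i u)"
      by (rule mean_convergent_bounded_mult[where K="5 / e"])
        (auto simp del: atLeastAtMost_iff intro!: \<beta>[OF i] wm m lim1 rate_weight_bounds[OF fin e] i)
    fix j assume j: "j \<in> I"
    show "mean_convergent T (\<lambda>N u. noise_weight I e i j (\<lambda>i. Z N i u) * (\<xi> N i u * \<xi> N j u))
      (\<lambda>u. noise_weight I e i j (\<lambda>i. X i u) * (H i u * H j u))"
    proof (rule mean_convergent_bounded_mult[where K="5 / e"])
      show "mean_convergent T (\<lambda>N u. \<xi> N i u * \<xi> N j u) (\<lambda>u. H i u * H j u)"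
        by (intro mean_convergent_product \<xi> m i j)
    qed (auto simp del: atLeastAtMost_iff intro!: wm borel_measurable_times m lim2 rate_weight_bounds[OF fin e] i j)
  qed
qed

text \<open>The correction from the second derivative only lowers the rate, which leaves an upper
  bound with constant 1; by Cauchy-Schwarz its size is at most 4 times the main term, which gives
  the two-sided bound. The first serves Gronwall's lemma, the second domination.\<close>

lemma energy_rate_noise_bounds:
  fixes z \<beta> \<xi> :: "'i \<Rightarrow> real" and I :: "'i set"
  assumes e: "0 < e"
  defines "w \<equiv> 1 + e * (\<Sum>i\<in>I. (z i)\<^sup>2)"
  defines "d \<equiv> energy_rate I e z \<beta> \<xi> - 2 * (\<Sum>i\<in>I. z i * \<beta> i) / w\<^sup>2"
  shows "d \<le> (\<Sum>i\<in>I. (\<xi> i)\<^sup>2) / w\<^sup>2" "\<bar>d\<bar> \<le> 4 * (\<Sum>i\<in>I. (\<xi> i)\<^sup>2) / w\<^sup>2"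
proof -
  define V where "V = (\<Sum>i\<in>I. (z i)\<^sup>2)"
  define S where "S = (\<Sum>i\<in>I. (\<xi> i)\<^sup>2)"
  define p where "p = (\<Sum>i\<in>I. z i * \<xi> i)\<^sup>2"
  have V: "0 \<le> V" and S: "0 \<le> S" and p: "0 \<le> p" by (simp_all add: V_def S_def p_def sum_nonneg)
  have w1: "1 \<le> w" "e * V \<le> w" using V e by (simp_all add: w_def V_def)
  have d: "d = S / w\<^sup>2 - 4 * e * p / w ^ 3"
    by (simp add: d_def energy_rate_def w_def S_def p_def add_divide_distrib)
  have "p \<le> V * S" unfolding p_def V_def S_def by (rule Cauchy_Schwarz_ineq_sum)
  then have "4 * e * p \<le> 4 * e * (V * S)" using e by (intro mult_left_mono) auto
  also have "\<dots> = 4 * (e * V) * S" by simp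
  also have "\<dots> \<le> 4 * w * S" using w1 S by (intro mult_right_mono) auto
  finally have "4 * e * p / w ^ 3 \<le> 4 * w * S / w ^ 3" using w1 by (intro divide_right_mono) auto
  also have "\<dots> = 4 * S / w\<^sup>2" using w1 by (simp add: power3_eq_cube power2_eq_square)
  finally have 1: "4 * e * p / w ^ 3 \<le> 4 * S / w\<^sup>2" .
  have 2: "0 \<le> 4 * e * p / w ^ 3" using e p w1 by simp
  have 3: "0 \<le> S / w\<^sup>2" using S by simp
  show "d \<le> (\<Sum>i\<in>I. (\<xi> i)\<^sup>2) / w\<^sup>2" using d 2 by (simp add: S_def)
  show "\<bar>d\<bar> \<le> 4 * (\<Sum>i\<in>I. (\<xi> i)\<^sup>2) / w\<^sup>2"
    using d 1 2 3 unfolding S_def[symmetric] times_divide_eq_right[symmetric] by linarith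
qed

text \<open>The bound is uniform in the state and involves only the size of the data; this size is
  exactly what the discount accumulates.\<close>

lemma energy_rate_abs_le:
  assumes fin: "finite I" and e: "0 < e" "e \<le> 1"
  shows "\<bar>energy_rate I e z \<beta> \<xi>\<bar> \<le> (5 / e) * (\<Sum>i\<in>I. (\<xi> i)\<^sup>2 + \<bar>\<beta> i\<bar>)"
proof -
  define w where "w = 1 + e * (\<Sum>i\<in>I. (z i)\<^sup>2)"
  have w1: "1 \<le> w" using e by (simp add: w_def sum_nonneg)
  have "2 * (\<Sum>i\<in>I. z i * \<beta> i) / w\<^sup>2 = (\<Sum>i\<in>I. drift_weight I e i z * \<beta> i)"
    by (simp add: drift_weight_def w_def sum_distrib_left sum_divide_distrib algebra_simps)
  also have "\<bar>\<dots>\<bar> \<le> (\<Sum>i\<in>I. (5 / e) * \<bar>\<beta> i\<bar>)"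
    by (rule order.trans[OF sum_abs sum_mono], unfold abs_mult, rule mult_right_mono)
      (use rate_weight_bounds(1)[OF fin e] in auto)
  finally have 1: "\<bar>2 * (\<Sum>i\<in>I. z i * \<beta> i) / w\<^sup>2\<bar> \<le> (5 / e) * (\<Sum>i\<in>I. \<bar>\<beta> i\<bar>)"
    by (simp only: sum_distrib_left)
  define S where "S = (\<Sum>i\<in>I. (\<xi> i)\<^sup>2)"
  have S0: "0 \<le> S" by (simp add: S_def sum_nonneg)
  have "4 * S / w\<^sup>2 \<le> 4 * S / 1" using w1 S0 by (intro divide_left_mono) auto
  also have "4 * S \<le> (5 / e) * S" using e S0 by (intro mult_right_mono) (auto simp: pos_le_divide_eq)
  finally have 2: "4 * S / w\<^sup>2 \<le> (5 / e) * S" by simp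
  have "\<bar>energy_rate I e z \<beta> \<xi> - 2 * (\<Sum>i\<in>I. z i * \<beta> i) / w\<^sup>2\<bar> \<le> 4 * S / w\<^sup>2"
    unfolding w_def S_def by (rule energy_rate_noise_bounds(2)[OF e(1)])
  then have "\<bar>energy_rate I e z \<beta> \<xi>\<bar> \<le> (5 / e) * S + (5 / e) * (\<Sum>i\<in>I. \<bar>\<beta> i\<bar>)"
    using 1 2 by linarith
  then show ?thesis by (simp add: S_def sum.distrib distrib_left)
qed

lemma mean_convergent_abs:
  assumes "mean_convergent T f g"
  shows "mean_convergent T (\<lambda>N u. \<bar>f N u\<bar>) (\<lambda>u. \<bar>g u\<bar>)"
proof -
  have i: "set_integrable lborel {0..T} (f N)" "set_integrable lborel {0..T} g" for N
    using assms by (auto simp: mean_convergent_def)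
  have "null_seq (\<lambda>N. LBINT u:{0..T}. \<bar>\<bar>f N u\<bar> - \<bar>g u\<bar>\<bar>)"
  proof (rule tendsto_sandwich[OF _ _ tendsto_const])
    show "null_seq (\<lambda>N. LBINT u:{0..T}. \<bar>f N u - g u\<bar>)" using assms by (simp add: mean_convergent_def)
    have "(LBINT u:{0..T}. \<bar>\<bar>f N u\<bar> - \<bar>g u\<bar>\<bar>) \<le> (LBINT u:{0..T}. \<bar>f N u - g u\<bar>)" for N
      by (intro set_integral_mono set_integrable_abs set_integral_diff(1) i) linarith
    then show "\<forall>\<^sub>F N in sequentially. (LBINT u:{0..T}. \<bar>\<bar>f N u\<bar> - \<bar>g u\<bar>\<bar>) \<le> (LBINT u:{0..T}. \<bar>f N u - g u\<bar>)"
      by simp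
  qed (simp add: set_integral_nonneg_all)
  then show ?thesis unfolding mean_convergent_def using i by (auto intro: set_integrable_abs)
qed

lemma mean_convergent_integral:
  assumes "mean_convergent T f g"
  shows "(\<lambda>N. LBINT u:{0..T}. f N u) \<longlonglongrightarrow> (LBINT u:{0..T}. g u)"
proof -
  have i: "set_integrable lborel {0..T} (f N)" "set_integrable lborel {0..T} g" for N
    using assms by (auto simp: mean_convergent_def)
  have "null_seq (\<lambda>N. (LBINT u:{0..T}. f N u) - (LBINT u:{0..T}. g u))"
  proof (rule Lim_null_comparison)
    show "null_seq (\<lambda>N. LBINT u:{0..T}. \<bar>f N u - g u\<bar>)" using assms by (simp add: mean_convergent_def)
    have "norm ((LBINT u:{0..T}. f N u) - (LBINT u:{0..T}. g u)) \<le> (LBINT u:{0..T}. \<bar>f N u - g u\<bar>)" for N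
      using set_integral_norm_bound[OF set_integral_diff(1)[OF i]] i by (simp add: set_integral_diff(2))
    then show "\<forall>\<^sub>F N in sequentially. norm ((LBINT u:{0..T}. f N u) - (LBINT u:{0..T}. g u)) \<le> (LBINT u:{0..T}. \<bar>f N u - g u\<bar>)"
      by simp
  qed
  then show ?thesis by (rule LIM_zero_cancel)
qed

lemma sum_tendsto_0_imp:
  fixes f :: "'i \<Rightarrow> nat \<Rightarrow> real"
  assumes "finite I" "i \<in> I" "\<And>i n. i \<in> I \<Longrightarrow> 0 \<le> f i n" "null_seq (\<lambda>n. \<Sum>i\<in>I. f i n)"
  shows "f i \<longlonglongrightarrow> 0"
proof (rule tendsto_sandwich[OF _ _ tendsto_const assms(4)])
  show "\<forall>\<^sub>F n in sequentially. f i n \<le> (\<Sum>i\<in>I. f i n)"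
    using member_le_sum[OF assms(2), of "\<lambda>i. f i n" for n] assms by (intro always_eventually allI) auto
qed (use assms in auto)

lemma min_one_tendsto_0_imp:
  fixes f :: "nat \<Rightarrow> real"
  assumes "null_seq (\<lambda>n. min 1 \<bar>f n\<bar>)"
  shows "null_seq f"
proof -
  have "\<forall>\<^sub>F n in sequentially. min 1 \<bar>f n\<bar> < 1" by (rule order_tendstoD[OF assms]) simp
  then have "\<forall>\<^sub>F n in sequentially. min 1 \<bar>f n\<bar> = \<bar>f n\<bar>" by eventually_elim auto
  from Lim_transform_eventually[OF assms this] show ?thesis by (simp add: tendsto_rabs_zero_iff)
qed

section \<open>Convergence of the Euler-type approximations\<close>

context conservative_system
begin

text \<open>The exponent 1/24 makes the total remainder of about \<open>N\<close> steps, of order N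
  L^6 h^(3/2), decay like N^(1 + 1/4 - 3/2) = N^(-1/4), and it also lets (L N)^2 / N tend to zero,
  as \<open>euler_tendsto\<close> requires.\<close>

lemma approximating_data:
  assumes T: "0 < T"
  obtains \<beta> \<xi> where
    "\<forall>N. \<forall>i\<in>I. grid_adapted (T / real (Suc N)) (\<beta> N i)" "\<forall>N. \<forall>i\<in>I. grid_adapted (T / real (Suc N)) (\<xi> N i)"
    "\<forall>N i j y. \<bar>\<beta> N i j y\<bar> \<le> real (Suc N) powr (1/24)" "\<forall>N i j y. \<bar>\<xi> N i j y\<bar> \<le> real (Suc N) powr (1/24)"
    "\<forall>i\<in>I. (\<lambda>N. L0 (\<lambda>y. LBINT u:{0..T}. \<bar>\<beta> N i (grid_index (T / real (Suc N)) u) y - b i u y\<bar>)) \<longlonglongrightarrow> 0"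
    "\<forall>i\<in>I. (\<lambda>N. L0 (\<lambda>y. LBINT u:{0..T}. (\<xi> N i (grid_index (T / real (Suc N)) u) y - H i u y)\<^sup>2)) \<longlonglongrightarrow> 0"
proof -
  define h where "h = (\<lambda>N. T / real (Suc N))"
  define L where "L = (\<lambda>N. real (Suc N) powr (1/24))"
  have L: "filterlim L at_top sequentially" unfolding L_def by real_asymp
  have L0: "0 \<le> L N" for N by (simp add: L_def)
  have "\<forall>i. \<exists>\<xi>. i \<in> I \<longrightarrow> (\<forall>N. grid_adapted (h N) (\<xi> N)) \<and>
      (\<lambda>N. L0 (\<lambda>y. LBINT u:{0..T}. (\<xi> N (grid_index (h N) u) y - H i u y)\<^sup>2)) \<longlonglongrightarrow> 0"
  proof
    fix i
    show "\<exists>\<xi>. i \<in> I \<longrightarrow> (\<forall>N. grid_adapted (h N) (\<xi> N)) \<and>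
      (\<lambda>N. L0 (\<lambda>y. LBINT u:{0..T}. (\<xi> N (grid_index (h N) u) y - H i u y)\<^sup>2)) \<longlonglongrightarrow> 0"
    proof (cases "i \<in> I")
      case True
      then obtain J where "ito_limit (H i) T J" using equation[OF True less_imp_le[OF T]] by blast
      then show ?thesis using T unfolding ito_limit_def h_def by (meson order_refl)
    qed simp
  qed
  from choice[OF this] obtain \<xi> where "\<forall>i. i \<in> I \<longrightarrow> (\<forall>N. grid_adapted (h N) (\<xi> i N)) \<and>
      (\<lambda>N. L0 (\<lambda>y. LBINT u:{0..T}. (\<xi> i N (grid_index (h N) u) y - H i u y)\<^sup>2)) \<longlonglongrightarrow> 0"
    by (rule exE)
  then have \<xi>: "\<And>i N. i \<in> I \<Longrightarrow> grid_adapted (h N) (\<xi> i N)"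
    and \<xi>l: "\<And>i. i \<in> I \<Longrightarrow> (\<lambda>N. L0 (\<lambda>y. LBINT u:{0..T}. (\<xi> i N (grid_index (h N) u) y - H i u y)\<^sup>2)) \<longlonglongrightarrow> 0"
    by blast+
  have "\<forall>i. \<exists>\<beta>. i \<in> I \<longrightarrow> (\<forall>N. grid_adapted (h N) (\<beta> N)) \<and>
      (\<lambda>N. L0 (\<lambda>y. LBINT u:{0..T}. \<bar>\<beta> N (grid_index (h N) u) y - b i u y\<bar>)) \<longlonglongrightarrow> 0"
    using drift_approximation[OF _ T] unfolding h_def by blast
  from choice[OF this] obtain \<beta> where "\<forall>i. i \<in> I \<longrightarrow> (\<forall>N. grid_adapted (h N) (\<beta> i N)) \<and>
      (\<lambda>N. L0 (\<lambda>y. LBINT u:{0..T}. \<bar>\<beta> i N (grid_index (h N) u) y - b i u y\<bar>)) \<longlonglongrightarrow> 0"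
    by (rule exE)
  then have \<beta>: "\<And>i N. i \<in> I \<Longrightarrow> grid_adapted (h N) (\<beta> i N)"
    and \<beta>l: "\<And>i. i \<in> I \<Longrightarrow> (\<lambda>N. L0 (\<lambda>y. LBINT u:{0..T}. \<bar>\<beta> i N (grid_index (h N) u) y - b i u y\<bar>)) \<longlonglongrightarrow> 0"
    by blast+
  define \<beta>' where "\<beta>' = (\<lambda>N i j y. clip (L N) (\<beta> i N j y))"
  define \<xi>' where "\<xi>' = (\<lambda>N i j y. clip (L N) (\<xi> i N j y))"
  have 1: "grid_adapted (h N) (\<beta>' N i)" "grid_adapted (h N) (\<xi>' N i)" if "i \<in> I" for N i
    using that unfolding \<beta>'_def \<xi>'_def by (auto intro!: grid_adapted_clip \<beta> \<xi> L0)
  have 2: "\<bar>\<beta>' N i j y\<bar> \<le> L N" "\<bar>\<xi>' N i j y\<bar> \<le> L N" for N i j y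
    unfolding \<beta>'_def \<xi>'_def by (auto intro!: abs_clip_le L0)
  have 3: "null_seq (\<lambda>N. L0 (\<lambda>y. LBINT u:{0..T}. \<bar>\<beta>' N i (grid_index (h N) u) y - b i u y\<bar>))" if i: "i \<in> I" for i
  proof -
    have "AE y in M. set_integrable lborel {0..T} (\<lambda>u. \<bar>b i u y\<bar> ^ 1)"
      using b_integrable[OF i less_imp_le[OF T]] by eventually_elim (simp add: set_integrable_abs)
    from clipped_approximation[OF b_jm this zero_less_one T L L0, of "\<beta> i"] \<beta>[OF i] \<beta>l[OF i]
    show ?thesis by (simp add: \<beta>'_def h_def)
  qed
  have 4: "null_seq (\<lambda>N. L0 (\<lambda>y. LBINT u:{0..T}. (\<xi>' N i (grid_index (h N) u) y - H i u y)\<^sup>2))" if i: "i \<in> I" for i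
  proof -
    have "AE y in M. set_integrable lborel {0..T} (\<lambda>u. \<bar>H i u y\<bar> ^ 2)"
      using H_square[OF i less_imp_le[OF T]] by (simp add: square_integrable_on_def)
    from clipped_approximation[OF H_jm[OF i] this _ T L L0, of "\<xi> i"] \<xi>[OF i] \<xi>l[OF i]
    show ?thesis by (simp add: \<xi>'_def h_def)
  qed
  show ?thesis
    by (rule that[of \<beta>' \<xi>']) (use 1 2 3 4 in \<open>simp_all only: h_def L_def, simp_all\<close>)
qed

text \<open>Convergence in probability at each time provides no common exceptional set. Integrating
  the truncated errors over [0, T] gives convergence in mean on the product of the probability space
  with time, so a subsequence converges for almost every pair; a second subsequence takes care of
  the terminal value and of the integrated data errors.\<close>

lemma almost_sure_approximation:
  assumes T: "0 < T"
  obtains r :: "nat \<Rightarrow> nat" and \<beta> \<xi> where "strict_mono r"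
    "\<forall>N. \<forall>i\<in>I. grid_adapted (T / real (Suc N)) (\<beta> N i)" "\<forall>N. \<forall>i\<in>I. grid_adapted (T / real (Suc N)) (\<xi> N i)"
    "\<forall>N i j y. \<bar>\<beta> N i j y\<bar> \<le> real (Suc N) powr (1/24)" "\<forall>N i j y. \<bar>\<xi> N i j y\<bar> \<le> real (Suc N) powr (1/24)"
    "AE y in M. \<forall>i\<in>I. (\<lambda>n. LBINT u:{0..T}. \<bar>\<beta> (r n) i (grid_index (T / real (Suc (r n))) u) y - b i u y\<bar>) \<longlonglongrightarrow> 0"
    "AE y in M. \<forall>i\<in>I. (\<lambda>n. LBINT u:{0..T}. (\<xi> (r n) i (grid_index (T / real (Suc (r n))) u) y - H i u y)\<^sup>2) \<longlonglongrightarrow> 0"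
    "AE y in M. \<forall>i\<in>I. (\<lambda>n. euler (T / real (Suc (r n))) (\<beta> (r n)) (\<xi> (r n)) i (Suc (r n)) y) \<longlonglongrightarrow> X i T y"
    "AE y in M. AE u in lborel. u \<in> {0..T} \<longrightarrow>
      (\<forall>i\<in>I. (\<lambda>n. euler (T / real (Suc (r n))) (\<beta> (r n)) (\<xi> (r n)) i (grid_index (T / real (Suc (r n))) u) y) \<longlonglongrightarrow> X i u y)"
proof -
  define h where "h = (\<lambda>N. T / real (Suc N))"
  define L where "L = (\<lambda>N. real (Suc N) powr (1/24))"
  have h: "0 < h N" "T \<le> real (Suc N) * h N" "real (Suc N) * h N = T" for N using T by (auto simp: h_def)
  obtain \<beta> \<xi> where
    "\<forall>N. \<forall>i\<in>I. grid_adapted (T / real (Suc N)) (\<beta> N i)" "\<forall>N. \<forall>i\<in>I. grid_adapted (T / real (Suc N)) (\<xi> N i)"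
    "\<forall>N i j y. \<bar>\<beta> N i j y\<bar> \<le> real (Suc N) powr (1/24)" "\<forall>N i j y. \<bar>\<xi> N i j y\<bar> \<le> real (Suc N) powr (1/24)"
    "\<forall>i\<in>I. (\<lambda>N. L0 (\<lambda>y. LBINT u:{0..T}. \<bar>\<beta> N i (grid_index (T / real (Suc N)) u) y - b i u y\<bar>)) \<longlonglongrightarrow> 0"
    "\<forall>i\<in>I. (\<lambda>N. L0 (\<lambda>y. LBINT u:{0..T}. (\<xi> N i (grid_index (T / real (Suc N)) u) y - H i u y)\<^sup>2)) \<longlonglongrightarrow> 0"
    by (rule approximating_data[OF T], rule that)
  then have \<beta>: "\<And>N i. i \<in> I \<Longrightarrow> grid_adapted (h N) (\<beta> N i)" and \<xi>: "\<And>N i. i \<in> I \<Longrightarrow> grid_adapted (h N) (\<xi> N i)"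
    and \<beta>L: "\<And>N i j y. \<bar>\<beta> N i j y\<bar> \<le> L N" and \<xi>L: "\<And>N i j y. \<bar>\<xi> N i j y\<bar> \<le> L N"
    and \<beta>l: "\<And>i. i \<in> I \<Longrightarrow> (\<lambda>N. L0 (\<lambda>y. LBINT u:{0..T}. \<bar>\<beta> N i (grid_index (h N) u) y - b i u y\<bar>)) \<longlonglongrightarrow> 0"
    and \<xi>l: "\<And>i. i \<in> I \<Longrightarrow> (\<lambda>N. L0 (\<lambda>y. LBINT u:{0..T}. (\<xi> N i (grid_index (h N) u) y - H i u y)\<^sup>2)) \<longlonglongrightarrow> 0"
    unfolding h_def L_def by blast+
  have L1: "1 \<le> L N" for N by (simp add: L_def ge_one_powr_ge_zero)
  have L2: "null_seq (\<lambda>N. (L N)\<^sup>2 / real (Suc N))" unfolding L_def by real_asymp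
  have conv: "null_seq (\<lambda>N. L0 (\<lambda>y. euler (h N) (\<beta> N) (\<xi> N) i (j N) y - X i s y))"
    if "i \<in> I" "0 \<le> s" "s \<le> T" "\<And>N. j N \<le> Suc N" "\<And>N. real (j N) * h N \<le> s" "\<And>N. s \<le> real (j N) * h N + h N" for i s j
    unfolding h_def
  proof (rule euler_tendsto[where \<beta>=\<beta> and \<xi>=\<xi> and L=L])
    show "\<bar>\<beta> N i j y\<bar> \<le> L N" "\<bar>\<xi> N i j y\<bar> \<le> L N" for N j y by (rule \<beta>L, rule \<xi>L)
  qed (rule that[unfolded h_def] T L1 L2 \<beta>[OF that(1), unfolded h_def] \<xi>[OF that(1), unfolded h_def]
      \<beta>l[OF that(1), unfolded h_def] \<xi>l[OF that(1), unfolded h_def])+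
  define Z where "Z = (\<lambda>N i u y. euler (h N) (\<beta> N) (\<xi> N) i (grid_index (h N) u) y)"
  have em: "euler (h N) (\<beta> N) (\<xi> N) i j \<in> borel_measurable M" if "i \<in> I" for N i j
    using \<beta>[OF that] \<xi>[OF that] h(1)[of N] grid_adapted_measurable by (intro euler_measurable) (blast, blast, simp)
  have Zj: "jointly_measurable M (Z N i)" if "i \<in> I" for N i
    unfolding Z_def by (rule jointly_measurable_grid) (rule em[OF that])
  have Zl: "null_seq (\<lambda>N. L0 (\<lambda>y. Z N i u y - X i u y))" if "i \<in> I" "0 < u" "u \<le> T" for i u
    unfolding Z_def
  proof (rule conv)
    fix N
    show "grid_index (h N) u \<le> Suc N"
      using grid_index_less[OF h(1), of "Suc N" u N] h(3)[of N] that by simp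
    show "real (grid_index (h N) u) * h N \<le> u" "u \<le> real (grid_index (h N) u) * h N + h N"
      using grid_index_bounds[OF h(1) that(2), of N] by (auto simp: algebra_simps)
  qed (use that in auto)
  \<comment> \<open>The truncation bounds the sum by the number of coordinates, so Fubini's theorem
    and dominated convergence in time apply without moments.\<close>
  define Y where "Y = (\<lambda>N u y. \<Sum>i\<in>I. min 1 \<bar>Z N i u y - X i u y\<bar>)"
  have Yj: "jointly_measurable M (Y N)" for N
    unfolding Y_def
    by (intro jointly_measurable_sum jointly_measurable_comp[OF jointly_measurable_diff[OF Zj X_jm], where \<phi>="\<lambda>x. min 1 \<bar>x\<bar>"]) auto
  have Y0: "0 \<le> Y N u y" for N u y by (simp add: Y_def sum_nonneg)
  have YB: "\<bar>Y N u y\<bar> \<le> real (card I)" for N u y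
    using Y0[of N u y] sum_bounded_above[of I "\<lambda>i. min 1 \<bar>Z N i u y - X i u y\<bar>" 1] by (simp add: Y_def)
  note fub = fubini_time_bounded[OF Yj YB]
  have EY: "\<E> (Y N u) = (\<Sum>i\<in>I. L0 (\<lambda>y. Z N i u y - X i u y))" for N u
    unfolding Y_def L0_def
    by (intro Bochner_Integration.integral_sum integrable_min_one borel_measurable_diff jointly_measurable_at[OF Zj] X_measurable)
  have Ylim: "null_seq (\<lambda>N. \<E> (\<lambda>y. LBINT u:{0..T}. Y N u y))"
  proof -
    have "(\<lambda>N. LBINT u:{0..T}. \<E> (Y N u)) \<longlonglongrightarrow> (LINT (u::real)|lborel. 0)"
      unfolding set_lebesgue_integral_def
    proof (rule integral_dominated_convergence[where w="\<lambda>u. indicator {0..T} u * real (card I)"])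
      show "integrable lborel (\<lambda>u. indicator {0..T} u * real (card I))" using T by simp
      show "(\<lambda>u. indicator {0..T} u *\<^sub>R \<E> (Y N u)) \<in> borel_measurable lborel" for N
        using fub(1)[of 0 T N] by (auto simp: set_integrable_def)
      have "AE u in lborel. u \<noteq> (0::real)" by (rule AE_lborel_singleton)
      then show "AE u in lborel. (\<lambda>N. indicator {0..T} u *\<^sub>R \<E> (Y N u)) \<longlonglongrightarrow> 0"
      proof eventually_elim
        case (elim u)
        show ?case
        proof (cases "u \<in> {0..T}")
          case True
          then have "(\<lambda>N. \<Sum>i\<in>I. L0 (\<lambda>y. Z N i u y - X i u y)) \<longlonglongrightarrow> (\<Sum>i\<in>I. 0)"
            using elim by (intro tendsto_sum Zl) auto
          then show ?thesis using True by (simp add: EY)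
        qed simp
      qed
      fix N
      have "norm (\<E> (Y N u)) \<le> real (card I)" for u
      proof -
        have "\<E> (Y N u) \<le> (\<Sum>i\<in>I. 1)" unfolding EY by (intro sum_mono L0_le_1)
        moreover have "0 \<le> \<E> (Y N u)" unfolding EY by (intro sum_nonneg L0_nonneg)
        ultimately show ?thesis by simp
      qed
      then show "AE u in lborel. norm (indicator {0..T} u *\<^sub>R \<E> (Y N u)) \<le> indicator {0..T} u * real (card I)"
        by (intro AE_I2) (auto simp: indicator_def)
    qed simp
    then show ?thesis using fub(4)[of 0 T] by simp
  qed
  interpret P: pair_sigma_finite M "lborel :: real measure"
    by (intro pair_sigma_finite.intro sigma_finite_lborel) unfold_locales
  define f where "f = (\<lambda>N (z :: 'w \<times> real). indicator {0..T} (snd z) *\<^sub>R Y N (snd z) (fst z))"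
  have fi: "integrable (M \<Otimes>\<^sub>M lborel) (f N)" and If: "(LINT z|(M \<Otimes>\<^sub>M lborel). norm (f N z)) = \<E> (\<lambda>y. LBINT u:{0..T}. Y N u y)" for N
  proof -
    have "(\<lambda>(u, y). Y N u y) \<in> borel_measurable (lborel \<Otimes>\<^sub>M M)" using Yj by (simp add: jointly_measurable_def)
    from measurable_pair_swap[OF this]
    have [measurable]: "(\<lambda>z. Y N (snd z) (fst z)) \<in> borel_measurable (M \<Otimes>\<^sub>M lborel)" by (simp add: split_beta')
    have fm: "f N \<in> borel_measurable (M \<Otimes>\<^sub>M lborel)" unfolding f_def by measurable
    have nf: "(\<lambda>u. norm (f N (y, u))) = (\<lambda>u. indicator {0..T} u *\<^sub>R Y N u y)" for y
      using Y0 by (auto simp: f_def)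
    have sf: "(\<lambda>u. f N (y, u)) = (\<lambda>u. indicator {0..T} u *\<^sub>R Y N u y)" for y by (auto simp: f_def)
    show fi: "integrable (M \<Otimes>\<^sub>M lborel) (f N)"
    proof (rule P.Fubini_integrable[OF fm])
      show "integrable M (\<lambda>y. LINT u|lborel. norm (f N (y, u)))"
        unfolding nf using fub(2)[of 0 T N] by (simp add: set_lebesgue_integral_def)
      show "AE y in M. integrable lborel (\<lambda>u. f N (y, u))"
        unfolding sf using fub(3)[of 0 T N] by (simp add: set_integrable_def)
    qed
    have "(LINT z|(M \<Otimes>\<^sub>M lborel). norm (f N z)) = (LINT z|(M \<Otimes>\<^sub>M lborel). f N z)"
      by (intro Bochner_Integration.integral_cong refl) (simp add: f_def Y0)
    also have "\<dots> = \<E> (\<lambda>y. LBINT u:{0..T}. Y N u y)"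
      using P.integral_fst'[OF fi] by (simp add: sf set_lebesgue_integral_def)
    finally show "(LINT z|(M \<Otimes>\<^sub>M lborel). norm (f N z)) = \<E> (\<lambda>y. LBINT u:{0..T}. Y N u y)" .
  qed
  have "\<exists>r1 :: nat \<Rightarrow> nat. strict_mono r1 \<and> (AE z in M \<Otimes>\<^sub>M lborel. (\<lambda>n. f (r1 n) z) \<longlonglongrightarrow> 0)"
  proof (rule tendsto_L1_AE_subseq)
    show "null_seq (\<lambda>n. LINT z|(M \<Otimes>\<^sub>M lborel). norm (f n z))" unfolding If by (rule Ylim)
  qed (rule fi)
  then obtain r1 :: "nat \<Rightarrow> nat" where r1: "strict_mono r1" and r1f: "AE z in M \<Otimes>\<^sub>M lborel. (\<lambda>n. f (r1 n) z) \<longlonglongrightarrow> 0"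
    by (elim exE conjE)
  have r1Z: "AE y in M. AE u in lborel. u \<in> {0..T} \<longrightarrow> (\<forall>i\<in>I. (\<lambda>n. Z (r1 n) i u y) \<longlonglongrightarrow> X i u y)"
    using P.AE_pair[OF r1f]
  proof eventually_elim
    case (elim y)
    then show ?case
    proof eventually_elim
      case (elim u)
      show ?case
      proof (intro impI ballI)
        fix i assume u: "u \<in> {0..T}" and i: "i \<in> I"
        have "null_seq (\<lambda>n. \<Sum>i\<in>I. min 1 \<bar>Z (r1 n) i u y - X i u y\<bar>)"
          using elim u by (simp add: f_def Y_def)
        from sum_tendsto_0_imp[OF fin i _ this]
        have "null_seq (\<lambda>n. min 1 \<bar>Z (r1 n) i u y - X i u y\<bar>)" by simp
        from min_one_tendsto_0_imp[OF this] show "(\<lambda>n. Z (r1 n) i u y) \<longlonglongrightarrow> X i u y" by (rule LIM_zero_cancel)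
      qed
    qed
  qed
  define b' where "b' = (\<lambda>N i y. LBINT u:{0..T}. \<bar>\<beta> N i (grid_index (h N) u) y - b i u y\<bar>)"
  define x' where "x' = (\<lambda>N i y. LBINT u:{0..T}. (\<xi> N i (grid_index (h N) u) y - H i u y)\<^sup>2)"
  define z' where "z' = (\<lambda>N i y. \<bar>euler (h N) (\<beta> N) (\<xi> N) i (Suc N) y - X i T y\<bar>)"
  \<comment> \<open>All remaining nonnegative errors are added up, so that a single subsequence
    serves every coordinate.\<close>
  define S where "S = (\<lambda>N y. \<Sum>i\<in>I. b' N i y + (x' N i y + z' N i y))"
  have gj: "jointly_measurable M (\<lambda>u y. \<eta> N i (grid_index (h N) u) y)"
    if "i \<in> I" "\<And>N i. i \<in> I \<Longrightarrow> grid_adapted (h N) (\<eta> N i)" for \<eta> N i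
    by (rule jointly_measurable_grid) (use that grid_adapted_measurable in blast)
  have b'm: "b' N i \<in> borel_measurable M" if "i \<in> I" for N i
    unfolding b'_def
    by (intro measurable_set_integral jointly_measurable_comp[OF jointly_measurable_diff[OF gj[OF that \<beta>] b_jm], where \<phi>=abs]) auto
  have x'm: "x' N i \<in> borel_measurable M" if "i \<in> I" for N i
    unfolding x'_def
    by (intro measurable_set_integral jointly_measurable_comp[OF jointly_measurable_diff[OF gj[OF that \<xi>] H_jm[OF that]], where \<phi>="\<lambda>x. x\<^sup>2"]) auto
  have z'm: "z' N i \<in> borel_measurable M" if "i \<in> I" for N i
    unfolding z'_def by (intro borel_measurable_abs borel_measurable_diff em that X_measurable)
  have nn: "0 \<le> b' N i y" "0 \<le> x' N i y" "0 \<le> z' N i y" for N i y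
    unfolding b'_def x'_def z'_def by (auto intro: set_integral_nonneg_all)
  have Sm: "S N \<in> borel_measurable M" for N
    unfolding S_def by (intro borel_measurable_sum borel_measurable_add b'm x'm z'm)
  have "null_seq (\<lambda>N. L0 (S N))"
  proof (rule L0_squeeze)
    show "L0 (S N) \<le> (\<Sum>i\<in>I. L0 (b' N i) + (L0 (x' N i) + L0 (z' N i)))" for N
    proof -
      have "L0 (S N) \<le> (\<Sum>i\<in>I. L0 (\<lambda>y. b' N i y + (x' N i y + z' N i y)))"
        unfolding S_def by (intro L0_sum fin borel_measurable_add b'm x'm z'm)
      also have "\<dots> \<le> (\<Sum>i\<in>I. L0 (b' N i) + (L0 (x' N i) + L0 (z' N i)))"
      proof (rule sum_mono)
        fix i assume i: "i \<in> I"
        have "L0 (\<lambda>y. b' N i y + (x' N i y + z' N i y)) \<le> L0 (b' N i) + L0 (\<lambda>y. x' N i y + z' N i y)"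
          by (intro L0_add borel_measurable_add b'm x'm z'm i)
        moreover have "L0 (\<lambda>y. x' N i y + z' N i y) \<le> L0 (x' N i) + L0 (z' N i)"
          by (intro L0_add x'm z'm i)
        ultimately show "L0 (\<lambda>y. b' N i y + (x' N i y + z' N i y)) \<le> L0 (b' N i) + (L0 (x' N i) + L0 (z' N i))" by linarith
      qed
      finally show ?thesis .
    qed
    have zl: "null_seq (\<lambda>N. L0 (z' N i))" if "i \<in> I" for i
    proof -
      have "null_seq (\<lambda>N. L0 (\<lambda>y. euler (h N) (\<beta> N) (\<xi> N) i (Suc N) y - X i T y))"
        by (rule conv[OF that]) (use T h less_imp_le[OF h(1)] in auto)
      then show ?thesis by (simp add: z'_def L0_def)
    qed
    have "(\<lambda>N. \<Sum>i\<in>I. L0 (b' N i) + (L0 (x' N i) + L0 (z' N i))) \<longlonglongrightarrow> (\<Sum>i\<in>I. 0 + (0 + 0))"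
      by (intro tendsto_sum tendsto_add zl) (auto simp: b'_def x'_def intro: \<beta>l \<xi>l)
    then show "null_seq (\<lambda>N. \<Sum>i\<in>I. L0 (b' N i) + (L0 (x' N i) + L0 (z' N i)))" by simp
  qed
  from LIMSEQ_subseq_LIMSEQ[OF this r1]
  have "null_seq (\<lambda>n. L0 (S (r1 n)))" by (simp add: comp_def)
  note sub = this
  obtain r2 :: "nat \<Rightarrow> nat" where r2: "strict_mono r2" and r2S: "AE y in M. (\<lambda>n. S (r1 (r2 n)) y) \<longlonglongrightarrow> 0"
    by (rule L0_subseq_AE[of "\<lambda>n. S (r1 n)", OF Sm sub])
  define r where "r = r1 \<circ> r2"
  have r: "strict_mono r" unfolding r_def by (rule strict_mono_o[OF r1 r2])
  have rZ: "AE y in M. AE u in lborel. u \<in> {0..T} \<longrightarrow> (\<forall>i\<in>I. (\<lambda>n. Z (r n) i u y) \<longlonglongrightarrow> X i u y)"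
    using r1Z
  proof eventually_elim
    case (elim y)
    then show ?case
    proof eventually_elim
      case (elim u)
      show ?case
      proof (intro impI ballI)
        fix i assume "u \<in> {0..T}" "i \<in> I"
        then have "(\<lambda>n. Z (r1 n) i u y) \<longlonglongrightarrow> X i u y" using elim by blast
        from LIMSEQ_subseq_LIMSEQ[OF this r2] show "(\<lambda>n. Z (r n) i u y) \<longlonglongrightarrow> X i u y"
          by (simp add: comp_def r_def)
      qed
    qed
  qed
  have rS: "AE y in M. \<forall>i\<in>I. (\<lambda>n. b' (r n) i y) \<longlonglongrightarrow> 0 \<and> (\<lambda>n. x' (r n) i y) \<longlonglongrightarrow> 0 \<and>
      (\<lambda>n. euler (h (r n)) (\<beta> (r n)) (\<xi> (r n)) i (Suc (r n)) y) \<longlonglongrightarrow> X i T y"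
    using r2S
  proof eventually_elim
    case (elim y)
    show ?case
    proof
      fix i assume i: "i \<in> I"
      have "null_seq (\<lambda>n. \<Sum>i\<in>I. b' (r n) i y + (x' (r n) i y + z' (r n) i y))"
        using elim by (simp add: S_def r_def)
      from sum_tendsto_0_imp[OF fin i _ this]
      have s: "null_seq (\<lambda>n. b' (r n) i y + (x' (r n) i y + z' (r n) i y))" using nn by simp
      have b0: "null_seq (\<lambda>n. b' (r n) i y)" and x0': "null_seq (\<lambda>n. x' (r n) i y)" and z0: "null_seq (\<lambda>n. z' (r n) i y)"
        by (rule tendsto_sandwich[OF _ _ tendsto_const s]; simp add: nn)+
      have "null_seq (\<lambda>n. euler (h (r n)) (\<beta> (r n)) (\<xi> (r n)) i (Suc (r n)) y - X i T y)"
        using z0 unfolding z'_def by (simp only: tendsto_rabs_zero_iff)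
      then have "(\<lambda>n. euler (h (r n)) (\<beta> (r n)) (\<xi> (r n)) i (Suc (r n)) y) \<longlonglongrightarrow> X i T y" by (rule LIM_zero_cancel)
      with b0 x0' show "(\<lambda>n. b' (r n) i y) \<longlonglongrightarrow> 0 \<and> (\<lambda>n. x' (r n) i y) \<longlonglongrightarrow> 0 \<and>
        (\<lambda>n. euler (h (r n)) (\<beta> (r n)) (\<xi> (r n)) i (Suc (r n)) y) \<longlonglongrightarrow> X i T y" by (intro conjI)
    qed
  qed
  have rS1: "AE y in M. \<forall>i\<in>I. (\<lambda>n. b' (r n) i y) \<longlonglongrightarrow> 0" "AE y in M. \<forall>i\<in>I. (\<lambda>n. x' (r n) i y) \<longlonglongrightarrow> 0"
    "AE y in M. \<forall>i\<in>I. (\<lambda>n. euler (h (r n)) (\<beta> (r n)) (\<xi> (r n)) i (Suc (r n)) y) \<longlonglongrightarrow> X i T y"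
    using rS by (eventually_elim, blast)+
  show ?thesis
  proof (rule that[of r \<beta> \<xi>])
    show "\<forall>N. \<forall>i\<in>I. grid_adapted (T / real (Suc N)) (\<beta> N i)" "\<forall>N. \<forall>i\<in>I. grid_adapted (T / real (Suc N)) (\<xi> N i)"
      using \<beta> \<xi> unfolding h_def by blast+
    show "\<forall>N i j y. \<bar>\<beta> N i j y\<bar> \<le> real (Suc N) powr (1/24)" "\<forall>N i j y. \<bar>\<xi> N i j y\<bar> \<le> real (Suc N) powr (1/24)"
      using \<beta>L \<xi>L unfolding L_def by blast+
  qed (rule r, rule rS1(1)[unfolded b'_def h_def], rule rS1(2)[unfolded x'_def h_def], rule rS1(3)[unfolded h_def], rule rZ[unfolded Z_def h_def])
qed

end

section \<open>The energy balance for a damped energy\<close>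

context conservative_system
begin

definition rate :: "real \<Rightarrow> real \<Rightarrow> 'w \<Rightarrow> real" where
  "rate e u y = energy_rate I e (\<lambda>i. X i u y) (\<lambda>i. b i u y) (\<lambda>i. H i u y)"

lemma rate_jm: "jointly_measurable M (rate e)"
proof -
  have m: "(\<lambda>z. X i (fst z) (snd z)) \<in> borel_measurable (lborel \<Otimes>\<^sub>M M)"
    "(\<lambda>z. b i (fst z) (snd z)) \<in> borel_measurable (lborel \<Otimes>\<^sub>M M)"
    "(\<lambda>z. H i (fst z) (snd z)) \<in> borel_measurable (lborel \<Otimes>\<^sub>M M)" if "i \<in> I" for i
    using X_jm[OF that] b_jm[of i] H_jm[OF that] by (simp_all add: jointly_measurable_def split_beta')
  have "(\<lambda>z. rate e (fst z) (snd z)) \<in> borel_measurable (lborel \<Otimes>\<^sub>M M)"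
    unfolding rate_def energy_rate_def
    by (intro borel_measurable_add borel_measurable_diff borel_measurable_times borel_measurable_divide borel_measurable_const
        borel_measurable_sum borel_measurable_power m; assumption)
  then show ?thesis by (simp add: jointly_measurable_def split_beta')
qed

text \<open>Here the conservative drift disappears: by \<open>skew\<close> the rate along the true
  solution contains only the noise.\<close>

lemma rate_bounds:
  assumes e: "0 < e" and u: "0 \<le> u" and y: "y \<in> space M"
  defines "w \<equiv> 1 + e * (\<Sum>i\<in>I. (X i u y)\<^sup>2)"
  shows "rate e u y \<le> (\<Sum>i\<in>I. (H i u y)\<^sup>2) / w\<^sup>2" "\<bar>rate e u y\<bar> \<le> 4 * (\<Sum>i\<in>I. (H i u y)\<^sup>2) / w\<^sup>2"
  using energy_rate_noise_bounds[OF e, of I "\<lambda>i. X i u y" "\<lambda>i. b i u y" "\<lambda>i. H i u y"] skew[OF u y]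
  unfolding rate_def w_def by simp_all

text \<open>The first bound dominates the rate for a fixed \<open>e\<close>; the second is free of 1
  / e and has the form that Gronwall's lemma needs.\<close>

lemma weight_energy_le:
  assumes e: "0 < e" "e \<le> 1" and v: "0 \<le> (v::real)"
  shows "(1 + v) / (1 + e * v)\<^sup>2 \<le> 1 / e" "(1 + v) / (1 + e * v)\<^sup>2 \<le> 1 + damped e v"
proof -
  define w where "w = 1 + e * v"
  have w1: "1 \<le> w" using e v by (simp add: w_def)
  have w2: "1 \<le> w\<^sup>2" "w \<le> w\<^sup>2" using w1 self_le_power[of w 2] by auto
  have "e * (1 + v) \<le> w" using e by (simp add: w_def distrib_left)
  then have "e * (1 + v) \<le> w\<^sup>2" using w2 by linarith
  then have "1 + v \<le> 1 / e * w\<^sup>2" using e by (simp add: pos_le_divide_eq mult.commute)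
  then show "(1 + v) / (1 + e * v)\<^sup>2 \<le> 1 / e"
    using w2 unfolding w_def[symmetric] by (subst pos_divide_le_eq) auto
  have "(1 + v) / w\<^sup>2 = 1 / w\<^sup>2 + v / w\<^sup>2" by (simp add: add_divide_distrib)
  also have "\<dots> \<le> 1 + v / w"
    using w1 w2 v by (intro add_mono divide_left_mono) auto
  finally show "(1 + v) / (1 + e * v)\<^sup>2 \<le> 1 + damped e v" by (simp add: damped_def w_def)
qed

lemma rate_abs_le:
  assumes e: "0 < e" "e \<le> 1" and u: "0 \<le> u" and y: "y \<in> space M"
  shows "\<bar>rate e u y\<bar> \<le> 4 * C / e"
proof -
  define V where "V = (\<Sum>i\<in>I. (X i u y)\<^sup>2)"
  have V: "0 \<le> V" by (simp add: V_def sum_nonneg)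
  have "\<bar>rate e u y\<bar> \<le> 4 * (\<Sum>i\<in>I. (H i u y)\<^sup>2) / (1 + e * V)\<^sup>2"
    using rate_bounds(2)[OF e(1) u y] by (simp add: V_def)
  also have "\<dots> \<le> 4 * (C * (1 + V)) / (1 + e * V)\<^sup>2"
    using growth[OF u y] unfolding V_def[symmetric] by (intro divide_right_mono mult_left_mono) auto
  also have "\<dots> = 4 * C * ((1 + V) / (1 + e * V)\<^sup>2)" by simp
  also have "\<dots> \<le> 4 * C * (1 / e)" using weight_energy_le(1)[OF e V] C_nonneg by (intro mult_left_mono) auto
  finally show ?thesis by simp
qed

text \<open>For a fixed discount rate \<kappa> the grid is refined. The remaining error is a
  constant free of \<kappa> times one minus the mean of exp(-\<kappa> A), where \<open>A\<close> is
  the total activity in the limit. Since \<open>A\<close> is a finite random variable, the error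
  vanishes as \<kappa> tends to zero.\<close>

lemma damped_energy_balance:
  assumes e: "0 < e" "e \<le> 1" and T: "0 < T"
  shows "\<E> (\<lambda>y. damped e (\<Sum>i\<in>I. (X i T y)\<^sup>2))
    = damped e (\<Sum>i\<in>I. (x0 i)\<^sup>2) + \<E> (\<lambda>y. LBINT u:{0..T}. rate e u y)"
proof -
  obtain r :: "nat \<Rightarrow> nat" and \<beta> \<xi> where r: "strict_mono r"
    and a1: "\<forall>N. \<forall>i\<in>I. grid_adapted (T / real (Suc N)) (\<beta> N i)" and a2: "\<forall>N. \<forall>i\<in>I. grid_adapted (T / real (Suc N)) (\<xi> N i)"
    and a3: "\<forall>N i j y. \<bar>\<beta> N i j y\<bar> \<le> real (Suc N) powr (1/24)" and a4: "\<forall>N i j y. \<bar>\<xi> N i j y\<bar> \<le> real (Suc N) powr (1/24)"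
    and l1: "AE y in M. \<forall>i\<in>I. (\<lambda>n. LBINT u:{0..T}. \<bar>\<beta> (r n) i (grid_index (T / real (Suc (r n))) u) y - b i u y\<bar>) \<longlonglongrightarrow> 0"
    and l2: "AE y in M. \<forall>i\<in>I. (\<lambda>n. LBINT u:{0..T}. (\<xi> (r n) i (grid_index (T / real (Suc (r n))) u) y - H i u y)\<^sup>2) \<longlonglongrightarrow> 0"
    and l3: "AE y in M. \<forall>i\<in>I. (\<lambda>n. euler (T / real (Suc (r n))) (\<beta> (r n)) (\<xi> (r n)) i (Suc (r n)) y) \<longlonglongrightarrow> X i T y"
    and l4: "AE y in M. AE u in lborel. u \<in> {0..T} \<longrightarrow>
      (\<forall>i\<in>I. (\<lambda>n. euler (T / real (Suc (r n))) (\<beta> (r n)) (\<xi> (r n)) i (grid_index (T / real (Suc (r n))) u) y) \<longlonglongrightarrow> X i u y)"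
    by (rule almost_sure_approximation[OF T])
  define h where "h n = T / real (Suc (r n))" for n
  define L where "L n = real (Suc (r n)) powr (1/24)" for n
  define B where "B n = \<beta> (r n)" for n
  define \<Xi> where "\<Xi> n = \<xi> (r n)" for n
  define act where "act n j y = activity (B n) (\<Xi> n) j y" for n j y
  define R where "R n j y = euler_rate e (h n) (B n) (\<Xi> n) j y" for n j y
  define V where "V n y = euler_energy (h n) (B n) (\<Xi> n) (Suc (r n)) y" for n y
  define VT where "VT y = (\<Sum>i\<in>I. (X i T y)\<^sup>2)" for y
  define g where "g n u = grid_index (h n) u" for n u
  \<comment> \<open>The limit of the accumulated activity; the square is written as a product to
    match \<open>mean_convergent_product\<close>.\<close>
  define A where "A y = (LBINT u:{0..T}. \<Sum>i\<in>I. H i u y * H i u y + \<bar>b i u y\<bar>)" for y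
  define d0 where "d0 = damped e (\<Sum>i\<in>I. (x0 i)\<^sup>2)"
  define Eq where "Eq = \<E> (\<lambda>y. LBINT u:{0..T}. rate e u y)"
  define Cq where "Cq = 4 * C / e"
  define err where "err n = real (Suc (r n)) * (step_constant I e * (L n ^ 6 * sqrt (h n) ^ 3))" for n
  let ?v = "\<lambda>n y. damped e (V n y)"
  let ?R = "\<lambda>n u y. R n (g n u) y"
  let ?d = "\<lambda>n u y. \<bar>?R n u y - rate e u y\<bar>"
  have h: "0 < h n" "real (Suc (r n)) * h n = T" for n using T by (simp_all add: h_def)
  have h0: "0 \<le> h n" for n using h(1)[of n] by simp
  have Ba: "grid_adapted (h n) (B n i)" and \<Xi>a: "grid_adapted (h n) (\<Xi> n i)" if "i \<in> I" for n i
    using a1 a2 that by (auto simp: h_def B_def \<Xi>_def)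
  have BL: "\<bar>B n i j y\<bar> \<le> L n" and \<Xi>L: "\<bar>\<Xi> n i j y\<bar> \<le> L n" for n i j y
    using a3 a4 by (auto simp: B_def \<Xi>_def L_def)
  have L1: "1 \<le> L n" for n by (simp add: L_def ge_one_powr_ge_zero)
  have h_lim: "null_seq h"
  proof -
    have "null_seq (\<lambda>N. T / real (Suc N))" by real_asymp
    from LIMSEQ_subseq_LIMSEQ[OF this r] show ?thesis unfolding h_def[abs_def] comp_def .
  qed
  have err_lim: "null_seq err"
  proof -
    have "null_seq (\<lambda>N. real (Suc N) * ((real (Suc N) powr (1/24)) ^ 6 * sqrt (T / real (Suc N)) ^ 3))"
      using T by real_asymp
    from LIMSEQ_subseq_LIMSEQ[OF this r]
    have "null_seq (\<lambda>n. real (Suc (r n)) * (L n ^ 6 * sqrt (h n) ^ 3))" unfolding h_def L_def comp_def .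
    from tendsto_mult_left[OF this, of "step_constant I e"] show ?thesis
      by (simp add: err_def[abs_def] mult.left_commute)
  qed
  have gj: "jointly_measurable M (\<lambda>u y. f (g n u) y)" if "\<And>j. f j \<in> borel_measurable M" for f n
    unfolding g_def by (rule jointly_measurable_grid[OF that])
  have em: "euler (h n) (B n) (\<Xi> n) i j \<in> borel_measurable M" if "i \<in> I" for n i j
    by (rule measurable_F_M[OF euler_adapted[OF h0]]) (use Ba \<Xi>a that in auto)
  have bm: "B n i j \<in> borel_measurable M" "\<Xi> n i j \<in> borel_measurable M" if "i \<in> I" for n i j
    using Ba[OF that] \<Xi>a[OF that] grid_adapted_measurable by blast+
  have Rm: "R n j \<in> borel_measurable M" for n j
    unfolding R_def euler_rate_def energy_rate_def
    by (intro borel_measurable_add borel_measurable_diff borel_measurable_times borel_measurable_divide borel_measurable_const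
        borel_measurable_sum borel_measurable_power em bm; assumption)
  have Cq0: "0 \<le> Cq" using C_nonneg e by (simp add: Cq_def)
  have q_le: "\<bar>rate e u y\<bar> \<le> Cq" if "u \<in> {0..T}" "y \<in> space M" for u y
    using rate_abs_le[OF e _ that(2), of u] that(1) by (simp add: Cq_def)
  have q_int: "set_integrable lborel {0..T} (\<lambda>u. rate e u y)" if "y \<in> space M" for y
    by (rule set_integrable_bounded[where B=Cq]) (use q_le that jointly_measurable_path[OF rate_jm that] in auto)
  have gint: "set_integrable lborel {0..T} (\<lambda>u. c (g n u))" for c :: "nat \<Rightarrow> real" and n
    unfolding g_def by (rule grid_set_integral(1)[OF h(1) order_refl less_imp_le[OF T], of "Suc (r n)"]) (simp only: h(2) order_refl)
  have gfull: "(LBINT u:{0..T}. c (g n u)) = (\<Sum>l<Suc (r n). h n * c l)" for c :: "nat \<Rightarrow> real" and n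
    unfolding g_def using grid_set_integral_full[OF h(1), of "Suc (r n)" n c] by (simp only: h(2))
  have g_less: "g n u < Suc (r n)" if "u \<in> {0..T}" for n u
    unfolding g_def by (rule grid_index_less[OF h(1)]) (use that in \<open>simp_all only: h(2) atLeastAtMost_iff zero_less_Suc\<close>)
  have V0: "0 \<le> V n y" "0 \<le> VT y" for n y by (simp_all add: V_def euler_energy_def VT_def sum_nonneg)
  have Vm: "V n \<in> borel_measurable M" for n
    unfolding V_def by (rule euler_energy_measurable[OF h0]) (use Ba \<Xi>a in auto)
  have VTm: "VT \<in> borel_measurable M" unfolding VT_def by (intro borel_measurable_sum borel_measurable_power X_measurable)
  \<comment> \<open>All convergence along individual paths is settled here; what follows are
    passages to the limit under expectations.\<close>
  have path: "AE y in M. mean_convergent T (\<lambda>n u. ?R n u y) (\<lambda>u. rate e u y)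
      \<and> (\<lambda>n. LBINT u:{0..T}. act n (g n u) y) \<longlonglongrightarrow> A y \<and> (\<lambda>n. V n y) \<longlonglongrightarrow> VT y"
  proof -
    have hs: "AE y in M. \<forall>i\<in>I. set_integrable lborel {0..T} (\<lambda>u. (H i u y)\<^sup>2)"
      using H_square[OF _ less_imp_le[OF T]] fin by (auto simp: square_integrable_on_def AE_finite_all)
    have bi: "AE y in M. \<forall>i\<in>I. set_integrable lborel {0..T} (\<lambda>u. b i u y)"
      using b_integrable[OF _ less_imp_le[OF T]] fin by (auto simp: AE_finite_all)
    show ?thesis
      using hs bi l1 l2 l3 l4 AE_space
    proof eventually_elim
      case (elim y)
      note y = elim(7)
      have mB: "mean_convergent T (\<lambda>n u. B n i (g n u) y) (\<lambda>u. b i u y)" if "i \<in> I" for i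
        unfolding mean_convergent_def
      proof (intro conjI allI)
        show "null_seq (\<lambda>n. LBINT u:{0..T}. \<bar>B n i (g n u) y - b i u y\<bar>)"
          using elim(3) that unfolding B_def g_def h_def by blast
      qed (use elim(2) that gint[of "\<lambda>j. B _ i j y"] in auto)
      have mX: "set_integrable lborel {0..T} (\<lambda>u. (\<Xi> n i (g n u) y)\<^sup>2)" for n i
        by (rule gint[of "\<lambda>j. (\<Xi> n i j y)\<^sup>2"])
      have lX: "null_seq (\<lambda>n. LBINT u:{0..T}. (\<Xi> n i (g n u) y - H i u y)\<^sup>2)" if "i \<in> I" for i
        using elim(4) that unfolding \<Xi>_def g_def h_def by blast
      have p1: "(\<lambda>u. \<Xi> n i (g n u) y) \<in> borel_measurable borel" and p2: "(\<lambda>u. B n i (g n u) y) \<in> borel_measurable borel"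
        and p3: "(\<lambda>u. euler (h n) (B n) (\<Xi> n) i (g n u) y) \<in> borel_measurable borel"
        and p4: "(\<lambda>u. H i u y) \<in> borel_measurable borel" and p5: "(\<lambda>u. b i u y) \<in> borel_measurable borel"
        and p6: "(\<lambda>u. X i u y) \<in> borel_measurable borel" if "i \<in> I" for n i
        using jointly_measurable_path[OF gj y, of "\<Xi> n i" n] jointly_measurable_path[OF gj y, of "B n i" n]
          jointly_measurable_path[OF gj y, of "euler (h n) (B n) (\<Xi> n) i" n] bm[OF that] em[OF that]
          jointly_measurable_path[OF H_jm[OF that] y] jointly_measurable_path[OF b_jm y] jointly_measurable_path[OF X_jm[OF that] y]
        by auto
      have "mean_convergent T (\<lambda>n u. energy_rate I e (\<lambda>i. euler (h n) (B n) (\<Xi> n) i (g n u) y) (\<lambda>i. B n i (g n u) y) (\<lambda>i. \<Xi> n i (g n u) y))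
        (\<lambda>u. energy_rate I e (\<lambda>i. X i u y) (\<lambda>i. b i u y) (\<lambda>i. H i u y))"
      proof (rule mean_convergent_energy_rate[OF fin e])
        show "AE u in lborel. u \<in> {0..T} \<longrightarrow> (\<forall>i\<in>I. (\<lambda>n. euler (h n) (B n) (\<Xi> n) i (g n u) y) \<longlonglongrightarrow> X i u y)"
          using elim(6) unfolding B_def \<Xi>_def g_def h_def .
        show "set_integrable lborel {0..T} (\<lambda>u. (H i u y)\<^sup>2)" if "i \<in> I" for i using elim(1) that by blast
      qed (rule mX | (rule p1 p2 p3 p4 p5 p6 mB lX, assumption))+
      then have c1: "mean_convergent T (\<lambda>n u. ?R n u y) (\<lambda>u. rate e u y)"
        by (simp add: R_def euler_rate_def rate_def)
      have "mean_convergent T (\<lambda>n u. \<Sum>i\<in>I. \<Xi> n i (g n u) y * \<Xi> n i (g n u) y + \<bar>B n i (g n u) y\<bar>)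
        (\<lambda>u. \<Sum>i\<in>I. H i u y * H i u y + \<bar>b i u y\<bar>)"
      proof (intro mean_convergent_sum mean_convergent_add fin)
        fix i assume i: "i \<in> I"
        show "mean_convergent T (\<lambda>n u. \<bar>B n i (g n u) y\<bar>) (\<lambda>u. \<bar>b i u y\<bar>)" by (rule mean_convergent_abs[OF mB[OF i]])
        show "mean_convergent T (\<lambda>n u. \<Xi> n i (g n u) y * \<Xi> n i (g n u) y) (\<lambda>u. H i u y * H i u y)"
          by (rule mean_convergent_product[OF p1[OF i] p1[OF i] p4[OF i] p4[OF i] mX mX _ _ lX[OF i] lX[OF i]])
            (use elim(1) i in blast)+
      qed
      from mean_convergent_integral[OF this]
      have c2: "(\<lambda>n. LBINT u:{0..T}. act n (g n u) y) \<longlonglongrightarrow> A y"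
        by (simp add: act_def activity_def A_def power2_eq_square)
      have c3: "(\<lambda>n. V n y) \<longlonglongrightarrow> VT y"
        unfolding V_def euler_energy_def VT_def
        using elim(5) unfolding B_def \<Xi>_def h_def by (intro tendsto_sum tendsto_power) blast
      show ?case using c1 c2 c3 by blast
    qed
  qed
  have Am: "A \<in> borel_measurable M"
    unfolding A_def
    by (intro measurable_set_integral jointly_measurable_sum jointly_measurable_add jointly_measurable_mult H_jm
        jointly_measurable_comp[OF b_jm, where \<phi>=abs]) auto
  have A0: "0 \<le> A y" for y unfolding A_def by (intro set_integral_nonneg_all sum_nonneg) simp
  have dm: "(\<lambda>y. damped e (f y)) \<in> borel_measurable M" if "f \<in> borel_measurable M" for f
    unfolding damped_def using that by measurable
  have dV_lim: "(\<lambda>n. \<E> (\<lambda>y. ?v n y)) \<longlonglongrightarrow> \<E> (\<lambda>y. damped e (VT y))"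
  proof (rule integral_dominated_convergence[where w="\<lambda>_. 1 / e"])
    show "AE y in M. (\<lambda>n. ?v n y) \<longlonglongrightarrow> damped e (VT y)"
      using path
    proof eventually_elim
      case (elim y)
      have "0 \<le> e * VT y" using e V0 by simp
      then have "1 + e * VT y \<noteq> 0" by linarith
      with elim show ?case unfolding damped_def by (intro tendsto_intros) auto
    qed
    show "AE y in M. norm (?v n y) \<le> 1 / e" for n
      using damped_nonneg[OF less_imp_le[OF e(1)] V0(1)] damped_le[OF e(1) V0(1)] by simp
  qed (use dm Vm VTm in auto)
  \<comment> \<open>One 1 / e comes from the inequality on the grid, the other from removing the
    discount in front of the terminal energy, and T * Cq from removing it in the rate.\<close>
  have main: "\<bar>\<E> (\<lambda>y. damped e (VT y)) - d0 - Eq\<bar> \<le> (2 / e + T * Cq) * (1 - \<E> (\<lambda>y. exp (- (\<kappa> * A y))))"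
    if \<kappa>: "0 < \<kappa>" for \<kappa>
  proof -
    define D where "D n j y = discount \<kappa> (h n) (B n) (\<Xi> n) j y" for n j y
    let ?D = "\<lambda>n u y. D n (Suc (g n u)) y"
    let ?I = "\<lambda>n y. (LBINT u:{0..T}. ?D n u y * ?R n u y)"
    define E where "E n y = D n (Suc (r n)) y" for n y
    define Q where "Q n y = (LBINT u:{0..T}. ?D n u y * ?d n u y)" for n y
    have Db: "0 < D n j y" "D n j y \<le> 1" "i \<le> j \<Longrightarrow> D n j y \<le> D n i y" for n i j y
      using discount_bounds[OF less_imp_le[OF \<kappa>] h0] by (auto simp: D_def)
    have Dm: "D n j \<in> borel_measurable M" for n j
      unfolding D_def by (rule discount_measurable[OF h0]) (use Ba \<Xi>a in auto)
    have E_eq: "E n y = exp (- (\<kappa> * (LBINT u:{0..T}. act n (g n u) y)))" for n y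
      unfolding gfull[of "\<lambda>j. act n j y" n] by (simp add: E_def D_def discount_def act_def sum_distrib_left mult.assoc distrib_left)
    have E_int: "integrable M (E n)" for n
      by (rule integrable_const_bound[where B=1]) (use Db Dm in \<open>auto simp: E_def[abs_def] less_imp_le\<close>)
    have E_lim: "(\<lambda>n. \<E> (E n)) \<longlonglongrightarrow> \<E> (\<lambda>y. exp (- (\<kappa> * A y)))"
    proof (rule integral_dominated_convergence[where w="\<lambda>_. 1"])
      show "AE y in M. (\<lambda>n. E n y) \<longlonglongrightarrow> exp (- (\<kappa> * A y))"
        using path unfolding E_eq by eventually_elim (intro tendsto_intros; blast)
      show "AE y in M. norm (E n y) \<le> 1" for n using Db by (auto simp: E_def less_imp_le)
    qed (use Am E_int in auto)
    have DR: "integrable M (\<lambda>y. LBINT u:{0..T}. ?D n u y * ?R n u y)"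
      and ineq: "\<bar>\<E> (\<lambda>y. E n y * ?v n y) - d0
          - \<E> (\<lambda>y. LBINT u:{0..T}. ?D n u y * ?R n u y)\<bar>
        \<le> (1 - \<E> (E n)) / e + err n" if "h n \<le> 1" for n
      using discounted_energy_inequality[where N="Suc (r n)" and \<beta>="B n" and \<xi>="\<Xi> n",
          OF e L1[of n] h(1)[of n] that less_imp_le[OF \<kappa>] Ba \<Xi>a BL \<Xi>L]
      unfolding h(2) D_def E_def R_def V_def d0_def err_def g_def by blast+
    have Dj: "jointly_measurable M (\<lambda>u y. ?D n u y)" and Rj: "jointly_measurable M (\<lambda>u y. ?R n u y)" for n
      by (rule gj, rule Dm) (rule gj, rule Rm)
    have Qj: "jointly_measurable M (\<lambda>u y. ?D n u y * ?d n u y)" for n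
      by (intro jointly_measurable_mult Dj jointly_measurable_comp[OF jointly_measurable_diff[OF Rj rate_jm], where \<phi>=abs]) simp
    have Qm: "Q n \<in> borel_measurable M" for n unfolding Q_def by (rule measurable_set_integral[OF Qj])
    have Q0: "0 \<le> Q n y" for n y unfolding Q_def using Db(1) by (intro set_integral_nonneg_all) (simp add: less_imp_le)
    have iDR: "set_integrable lborel {0..T} (\<lambda>u. ?D n u y * ?R n u y)"
      and iDaR: "set_integrable lborel {0..T} (\<lambda>u. ?D n u y * \<bar>?R n u y\<bar>)"
      and iR: "set_integrable lborel {0..T} (\<lambda>u. ?R n u y)" for n y
      using gint[of "\<lambda>j. D n (Suc j) y * R n j y"] gint[of "\<lambda>j. D n (Suc j) y * \<bar>R n j y\<bar>"] gint[of "\<lambda>j. R n j y"] by auto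
    have ia: "set_integrable lborel {0..T} (\<lambda>u. ?d n u y)" if "y \<in> space M" for n y
      by (intro set_integrable_abs set_integral_diff(1) iR q_int that)
    have iDa: "set_integrable lborel {0..T} (\<lambda>u. ?D n u y * ?d n u y)" if y: "y \<in> space M" for n y
    proof (rule set_integrable_bound[OF ia[OF y]])
      show "set_borel_measurable lborel {0..T} (\<lambda>u. ?D n u y * ?d n u y)"
        using jointly_measurable_path[OF Qj y] by (simp add: set_borel_measurable_def)
      have "?D n u y * ?d n u y \<le> 1 * ?d n u y" for u
        by (rule mult_right_mono[OF Db(2)]) simp
      then show "AE u in lborel. u \<in> {0..T} \<longrightarrow> norm (?D n u y * ?d n u y) \<le> norm (?d n u y)"
        using Db(1) by (auto simp: abs_mult abs_of_pos)
    qed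
    \<comment> \<open>A dominating constant independent of \<open>n\<close>: the discounted
      approximate rates contribute at most (5 / e) / \<kappa> by \<open>sum_mult_exp_le\<close>, and
      the rate of the limit at most T * Cq.\<close>
    define K where "K = (5 / e) / \<kappa> + T * Cq"
    have QK: "Q n y \<le> K" if y: "y \<in> space M" for n y
    proof -
      have ic: "set_integrable lborel {0..T} (\<lambda>u. Cq)" by (rule set_integrable_bounded[OF _ order_refl]) simp
      have "Q n y \<le> (LBINT u:{0..T}. ?D n u y * \<bar>?R n u y\<bar> + Cq)"
        unfolding Q_def
      proof (intro set_integral_mono iDa y set_integral_add(1) iDaR ic)
        fix u assume u: "u \<in> {0..T}"
        have "?D n u y * ?d n u y \<le> ?D n u y * (\<bar>?R n u y\<bar> + \<bar>rate e u y\<bar>)"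
          using Db(1)[of n "Suc (g n u)" y] by (intro mult_left_mono) auto
        also have "\<dots> \<le> ?D n u y * \<bar>?R n u y\<bar> + 1 * Cq"
          unfolding distrib_left using Db(1,2)[of n "Suc (g n u)" y] q_le[OF u y] by (intro add_mono mult_mono) auto
        finally show "?D n u y * ?d n u y \<le> ?D n u y * \<bar>?R n u y\<bar> + Cq" by simp
      qed
      also have "\<dots> = (LBINT u:{0..T}. ?D n u y * \<bar>?R n u y\<bar>) + T * Cq"
        using T by (subst set_integral_add(2)[OF iDaR ic]) (simp add: set_lebesgue_integral_def)
      also have "(LBINT u:{0..T}. ?D n u y * \<bar>?R n u y\<bar>) \<le> (5 / e) / \<kappa>"
      proof -
        define x where "x l = \<kappa> * h n * act n l y" for l
        have x0: "0 \<le> x l" for l using \<kappa> h0[of n] activity_nonneg by (simp add: x_def act_def)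
        have "(LBINT u:{0..T}. ?D n u y * \<bar>?R n u y\<bar>) = (\<Sum>l<Suc (r n). h n * (D n (Suc l) y * \<bar>R n l y\<bar>))"
          using gfull[of "\<lambda>j. D n (Suc j) y * \<bar>R n j y\<bar>" n] .
        also have "\<dots> \<le> (\<Sum>l<Suc (r n). (5 / e) / \<kappa> * (x l * exp (- (\<Sum>k<Suc l. x k))))"
        proof (rule sum_mono)
          fix l
          have "\<bar>R n l y\<bar> \<le> (5 / e) * act n l y"
            unfolding R_def euler_rate_def act_def activity_def by (rule energy_rate_abs_le[OF fin e])
          then have "h n * (D n (Suc l) y * \<bar>R n l y\<bar>) \<le> h n * (D n (Suc l) y * ((5 / e) * act n l y))"
            using h0[of n] Db(1)[of n "Suc l" y] by (intro mult_left_mono) auto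
          also have "\<dots> = (5 / e) / \<kappa> * (x l * D n (Suc l) y)" using \<kappa> by (simp add: x_def)
          finally have "h n * (D n (Suc l) y * \<bar>R n l y\<bar>) \<le> (5 / e) / \<kappa> * (x l * D n (Suc l) y)" .
          moreover have "D n (Suc l) y = exp (- (\<Sum>k<Suc l. x k))" by (simp add: D_def discount_def x_def act_def)
          ultimately show "h n * (D n (Suc l) y * \<bar>R n l y\<bar>) \<le> (5 / e) / \<kappa> * (x l * exp (- (\<Sum>k<Suc l. x k)))" by simp
        qed
        also have "\<dots> = (5 / e) / \<kappa> * (\<Sum>l<Suc (r n). x l * exp (- (\<Sum>k<Suc l. x k)))" by (simp only: sum_distrib_left)
        also have "\<dots> \<le> (5 / e) / \<kappa> * 1"
        proof (rule mult_left_mono)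
          show "(\<Sum>l<Suc (r n). x l * exp (- (\<Sum>k<Suc l. x k))) \<le> 1"
            by (rule order.trans[OF sum_mult_exp_le[OF x0]]) simp
        qed (use e \<kappa> in simp)
        finally show ?thesis by simp
      qed
      finally show ?thesis by (simp add: K_def)
    qed
    have Qint: "integrable M (Q n)" for n
      by (rule integrable_const_bound[where B=K]) (use Qm Q0 QK in auto)
    have Q_lim: "(\<lambda>n. \<E> (Q n)) \<longlonglongrightarrow> \<E> (\<lambda>_. 0)"
    proof (rule integral_dominated_convergence[where w="\<lambda>_. K"])
      show "AE y in M. (\<lambda>n. Q n y) \<longlonglongrightarrow> 0"
        using path AE_space
      proof eventually_elim
        case (elim y)
        have lim: "null_seq (\<lambda>n. LBINT u:{0..T}. ?d n u y)"
          using elim(1) by (simp add: mean_convergent_def)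
        have le: "Q n y \<le> (LBINT u:{0..T}. ?d n u y)" for n
          unfolding Q_def
        proof (intro set_integral_mono iDa ia elim(2))
          fix u
          have "?D n u y * ?d n u y \<le> 1 * ?d n u y"
            by (rule mult_right_mono[OF Db(2)]) simp
          then show "?D n u y * ?d n u y \<le> ?d n u y" by simp
        qed
        show ?case
          by (rule tendsto_sandwich[OF always_eventually[OF allI] always_eventually[OF allI] tendsto_const lim]) (rule Q0, rule le)
      qed
      show "AE y in M. norm (Q n y) \<le> K" for n using Q0 QK by auto
    qed (use Qm in auto)
    have qint: "integrable M (\<lambda>y. LBINT u:{0..T}. rate e u y)"
      using fubini_time_bounded(2)[OF rate_jm q_le] by blast
    have bound: "\<bar>\<E> (\<lambda>y. ?v n y) - d0 - Eq\<bar>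
      \<le> (2 / e + T * Cq) * (1 - \<E> (E n)) + err n + \<E> (Q n)" if hn: "h n \<le> 1" for n
    proof -
      have db: "0 \<le> ?v n y" "?v n y \<le> 1 / e" for y
        using damped_nonneg[OF less_imp_le[OF e(1)] V0(1)] damped_le[OF e(1) V0(1)] by auto
      have id: "integrable M (\<lambda>y. ?v n y)"
        by (rule integrable_const_bound[where B="1 / e"]) (use db dm[OF Vm] in auto)
      have Em: "E n \<in> borel_measurable M" using E_int by auto
      have iEd: "integrable M (\<lambda>y. E n y * ?v n y)"
      proof (rule Bochner_Integration.integrable_bound[OF id])
        have "\<bar>E n y\<bar> * \<bar>?v n y\<bar> \<le> 1 * \<bar>?v n y\<bar>" for y
          using Db(1,2)[of n "Suc (r n)" y] by (intro mult_right_mono) (auto simp: E_def)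
        then show "AE y in M. norm (E n y * ?v n y) \<le> norm (?v n y)"
          by (simp add: abs_mult)
      qed (use Em dm[OF Vm] in measurable)
      have 1: "\<bar>\<E> (\<lambda>y. ?v n y) - \<E> (\<lambda>y. E n y * ?v n y)\<bar> \<le> (1 - \<E> (E n)) / e"
      proof -
        have "\<bar>\<E> (\<lambda>y. ?v n y) - \<E> (\<lambda>y. E n y * ?v n y)\<bar>
          = \<bar>\<E> (\<lambda>y. ?v n y - E n y * ?v n y)\<bar>" using id iEd by simp
        also have "\<dots> \<le> \<E> (\<lambda>y. \<bar>?v n y - E n y * ?v n y\<bar>)" by (rule integral_abs_bound)
        also have "\<dots> \<le> \<E> (\<lambda>y. (1 - E n y) * (1 / e))"
        proof (rule integral_mono)
          fix y
          have "\<bar>(1 - E n y) * ?v n y\<bar> \<le> (1 - E n y) * (1 / e)"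
            unfolding abs_mult using Db(1,2)[of n "Suc (r n)" y] db[of y] by (intro mult_mono) (auto simp: E_def)
          then show "\<bar>?v n y - E n y * ?v n y\<bar> \<le> (1 - E n y) * (1 / e)" by (simp add: left_diff_distrib)
        qed (use id iEd E_int in auto)
        also have "\<dots> = (1 - \<E> (E n)) / e" using E_int by (simp add: prob_space)
        finally show ?thesis .
      qed
      have 2: "\<bar>\<E> (\<lambda>y. LBINT u:{0..T}. ?D n u y * ?R n u y) - Eq\<bar>
        \<le> \<E> (Q n) + T * Cq * (1 - \<E> (E n))"
      proof -
        have "\<bar>\<E> (\<lambda>y. LBINT u:{0..T}. ?D n u y * ?R n u y) - Eq\<bar>
          = \<bar>\<E> (\<lambda>y. ?I n y - (LBINT u:{0..T}. rate e u y))\<bar>"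
          unfolding Eq_def using DR[OF hn] qint by simp
        also have "\<dots> \<le> \<E> (\<lambda>y. \<bar>?I n y - (LBINT u:{0..T}. rate e u y)\<bar>)"
          by (rule integral_abs_bound)
        also have "\<dots> \<le> \<E> (\<lambda>y. Q n y + T * Cq * (1 - E n y))"
        proof (rule integral_mono)
          fix y assume y: "y \<in> space M"
          define c where "c = (1 - E n y) * Cq"
          have ic: "set_integrable lborel {0..T} (\<lambda>u. c)" by (rule set_integrable_bounded[OF _ order_refl]) simp
          have idf: "set_integrable lborel {0..T} (\<lambda>u. ?D n u y * ?R n u y - rate e u y)"
            by (intro set_integral_diff(1) iDR q_int y)
          have "\<bar>?I n y - (LBINT u:{0..T}. rate e u y)\<bar>
            = \<bar>LBINT u:{0..T}. ?D n u y * ?R n u y - rate e u y\<bar>"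
            by (subst set_integral_diff(2)[OF iDR q_int[OF y]]) simp
          also have "\<dots> \<le> (LBINT u:{0..T}. \<bar>?D n u y * ?R n u y - rate e u y\<bar>)"
            using set_integral_norm_bound[OF idf] by simp
          also have "\<dots> \<le> (LBINT u:{0..T}. ?D n u y * ?d n u y + c)"
          proof (intro set_integral_mono set_integrable_abs idf set_integral_add(1) iDa y ic)
            fix u assume u: "u \<in> {0..T}"
            define d where "d = ?D n u y"
            \<comment> \<open>The discount decreases with the step, so its final value is a lower
              bound, and 1 - d is at most 1 - E n y.\<close>
            have d: "0 < d" "E n y \<le> d" "d \<le> 1"
              unfolding d_def E_def using Db g_less[OF u, of n] by auto
            have "d * ?R n u y - rate e u y = d * (?R n u y - rate e u y) - (1 - d) * rate e u y"
              by (simp add: algebra_simps)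
            then have "\<bar>d * ?R n u y - rate e u y\<bar> \<le> \<bar>d * (?R n u y - rate e u y)\<bar> + \<bar>(1 - d) * rate e u y\<bar>"
              by linarith
            also have "\<bar>(1 - d) * rate e u y\<bar> \<le> c"
              unfolding abs_mult c_def using d q_le[OF u y] by (intro mult_mono) auto
            also have "\<bar>d * (?R n u y - rate e u y)\<bar> = d * ?d n u y"
              using d by (simp add: abs_mult)
            finally show "\<bar>?D n u y * ?R n u y - rate e u y\<bar> \<le> ?D n u y * ?d n u y + c"
              by (simp add: d_def)
          qed
          also have "\<dots> = Q n y + T * c"
            using T by (subst set_integral_add(2)[OF iDa[OF y] ic]) (simp add: Q_def, simp add: set_lebesgue_integral_def)
          finally show "\<bar>?I n y - (LBINT u:{0..T}. rate e u y)\<bar>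
            \<le> Q n y + T * Cq * (1 - E n y)" by (simp add: c_def mult.commute mult.left_commute)
        qed (use DR[OF hn] qint Qint E_int in auto)
        also have "\<dots> = \<E> (Q n) + T * Cq * (1 - \<E> (E n))"
          using Qint E_int by (simp add: prob_space)
        finally show ?thesis .
      qed
      have "(2 / e + T * Cq) * (1 - \<E> (E n))
        = (1 - \<E> (E n)) / e + (1 - \<E> (E n)) / e + T * Cq * (1 - \<E> (E n))"
        by (simp add: field_simps)
      then show ?thesis using 1 2 ineq[OF hn] by linarith
    qed
    \<comment> \<open>The one-step expansion is available for step widths of at most 1.\<close>
    have "\<forall>\<^sub>F n in sequentially. h n < 1" by (rule order_tendstoD(2)[OF h_lim]) simp
    then have ev: "\<forall>\<^sub>F n in sequentially. \<bar>\<E> (\<lambda>y. ?v n y) - d0 - Eq\<bar>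
      \<le> (2 / e + T * Cq) * (1 - \<E> (E n)) + err n + \<E> (Q n)"
      by eventually_elim (rule bound, simp)
    have rhs: "(\<lambda>n. (2 / e + T * Cq) * (1 - \<E> (E n)) + err n + \<E> (Q n))
      \<longlonglongrightarrow> (2 / e + T * Cq) * (1 - \<E> (\<lambda>y. exp (- (\<kappa> * A y)))) + 0 + \<E> (\<lambda>_. 0)"
      by (intro tendsto_intros E_lim err_lim Q_lim)
    have lhs: "(\<lambda>n. \<bar>\<E> (\<lambda>y. ?v n y) - d0 - Eq\<bar>) \<longlonglongrightarrow> \<bar>\<E> (\<lambda>y. damped e (VT y)) - d0 - Eq\<bar>"
      by (intro tendsto_intros dV_lim)
    show ?thesis using tendsto_le[OF sequentially_bot rhs lhs ev] by simp
  qed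
  have "(\<lambda>m. \<E> (\<lambda>y. exp (- (1 / real (Suc m) * A y)))) \<longlonglongrightarrow> \<E> (\<lambda>_. 1)"
  proof (rule integral_dominated_convergence[where w="\<lambda>_. 1"])
    have "(\<lambda>m. exp (- (1 / real (Suc m) * A y))) \<longlonglongrightarrow> exp (- (0 * A y))" for y
    proof (intro tendsto_intros)
      show "null_seq (\<lambda>m. 1 / real (Suc m))" by real_asymp
    qed
    then show "AE y in M. (\<lambda>m. exp (- (1 / real (Suc m) * A y))) \<longlonglongrightarrow> 1" by simp
    show "AE y in M. norm (exp (- (1 / real (Suc m) * A y))) \<le> 1" for m using A0 by simp
  qed (use Am in auto)
  then have "(\<lambda>m. (2 / e + T * Cq) * (1 - \<E> (\<lambda>y. exp (- (1 / real (Suc m) * A y))))) \<longlonglongrightarrow> (2 / e + T * Cq) * (1 - \<E> (\<lambda>_. 1))"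
    by (intro tendsto_intros)
  moreover have "\<bar>\<E> (\<lambda>y. damped e (VT y)) - d0 - Eq\<bar> \<le> (2 / e + T * Cq) * (1 - \<E> (\<lambda>y. exp (- (1 / real (Suc m) * A y))))" for m
    by (rule main) simp
  ultimately have "\<bar>\<E> (\<lambda>y. damped e (VT y)) - d0 - Eq\<bar> \<le> (2 / e + T * Cq) * (1 - \<E> (\<lambda>_. 1))"
    by (intro LIMSEQ_le_const) auto
  then show ?thesis by (simp add: prob_space VT_def d0_def Eq_def)
qed

end

section \<open>The energy balance\<close>

text \<open>With the weight exp(-2 c t) the integral inequality becomes S \<le> a + S / 2 for the
  supremum \<open>S\<close>. This works for a bounded measurable function without continuity, at the
  price of the two factors 2.\<close>

lemma gronwall_bound:
  fixes u :: "real \<Rightarrow> real"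
  assumes T: "0 \<le> T" and c: "0 \<le> c" and a: "0 \<le> a" and m: "u \<in> borel_measurable borel"
    and u: "\<And>t. 0 \<le> t \<Longrightarrow> t \<le> T \<Longrightarrow> 0 \<le> u t" "\<And>t. 0 \<le> t \<Longrightarrow> t \<le> T \<Longrightarrow> u t \<le> B"
    and le: "\<And>t. 0 \<le> t \<Longrightarrow> t \<le> T \<Longrightarrow> u t \<le> a + c * (LBINT s:{0..t}. u s)"
    and t: "0 \<le> t" "t \<le> T"
  shows "u t \<le> 2 * a * exp (2 * c * T)"
proof -
  define v where "v s = exp (- (2 * c * s)) * u s" for s
  define S where "S = Sup (v ` {0..T})"
  have vB: "v s \<le> B" if "0 \<le> s" "s \<le> T" for s
  proof -
    have "exp (- (2 * c * s)) * u s \<le> 1 * u s" using u(1)[OF that] c that by (intro mult_right_mono) auto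
    then show ?thesis using u(2)[OF that] by (simp add: v_def)
  qed
  then have bdd: "bdd_above (v ` {0..T})" by (auto intro!: bdd_aboveI[of _ B])
  have vS: "v s \<le> S" if "0 \<le> s" "s \<le> T" for s
    unfolding S_def using bdd that by (intro cSup_upper) auto
  have uS: "u s \<le> exp (2 * c * s) * S" if "0 \<le> s" "s \<le> T" for s
  proof -
    have "u s = exp (2 * c * s) * v s" by (simp add: v_def mult.assoc[symmetric] exp_add[symmetric])
    then show ?thesis using vS[OF that] by simp
  qed
  have S0: "0 \<le> S" using vS[of 0] u(1)[of 0] T by (simp add: v_def)
  have half: "v s \<le> a + S / 2" if s: "0 \<le> s" "s \<le> T" for s
  proof -
    \<comment> \<open>The antiderivative of c exp(2 c x) is exp(2 c x) / 2; this 1/2 is the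
      contraction factor, and it is the reason for the rate 2 c in the weight.\<close>
    have int: "has_bochner_integral lborel (\<lambda>x. (c * exp (2 * c * x)) * indicator {0..s} x) (exp (2 * c * s) / 2 - exp (2 * c * 0) / 2)"
      using s by (intro has_bochner_integral_FTC_Icc_real) (auto intro!: derivative_eq_intros)
    then have ie: "set_integrable lborel {0..s} (\<lambda>x. c * exp (2 * c * x))"
      and Ie: "(LBINT x:{0..s}. c * exp (2 * c * x)) = exp (2 * c * s) / 2 - 1 / 2"
      using int by (simp_all only: set_integrable_def set_lebesgue_integral_def mult.commute[of _ "indicator _ _"] has_bochner_integral_iff real_scaleR_def)
        simp
    have iu: "set_integrable lborel {0..s} u"
      by (rule set_integrable_bounded[OF m, where B=B]) (use u s in auto)
    have "c * (LBINT x:{0..s}. u x) = (LBINT x:{0..s}. c * u x)" by simp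
    also have "\<dots> \<le> (LBINT x:{0..s}. S * (c * exp (2 * c * x)))"
    proof (rule set_integral_mono, rule set_integrable_mult_right, rule iu, rule set_integrable_mult_right, rule ie)
      fix x assume "x \<in> {0..s}"
      then have "c * u x \<le> c * (exp (2 * c * x) * S)" using uS[of x] s c by (intro mult_left_mono) auto
      then show "c * u x \<le> S * (c * exp (2 * c * x))" by (simp add: mult_ac)
    qed
    also have "\<dots> = S * (exp (2 * c * s) / 2 - 1 / 2)" by (subst set_integral_mult_right) (simp only: Ie)
    also have "\<dots> \<le> S * (exp (2 * c * s) / 2)" using S0 by (intro mult_left_mono) auto
    finally have "u s \<le> a + S * (exp (2 * c * s) / 2)" using le[OF s] by linarith
    also have "a \<le> a * exp (2 * c * s)" using a c s mult_left_mono[of 1 "exp (2 * c * s)" a] by simp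
    finally have "u s \<le> exp (2 * c * s) * (a + S / 2)" by (simp add: algebra_simps)
    then have "exp (- (2 * c * s)) * u s \<le> exp (- (2 * c * s)) * (exp (2 * c * s) * (a + S / 2))"
      by (intro mult_left_mono) auto
    also have "\<dots> = a + S / 2" by (simp add: mult.assoc[symmetric] exp_add[symmetric])
    finally show ?thesis by (simp add: v_def)
  qed
  have "S \<le> a + S / 2" unfolding S_def[of] using half T by (intro cSup_least) (auto simp: S_def)
  then have "S \<le> 2 * a" by simp
  then have "exp (2 * c * t) * S \<le> exp (2 * c * T) * (2 * a)"
    using S0 c t by (intro mult_mono) (auto intro: mult_left_mono)
  then show ?thesis using uS[OF t] by (simp add: mult_ac)
qed

context conservative_system
begin

definition energy :: "real \<Rightarrow> 'w \<Rightarrow> real" where "energy t y = (\<Sum>i\<in>I. (X i t y)\<^sup>2)"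

definition noise :: "real \<Rightarrow> 'w \<Rightarrow> real" where "noise t y = (\<Sum>i\<in>I. (H i t y)\<^sup>2)"

lemma energy_jm: "jointly_measurable M energy"
  unfolding energy_def[abs_def] by (intro jointly_measurable_sum jointly_measurable_comp[OF X_jm, where \<phi>="\<lambda>x. x\<^sup>2"]) auto

lemma noise_jm: "jointly_measurable M noise"
  unfolding noise_def[abs_def] by (intro jointly_measurable_sum jointly_measurable_comp[OF H_jm, where \<phi>="\<lambda>x. x\<^sup>2"]) auto

lemma energy_nonneg: "0 \<le> energy t y" by (simp add: energy_def sum_nonneg)

lemma noise_nonneg: "0 \<le> noise t y" by (simp add: noise_def sum_nonneg)

lemma noise_le: "0 \<le> t \<Longrightarrow> y \<in> space M \<Longrightarrow> noise t y \<le> C * (1 + energy t y)"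
  unfolding noise_def energy_def by (rule growth)

lemma damped_energy_integrable:
  assumes "0 < e"
  shows "integrable M (\<lambda>y. damped e (energy t y))"
proof (rule integrable_const_bound[where B="1 / e"])
  show "AE y in M. norm (damped e (energy t y)) \<le> 1 / e"
    using damped_nonneg[OF less_imp_le[OF assms] energy_nonneg] damped_le[OF assms energy_nonneg] by simp
  show "(\<lambda>y. damped e (energy t y)) \<in> borel_measurable M"
    unfolding damped_def using jointly_measurable_at[OF energy_jm, of t] by measurable
qed

lemma damped_le_self: "0 \<le> e \<Longrightarrow> 0 \<le> v \<Longrightarrow> damped e v \<le> v"
  by (simp add: damped_def divide_le_eq add_pos_nonneg not_less algebra_simps)

text \<open>Damping makes the mean finite beforehand, as Gronwall's lemma demands, while the
  resulting bound does not depend on \<open>e\<close>.\<close>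

lemma damped_energy_bound:
  assumes initial: "AE y in M. \<forall>i\<in>I. X i 0 y = x0 i" and e: "0 < e" "e \<le> 1" and t: "0 \<le> t" "t \<le> T"
  shows "\<E> (\<lambda>y. damped e (energy t y)) \<le> 2 * (1 + (\<Sum>i\<in>I. (x0 i)\<^sup>2)) * exp (2 * C * T)"
proof -
  define v0 where "v0 = (\<Sum>i\<in>I. (x0 i)\<^sup>2)"
  have v0: "0 \<le> v0" by (simp add: v0_def sum_nonneg)
  \<comment> \<open>Adding 1 absorbs the constant term of the growth bound.\<close>
  define u where "u s = 1 + \<E> (\<lambda>y. damped e (energy s y))" for s
  have d0: "0 \<le> damped e (energy s y)" and d1: "damped e (energy s y) \<le> 1 / e" for s y
    using damped_nonneg[OF less_imp_le[OF e(1)] energy_nonneg] damped_le[OF e(1) energy_nonneg] by auto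
  have dj: "jointly_measurable M (\<lambda>s y. damped e (energy s y))"
    by (rule jointly_measurable_comp[OF energy_jm, where \<phi>="damped e"]) (simp add: damped_def[abs_def])
  have um: "u \<in> borel_measurable borel"
  proof -
    have "(\<lambda>s. \<E> (\<lambda>y. damped e (energy s y))) \<in> borel_measurable lborel"
      using dj unfolding jointly_measurable_def by (rule borel_measurable_lebesgue_integral)
    then show ?thesis unfolding u_def by simp
  qed
  have u0: "0 \<le> u s" for s unfolding u_def by (intro add_nonneg_nonneg Bochner_Integration.integral_nonneg d0) simp
  have uB: "u s \<le> 1 + 1 / e" for s
  proof -
    have "\<E> (\<lambda>y. damped e (energy s y)) \<le> \<E> (\<lambda>_. 1 / e)"
      by (intro integral_mono damped_energy_integrable e d1) simp
    then show ?thesis by (simp add: u_def prob_space)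
  qed
  have "u t \<le> 2 * (1 + v0) * exp (2 * C * T)"
  proof (rule gronwall_bound[where u=u and t=t])
    show "u s \<le> 1 + v0 + C * (LBINT x:{0..s}. u x)" if s: "0 \<le> s" "s \<le> T" for s
    \<comment> \<open>The damped balance is stated for positive times; at time zero the initial
      condition is used directly.\<close>
    proof (cases "s = 0")
      case True
      have "\<E> (\<lambda>y. damped e (energy 0 y)) \<le> \<E> (\<lambda>_. v0)"
      proof (rule integral_mono_AE)
        show "AE y in M. damped e (energy 0 y) \<le> v0"
          using initial
        proof eventually_elim
          case (elim y)
          then have "energy 0 y = v0" by (simp add: energy_def v0_def)
          then show ?case using damped_le_self[of e "v0"] e v0 by simp
        qed
      qed (use damped_energy_integrable[OF e(1)] in auto)
      moreover have "0 \<le> C * (LBINT x:{0..s}. u x)" using C_nonneg u0 by (intro mult_nonneg_nonneg set_integral_nonneg_all) auto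
      ultimately show ?thesis using True by (simp add: u_def prob_space)
    next
      case False
      then have s0: "0 < s" using s by simp
      have rb: "\<bar>rate e x y\<bar> \<le> 4 * C / e" if "x \<in> {0..s}" "y \<in> space M" for x y
        using rate_abs_le[OF e _ that(2)] that(1) by simp
      note fub = fubini_time_bounded[OF rate_jm rb]
      have iu: "set_integrable lborel {0..s} u"
        by (rule set_integrable_bounded[OF um, where B="1 + 1 / e"]) (use u0 uB in \<open>auto simp: abs_of_nonneg\<close>)
      have "\<E> (\<lambda>y. LBINT x:{0..s}. rate e x y) = (LBINT x:{0..s}. \<E> (rate e x))"
        by (rule fub(4))
      also have "\<dots> \<le> (LBINT x:{0..s}. C * u x)"
      proof (intro set_integral_mono fub(1) set_integrable_mult_right iu)
        fix x assume x: "x \<in> {0..s}"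
        have ir: "integrable M (rate e x)"
          by (rule integrable_const_bound[where B="4 * C / e"]) (use rb[OF x] jointly_measurable_at[OF rate_jm] in auto)
        have "\<E> (rate e x) \<le> \<E> (\<lambda>y. C * (1 + damped e (energy x y)))"
        proof (rule integral_mono[OF ir])
          show "integrable M (\<lambda>y. C * (1 + damped e (energy x y)))" using damped_energy_integrable[OF e(1)] by simp
          fix y assume y: "y \<in> space M"
          have x0: "0 \<le> x" using x by simp
          have "rate e x y \<le> noise x y / (1 + e * energy x y)\<^sup>2"
            using rate_bounds(1)[OF e(1) x0 y] by (simp add: noise_def energy_def)
          also have "\<dots> \<le> C * (1 + energy x y) / (1 + e * energy x y)\<^sup>2"
            using noise_le[OF x0 y] by (intro divide_right_mono) auto
          also have "\<dots> = C * ((1 + energy x y) / (1 + e * energy x y)\<^sup>2)" by simp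
          also have "\<dots> \<le> C * (1 + damped e (energy x y))"
            by (intro mult_left_mono weight_energy_le(2) e energy_nonneg C_nonneg)
          finally show "rate e x y \<le> C * (1 + damped e (energy x y))" .
        qed
        then show "\<E> (rate e x) \<le> C * u x"
          using damped_energy_integrable[OF e(1)] by (simp add: u_def prob_space)
      qed
      finally have "\<E> (\<lambda>y. LBINT x:{0..s}. rate e x y) \<le> C * (LBINT x:{0..s}. u x)" by simp
      moreover have "damped e v0 \<le> v0" using damped_le_self[of e v0] e v0 by simp
      ultimately show ?thesis
        using damped_energy_balance[OF e s0] unfolding u_def energy_def v0_def by linarith
    qed
  qed (use t C_nonneg v0 um u0 uB in auto)
  then show ?thesis by (simp add: u_def v0_def)
qed

lemma damped_tendsto:
  assumes "0 \<le> v"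
  shows "(\<lambda>n. damped (1 / real (Suc n)) v) \<longlonglongrightarrow> v"
proof -
  have "null_seq (\<lambda>n. 1 / real (Suc n))" by real_asymp
  then have "(\<lambda>n. v / (1 + 1 / real (Suc n) * v)) \<longlonglongrightarrow> v / (1 + 0 * v)"
    by (intro tendsto_intros) auto
  then show ?thesis by (simp add: damped_def)
qed

text \<open>Monotone convergence along e = 1 / (n + 1), with the bound of
  \<open>damped_energy_bound\<close>, which is uniform in \<open>e\<close>.\<close>

lemma energy_integrable:
  assumes initial: "AE y in M. \<forall>i\<in>I. X i 0 y = x0 i" and t: "0 \<le> t" "t \<le> T"
  shows "integrable M (energy t)" "\<E> (energy t) \<le> 2 * (1 + (\<Sum>i\<in>I. (x0 i)\<^sup>2)) * exp (2 * C * T)"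
proof -
  define K where "K = 2 * (1 + (\<Sum>i\<in>I. (x0 i)\<^sup>2)) * exp (2 * C * T)"
  define f where "f n y = damped (1 / real (Suc n)) (energy t y)" for n y
  have fi: "integrable M (f n)" for n unfolding f_def by (rule damped_energy_integrable) simp
  have fm: "f m y \<le> f n y" if "m \<le> n" for m n y
  proof -
    have "1 / real (Suc n) * energy t y \<le> 1 / real (Suc m) * energy t y"
      using that energy_nonneg[of t y] by (intro mult_right_mono divide_left_mono) auto
    moreover have "0 < 1 + 1 / real (Suc n) * energy t y" "0 < 1 + 1 / real (Suc m) * energy t y"
      using energy_nonneg[of t y] by (auto intro!: add_pos_nonneg)
    ultimately show ?thesis
      unfolding f_def damped_def using energy_nonneg[of t y] by (intro divide_left_mono mult_pos_pos) auto
  qed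
  have EK: "\<E> (f n) \<le> K" for n
    unfolding f_def K_def by (rule damped_energy_bound[OF initial _ _ t]) auto
  have "incseq (\<lambda>n. \<E> (f n))"
    by (intro incseq_SucI integral_mono fi fm) simp
  then have "(\<lambda>n. \<E> (f n)) \<longlonglongrightarrow> (SUP n. \<E> (f n))"
    by (intro LIMSEQ_incseq_SUP bdd_aboveI[of _ K]) (auto intro: EK)
  note lim = this
  have mono: "AE y in M. mono (\<lambda>n. f n y)" using fm by (auto simp: mono_def)
  have ptw: "AE y in M. (\<lambda>n. f n y) \<longlonglongrightarrow> energy t y"
    unfolding f_def by (intro AE_I2 damped_tendsto energy_nonneg)
  note mc = fi mono ptw lim jointly_measurable_at[OF energy_jm]
  show "integrable M (energy t)" by (rule integrable_monotone_convergence[OF mc])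
  have "\<E> (energy t) = (SUP n. \<E> (f n))" by (rule integral_monotone_convergence[OF mc])
  also have "\<dots> \<le> K" by (intro cSUP_least EK) simp
  finally show "\<E> (energy t) \<le> 2 * (1 + (\<Sum>i\<in>I. (x0 i)\<^sup>2)) * exp (2 * C * T)" by (simp add: K_def)
qed

lemma rate_tendsto:
  assumes "0 \<le> u" "y \<in> space M"
  shows "(\<lambda>n. rate (1 / real (Suc n)) u y) \<longlonglongrightarrow> noise u y"
proof -
  have l: "null_seq (\<lambda>n. 1 / real (Suc n))" by real_asymp
  have "(\<lambda>n. (2 * (\<Sum>i\<in>I. X i u y * b i u y) + noise u y) / (1 + 1 / real (Suc n) * energy u y)\<^sup>2
      - 4 * (1 / real (Suc n)) * (\<Sum>i\<in>I. X i u y * H i u y)\<^sup>2 / (1 + 1 / real (Suc n) * energy u y) ^ 3)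
    \<longlonglongrightarrow> (2 * (\<Sum>i\<in>I. X i u y * b i u y) + noise u y) / (1 + 0 * energy u y)\<^sup>2
      - 4 * 0 * (\<Sum>i\<in>I. X i u y * H i u y)\<^sup>2 / (1 + 0 * energy u y) ^ 3"
    by (intro tendsto_intros l) auto
  then show ?thesis using skew[OF assms] by (simp add: rate_def energy_rate_def noise_def energy_def)
qed

text \<open>Once the energy is known to be integrable, the growth bound makes the noise integrable,
  and 4 times the noise dominates all damped rates; this is what allows \<open>e\<close> to tend to
  zero in the damped balance.\<close>

theorem energy_balance:
  assumes initial: "AE y in M. \<forall>i\<in>I. X i 0 y = x0 i" and T: "0 \<le> T"
  shows "integrable M (energy T)"
    and "integrable M (noise T)"
    and "set_integrable lborel {0..T} (\<lambda>u. \<E> (noise u))"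
    and "\<E> (energy T) = (\<Sum>i\<in>I. (x0 i)\<^sup>2) + (LBINT u:{0..T}. \<E> (noise u))"
proof -
  define v0 where "v0 = (\<Sum>i\<in>I. (x0 i)\<^sup>2)"
  have v0: "0 \<le> v0" by (simp add: v0_def sum_nonneg)
  define K where "K = C * (1 + 2 * (1 + v0) * exp (2 * C * T))"
  show iV: "integrable M (energy T)" by (rule energy_integrable(1)[OF initial T order_refl])
  have ni: "integrable M (noise u)" and nK: "\<E> (noise u) \<le> K" if u: "0 \<le> u" "u \<le> T" for u
  proof -
    have ie: "integrable M (\<lambda>y. C * (1 + energy u y))" using energy_integrable(1)[OF initial u] by simp
    show ni: "integrable M (noise u)"
    proof (rule Bochner_Integration.integrable_bound[OF ie])
      show "AE y in M. norm (noise u y) \<le> norm (C * (1 + energy u y))"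
        using noise_le[OF u(1)] noise_nonneg[of u] by (intro AE_I2) (force simp: abs_of_nonneg)
    qed (rule jointly_measurable_at[OF noise_jm])
    have "\<E> (noise u) \<le> \<E> (\<lambda>y. C * (1 + energy u y))"
      by (intro integral_mono ni ie noise_le u)
    also have "\<dots> = C * (1 + \<E> (energy u))" using energy_integrable(1)[OF initial u] by (simp add: prob_space)
    also have "\<dots> \<le> K"
      unfolding K_def using energy_integrable(2)[OF initial u] C_nonneg by (intro mult_left_mono) (auto simp: v0_def)
    finally show "\<E> (noise u) \<le> K" .
  qed
  show "integrable M (noise T)" by (rule ni[OF T order_refl])
  have nm: "(\<lambda>u. \<E> (noise u)) \<in> borel_measurable borel"
  proof -
    have "(\<lambda>u. \<E> (\<lambda>y. noise u y)) \<in> borel_measurable lborel"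
      using noise_jm unfolding jointly_measurable_def by (rule borel_measurable_lebesgue_integral)
    then show ?thesis by simp
  qed
  have n0: "0 \<le> \<E> (noise u)" for u by (rule integral_nonneg_AE) (simp add: noise_nonneg)
  show si: "set_integrable lborel {0..T} (\<lambda>u. \<E> (noise u))"
    by (rule set_integrable_bounded[OF nm, where B=K]) (use nK n0 in \<open>auto simp: abs_of_nonneg\<close>)
  show "\<E> (energy T) = (\<Sum>i\<in>I. (x0 i)\<^sup>2) + (LBINT u:{0..T}. \<E> (noise u))"
  proof (cases "T = 0")
    case True
    have "\<E> (energy 0) = \<E> (\<lambda>_. v0)"
    proof (rule integral_cong_AE)
      show "AE y in M. energy 0 y = v0" using initial by eventually_elim (simp add: energy_def v0_def)
    qed (use jointly_measurable_at[OF energy_jm] in auto)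
    moreover have "(LBINT u:{0..0}. \<E> (noise u)) = 0"
    proof -
      have "(LBINT u:{0..0}. \<E> (noise u)) = (LBINT u:{0..0::real}. \<E> (noise 0))"
        by (rule set_lebesgue_integral_cong) auto
      then show ?thesis by (simp add: set_lebesgue_integral_def)
    qed
    ultimately show ?thesis using True by (simp add: v0_def prob_space)
  next
    case False
    then have T0: "0 < T" using T by simp
    let ?e = "\<lambda>n. 1 / real (Suc n)"
    have e: "0 < ?e n" "?e n \<le> 1" for n by auto
    have bal: "\<E> (\<lambda>y. damped (?e n) (energy T y)) = damped (?e n) v0 + (LBINT u:{0..T}. \<E> (rate (?e n) u))" for n
    proof -
      have rb: "\<bar>rate (?e n) x y\<bar> \<le> 4 * C / ?e n" if "x \<in> {0..T}" "y \<in> space M" for x y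
        using rate_abs_le[OF e _ that(2)] that(1) by simp
      show ?thesis
        using damped_energy_balance[OF e T0, of n] fubini_time_bounded(4)[OF rate_jm rb]
        unfolding energy_def v0_def by simp
    qed
    have l1: "(\<lambda>n. \<E> (\<lambda>y. damped (?e n) (energy T y))) \<longlonglongrightarrow> \<E> (energy T)"
    proof (rule integral_dominated_convergence[where w="energy T"])
      show "AE y in M. (\<lambda>n. damped (?e n) (energy T y)) \<longlonglongrightarrow> energy T y"
        by (intro AE_I2 damped_tendsto energy_nonneg)
      show "AE y in M. norm (damped (?e n) (energy T y)) \<le> energy T y" for n
        using damped_le_self[OF less_imp_le[OF e(1)] energy_nonneg] damped_nonneg[OF less_imp_le[OF e(1)] energy_nonneg]
        by (intro AE_I2) (simp add: abs_of_nonneg)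
      show "(\<lambda>y. damped (?e n) (energy T y)) \<in> borel_measurable M" for n
        using damped_energy_integrable[OF e(1)] by blast
    qed (use iV in auto)
    have r4: "\<bar>rate (?e n) u y\<bar> \<le> 4 * noise u y" if u: "0 \<le> u" and y: "y \<in> space M" for n u y
    proof -
      have w: "1 \<le> (1 + ?e n * energy u y)\<^sup>2" using energy_nonneg[of u y] by (intro one_le_power) simp
      have "\<bar>rate (?e n) u y\<bar> \<le> 4 * noise u y / (1 + ?e n * energy u y)\<^sup>2"
        using rate_bounds(2)[OF e(1) u y] by (simp only: noise_def energy_def)
      also have "\<dots> \<le> 4 * noise u y / 1" using w noise_nonneg[of u y] by (intro divide_left_mono) auto
      finally show ?thesis by simp
    qed
    have Er: "(\<lambda>n. \<E> (rate (?e n) u)) \<longlonglongrightarrow> \<E> (noise u)" if u: "0 \<le> u" "u \<le> T" for u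
    proof (rule integral_dominated_convergence[where w="\<lambda>y. 4 * noise u y"])
      show "AE y in M. (\<lambda>n. rate (?e n) u y) \<longlonglongrightarrow> noise u y" by (intro AE_I2 rate_tendsto u)
      show "AE y in M. norm (rate (?e n) u y) \<le> 4 * noise u y" for n using r4[OF u(1)] by (intro AE_I2) simp
    qed (use ni[OF u] jointly_measurable_at[OF rate_jm] in auto)
    have Eb: "\<bar>\<E> (rate (?e n) u)\<bar> \<le> 4 * K" if u: "0 \<le> u" "u \<le> T" for n u
    proof -
      have i4: "integrable M (\<lambda>y. 4 * noise u y)" using ni[OF u] by simp
      have ir: "integrable M (rate (?e n) u)"
      proof (rule Bochner_Integration.integrable_bound[OF i4 jointly_measurable_at[OF rate_jm]])
        show "AE y in M. norm (rate (?e n) u y) \<le> norm (4 * noise u y)"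
          using r4[OF u(1)] noise_nonneg[of u] by (intro AE_I2) (simp add: abs_of_nonneg)
      qed
      have "\<bar>\<E> (rate (?e n) u)\<bar> \<le> \<E> (\<lambda>y. \<bar>rate (?e n) u y\<bar>)" by (rule integral_abs_bound)
      also have "\<dots> \<le> \<E> (\<lambda>y. 4 * noise u y)" using ir i4 r4[OF u(1)] by (intro integral_mono) auto
      also have "\<dots> \<le> 4 * K" using nK[OF u] by simp
      finally show ?thesis .
    qed
    have l2: "(\<lambda>n. LBINT u:{0..T}. \<E> (rate (?e n) u)) \<longlonglongrightarrow> (LBINT u:{0..T}. \<E> (noise u))"
      unfolding set_lebesgue_integral_def
    proof (rule integral_dominated_convergence[where w="\<lambda>u. indicator {0..T} u * (4 * K)"])
      show "integrable lborel (\<lambda>u. indicator {0..T} u * (4 * K))" using T by simp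
      show "AE u in lborel. (\<lambda>n. indicator {0..T} u *\<^sub>R \<E> (rate (?e n) u)) \<longlonglongrightarrow> indicator {0..T} u *\<^sub>R \<E> (noise u)"
        using Er by (intro AE_I2) (auto simp: indicator_def)
      show "AE u in lborel. norm (indicator {0..T} u *\<^sub>R \<E> (rate (?e n) u)) \<le> indicator {0..T} u * (4 * K)" for n
        using Eb by (intro AE_I2) (auto simp: indicator_def)
      show "(\<lambda>u. indicator {0..T} u *\<^sub>R \<E> (rate (?e n) u)) \<in> borel_measurable lborel" for n
      proof -
        have "(\<lambda>u. \<E> (\<lambda>y. rate (?e n) u y)) \<in> borel_measurable lborel"
          using rate_jm unfolding jointly_measurable_def by (rule borel_measurable_lebesgue_integral)
        then show ?thesis by measurable
      qed
    qed (use nm in measurable)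
    have "(\<lambda>n. damped (?e n) v0 + (LBINT u:{0..T}. \<E> (rate (?e n) u)))
      \<longlonglongrightarrow> v0 + (LBINT u:{0..T}. \<E> (noise u))"
      by (intro tendsto_add damped_tendsto v0 l2)
    from LIMSEQ_unique[OF l1[unfolded bal] this] show ?thesis by (simp add: v0_def)
  qed
qed

end

section \<open>The discontinuous Galerkin forms\<close>

text \<open>Integrability is part of the conclusion: if one function fails to be integrable, so does
  the other, and both integrals take the default value 0.\<close>

lemma set_integral_spike:
  fixes f g :: "'a::euclidean_space \<Rightarrow> real"
  assumes "negligible N" "\<And>x. x \<in> S - N \<Longrightarrow> f x = g x"
  shows "set_integrable lebesgue S f \<longleftrightarrow> set_integrable lebesgue S g"
    and "(LINT x:S|lebesgue. f x) = (LINT x:S|lebesgue. g x)"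
proof -
  show *: "set_integrable lebesgue S f \<longleftrightarrow> set_integrable lebesgue S g"
    by (rule absolutely_integrable_spike_eq[OF assms(1)]) (simp add: assms(2))
  show "(LINT x:S|lebesgue. f x) = (LINT x:S|lebesgue. g x)"
  proof (cases "set_integrable lebesgue S f")
    case True
    have "integral S f = integral S g" by (rule integral_spike[OF assms(1)]) (simp add: assms(2))
    then show ?thesis using True * by (simp add: set_lebesgue_integral_eq_integral)
  next
    case False
    then show ?thesis
      using * by (simp add: set_integrable_def set_lebesgue_integral_def not_integrable_integral_eq)
  qed
qed

lemma set_integral_sum:
  fixes f :: "'i \<Rightarrow> 'a \<Rightarrow> real"
  assumes "\<And>i. i \<in> I \<Longrightarrow> set_integrable M A (f i)"
  shows "set_integrable M A (\<lambda>x. \<Sum>i\<in>I. f i x)" and "(LINT x:A|M. \<Sum>i\<in>I. f i x) = (\<Sum>i\<in>I. LINT x:A|M. f i x)"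
  using assms unfolding set_integrable_def set_lebesgue_integral_def
  by (simp_all add: sum_distrib_left)

lemma mesh_less: "mesh xs \<Longrightarrow> i < j \<Longrightarrow> j < length xs \<Longrightarrow> xs ! i < xs ! j"
  by (simp add: mesh_def sorted_wrt_iff_nth_less)

lemma cells_less: "mesh xs \<Longrightarrow> i \<in> cells xs \<Longrightarrow> xs ! (i - 1) < xs ! i"
  by (rule mesh_less) (auto simp: cells_def mesh_def)

lemma mesh_ends: "mesh xs \<Longrightarrow> hd xs = xs ! 0 \<and> last xs = xs ! (length xs - 1)"
  by (cases xs) (auto simp: mesh_def last_conv_nth)

definition pieces :: "real list \<Rightarrow> (real \<Rightarrow> real) \<Rightarrow> (nat \<Rightarrow> real poly) \<Rightarrow> bool" where
  "pieces xs p P \<longleftrightarrow> (\<forall>i\<in>cells xs. \<forall>x\<in>{xs ! (i - 1)<..<xs ! i}. p x = poly (P i) x)"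

text \<open>Periodic identification: at the last node the limit from the right is taken in cell 1 at
  the first node; \<open>left_value\<close> treats node 0 likewise, in the last cell.\<close>

definition right_value :: "real list \<Rightarrow> nat \<Rightarrow> (nat \<Rightarrow> real poly) \<Rightarrow> real" where
  "right_value xs i P = (if i = length xs - 1 then poly (P 1) (xs ! 0) else poly (P (Suc i)) (xs ! i))"

definition left_value :: "real list \<Rightarrow> nat \<Rightarrow> (nat \<Rightarrow> real poly) \<Rightarrow> real" where
  "left_value xs i P = (if i = 0 then poly (P (length xs - 1)) (xs ! (length xs - 1)) else poly (P i) (xs ! i))"

text \<open>\<open>dg_form\<close> with limits and derivatives replaced by operations on
  polynomials. The arguments are families of polynomials, one per cell, so bilinearity holds without
  side conditions on limits or differentiability.\<close>

definition poly_form :: "real list \<Rightarrow> nat \<Rightarrow> (nat \<Rightarrow> real poly) \<Rightarrow> (nat \<Rightarrow> real poly) \<Rightarrow> real \<Rightarrow> real" where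
  "poly_form xs i P Q \<alpha> = (LINT x:cell xs i|lebesgue. poly (P i) x * poly (pderiv (Q i)) x)
    - ((right_value xs i P + left_value xs i P) / 2 + \<alpha> * (right_value xs i P - left_value xs i P)) * left_value xs i Q
    + ((right_value xs (i - 1) P + left_value xs (i - 1) P) / 2
        + \<alpha> * (right_value xs (i - 1) P - left_value xs (i - 1) P)) * right_value xs (i - 1) Q"

lemma Lim_at_right_pieces:
  assumes "mesh xs" "pieces xs p P" "Suc i \<in> cells xs"
  shows "Lim (at_right (xs ! i)) p = poly (P (Suc i)) (xs ! i)"
proof (rule tendsto_Lim)
  have "\<forall>\<^sub>F x in at_right (xs ! i). p x = poly (P (Suc i)) x"
    using eventually_at_right_real[OF cells_less[OF assms(1,3), simplified]] assms(2,3)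
    by (auto simp: pieces_def elim!: eventually_mono)
  moreover have "(poly (P (Suc i)) \<longlongrightarrow> poly (P (Suc i)) (xs ! i)) (at_right (xs ! i))"
    by (intro tendsto_intros)
  ultimately show "(p \<longlongrightarrow> poly (P (Suc i)) (xs ! i)) (at_right (xs ! i))"
    by (simp add: tendsto_cong)
qed simp

lemma Lim_at_left_pieces:
  assumes "mesh xs" "pieces xs p P" "i \<in> cells xs"
  shows "Lim (at_left (xs ! i)) p = poly (P i) (xs ! i)"
proof (rule tendsto_Lim)
  have "\<forall>\<^sub>F x in at_left (xs ! i). p x = poly (P i) x"
    using eventually_at_left_real[OF cells_less[OF assms(1,3)]] assms(2,3)
    by (auto simp: pieces_def elim!: eventually_mono)
  moreover have "(poly (P i) \<longlongrightarrow> poly (P i) (xs ! i)) (at_left (xs ! i))"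
    by (intro tendsto_intros)
  ultimately show "(p \<longlongrightarrow> poly (P i) (xs ! i)) (at_left (xs ! i))"
    by (simp add: tendsto_cong)
qed simp

lemma trace_pieces:
  assumes "mesh xs" "pieces xs p P" "i \<le> length xs - 1"
  shows "trace_right xs i p = right_value xs i P" "trace_left xs i p = left_value xs i P"
proof -
  have N: "2 \<le> length xs" using assms(1) by (simp add: mesh_def)
  show "trace_right xs i p = right_value xs i P"
    using assms N Lim_at_right_pieces[OF assms(1,2), of 0] Lim_at_right_pieces[OF assms(1,2), of i] mesh_ends[OF assms(1)]
    by (auto simp: trace_right_def right_value_def cells_def)
  show "trace_left xs i p = left_value xs i P"
    using assms N Lim_at_left_pieces[OF assms(1,2), of i] Lim_at_left_pieces[OF assms(1,2), of "length xs - 1"] mesh_ends[OF assms(1)]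
    by (auto simp: trace_left_def left_value_def cells_def)
qed

lemma deriv_pieces:
  assumes "pieces xs q Q" "i \<in> cells xs" "x \<in> {xs ! (i - 1)<..<xs ! i}"
  shows "deriv q x = poly (pderiv (Q i)) x"
proof (rule DERIV_imp_deriv)
  show "(q has_real_derivative poly (pderiv (Q i)) x) (at x)"
    by (rule has_field_derivative_transform_within_open[OF poly_DERIV[of "Q i"] open_greaterThanLessThan assms(3)])
      (use assms in \<open>auto simp: pieces_def\<close>)
qed

lemma set_integrable_poly: "set_integrable lebesgue (cell xs i) (poly (P :: real poly))"
proof -
  have "continuous_on (cbox (xs ! (i - 1)) (xs ! i)) (poly P)" by (intro continuous_intros)
  from absolutely_integrable_continuous[OF this] show ?thesis by (simp add: cell_def)
qed

lemma dg_form_pieces: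
  assumes m: "mesh xs" and p: "pieces xs p P" and q: "pieces xs q Q" and i: "i \<in> cells xs"
  shows "dg_form xs i p q \<alpha> = poly_form xs i P Q \<alpha>"
proof -
  have "(LINT x:cell xs i|lebesgue. p x * deriv q x) = (LINT x:cell xs i|lebesgue. poly (P i) x * poly (pderiv (Q i)) x)"
  proof (rule set_integral_spike(2)[where N="{xs ! (i - 1), xs ! i}"])
    fix x assume "x \<in> cell xs i - {xs ! (i - 1), xs ! i}"
    then have "x \<in> {xs ! (i - 1)<..<xs ! i}" by (auto simp: cell_def)
    then show "p x * deriv q x = poly (P i) x * poly (pderiv (Q i)) x"
      using p i deriv_pieces[OF q i] by (auto simp: pieces_def)
  qed simp
  moreover have "i \<le> length xs - 1" "i - 1 \<le> length xs - 1" using i by (auto simp: cells_def)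
  ultimately show ?thesis
    using trace_pieces[OF m p] trace_pieces[OF m q] by (simp add: dg_form_def poly_form_def flux_def)
qed

lemma poly_form_add_left: "poly_form xs i (\<lambda>i. P i + P' i) Q \<alpha> = poly_form xs i P Q \<alpha> + poly_form xs i P' Q \<alpha>"
proof -
  have "(LINT x:cell xs i|lebesgue. poly (P i + P' i) x * poly (pderiv (Q i)) x) =
      (LINT x:cell xs i|lebesgue. poly (P i) x * poly (pderiv (Q i)) x) + (LINT x:cell xs i|lebesgue. poly (P' i) x * poly (pderiv (Q i)) x)"
    by (subst set_integral_add(2)[symmetric])
      (simp_all add: set_integrable_poly[of _ _ "_ * _", unfolded poly_mult] distrib_right)
  moreover have "right_value xs i (\<lambda>i. P i + P' i) = right_value xs i P + right_value xs i P'"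
    "left_value xs i (\<lambda>i. P i + P' i) = left_value xs i P + left_value xs i P'" for i
    by (simp_all add: right_value_def left_value_def)
  ultimately show ?thesis by (simp add: poly_form_def field_simps)
qed

lemma poly_form_add_right: "poly_form xs i P (\<lambda>i. Q i + Q' i) \<alpha> = poly_form xs i P Q \<alpha> + poly_form xs i P Q' \<alpha>"
proof -
  have "(LINT x:cell xs i|lebesgue. poly (P i) x * poly (pderiv (Q i + Q' i)) x) =
      (LINT x:cell xs i|lebesgue. poly (P i) x * poly (pderiv (Q i)) x) + (LINT x:cell xs i|lebesgue. poly (P i) x * poly (pderiv (Q' i)) x)"
    by (subst set_integral_add(2)[symmetric])
      (simp_all add: set_integrable_poly[of _ _ "_ * _", unfolded poly_mult] distrib_left pderiv_add)
  moreover have "right_value xs i (\<lambda>i. Q i + Q' i) = right_value xs i Q + right_value xs i Q'"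
    "left_value xs i (\<lambda>i. Q i + Q' i) = left_value xs i Q + left_value xs i Q'" for i
    by (simp_all add: right_value_def left_value_def)
  ultimately show ?thesis by (simp add: poly_form_def algebra_simps add_divide_distrib)
qed

lemma poly_form_smult:
  "poly_form xs i (\<lambda>i. smult s (P i)) Q \<alpha> = s * poly_form xs i P Q \<alpha>"
  "poly_form xs i P (\<lambda>i. smult s (Q i)) \<alpha> = s * poly_form xs i P Q \<alpha>"
proof -
  have *: "right_value xs i (\<lambda>i. smult s (P i)) = s * right_value xs i P"
    "left_value xs i (\<lambda>i. smult s (P i)) = s * left_value xs i P" for i P
    by (simp_all add: right_value_def left_value_def)
  show "poly_form xs i (\<lambda>i. smult s (P i)) Q \<alpha> = s * poly_form xs i P Q \<alpha>"
    by (simp add: poly_form_def * field_simps)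
  show "poly_form xs i P (\<lambda>i. smult s (Q i)) \<alpha> = s * poly_form xs i P Q \<alpha>"
  proof -
    have "(LINT x:cell xs i|lebesgue. poly (P i) x * poly (pderiv (smult s (Q i))) x) = s * (LINT x:cell xs i|lebesgue. poly (P i) x * poly (pderiv (Q i)) x)"
      by (simp add: pderiv_smult mult.left_commute[of _ s])
    then show ?thesis by (simp add: poly_form_def * right_diff_distrib distrib_left mult.left_commute[of s])
  qed
qed

lemma poly_form_sum_left:
  "poly_form xs i (\<lambda>i. \<Sum>b\<in>A. smult (s b) (P b i)) Q \<alpha> = (\<Sum>b\<in>A. s b * poly_form xs i (P b) Q \<alpha>)"
proof -
  have "poly_form xs i (\<lambda>i. 0) Q \<alpha> = 0" using poly_form_smult(1)[of xs i 0 "\<lambda>_. 0" Q \<alpha>] by simp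
  then show ?thesis
    by (induction A rule: infinite_finite_induct) (simp_all add: poly_form_add_left poly_form_smult)
qed

lemma poly_form_sum_right:
  "poly_form xs i P (\<lambda>i. \<Sum>b\<in>A. smult (s b) (Q b i)) \<alpha> = (\<Sum>b\<in>A. s b * poly_form xs i P (Q b) \<alpha>)"
proof -
  have "poly_form xs i P (\<lambda>i. 0) \<alpha> = 0" using poly_form_smult(2)[of xs i P 0 "\<lambda>_. 0" \<alpha>] by simp
  then show ?thesis
    by (induction A rule: infinite_finite_induct) (simp_all add: poly_form_add_right poly_form_smult)
qed

text \<open>After integration by parts each node contributes
  \<open>p\<^sup>-q\<^sup>- - p\<^sup>+q\<^sup>+ + ({p} + \<alpha>[p])[q] + ({q} - \<alpha>[q])[p] = 0\<close>.\<close>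

lemma node_identity:
  fixes \<alpha> :: real
  assumes "I + J = lp * lq - rp' * rq'"
  shows "I - ((rp + lp) / 2 + \<alpha> * (rp - lp)) * lq + ((rp' + lp') / 2 + \<alpha> * (rp' - lp')) * rq'
      + (J - ((rq + lq) / 2 + - \<alpha> * (rq - lq)) * lp + ((rq' + lq') / 2 + - \<alpha> * (rq' - lq')) * rp')
    = (lp * lq - ((rp + lp) / 2 + \<alpha> * (rp - lp)) * lq - ((rq + lq) / 2 - \<alpha> * (rq - lq)) * lp)
      - (lp' * lq' - ((rp' + lp') / 2 + \<alpha> * (rp' - lp')) * lq' - ((rq' + lq') / 2 - \<alpha> * (rq' - lq')) * lp')"
proof -
  have "I = lp * lq - rp' * rq' - J" using assms by simp
  then show ?thesis by (simp add: algebra_simps add_divide_distrib)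
qed

text \<open>On each cell the two forms add up to the difference of a quantity at its two nodes; the
  sum over cells telescopes, and the periodic identification makes both ends equal.\<close>

lemma poly_form_skew:
  assumes m: "mesh xs"
  shows "(\<Sum>i\<in>cells xs. poly_form xs i P Q \<alpha>) + (\<Sum>i\<in>cells xs. poly_form xs i Q P (- \<alpha>)) = 0"
proof -
  \<comment> \<open>Outside the fluxes only limits from the left occur. At the left node of a cell
    those from the right would be natural; by the cancellation at a node both expressions are
    equal.\<close>
  define G where "G = (\<lambda>i. left_value xs i P * left_value xs i Q
    - ((right_value xs i P + left_value xs i P) / 2 + \<alpha> * (right_value xs i P - left_value xs i P)) * left_value xs i Q
    - ((right_value xs i Q + left_value xs i Q) / 2 - \<alpha> * (right_value xs i Q - left_value xs i Q)) * left_value xs i P)"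
  have step: "poly_form xs i P Q \<alpha> + poly_form xs i Q P (- \<alpha>) = G i - G (i - 1)" if i: "i \<in> cells xs" for i
  proof -
    let ?a = "xs ! (i - 1)" and ?b = "xs ! i"
    have ab: "?a \<le> ?b" using cells_less[OF m i] by simp
    have "((\<lambda>x. poly (pderiv (P i * Q i)) x) has_integral (poly (P i * Q i) ?b - poly (P i * Q i) ?a)) {?a..?b}"
      using ab by (intro fundamental_theorem_of_calculus)
        (auto simp: has_real_derivative_iff_has_vector_derivative[symmetric] simp del: poly_mult intro: DERIV_subset[OF poly_DERIV])
    then have "(LINT x:cell xs i|lebesgue. poly (pderiv (P i * Q i)) x) = poly (P i * Q i) ?b - poly (P i * Q i) ?a"
      using set_lebesgue_integral_eq_integral(2)[OF set_integrable_poly[of xs i "pderiv (P i * Q i)"]]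
      by (simp add: integral_unique cell_def)
    moreover have "(LINT x:cell xs i|lebesgue. poly (pderiv (P i * Q i)) x) =
        (LINT x:cell xs i|lebesgue. poly (P i) x * poly (pderiv (Q i)) x) + (LINT x:cell xs i|lebesgue. poly (Q i) x * poly (pderiv (P i)) x)"
    proof -
      have "poly (pderiv (P i * Q i)) = (\<lambda>x. poly (P i) x * poly (pderiv (Q i)) x + poly (Q i) x * poly (pderiv (P i)) x)"
        by (simp add: pderiv_mult fun_eq_iff)
      then show ?thesis
        by (simp add: set_integral_add(2) set_integrable_poly[of _ _ "_ * _", unfolded poly_mult])
    qed
    moreover have "left_value xs i R = poly (R i) ?b" "right_value xs (i - 1) R = poly (R i) ?a" for R
      using i by (auto simp: left_value_def right_value_def cells_def)
    ultimately have "(LINT x:cell xs i|lebesgue. poly (P i) x * poly (pderiv (Q i)) x) + (LINT x:cell xs i|lebesgue. poly (Q i) x * poly (pderiv (P i)) x)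
        = left_value xs i P * left_value xs i Q - right_value xs (i - 1) P * right_value xs (i - 1) Q"
      by simp
    then show ?thesis unfolding poly_form_def G_def by (rule node_identity)
  qed
  have "(\<Sum>i\<in>cells xs. poly_form xs i P Q \<alpha>) + (\<Sum>i\<in>cells xs. poly_form xs i Q P (- \<alpha>)) = (\<Sum>i\<in>{1..length xs - 1}. G i - G (i - 1))"
    by (simp add: sum.distrib[symmetric] step) (simp add: cells_def)
  also have "\<dots> = (\<Sum>i<length xs - 1. G (Suc i) - G i)"
    by (rule sum.reindex_bij_witness[of _ Suc "\<lambda>i. i - 1"]) auto
  also have "\<dots> = G (length xs - 1) - G 0" by (rule sum_lessThan_telescope)
  also have "G (length xs - 1) = G 0"
  proof -
    have "right_value xs (length xs - 1) R = right_value xs 0 R" "left_value xs (length xs - 1) R = left_value xs 0 R" for R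
      using m by (auto simp: right_value_def left_value_def mesh_def)
    then show ?thesis by (simp add: G_def)
  qed
  finally show ?thesis by simp
qed

section \<open>Forms on the two-dimensional mesh\<close>

abbreviation open_cell :: "real list \<Rightarrow> real list \<Rightarrow> nat \<Rightarrow> nat \<Rightarrow> (real \<times> real) set" where
  "open_cell xs ys i j \<equiv> interior (cell xs i \<times> cell ys j)"

text \<open>Equality off the mesh lines, the sense in which polynomials on the cells determine an
  element of \<open>Vh\<close>.\<close>

definition agree :: "real list \<Rightarrow> real list \<Rightarrow> (real \<times> real \<Rightarrow> real) \<Rightarrow> (real \<times> real \<Rightarrow> real) \<Rightarrow> bool" where
  "agree xs ys v w \<longleftrightarrow> (\<forall>i\<in>cells xs. \<forall>j\<in>cells ys. \<forall>z\<in>open_cell xs ys i j. v z = w z)"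

lemma interior_cell: "open_cell xs ys i j = {xs ! (i - 1)<..<xs ! i} \<times> {ys ! (j - 1)<..<ys ! j}"
  by (simp add: interior_Times cell_def)

text \<open>On each cell the function is a polynomial in y whose coefficients are polynomials in x.
  The cell index in x comes last, so that \<open>V b j\<close> is a family to which
  \<open>poly_form\<close> applies.\<close>

definition y_expansion :: "real list \<Rightarrow> real list \<Rightarrow> nat \<Rightarrow> (real \<times> real \<Rightarrow> real) \<Rightarrow> (nat \<Rightarrow> nat \<Rightarrow> nat \<Rightarrow> real poly) \<Rightarrow> bool" where
  "y_expansion xs ys k v V \<longleftrightarrow> (\<forall>i\<in>cells xs. \<forall>j\<in>cells ys. \<forall>z\<in>open_cell xs ys i j.
    v z = (\<Sum>b\<le>k. snd z ^ b * poly (V b j i) (fst z)))"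

lemma Vh_coefficients:
  assumes "v \<in> Vh xs ys k"
  shows "\<exists>c. \<forall>i\<in>cells xs. \<forall>j\<in>cells ys. \<forall>z\<in>open_cell xs ys i j.
    v z = (\<Sum>a\<le>k. \<Sum>b\<le>k. c i j a b * fst z ^ a * snd z ^ b)"
proof -
  have "\<forall>i j. \<exists>c. i \<in> cells xs \<longrightarrow> j \<in> cells ys \<longrightarrow> (\<forall>z\<in>open_cell xs ys i j.
      v z = (\<Sum>a\<le>k. \<Sum>b\<le>k. c a b * fst z ^ a * snd z ^ b))"
  proof (intro allI)
    fix i j
    show "\<exists>c. i \<in> cells xs \<longrightarrow> j \<in> cells ys \<longrightarrow> (\<forall>z\<in>open_cell xs ys i j.
      v z = (\<Sum>a\<le>k. \<Sum>b\<le>k. c a b * fst z ^ a * snd z ^ b))"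
    proof (cases "i \<in> cells xs \<and> j \<in> cells ys")
      case True
      then obtain q where q: "q \<in> Qk k" "\<forall>z\<in>open_cell xs ys i j. v z = q z"
        using assms unfolding Vh_def by blast
      then obtain c where "\<And>x y. q (x, y) = (\<Sum>a\<le>k. \<Sum>b\<le>k. c a b * x ^ a * y ^ b)" by (auto simp: Qk_def)
      then have "q z = (\<Sum>a\<le>k. \<Sum>b\<le>k. c a b * fst z ^ a * snd z ^ b)" for z by (cases z) simp
      then have "\<forall>z\<in>open_cell xs ys i j. v z = (\<Sum>a\<le>k. \<Sum>b\<le>k. c a b * fst z ^ a * snd z ^ b)"
        using q(2) by simp
      then show ?thesis by blast
    qed blast
  qed
  then show ?thesis unfolding choice_iff by blast
qed

lemma y_expansion_exists:
  assumes "v \<in> Vh xs ys k"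
  shows "\<exists>V. y_expansion xs ys k v V"
proof -
  obtain c where c: "\<forall>i\<in>cells xs. \<forall>j\<in>cells ys. \<forall>z\<in>open_cell xs ys i j.
      v z = (\<Sum>a\<le>k. \<Sum>b\<le>k. c i j a b * fst z ^ a * snd z ^ b)" using Vh_coefficients[OF assms] by blast
  have "y_expansion xs ys k v (\<lambda>b j i. \<Sum>a\<le>k. monom (c i j a b) a)"
    unfolding y_expansion_def
  proof (intro ballI)
    fix i j z assume z: "i \<in> cells xs" "j \<in> cells ys" "z \<in> open_cell xs ys i j"
    show "v z = (\<Sum>b\<le>k. snd z ^ b * poly (\<Sum>a\<le>k. monom (c i j a b) a) (fst z))"
    proof -
      have "v z = (\<Sum>a\<le>k. \<Sum>b\<le>k. c i j a b * fst z ^ a * snd z ^ b)"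
        by (rule c[rule_format]) (rule z)+
      also have "\<dots> = (\<Sum>b\<le>k. \<Sum>a\<le>k. c i j a b * fst z ^ a * snd z ^ b)" by (rule sum.swap)
      also have "\<dots> = (\<Sum>b\<le>k. snd z ^ b * poly (\<Sum>a\<le>k. monom (c i j a b) a) (fst z))"
        by (intro sum.cong refl) (simp add: poly_sum poly_monom sum_distrib_left mult.assoc mult.commute[of "snd z ^ _"])
      finally show ?thesis .
    qed
  qed
  then show ?thesis by (rule exI[where P="y_expansion xs ys k v"])
qed

definition dg_total :: "real list \<Rightarrow> real list \<Rightarrow> (real \<times> real \<Rightarrow> real) \<Rightarrow> (real \<times> real \<Rightarrow> real) \<Rightarrow> real \<Rightarrow> real" where
  "dg_total xs ys v w \<alpha> = (\<Sum>j\<in>cells ys. \<Sum>i\<in>cells xs. LINT y:cell ys j|lebesgue. dg_form_x xs i v w \<alpha> y)"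

text \<open>Separation of variables: a form in x integrated over y is a sum of y-moments times
  one-dimensional forms. Linearity and skew-symmetry on the rectangle are then inherited from
  \<open>poly_form\<close>.\<close>

lemma dg_total_expansion:
  assumes m: "mesh xs" "mesh ys" and V: "y_expansion xs ys k v V" and U: "y_expansion xs ys k w U"
  shows "dg_total xs ys v w \<alpha> = (\<Sum>j\<in>cells ys. \<Sum>b\<le>k. \<Sum>b'\<le>k. (LINT y:cell ys j|lebesgue. y ^ b * y ^ b') *
    (\<Sum>i\<in>cells xs. poly_form xs i (V b j) (U b' j) \<alpha>))"
  unfolding dg_total_def
proof (rule sum.cong[OF refl])
  fix j assume j: "j \<in> cells ys"
  have iy: "set_integrable lebesgue (cell ys j) (\<lambda>y. y ^ b * y ^ b' * c)" for b b' and c :: real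
    using set_integrable_poly[of ys j "monom c (b + b')"] by (simp add: poly_monom[abs_def] power_add mult_ac)
  have "(LINT y:cell ys j|lebesgue. dg_form_x xs i v w \<alpha> y) =
      (\<Sum>b\<le>k. \<Sum>b'\<le>k. (LINT y:cell ys j|lebesgue. y ^ b * y ^ b') * poly_form xs i (V b j) (U b' j) \<alpha>)" if i: "i \<in> cells xs" for i
  proof -
    have "(LINT y:cell ys j|lebesgue. dg_form_x xs i v w \<alpha> y) =
        (LINT y:cell ys j|lebesgue. \<Sum>b\<le>k. \<Sum>b'\<le>k. y ^ b * y ^ b' * poly_form xs i (V b j) (U b' j) \<alpha>)"
    \<comment> \<open>At the two end values of y the functions \<open>v\<close> and \<open>w\<close>
      are arbitrary, so the integrand is known only inside the cell.\<close>
    proof (rule set_integral_spike(2)[where N="{ys ! (j - 1), ys ! j}"])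
      fix y assume "y \<in> cell ys j - {ys ! (j - 1), ys ! j}"
      then have y: "y \<in> {ys ! (j - 1)<..<ys ! j}" by (auto simp: cell_def)
      have pc: "pieces xs (\<lambda>x. v (x, y)) (\<lambda>i. \<Sum>b\<le>k. smult (y ^ b) (V b j i))"
        if "y_expansion xs ys k v V" for v V
        using that j y by (auto simp: y_expansion_def pieces_def interior_cell poly_sum)
      show "dg_form_x xs i v w \<alpha> y = (\<Sum>b\<le>k. \<Sum>b'\<le>k. y ^ b * y ^ b' * poly_form xs i (V b j) (U b' j) \<alpha>)"
        unfolding dg_form_x_def dg_form_pieces[OF m(1) pc[OF V] pc[OF U] i] poly_form_sum_left poly_form_sum_right
        by (simp add: sum_distrib_left mult_ac)
    qed simp
    also have "\<dots> = (\<Sum>b\<le>k. \<Sum>b'\<le>k. LINT y:cell ys j|lebesgue. y ^ b * y ^ b' * poly_form xs i (V b j) (U b' j) \<alpha>)"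
      by (simp add: set_integral_sum iy)
    finally show ?thesis by simp
  qed
  then have "(\<Sum>i\<in>cells xs. LINT y:cell ys j|lebesgue. dg_form_x xs i v w \<alpha> y) = (\<Sum>i\<in>cells xs. \<Sum>b\<le>k. \<Sum>b'\<le>k.
      (LINT y:cell ys j|lebesgue. y ^ b * y ^ b') * poly_form xs i (V b j) (U b' j) \<alpha>)" by simp
  also have "\<dots> = (\<Sum>b\<le>k. \<Sum>b'\<le>k. \<Sum>i\<in>cells xs. (LINT y:cell ys j|lebesgue. y ^ b * y ^ b') * poly_form xs i (V b j) (U b' j) \<alpha>)"
    by (subst sum.swap, rule sum.cong[OF refl], rule sum.swap)
  finally show "(\<Sum>i\<in>cells xs. LINT y:cell ys j|lebesgue. dg_form_x xs i v w \<alpha> y) =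
      (\<Sum>b\<le>k. \<Sum>b'\<le>k. (LINT y:cell ys j|lebesgue. y ^ b * y ^ b') * (\<Sum>i\<in>cells xs. poly_form xs i (V b j) (U b' j) \<alpha>))"
    by (simp only: sum_distrib_left)
qed

text \<open>Values on the mesh lines are arbitrary, so linearity is stated up to
  \<open>agree\<close>. It is what turns the scheme into a linear system for the
  coordinates.\<close>

lemma dg_total_linear:
  assumes m: "mesh xs" "mesh ys" and w: "w \<in> Vh xs ys k" and e: "\<And>l. l \<in> A \<Longrightarrow> e l \<in> Vh xs ys k"
    and v: "agree xs ys v (\<lambda>z. \<Sum>l\<in>A. c l * e l z)"
  shows "dg_total xs ys v w \<alpha> = (\<Sum>l\<in>A. c l * dg_total xs ys (e l) w \<alpha>)"
proof -
  obtain U where U: "y_expansion xs ys k w U" using y_expansion_exists[OF w] by blast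
  have "\<forall>l. \<exists>V. l \<in> A \<longrightarrow> y_expansion xs ys k (e l) V" using y_expansion_exists[OF e] by blast
  then obtain V where V: "\<And>l. l \<in> A \<Longrightarrow> y_expansion xs ys k (e l) (V l)" by metis
  have "y_expansion xs ys k v (\<lambda>b j i. \<Sum>l\<in>A. smult (c l) (V l b j i))"
    unfolding y_expansion_def
  proof (intro ballI)
    fix i j z assume z: "i \<in> cells xs" "j \<in> cells ys" "z \<in> open_cell xs ys i j"
    have "v z = (\<Sum>l\<in>A. c l * e l z)" using v z by (auto simp: agree_def)
    also have "\<dots> = (\<Sum>l\<in>A. c l * (\<Sum>b\<le>k. snd z ^ b * poly (V l b j i) (fst z)))"
      using V z by (intro sum.cong refl arg_cong2[where f="(*)"]) (auto simp: y_expansion_def)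
    also have "\<dots> = (\<Sum>b\<le>k. \<Sum>l\<in>A. c l * (snd z ^ b * poly (V l b j i) (fst z)))"
      unfolding sum_distrib_left by (rule sum.swap)
    finally show "v z = (\<Sum>b\<le>k. snd z ^ b * poly (\<Sum>l\<in>A. smult (c l) (V l b j i)) (fst z))"
      by (simp add: poly_sum sum_distrib_left mult_ac)
  qed
  note dg_total_expansion[OF m this U, of \<alpha>]
  also have "(\<Sum>j\<in>cells ys. \<Sum>b\<le>k. \<Sum>b'\<le>k. (LINT y:cell ys j|lebesgue. y ^ b * y ^ b') *
      (\<Sum>i\<in>cells xs. poly_form xs i (\<lambda>i. \<Sum>l\<in>A. smult (c l) (V l b j i)) (U b' j) \<alpha>)) =
    (\<Sum>j\<in>cells ys. \<Sum>b\<le>k. \<Sum>b'\<le>k. \<Sum>l\<in>A. c l * ((LINT y:cell ys j|lebesgue. y ^ b * y ^ b') *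
      (\<Sum>i\<in>cells xs. poly_form xs i (V l b j) (U b' j) \<alpha>)))"
  proof (intro sum.cong refl)
    fix j b b'
    have "(\<Sum>i\<in>cells xs. poly_form xs i (\<lambda>i. \<Sum>l\<in>A. smult (c l) (V l b j i)) (U b' j) \<alpha>) =
        (\<Sum>l\<in>A. c l * (\<Sum>i\<in>cells xs. poly_form xs i (V l b j) (U b' j) \<alpha>))"
      unfolding poly_form_sum_left sum_distrib_left by (rule sum.swap)
    then show "(LINT y:cell ys j|lebesgue. y ^ b * y ^ b') * (\<Sum>i\<in>cells xs. poly_form xs i (\<lambda>i. \<Sum>l\<in>A. smult (c l) (V l b j i)) (U b' j) \<alpha>)
      = (\<Sum>l\<in>A. c l * ((LINT y:cell ys j|lebesgue. y ^ b * y ^ b') * (\<Sum>i\<in>cells xs. poly_form xs i (V l b j) (U b' j) \<alpha>)))"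
      by (simp add: sum_distrib_left mult.left_commute)
  qed
  also have "\<dots> = (\<Sum>l\<in>A. \<Sum>j\<in>cells ys. \<Sum>b\<le>k. \<Sum>b'\<le>k. c l * ((LINT y:cell ys j|lebesgue. y ^ b * y ^ b') *
      (\<Sum>i\<in>cells xs. poly_form xs i (V l b j) (U b' j) \<alpha>)))"
    (is "(\<Sum>j\<in>_. \<Sum>b\<in>_. \<Sum>b'\<in>_. \<Sum>l\<in>A. ?f j b b' l) = _")
  proof -
    have "(\<Sum>b\<le>k. \<Sum>b'\<le>k. \<Sum>l\<in>A. ?f j b b' l) = (\<Sum>l\<in>A. \<Sum>b\<le>k. \<Sum>b'\<le>k. ?f j b b' l)" for j
      by (rule trans[OF sum.cong[OF refl sum.swap] sum.swap])
    then have "(\<Sum>j\<in>cells ys. \<Sum>b\<le>k. \<Sum>b'\<le>k. \<Sum>l\<in>A. ?f j b b' l) = (\<Sum>j\<in>cells ys. \<Sum>l\<in>A. \<Sum>b\<le>k. \<Sum>b'\<le>k. ?f j b b' l)"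
      by (intro sum.cong refl)
    also have "\<dots> = (\<Sum>l\<in>A. \<Sum>j\<in>cells ys. \<Sum>b\<le>k. \<Sum>b'\<le>k. ?f j b b' l)" by (rule sum.swap)
    finally show ?thesis .
  qed
  also have "\<dots> = (\<Sum>l\<in>A. c l * dg_total xs ys (e l) w \<alpha>)"
    using dg_total_expansion[OF m V U, of _ \<alpha>] by (simp add: sum_distrib_left)
  finally show ?thesis .
qed

text \<open>The matrix of y-moments is symmetric in \<open>b\<close> and \<open>b'\<close>, so
  exchanging the arguments merely exchanges the one-dimensional forms.\<close>

lemma dg_total_skew:
  assumes m: "mesh xs" "mesh ys" and v: "v \<in> Vh xs ys k" and w: "w \<in> Vh xs ys k"
  shows "dg_total xs ys w v (- \<alpha>) = - dg_total xs ys v w \<alpha>"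
proof -
  obtain V U where V: "y_expansion xs ys k v V" and U: "y_expansion xs ys k w U"
    using y_expansion_exists v w by blast
  have eq: "(\<Sum>i\<in>cells xs. poly_form xs i P Q (- \<alpha>)) = - (\<Sum>i\<in>cells xs. poly_form xs i Q P \<alpha>)" for P Q
    using poly_form_skew[OF m(1), of Q P \<alpha>] by linarith
  show ?thesis
    unfolding dg_total_expansion[OF m V U] dg_total_expansion[OF m U V] sum_negf[symmetric]
  proof (rule sum.cong[OF refl])
    fix j
    show "(\<Sum>b\<le>k. \<Sum>b'\<le>k. (LINT y:cell ys j|lebesgue. y ^ b * y ^ b') * (\<Sum>i\<in>cells xs. poly_form xs i (U b j) (V b' j) (- \<alpha>)))
      = (\<Sum>b\<le>k. \<Sum>b'\<le>k. - ((LINT y:cell ys j|lebesgue. y ^ b * y ^ b') * (\<Sum>i\<in>cells xs. poly_form xs i (V b j) (U b' j) \<alpha>)))"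
      by (subst sum.swap) (simp add: eq mult.commute)
  qed
qed

lemma mesh_le: "mesh xs \<Longrightarrow> i \<le> j \<Longrightarrow> j < length xs \<Longrightarrow> xs ! i \<le> xs ! j"
  using mesh_less[of xs i j] by (cases "i = j") auto

section \<open>The discontinuous Galerkin space\<close>

text \<open>The coefficients along the numerical solution need not belong to \<open>Vh\<close>, but
  they still extend continuously from each open cell to the closed one; this class contains both
  kinds of functions, and its members are integrable over the rectangle.\<close>

definition piecewise_continuous :: "real list \<Rightarrow> real list \<Rightarrow> (real \<times> real \<Rightarrow> real) \<Rightarrow> bool" where
  "piecewise_continuous xs ys f \<longleftrightarrow> (\<forall>i\<in>cells xs. \<forall>j\<in>cells ys. \<exists>q.
    continuous_on (cell xs i \<times> cell ys j) q \<and> (\<forall>z\<in>open_cell xs ys i j. f z = q z))"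

lemma piecewise_continuous_const: "piecewise_continuous xs ys (\<lambda>_. c)"
  by (auto simp: piecewise_continuous_def intro!: exI[of _ "\<lambda>_. c"])

lemma piecewise_continuous_comp2:
  fixes \<phi> :: "real \<Rightarrow> real \<Rightarrow> real"
  assumes "piecewise_continuous xs ys f" "piecewise_continuous xs ys g"
    and \<phi>: "\<And>A p q. continuous_on A p \<Longrightarrow> continuous_on A q \<Longrightarrow> continuous_on A (\<lambda>z :: real \<times> real. \<phi> (p z) (q z))"
  shows "piecewise_continuous xs ys (\<lambda>z. \<phi> (f z) (g z))"
  unfolding piecewise_continuous_def
proof (intro ballI)
  fix i j assume ij: "i \<in> cells xs" "j \<in> cells ys"
  obtain p where p: "continuous_on (cell xs i \<times> cell ys j) p" "\<forall>z\<in>open_cell xs ys i j. f z = p z"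
    using assms(1) ij unfolding piecewise_continuous_def by blast
  obtain q where q: "continuous_on (cell xs i \<times> cell ys j) q" "\<forall>z\<in>open_cell xs ys i j. g z = q z"
    using assms(2) ij unfolding piecewise_continuous_def by blast
  show "\<exists>q. continuous_on (cell xs i \<times> cell ys j) q \<and> (\<forall>z\<in>open_cell xs ys i j. \<phi> (f z) (g z) = q z)"
    by (rule exI[of _ "\<lambda>z. \<phi> (p z) (q z)"]) (use p q \<phi>[OF p(1) q(1)] in simp)
qed

lemma piecewise_continuous_mult:
  "piecewise_continuous xs ys f \<Longrightarrow> piecewise_continuous xs ys g \<Longrightarrow> piecewise_continuous xs ys (\<lambda>z. f z * g z)"
  by (erule (1) piecewise_continuous_comp2) (rule continuous_on_mult)

lemma Vh_iff:
  "v \<in> Vh xs ys k \<longleftrightarrow> (\<exists>c. \<forall>i\<in>cells xs. \<forall>j\<in>cells ys. \<forall>z\<in>open_cell xs ys i j.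
    v z = (\<Sum>a\<le>k. \<Sum>b\<le>k. c i j a b * fst z ^ a * snd z ^ b))" (is "_ \<longleftrightarrow> ?R")
proof
  assume ?R
  then obtain c where c: "\<forall>i\<in>cells xs. \<forall>j\<in>cells ys. \<forall>z\<in>open_cell xs ys i j.
    v z = (\<Sum>a\<le>k. \<Sum>b\<le>k. c i j a b * fst z ^ a * snd z ^ b)" by blast
  have "(\<lambda>z. \<Sum>a\<le>k. \<Sum>b\<le>k. c i j a b * fst z ^ a * snd z ^ b) \<in> Qk k" for i j
    unfolding Qk_def by (auto intro!: exI[of _ "c i j"])
  then have "\<exists>q\<in>Qk k. \<forall>z\<in>open_cell xs ys i j. v z = q z" if "i \<in> cells xs" "j \<in> cells ys" for i j
    using c that by (intro bexI[of _ "\<lambda>z. \<Sum>a\<le>k. \<Sum>b\<le>k. c i j a b * fst z ^ a * snd z ^ b"]) auto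
  then show "v \<in> Vh xs ys k" by (simp add: Vh_def)
qed (rule Vh_coefficients)

lemma Vh_sum:
  assumes "\<And>l. l \<in> A \<Longrightarrow> e l \<in> Vh xs ys k"
  shows "(\<lambda>z. \<Sum>l\<in>A. c l * e l z) \<in> Vh xs ys k"
proof -
  have "\<forall>l. \<exists>d. l \<in> A \<longrightarrow> (\<forall>i\<in>cells xs. \<forall>j\<in>cells ys. \<forall>z\<in>open_cell xs ys i j.
    e l z = (\<Sum>a\<le>k. \<Sum>b\<le>k. d i j a b * fst z ^ a * snd z ^ b))"
    using assms unfolding Vh_iff by blast
  then obtain d where d: "\<And>l. l \<in> A \<Longrightarrow> \<forall>i\<in>cells xs. \<forall>j\<in>cells ys. \<forall>z\<in>open_cell xs ys i j.
    e l z = (\<Sum>a\<le>k. \<Sum>b\<le>k. d l i j a b * fst z ^ a * snd z ^ b)"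
    unfolding choice_iff by blast
  show ?thesis
    unfolding Vh_iff
  proof (intro exI ballI)
    fix i j z assume z: "i \<in> cells xs" "j \<in> cells ys" "z \<in> open_cell xs ys i j"
    have "(\<Sum>l\<in>A. c l * e l z) = (\<Sum>l\<in>A. \<Sum>a\<le>k. \<Sum>b\<le>k. c l * d l i j a b * fst z ^ a * snd z ^ b)"
      using d[rule_format, OF _ z] by (intro sum.cong refl) (simp add: sum_distrib_left mult.assoc)
    also have "\<dots> = (\<Sum>a\<le>k. \<Sum>l\<in>A. \<Sum>b\<le>k. c l * d l i j a b * fst z ^ a * snd z ^ b)" by (rule sum.swap)
    also have "\<dots> = (\<Sum>a\<le>k. \<Sum>b\<le>k. \<Sum>l\<in>A. c l * d l i j a b * fst z ^ a * snd z ^ b)"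
      by (intro sum.cong[OF refl] sum.swap)
    finally show "(\<Sum>l\<in>A. c l * e l z) = (\<Sum>a\<le>k. \<Sum>b\<le>k. (\<Sum>l\<in>A. c l * d l i j a b) * fst z ^ a * snd z ^ b)"
      by (simp only: sum_distrib_right)
  qed
qed

lemma Vh_lincomb2:
  assumes "v \<in> Vh xs ys k" "w \<in> Vh xs ys k"
  shows "(\<lambda>z. c * v z + d * w z) \<in> Vh xs ys k"
proof -
  have "(\<lambda>z. \<Sum>l\<in>{False, True}. (if l then c else d) * (if l then v else w) z) \<in> Vh xs ys k"
    by (rule Vh_sum) (use assms in auto)
  then show ?thesis by (simp add: add.commute)
qed

lemma Vh_piecewise_continuous:
  assumes "v \<in> Vh xs ys k"
  shows "piecewise_continuous xs ys v"
proof -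
  obtain c where c: "\<forall>i\<in>cells xs. \<forall>j\<in>cells ys. \<forall>z\<in>open_cell xs ys i j.
      v z = (\<Sum>a\<le>k. \<Sum>b\<le>k. c i j a b * fst z ^ a * snd z ^ b)" using Vh_coefficients[OF assms] by blast
  have cont: "continuous_on A (\<lambda>z :: real \<times> real. \<Sum>a\<le>k. \<Sum>b\<le>k. c i j a b * fst z ^ a * snd z ^ b)" for A i j
    by (intro continuous_intros)
  show ?thesis unfolding piecewise_continuous_def using c cont by blast
qed

lemma cell_box: "cell xs i \<times> cell ys j = cbox (xs ! (i - 1), ys ! (j - 1)) (xs ! i, ys ! j)"
  by (simp add: cell_def cbox_Pair_eq)

lemma negligible_cell_boundary: "negligible (cell xs i \<times> cell ys j - open_cell xs ys i j)"
  unfolding cell_box interior_cbox by (rule negligible_frontier_interval)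

lemma set_integrable_cell:
  assumes "piecewise_continuous xs ys f" "i \<in> cells xs" "j \<in> cells ys"
  shows "set_integrable lebesgue (cell xs i \<times> cell ys j) f"
proof -
  obtain q where q: "continuous_on (cell xs i \<times> cell ys j) q" "\<forall>z\<in>open_cell xs ys i j. f z = q z"
    using assms unfolding piecewise_continuous_def by blast
  have "set_integrable lebesgue (cell xs i \<times> cell ys j) q"
    using q(1) unfolding cell_box by (rule absolutely_integrable_continuous)
  then show ?thesis
    using set_integral_spike(1)[OF negligible_cell_boundary[of xs i ys j], of "cell xs i \<times> cell ys j" f q] q(2) by auto
qed

section \<open>The rectangle as a union of cells\<close>

definition node_lines :: "real list \<Rightarrow> real list \<Rightarrow> (real \<times> real) set" where
  "node_lines xs ys = {z. fst z \<in> set xs \<or> snd z \<in> set ys}"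

lemma negligible_node_lines: "negligible (node_lines xs ys)"
proof -
  have "negligible {z :: real \<times> real. z \<bullet> (1, 0) = c}" "negligible {z :: real \<times> real. z \<bullet> (0, 1) = c}" for c
    by (rule negligible_standard_hyperplane, simp add: Basis_prod_def)+
  then have "negligible ((\<Union>c\<in>set xs. {z :: real \<times> real. z \<bullet> (1, 0) = c}) \<union> (\<Union>c\<in>set ys. {z :: real \<times> real. z \<bullet> (0, 1) = c}))"
    by (intro negligible_Un negligible_Union) auto
  then show ?thesis by (rule negligible_subset) (auto simp: node_lines_def inner_prod_def)
qed

lemma indicator_cells:
  assumes m: "mesh xs" and x: "x \<notin> set xs"
  shows "(\<Sum>i\<in>cells xs. indicator (cell xs i) x :: real) = indicator {hd xs..last xs} x"
proof -
  \<comment> \<open>Off the nodes the indicator of a cell is a difference of two values of this step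
    function, so the sum over the cells telescopes.\<close>
  define u where "u i = (of_bool (x \<le> xs ! i) :: real)" for i
  have N: "2 \<le> length xs" using m by (simp add: mesh_def)
  have ne: "x \<noteq> xs ! i" if "i < length xs" for i using x that by auto
  have "(\<Sum>i\<in>cells xs. indicator (cell xs i) x :: real) = (\<Sum>i\<in>{1..length xs - 1}. u i - u (i - 1))"
    unfolding cells_def
  proof (rule sum.cong[OF refl])
    fix i assume i: "i \<in> {1..length xs - 1}"
    then have "i - 1 < length xs" "i \<in> cells xs" using N by (auto simp: cells_def)
    then have "xs ! (i - 1) < xs ! i" "x \<noteq> xs ! (i - 1)" using cells_less[OF m] ne by auto
    then show "indicator (cell xs i) x = u i - u (i - 1)" by (auto simp: u_def cell_def indicator_def)
  qed
  also have "\<dots> = (\<Sum>i<length xs - 1. u (Suc i) - u i)"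
    by (rule sum.reindex_bij_witness[of _ Suc "\<lambda>i. i - 1"]) auto
  also have "\<dots> = u (length xs - 1) - u 0" by (rule sum_lessThan_telescope)
  also have "\<dots> = indicator {hd xs..last xs} x"
  proof -
    have "0 < length xs" "length xs - 1 < length xs" using N by auto
    then have "x \<noteq> xs ! 0" "xs ! 0 \<le> xs ! (length xs - 1)" using ne mesh_le[OF m, of 0 "length xs - 1"] by auto
    then show ?thesis using mesh_ends[OF m] by (auto simp: u_def indicator_def)
  qed
  finally show ?thesis .
qed

lemma indicator_rectangle:
  assumes m: "mesh xs" "mesh ys" and z: "z \<notin> node_lines xs ys"
  shows "indicator (rectangle xs ys) z = (\<Sum>i\<in>cells xs. \<Sum>j\<in>cells ys. indicator (cell xs i \<times> cell ys j) z :: real)"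
  using indicator_cells[OF m(1), of "fst z"] indicator_cells[OF m(2), of "snd z"] z
  by (simp add: node_lines_def rectangle_def indicator_times sum_product[symmetric])

lemma rectangle_cell:
  assumes m: "mesh xs" "mesh ys" and z: "z \<in> rectangle xs ys - node_lines xs ys"
  shows "\<exists>i\<in>cells xs. \<exists>j\<in>cells ys. z \<in> open_cell xs ys i j"
proof -
  have "(\<Sum>i\<in>cells xs. \<Sum>j\<in>cells ys. indicator (cell xs i \<times> cell ys j) z :: real) = 1"
    using indicator_rectangle[OF m, of z] z by simp
  then obtain i where i: "i \<in> cells xs" "(\<Sum>j\<in>cells ys. indicator (cell xs i \<times> cell ys j) z :: real) \<noteq> 0"
    by (metis (no_types, lifting) sum.neutral zero_neq_one)
  then obtain j where j: "j \<in> cells ys" "indicator (cell xs i \<times> cell ys j) z \<noteq> (0 :: real)"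
    by (meson sum.not_neutral_contains_not_neutral)
  have "xs ! (i - 1) \<in> set xs" "xs ! i \<in> set xs" "ys ! (j - 1) \<in> set ys" "ys ! j \<in> set ys"
    using i(1) j(1) m by (auto simp: cells_def mesh_def intro!: nth_mem)
  then have "z \<in> open_cell xs ys i j"
    unfolding interior_cell using j(2) z by (cases z) (auto simp: cell_def indicator_def node_lines_def less_le split: if_splits)
  then show ?thesis using i j by blast
qed

lemma rectangle_decomposition:
  fixes f :: "real \<times> real \<Rightarrow> real"
  assumes m: "mesh xs" "mesh ys"
    and f: "\<And>i j. i \<in> cells xs \<Longrightarrow> j \<in> cells ys \<Longrightarrow> set_integrable lebesgue (cell xs i \<times> cell ys j) f"
  shows "set_integrable lebesgue (rectangle xs ys) f"
    and "(LINT z:rectangle xs ys|lebesgue. f z) = (\<Sum>i\<in>cells xs. \<Sum>j\<in>cells ys. LINT z:cell xs i \<times> cell ys j|lebesgue. f z)"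
proof -
  let ?g = "\<lambda>i j z. indicator (cell xs i \<times> cell ys j) z * f z"
  have eq: "indicator (rectangle xs ys) z * f z = (\<Sum>i\<in>cells xs. \<Sum>j\<in>cells ys. ?g i j z)" if "z \<in> UNIV - node_lines xs ys" for z
    using that by (simp add: indicator_rectangle[OF m] sum_distrib_right)
  have g: "set_integrable lebesgue UNIV (?g i j)" if "i \<in> cells xs" "j \<in> cells ys" for i j
    using f[OF that] by (simp add: set_integrable_def)
  have g': "set_integrable lebesgue UNIV (\<lambda>z. \<Sum>j\<in>cells ys. ?g i j z)" if "i \<in> cells xs" for i
    by (rule set_integral_sum(1)) (rule g[OF that])
  have "set_integrable lebesgue UNIV (\<lambda>z. \<Sum>i\<in>cells xs. \<Sum>j\<in>cells ys. ?g i j z)"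
    by (rule set_integral_sum(1)) (rule g')
  then have "set_integrable lebesgue UNIV (\<lambda>z. indicator (rectangle xs ys) z * f z)"
    by (simp only: set_integral_spike(1)[OF negligible_node_lines eq])
  then show "set_integrable lebesgue (rectangle xs ys) f" by (simp add: set_integrable_def)
  have "(LINT z:rectangle xs ys|lebesgue. f z) = (LINT z:UNIV|lebesgue. indicator (rectangle xs ys) z * f z)"
    by (simp add: set_lebesgue_integral_def)
  also have "\<dots> = (LINT z:UNIV|lebesgue. \<Sum>i\<in>cells xs. \<Sum>j\<in>cells ys. ?g i j z)"
    by (rule set_integral_spike(2)[OF negligible_node_lines eq])
  also have "\<dots> = (\<Sum>i\<in>cells xs. \<Sum>j\<in>cells ys. LINT z:UNIV|lebesgue. ?g i j z)"
    using g g' by (simp add: set_integral_sum(2))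
  finally show "(LINT z:rectangle xs ys|lebesgue. f z) = (\<Sum>i\<in>cells xs. \<Sum>j\<in>cells ys. LINT z:cell xs i \<times> cell ys j|lebesgue. f z)"
    by (simp add: set_lebesgue_integral_def)
qed

lemma set_integrable_rectangle:
  "mesh xs \<Longrightarrow> mesh ys \<Longrightarrow> piecewise_continuous xs ys f \<Longrightarrow> set_integrable lebesgue (rectangle xs ys) f"
  by (intro rectangle_decomposition(1)) (simp_all add: set_integrable_cell)

section \<open>The L2 product\<close>

lemma L2_inner_eq_sum_cells:
  assumes "mesh xs" "mesh ys" "piecewise_continuous xs ys v" "piecewise_continuous xs ys w"
  shows "L2_inner xs ys v w = (\<Sum>i\<in>cells xs. \<Sum>j\<in>cells ys. cell_inner xs ys i j v w)"
  unfolding L2_inner_def cell_inner_def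
  by (rule rectangle_decomposition(2)[OF assms(1,2)]) (rule set_integrable_cell[OF piecewise_continuous_mult[OF assms(3,4)]])

lemma L2_inner_commute: "L2_inner xs ys v w = L2_inner xs ys w v"
  by (simp add: L2_inner_def mult.commute)

lemma L2_inner_cong:
  assumes "mesh xs" "mesh ys" "agree xs ys v v'"
  shows "L2_inner xs ys v w = L2_inner xs ys v' w"
  unfolding L2_inner_def
proof (rule set_integral_spike(2)[OF negligible_node_lines])
  fix z assume "z \<in> rectangle xs ys - node_lines xs ys"
  then show "v z * w z = v' z * w z" using rectangle_cell[OF assms(1,2)] assms(3) unfolding agree_def by fastforce
qed

lemma L2_inner_add:
  assumes "mesh xs" "mesh ys" "piecewise_continuous xs ys v" "piecewise_continuous xs ys v'" "piecewise_continuous xs ys w"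
  shows "L2_inner xs ys (\<lambda>z. v z + v' z) w = L2_inner xs ys v w + L2_inner xs ys v' w"
  unfolding L2_inner_def distrib_right
  by (intro set_integral_add set_integrable_rectangle piecewise_continuous_mult assms)

lemma L2_inner_cmult: "L2_inner xs ys (\<lambda>z. c * v z) w = c * L2_inner xs ys v w"
  by (simp add: L2_inner_def mult.assoc)

lemma L2_inner_sum:
  assumes "mesh xs" "mesh ys" "\<And>l. l \<in> A \<Longrightarrow> piecewise_continuous xs ys (e l)" "piecewise_continuous xs ys w"
  shows "L2_inner xs ys (\<lambda>z. \<Sum>l\<in>A. c l * e l z) w = (\<Sum>l\<in>A. c l * L2_inner xs ys (e l) w)"
proof -
  have "L2_inner xs ys (\<lambda>z. \<Sum>l\<in>A. c l * e l z) w = (LINT z:rectangle xs ys|lebesgue. \<Sum>l\<in>A. c l * (e l z * w z))"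
    by (simp add: L2_inner_def sum_distrib_right mult.assoc)
  also have "\<dots> = (\<Sum>l\<in>A. LINT z:rectangle xs ys|lebesgue. c l * (e l z * w z))"
    by (rule set_integral_sum(2), rule set_integrable_mult_right, rule set_integrable_rectangle[OF assms(1,2)], rule piecewise_continuous_mult)
      (simp_all add: assms)
  finally show ?thesis by (simp add: L2_inner_def)
qed

lemma L2_inner_nonneg: "0 \<le> L2_inner xs ys v v"
  unfolding L2_inner_def by (rule set_integral_nonneg_all) simp

text \<open>A continuous nonnegative function with zero integral over a nondegenerate box vanishes
  there; applied on every cell, this makes the L2 product definite up to
  \<open>agree\<close>.\<close>

lemma L2_inner_eq_0:
  assumes m: "mesh xs" "mesh ys" and v: "piecewise_continuous xs ys v" and 0: "L2_inner xs ys v v = 0"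
  shows "agree xs ys v (\<lambda>_. 0)"
  unfolding agree_def
proof (intro ballI)
  fix i j z assume ij: "i \<in> cells xs" "j \<in> cells ys" and z: "z \<in> open_cell xs ys i j"
  have nn: "0 \<le> cell_inner xs ys i j v v" for i j
    unfolding cell_inner_def by (rule set_integral_nonneg_all) simp
  have fin: "finite (cells xs)" "finite (cells ys)" by (auto simp: cells_def)
  have "(\<Sum>i\<in>cells xs. \<Sum>j\<in>cells ys. cell_inner xs ys i j v v) = 0"
    using 0 L2_inner_eq_sum_cells[OF m v v] by simp
  then have "cell_inner xs ys i j v v = 0"
    using ij fin nn by (simp add: sum_nonneg_eq_0_iff sum_nonneg)
  moreover obtain q where q: "continuous_on (cell xs i \<times> cell ys j) q" "\<forall>z\<in>open_cell xs ys i j. v z = q z"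
    using v ij unfolding piecewise_continuous_def by blast
  have qi: "set_integrable lebesgue (cell xs i \<times> cell ys j) (\<lambda>z. q z * q z)"
    using continuous_on_mult[OF q(1) q(1)] unfolding cell_box by (rule absolutely_integrable_continuous)
  have "cell_inner xs ys i j v v = (LINT z:cell xs i \<times> cell ys j|lebesgue. q z * q z)"
    unfolding cell_inner_def by (rule set_integral_spike(2)[OF negligible_cell_boundary[of xs i ys j]]) (use q(2) in auto)
  ultimately have "integral (cell xs i \<times> cell ys j) (\<lambda>z. q z * q z) = 0"
    using set_lebesgue_integral_eq_integral(2)[OF qi] by simp
  moreover have "box (xs ! (i - 1), ys ! (j - 1)) (xs ! i, ys ! j) \<noteq> {}"
    using z unfolding cell_box interior_cbox by auto
  ultimately have "\<forall>z\<in>cell xs i \<times> cell ys j. q z * q z = 0"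
    using integral_cbox_eq_0_iff[OF continuous_on_mult[OF q(1) q(1), unfolded cell_box]] unfolding cell_box by simp
  then show "v z = 0" using z q(2) interior_subset by fastforce
qed

section \<open>An orthonormal basis of the finite element space\<close>

definition orthonormal_family :: "real list \<Rightarrow> real list \<Rightarrow> nat \<Rightarrow> nat \<Rightarrow> (nat \<Rightarrow> real \<times> real \<Rightarrow> real) \<Rightarrow> bool" where
  "orthonormal_family xs ys k n e \<longleftrightarrow> (\<forall>l<n. e l \<in> Vh xs ys k) \<and> (\<forall>l<n. \<forall>m<n. L2_inner xs ys (e l) (e m) = of_bool (l = m))"

text \<open>Elements are determined only up to \<open>agree\<close>, so spanning is expressed by the
  Fourier expansion. The last conjunct preserves the expansions obtained so far. A residual of norm
  zero adds no vector, so the given functions may be linearly dependent.\<close>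

lemma gram_schmidt_step:
  assumes m: "mesh xs" "mesh ys" and e: "orthonormal_family xs ys k n e" and v: "v \<in> Vh xs ys k"
  shows "\<exists>n' e'. orthonormal_family xs ys k n' e' \<and> agree xs ys v (\<lambda>z. \<Sum>l<n'. L2_inner xs ys v (e' l) * e' l z) \<and>
    (\<forall>w\<in>Vh xs ys k. agree xs ys w (\<lambda>z. \<Sum>l<n. L2_inner xs ys w (e l) * e l z) \<longrightarrow>
      agree xs ys w (\<lambda>z. \<Sum>l<n'. L2_inner xs ys w (e' l) * e' l z))"
proof -
  let ?ip = "L2_inner xs ys"
  have eV: "e l \<in> Vh xs ys k" and ee: "j < n \<Longrightarrow> ?ip (e l) (e j) = of_bool (l = j)" if "l < n" for l j
    using e that by (auto simp: orthonormal_family_def)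
  note pc = Vh_piecewise_continuous
  define s where "s = (\<lambda>z. \<Sum>l<n. ?ip v (e l) * e l z)"
  define r where "r = (\<lambda>z. 1 * v z + (- 1) * s z)"
  have sV: "s \<in> Vh xs ys k" unfolding s_def by (rule Vh_sum) (use eV in auto)
  have rV: "r \<in> Vh xs ys k" unfolding r_def by (rule Vh_lincomb2[OF v sV])
  have ip_sum: "?ip (\<lambda>z. \<Sum>l<n. c l * e l z) w = (\<Sum>l<n. c l * ?ip (e l) w)" if "w \<in> Vh xs ys k" for w and c :: "nat \<Rightarrow> real"
    by (rule L2_inner_sum[OF m]) (use pc[OF eV] pc[OF that] in auto)
  have ip_r: "?ip r w = ?ip v w - ?ip s w" if "w \<in> Vh xs ys k" for w
  proof -
    have "?ip r w = ?ip (\<lambda>z. 1 * v z) w + ?ip (\<lambda>z. (- 1) * s z) w"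
      unfolding r_def by (rule L2_inner_add[OF m]) (use pc[OF Vh_lincomb2[OF v v, of 1 0]] pc[OF Vh_lincomb2[OF sV sV, of "- 1" 0]] pc[OF that] in simp_all)
    then show ?thesis by (simp only: L2_inner_cmult)
  qed
  have re: "?ip r (e l) = 0" if "l < n" for l
    using ip_r[OF eV[OF that]] ip_sum[OF eV[OF that]] that by (simp add: s_def ee if_distrib sum.delta of_bool_def cong: if_cong)
  show ?thesis
  proof (cases "?ip r r = 0")
    case True
    from L2_inner_eq_0[OF m pc[OF rV] True] have "agree xs ys v s" by (auto simp: agree_def r_def)
    then show ?thesis using e unfolding s_def by blast
  next
    case False
    then have rr: "0 < ?ip r r" using L2_inner_nonneg[of xs ys r] by simp
    define N where "N = sqrt (?ip r r)"
    have N: "0 < N" "N * N = ?ip r r" using rr by (simp_all add: N_def)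
    define e' where "e' = (\<lambda>l. if l < n then e l else (\<lambda>z. (1 / N) * r z))"
    have e'n: "e' n = (\<lambda>z. (1 / N) * r z)" and e'l: "l < n \<Longrightarrow> e' l = e l" for l by (simp_all add: e'_def)
    have nV: "e' n \<in> Vh xs ys k" using Vh_lincomb2[OF rV rV, of "1 / N" 0] by (simp add: e'n)
    have n_ip: "?ip (e' n) w = ?ip r w / N" for w unfolding e'n L2_inner_cmult by simp
    have ip_n: "?ip w (e' n) = ?ip r w / N" for w using n_ip[of w] L2_inner_commute[of xs ys w "e' n"] by (simp only:)
    have er: "?ip (e l) r = 0" if "l < n" for l using re[OF that] L2_inner_commute[of xs ys "e l" r] by simp
    have "orthonormal_family xs ys k (Suc n) e'"
      unfolding orthonormal_family_def
    proof (intro conjI allI impI)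
      fix l j assume l: "l < Suc n" "j < Suc n"
      show "e' l \<in> Vh xs ys k" using l nV eV by (auto simp: e'l less_Suc_eq)
      have nn: "?ip (e' n) (e' n) = 1"
        unfolding n_ip ip_n[of r] N(2)[symmetric] using N(1) by simp
      show "?ip (e' l) (e' j) = of_bool (l = j)"
        using l nn by (auto simp: less_Suc_eq e'l ee ip_n n_ip re)
    qed
    moreover have "agree xs ys v (\<lambda>z. \<Sum>l<Suc n. ?ip v (e' l) * e' l z)"
    proof -
      have "?ip s r = 0" using ip_sum[OF rV, of "\<lambda>l. ?ip v (e l)"] by (simp add: s_def er)
      then have "?ip v (e' n) = N" using ip_r[OF rV] N L2_inner_commute[of xs ys r v] by (simp add: ip_n nonzero_divide_eq_eq)
      then have "?ip v (e' n) * e' n z = r z" for z using N by (simp add: e'n)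
      then have "(\<Sum>l<Suc n. ?ip v (e' l) * e' l z) = v z" for z by (simp add: e'l r_def s_def)
      then show ?thesis by (simp add: agree_def)
    qed
    moreover have "agree xs ys w (\<lambda>z. \<Sum>l<Suc n. ?ip w (e' l) * e' l z)"
      if w: "w \<in> Vh xs ys k" "agree xs ys w (\<lambda>z. \<Sum>l<n. ?ip w (e l) * e l z)" for w
    proof -
      have "?ip w r = 0" using L2_inner_cong[OF m w(2), of r] ip_sum[OF rV, of "\<lambda>l. ?ip w (e l)"] by (simp add: er)
      then have "?ip w (e' n) = 0" using L2_inner_commute[of xs ys r w] by (simp add: ip_n)
      then show ?thesis using w(2) by (simp add: e'l)
    qed
    ultimately show ?thesis by blast
  qed
qed

lemma gram_schmidt:
  assumes m: "mesh xs" "mesh ys" and "finite A" "\<And>p. p \<in> A \<Longrightarrow> g p \<in> Vh xs ys k"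
  shows "\<exists>n e. orthonormal_family xs ys k n e \<and> (\<forall>p\<in>A. agree xs ys (g p) (\<lambda>z. \<Sum>l<n. L2_inner xs ys (g p) (e l) * e l z))"
  using assms(3,4)
proof (induction A)
  case empty
  have "orthonormal_family xs ys k 0 (\<lambda>_ _. 0)" by (simp add: orthonormal_family_def)
  then show ?case by blast
next
  case (insert p A)
  then obtain n e where e: "orthonormal_family xs ys k n e" "\<forall>p\<in>A. agree xs ys (g p) (\<lambda>z. \<Sum>l<n. L2_inner xs ys (g p) (e l) * e l z)"
    by auto
  from gram_schmidt_step[OF m e(1) insert.prems[of p]] obtain n' e' where
    "orthonormal_family xs ys k n' e'" "agree xs ys (g p) (\<lambda>z. \<Sum>l<n'. L2_inner xs ys (g p) (e' l) * e' l z)"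
    and "\<forall>w\<in>Vh xs ys k. agree xs ys w (\<lambda>z. \<Sum>l<n. L2_inner xs ys w (e l) * e l z) \<longrightarrow>
      agree xs ys w (\<lambda>z. \<Sum>l<n'. L2_inner xs ys w (e' l) * e' l z)" by auto
  then show ?case using e(2) insert.prems by (intro exI[of _ n'] exI[of _ e']) auto
qed

lemma interior_cells_disjoint:
  assumes m: "mesh xs" "mesh ys" and "i \<in> cells xs" "j \<in> cells ys" "i' \<in> cells xs" "j' \<in> cells ys"
    and z: "z \<in> open_cell xs ys i j" "z \<in> open_cell xs ys i' j'"
  shows "i = i' \<and> j = j'"
proof -
  have *: "i = i'" if "mesh xs" "i \<in> cells xs" "i' \<in> cells xs" "xs ! (i - 1) < x" "x < xs ! i" "xs ! (i' - 1) < x" "x < xs ! i'" for xs i i' x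
  proof (rule linorder_cases[of i i'])
    assume "i < i'"
    then have "i \<le> i' - 1" "i' - 1 < length xs" using that(2,3) by (auto simp: cells_def)
    from mesh_le[OF that(1) this] have "xs ! i \<le> xs ! (i' - 1)" .
    then show ?thesis using that by simp
  next
    assume "i' < i"
    then have "i' \<le> i - 1" "i - 1 < length xs" using that(2,3) by (auto simp: cells_def)
    from mesh_le[OF that(1) this] have "xs ! i' \<le> xs ! (i - 1)" .
    then show ?thesis using that by simp
  qed
  show ?thesis using *[OF m(1) assms(3,5), of "fst z"] *[OF m(2) assms(4,6), of "snd z"] z by (auto simp: interior_cell)
qed

text \<open>Monomials restricted to open cells span the space up to \<open>agree\<close>; the
  dimension \<open>n\<close> is whatever Gram-Schmidt yields.\<close>

lemma Vh_orthonormal_basis: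
  assumes m: "mesh xs" "mesh ys"
  shows "\<exists>n e. orthonormal_family xs ys k n e \<and> (\<forall>v\<in>Vh xs ys k. agree xs ys v (\<lambda>z. \<Sum>l<n. L2_inner xs ys v (e l) * e l z))"
proof -
  define A where "A = (cells xs \<times> cells ys) \<times> {..k} \<times> {..k}"
  define g where "g = (\<lambda>((i, j), a, b) z :: real \<times> real. indicator (open_cell xs ys i j) z * (fst z ^ a * snd z ^ b) :: real)"
  have fin: "finite A" by (auto simp: A_def cells_def)
  have ind: "indicator (open_cell xs ys i j) z = (of_bool (i = i' \<and> j = j') :: real)"
    if "i \<in> cells xs" "j \<in> cells ys" "i' \<in> cells xs" "j' \<in> cells ys" "z \<in> open_cell xs ys i' j'" for i j i' j' z
  proof (cases "i = i' \<and> j = j'")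
    case False
    then have "z \<notin> open_cell xs ys i j" using interior_cells_disjoint[OF m that(1-4) _ that(5)] by blast
    then show ?thesis using False by simp
  qed (use that(5) in simp)
  \<comment> \<open>Open cells are disjoint, so inside one of them the generators of all the others
    vanish.\<close>
  have span: "(\<Sum>p\<in>A. c p * g p z) = (\<Sum>a\<le>k. \<Sum>b\<le>k. c ((i, j), a, b) * fst z ^ a * snd z ^ b)"
    if z: "i \<in> cells xs" "j \<in> cells ys" "z \<in> open_cell xs ys i j" for i j z and c :: "_ \<Rightarrow> real"
  proof -
    have "(\<Sum>p\<in>A. c p * g p z) = (\<Sum>p\<in>{(i, j)} \<times> {..k} \<times> {..k}. c p * g p z)"
    proof (rule sum.mono_neutral_right[OF fin])
      show "\<forall>p\<in>A - {(i, j)} \<times> {..k} \<times> {..k}. c p * g p z = 0"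
        using ind[OF _ _ z] by (auto simp: A_def g_def)
    qed (use z in \<open>auto simp: A_def\<close>)
    also have "\<dots> = (\<Sum>a\<le>k. \<Sum>b\<le>k. c ((i, j), a, b) * g ((i, j), a, b) z)"
      by (simp add: sum.cartesian_product')
    finally show ?thesis using z(3) by (simp add: g_def mult.assoc)
  qed
  have gV: "g p \<in> Vh xs ys k" if p: "p \<in> A" for p
  proof -
    have "g p z = (\<Sum>a\<le>k. \<Sum>b\<le>k. of_bool (((i, j), a, b) = p) * fst z ^ a * snd z ^ b)"
      if "i \<in> cells xs" "j \<in> cells ys" "z \<in> open_cell xs ys i j" for i j z
    proof -
      have "A \<inter> {q. q = p} = {p}" using p by auto
      then have "(\<Sum>q\<in>A. of_bool (q = p) * g q z) = g p z" by (simp only: sum_of_bool_mult_eq[OF fin]) simp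
      then show ?thesis using span[OF that, of "\<lambda>q. of_bool (q = p)"] by (simp only:)
    qed
    then show ?thesis unfolding Vh_iff by (intro exI[of _ "\<lambda>i j a b. of_bool (((i, j), a, b) = p)"] ballI)
  qed
  obtain n e where e: "orthonormal_family xs ys k n e" and ag: "\<And>p. p \<in> A \<Longrightarrow> agree xs ys (g p) (\<lambda>z. \<Sum>l<n. L2_inner xs ys (g p) (e l) * e l z)"
    using gram_schmidt[where g=g and k=k, OF m fin] gV by blast
  have ePC: "piecewise_continuous xs ys (e l)" if "l < n" for l
    by (rule Vh_piecewise_continuous[where k=k]) (use e that in \<open>simp add: orthonormal_family_def\<close>)
  have "agree xs ys v (\<lambda>z. \<Sum>l<n. L2_inner xs ys v (e l) * e l z)" if v: "v \<in> Vh xs ys k" for v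
  proof -
    obtain c where c: "\<forall>i\<in>cells xs. \<forall>j\<in>cells ys. \<forall>z\<in>open_cell xs ys i j.
      v z = (\<Sum>a\<le>k. \<Sum>b\<le>k. c i j a b * fst z ^ a * snd z ^ b)" using Vh_coefficients[OF v] by blast
    define d where "d = (\<lambda>((i, j), a, b). c i j a b)"
    have vg: "agree xs ys v (\<lambda>z. \<Sum>p\<in>A. d p * g p z)"
      unfolding agree_def
    proof (intro ballI)
      fix i j z assume z: "i \<in> cells xs" "j \<in> cells ys" "z \<in> open_cell xs ys i j"
      show "v z = (\<Sum>p\<in>A. d p * g p z)" unfolding span[OF z] d_def prod.case using c z by simp
    qed
    have "L2_inner xs ys v (e l) = (\<Sum>p\<in>A. d p * L2_inner xs ys (g p) (e l))" if "l < n" for l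
      unfolding L2_inner_cong[OF m vg] by (rule L2_inner_sum[OF m]) (use Vh_piecewise_continuous[OF gV] ePC[OF that] in auto)
    note vip = this
    have eq: "(\<Sum>l<n. L2_inner xs ys v (e l) * e l z) = (\<Sum>p\<in>A. d p * (\<Sum>l<n. L2_inner xs ys (g p) (e l) * e l z))" for z
    proof -
      have "(\<Sum>l<n. (\<Sum>p\<in>A. d p * L2_inner xs ys (g p) (e l)) * e l z) = (\<Sum>l<n. \<Sum>p\<in>A. d p * (L2_inner xs ys (g p) (e l) * e l z))"
        by (simp only: sum_distrib_right mult.assoc)
      also have "\<dots> = (\<Sum>p\<in>A. \<Sum>l<n. d p * (L2_inner xs ys (g p) (e l) * e l z))" by (rule sum.swap)
      finally show ?thesis using vip by (simp add: sum_distrib_left)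
    qed
    show ?thesis
      unfolding agree_def eq
    proof (intro ballI)
      fix i j z assume z: "i \<in> cells xs" "j \<in> cells ys" "z \<in> open_cell xs ys i j"
      have "v z = (\<Sum>p\<in>A. d p * g p z)" using vg z by (auto simp: agree_def)
      also have "\<dots> = (\<Sum>p\<in>A. d p * (\<Sum>l<n. L2_inner xs ys (g p) (e l) * e l z))"
        using ag z by (intro sum.cong refl) (auto simp: agree_def)
      finally show "v z = (\<Sum>p\<in>A. d p * (\<Sum>l<n. L2_inner xs ys (g p) (e l) * e l z))" .
    qed
  qed
  then show ?thesis using e by blast
qed

locale dg_basis =
  fixes xs ys :: "real list" and k n :: nat and e :: "nat \<Rightarrow> real \<times> real \<Rightarrow> real"
  assumes mesh: "mesh xs" "mesh ys"
    and orthonormal: "orthonormal_family xs ys k n e"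
    and expansion: "v \<in> Vh xs ys k \<Longrightarrow> agree xs ys v (\<lambda>z. \<Sum>l<n. L2_inner xs ys v (e l) * e l z)"
begin

lemma e_Vh: "l < n \<Longrightarrow> e l \<in> Vh xs ys k"
  using orthonormal by (simp add: orthonormal_family_def)

lemma inner_expansion:
  assumes "v \<in> Vh xs ys k" "piecewise_continuous xs ys h"
  shows "L2_inner xs ys v h = (\<Sum>l<n. L2_inner xs ys v (e l) * L2_inner xs ys h (e l))"
  unfolding L2_inner_commute[of xs ys h]
  by (rule trans[OF L2_inner_cong[OF mesh expansion[OF assms(1)]] L2_inner_sum[OF mesh]]) (use Vh_piecewise_continuous[OF e_Vh] assms in auto)

lemma L2_norm_square: "(L2_norm xs ys v)\<^sup>2 = L2_inner xs ys v v"
  using L2_inner_nonneg[of xs ys v] by (simp add: L2_norm_def L2_inner_def power2_eq_square)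

lemma parseval:
  assumes v: "v \<in> Vh xs ys k"
  shows "(L2_norm xs ys v)\<^sup>2 = (\<Sum>l<n. (L2_inner xs ys v (e l))\<^sup>2)"
  using inner_expansion[OF v Vh_piecewise_continuous[OF v]] by (simp only: L2_norm_square) (simp only: power2_eq_square)

text \<open>The finite Fourier sum of \<open>h\<close> has the required products, so the choice in
  \<open>L2_proj\<close> is made from a nonempty set.\<close>

lemma projection:
  assumes h: "piecewise_continuous xs ys h"
  shows "L2_proj xs ys k h \<in> Vh xs ys k"
    and "\<phi> \<in> Vh xs ys k \<Longrightarrow> L2_inner xs ys (L2_proj xs ys k h) \<phi> = L2_inner xs ys h \<phi>"
proof -
  define p where "p = (\<lambda>z. \<Sum>l<n. L2_inner xs ys h (e l) * e l z)"
  have "p \<in> Vh xs ys k" unfolding p_def by (rule Vh_sum) (use e_Vh in auto)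
  moreover have "L2_inner xs ys p \<phi> = L2_inner xs ys h \<phi>" if \<phi>: "\<phi> \<in> Vh xs ys k" for \<phi>
  proof -
    have "L2_inner xs ys p \<phi> = (\<Sum>l<n. L2_inner xs ys h (e l) * L2_inner xs ys (e l) \<phi>)"
      unfolding p_def by (rule L2_inner_sum[OF mesh]) (use Vh_piecewise_continuous[OF e_Vh] Vh_piecewise_continuous[OF \<phi>] in auto)
    then show ?thesis
      using inner_expansion[OF \<phi> h] L2_inner_commute[of xs ys h \<phi>]
      by (simp add: L2_inner_commute[of xs ys "e _" \<phi>] mult.commute)
  qed
  ultimately have "\<exists>p. p \<in> Vh xs ys k \<and> (\<forall>\<phi>\<in>Vh xs ys k. L2_inner xs ys p \<phi> = L2_inner xs ys h \<phi>)" by blast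
  from someI_ex[OF this] show "L2_proj xs ys k h \<in> Vh xs ys k"
    "\<phi> \<in> Vh xs ys k \<Longrightarrow> L2_inner xs ys (L2_proj xs ys k h) \<phi> = L2_inner xs ys h \<phi>"
    by (auto simp: L2_proj_def)
qed

lemma L2_norm_projection:
  assumes "piecewise_continuous xs ys h"
  shows "(L2_norm xs ys (L2_proj xs ys k h))\<^sup>2 = (\<Sum>l<n. (L2_inner xs ys h (e l))\<^sup>2)"
  using projection[OF assms] e_Vh by (simp add: parseval)

text \<open>The squared norm of \<open>h - p\<close> is nonnegative, and it equals that of
  \<open>h\<close> minus that of the projection \<open>p\<close>.\<close>

lemma bessel:
  assumes h: "piecewise_continuous xs ys h"
  shows "(\<Sum>l<n. (L2_inner xs ys h (e l))\<^sup>2) \<le> L2_inner xs ys h h"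
proof -
  define p where "p = L2_proj xs ys k h"
  have pV: "p \<in> Vh xs ys k" and ph: "L2_inner xs ys p p = L2_inner xs ys h p"
    using projection[OF h] by (auto simp: p_def)
  have pc: "piecewise_continuous xs ys p" by (rule Vh_piecewise_continuous[OF pV])
  have i: "set_integrable lebesgue (rectangle xs ys) (\<lambda>z. u z * w z)"
    if "piecewise_continuous xs ys u" "piecewise_continuous xs ys w" for u w
    by (intro set_integrable_rectangle mesh piecewise_continuous_mult that)
  have "0 \<le> L2_inner xs ys (\<lambda>z. h z - p z) (\<lambda>z. h z - p z)" by (rule L2_inner_nonneg)
  also have "\<dots> = (LINT z:rectangle xs ys|lebesgue. (h z * h z - 2 * (h z * p z)) + p z * p z)"
    by (simp add: L2_inner_def algebra_simps)
  also have "\<dots> = L2_inner xs ys h h - 2 * L2_inner xs ys h p + L2_inner xs ys p p"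
    using i[OF h h] i[OF h pc] i[OF pc pc] by (simp add: L2_inner_def set_integral_add set_integral_diff)
  also have "\<dots> = L2_inner xs ys h h - (L2_norm xs ys p)\<^sup>2" using ph by (simp add: L2_norm_square)
  finally show ?thesis using L2_norm_projection[OF h] by (simp add: p_def)
qed

end

section \<open>The numerical solution\<close>

text \<open>Replacing time by its positive part stays within the half line on which measurability is
  given; the indicator then erases the values copied to negative times.\<close>

lemma jointly_measurable_of_adapted:
  assumes "measurable_adapted M F X"
  shows "jointly_measurable M (\<lambda>u y. indicator {0..} u * X u y)"
proof -
  have "(\<lambda>u. max u 0) \<in> lborel \<rightarrow>\<^sub>M restrict_space borel {0 :: real..}"
    by (intro measurable_restrict_space2) auto
  then have "(\<lambda>z. (max (fst z) 0, snd z)) \<in> lborel \<Otimes>\<^sub>M M \<rightarrow>\<^sub>M restrict_space borel {0 :: real..} \<Otimes>\<^sub>M M"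
    by (rule measurable_Pair[OF measurable_compose[OF measurable_fst] measurable_snd])
  from measurable_compose[OF this, of "\<lambda>(t, y). X t y" borel] assms
  have "(\<lambda>z. X (max (fst z) 0) (snd z)) \<in> borel_measurable (lborel \<Otimes>\<^sub>M M)"
    by (simp add: measurable_adapted_def)
  then have "(\<lambda>z. indicator {0..} (fst z) * X (max (fst z) 0) (snd z)) \<in> borel_measurable (lborel \<Otimes>\<^sub>M M)"
    by measurable
  also have "(\<lambda>z. indicator {0..} (fst z) * X (max (fst z) 0) (snd z)) = (\<lambda>z. indicator {0..} (fst z) * X (fst z) (snd z))"
    by (auto simp: fun_eq_iff indicator_def max_def)
  finally show ?thesis by (simp add: jointly_measurable_def split_beta')
qed

context brownian
begin

text \<open>The scheme is tested cell by cell, with an Ito integral of its own on each cell;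
  summation over the cells gives one equation per global coordinate, with a single Ito
  limit.\<close>

lemma ito_differential_sum:
  assumes A: "finite A" and d: "\<And>p. p \<in> A \<Longrightarrow> ito_differential M F W (Y p) (d p) (h p)" and s: "0 \<le> s"
  shows "square_integrable_on 0 s (\<lambda>u y. \<Sum>p\<in>A. indicator {0..} u * h p u y)"
    and "AE y in M. set_integrable lborel {0..s} (\<lambda>u. \<Sum>p\<in>A. d p u y)"
    and "\<exists>J. ito_limit (\<lambda>u y. \<Sum>p\<in>A. indicator {0..} u * h p u y) s J \<and>
      (AE y in M. (\<Sum>p\<in>A. Y p s y) = (\<Sum>p\<in>A. Y p 0 y) + (LBINT u:{0..s}. \<Sum>p\<in>A. d p u y) + J y)"
proof -
  have di: "AE y in M. \<forall>p\<in>A. set_integrable lborel {0..s} (\<lambda>u. d p u y)"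
    unfolding AE_finite_all[OF A] using d s by (simp add: ito_differential_def)
  have "\<forall>p. \<exists>J. p \<in> A \<longrightarrow> has_ito_integral M F W (h p) s J \<and>
      (AE y in M. Y p s y = Y p 0 y + (LBINT u:{0..s}. d p u y) + J y)"
    using d s unfolding ito_differential_def by blast
  then obtain J where J: "\<And>p. p \<in> A \<Longrightarrow> has_ito_integral M F W (h p) s (J p)"
    and eq: "\<And>p. p \<in> A \<Longrightarrow> AE y in M. Y p s y = Y p 0 y + (LBINT u:{0..s}. d p u y) + J p y"
    unfolding choice_iff by blast
  have jm: "jointly_measurable M (\<lambda>u y. indicator {0..} u * h p u y)" if "p \<in> A" for p
    by (rule jointly_measurable_of_adapted[of M F]) (use J[OF that] in \<open>simp add: has_ito_integral_def\<close>)
  note il = has_ito_integral_imp_ito_limit[OF J s jm]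
  show "square_integrable_on 0 s (\<lambda>u y. \<Sum>p\<in>A. indicator {0..} u * h p u y)"
    by (rule square_integrable_on_sum[OF A]) (rule il(2), auto)
  show "AE y in M. set_integrable lborel {0..s} (\<lambda>u. \<Sum>p\<in>A. d p u y)"
    using di by eventually_elim (rule set_integral_sum(1), blast)
  have "ito_limit (\<lambda>u y. \<Sum>p\<in>A. indicator {0..} u * h p u y) s (\<lambda>y. \<Sum>p\<in>A. J p y)"
    by (rule ito_limit_sum[OF A s]) (rule il; auto)+
  moreover have "AE y in M. (\<Sum>p\<in>A. Y p s y) = (\<Sum>p\<in>A. Y p 0 y) + (LBINT u:{0..s}. \<Sum>p\<in>A. d p u y) + (\<Sum>p\<in>A. J p y)"
  proof -
    have "AE y in M. \<forall>p\<in>A. Y p s y = Y p 0 y + (LBINT u:{0..s}. d p u y) + J p y"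
      unfolding AE_finite_all[OF A] using eq by blast
    with di show ?thesis
    proof eventually_elim
      case (elim y)
      have "(LBINT u:{0..s}. \<Sum>p\<in>A. d p u y) = (\<Sum>p\<in>A. LBINT u:{0..s}. d p u y)"
        by (rule set_integral_sum(2)) (use elim(1) in blast)
      moreover have "(\<Sum>p\<in>A. Y p s y) = (\<Sum>p\<in>A. Y p 0 y + (LBINT u:{0..s}. d p u y) + J p y)"
        by (rule sum.cong[OF refl]) (use elim(2) in blast)
      ultimately show ?case by (simp add: sum.distrib)
    qed
  qed
  ultimately show "\<exists>J. ito_limit (\<lambda>u y. \<Sum>p\<in>A. indicator {0..} u * h p u y) s J \<and>
      (AE y in M. (\<Sum>p\<in>A. Y p s y) = (\<Sum>p\<in>A. Y p 0 y) + (LBINT u:{0..s}. \<Sum>p\<in>A. d p u y) + J y)"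
    by blast
qed

end

lemma cell_subset_rectangle:
  assumes "mesh xs" "mesh ys" "i \<in> cells xs" "j \<in> cells ys"
  shows "cell xs i \<times> cell ys j \<subseteq> rectangle xs ys"
proof -
  have "cell xs i \<subseteq> {hd xs..last xs}" if "mesh xs" "i \<in> cells xs" for xs i
  proof -
    have "i - 1 < length xs" "i \<le> length xs - 1" "length xs - 1 < length xs" using that by (auto simp: cells_def mesh_def)
    then show ?thesis
      using mesh_le[OF that(1), of 0 "i - 1"] mesh_le[OF that(1), of i "length xs - 1"] mesh_ends[OF that(1)]
      by (auto simp: cell_def)
  qed
  then show ?thesis using assms by (auto simp: rectangle_def)
qed

text \<open>Smoothness yields continuity on a set containing the closed rectangle, so composing with
  the continuous extensions of the solution to a closed cell stays continuous up to its
  boundary.\<close>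

lemma along_piecewise_continuous:
  assumes m: "mesh xs" "mesh ys" and c: "smooth_on (rectangle xs ys \<times> {0..} \<times> UNIV) (\<lambda>(z, t, u). c z t u)"
    and t: "0 \<le> t" and pc: "piecewise_continuous xs ys (E t y)" "piecewise_continuous xs ys (S t y)" "piecewise_continuous xs ys (T t y)"
  shows "piecewise_continuous xs ys (along c E S T t y)"
  unfolding piecewise_continuous_def
proof (intro ballI)
  fix i j assume ij: "i \<in> cells xs" "j \<in> cells ys"
  let ?R = "cell xs i \<times> cell ys j"
  have ex: "\<exists>q. continuous_on ?R q \<and> (\<forall>z\<in>interior ?R. v z = q z)" if "piecewise_continuous xs ys v" for v
    using that ij unfolding piecewise_continuous_def by blast
  obtain qE where qE: "continuous_on ?R qE" "\<forall>z\<in>interior ?R. E t y z = qE z" using ex[OF pc(1)] by blast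
  obtain qS where qS: "continuous_on ?R qS" "\<forall>z\<in>interior ?R. S t y z = qS z" using ex[OF pc(2)] by blast
  obtain qT where qT: "continuous_on ?R qT" "\<forall>z\<in>interior ?R. T t y z = qT z" using ex[OF pc(3)] by blast
  obtain D where D: "rectangle xs ys \<times> {0..} \<times> UNIV \<subseteq> D" "\<forall>n. Cn_on n D (\<lambda>(z, t, u). c z t u)"
    using c unfolding smooth_on_def by blast
  have "continuous_on D (\<lambda>(z, t, u). c z t u)" using D(2)[rule_format, of 0] by simp
  moreover have "continuous_on ?R (\<lambda>z. (z, t, qE z, qS z, qT z))" by (intro continuous_intros qE(1) qS(1) qT(1))
  moreover have "(\<lambda>z. (z, t, qE z, qS z, qT z)) ` ?R \<subseteq> D"
    using D(1) cell_subset_rectangle[OF m ij] t by (auto simp: subset_iff)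
  ultimately have "continuous_on ?R (\<lambda>z. case (z, t, qE z, qS z, qT z) of (z, t, u) \<Rightarrow> c z t u)"
    by (rule continuous_on_compose2)
  then show "\<exists>q. continuous_on ?R q \<and> (\<forall>z\<in>interior ?R. along c E S T t y z = q z)"
    using qE(2) qS(2) qT(2) by (intro exI[of _ "\<lambda>z. c z t (qE z, qS z, qT z)"]) (simp add: along_def)
qed

text \<open>The factor 4 arises from grouping four summands in pairs and applying
  \<open>square_add_le\<close> twice. Squares are spelled out as products to match
  \<open>L2_inner\<close>.\<close>

lemma linear_growth_square:
  fixes C f g r x y z :: real
  assumes "\<bar>f\<bar> + \<bar>g\<bar> + \<bar>r\<bar> \<le> C * (1 + \<bar>x\<bar> + \<bar>y\<bar> + \<bar>z\<bar>)"
  shows "f * f + g * g + r * r \<le> 4 * C\<^sup>2 * (1 * 1 + x * x + y * y + z * z)"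
proof -
  have "f * f + g * g + r * r = \<bar>f\<bar> * \<bar>f\<bar> + \<bar>g\<bar> * \<bar>g\<bar> + \<bar>r\<bar> * \<bar>r\<bar>" by (simp add: abs_mult_self_eq)
  also have "\<dots> \<le> (\<bar>f\<bar> + \<bar>g\<bar> + \<bar>r\<bar>)\<^sup>2" by (simp add: power2_eq_square algebra_simps)
  also have "\<dots> \<le> (C * (1 + \<bar>x\<bar> + \<bar>y\<bar> + \<bar>z\<bar>))\<^sup>2" using assms by (intro power_mono) auto
  also have "\<dots> = C\<^sup>2 * ((1 + \<bar>x\<bar>) + (\<bar>y\<bar> + \<bar>z\<bar>))\<^sup>2" by (simp add: power_mult_distrib add.assoc)
  also have "\<dots> \<le> C\<^sup>2 * (2 * (2 * 1\<^sup>2 + 2 * \<bar>x\<bar>\<^sup>2) + 2 * (2 * \<bar>y\<bar>\<^sup>2 + 2 * \<bar>z\<bar>\<^sup>2))"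
    by (intro mult_left_mono order.trans[OF square_add_le] add_mono square_add_le) auto
  finally show ?thesis by (simp add: power2_eq_square algebra_simps)
qed

lemma antisymmetric_form:
  fixes a :: "'i \<Rightarrow> 'i \<Rightarrow> real"
  assumes "\<And>p q. p \<in> I \<Longrightarrow> q \<in> I \<Longrightarrow> a q p = - a p q"
  shows "(\<Sum>p\<in>I. x p * (\<Sum>q\<in>I. a p q * x q)) = 0"
proof -
  have "(\<Sum>p\<in>I. \<Sum>q\<in>I. x p * (a p q * x q)) = (\<Sum>q\<in>I. \<Sum>p\<in>I. x p * (a p q * x q))" by (rule sum.swap)
  also have "\<dots> = (\<Sum>q\<in>I. \<Sum>p\<in>I. - (x q * (a q p * x p)))"
  proof (intro sum.cong refl)
    fix q p assume "q \<in> I" "p \<in> I"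
    then show "x p * (a p q * x q) = - (x q * (a q p * x p))" using assms[of q p] by simp
  qed
  finally have "(\<Sum>p\<in>I. \<Sum>q\<in>I. x p * (a p q * x q)) = - (\<Sum>p\<in>I. \<Sum>q\<in>I. x p * (a p q * x q))" by (simp add: sum_negf)
  then show ?thesis by (simp add: sum_distrib_left)
qed

text \<open>Exchanging the coordinates reduces the forms in y to those in x.\<close>

lemma Vh_swap: "v \<in> Vh xs ys k \<Longrightarrow> v \<circ> prod.swap \<in> Vh ys xs k"
  unfolding Vh_iff
proof (elim exE)
  fix c assume c: "\<forall>i\<in>cells xs. \<forall>j\<in>cells ys. \<forall>z\<in>open_cell xs ys i j.
    v z = (\<Sum>a\<le>k. \<Sum>b\<le>k. c i j a b * fst z ^ a * snd z ^ b)"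
  show "\<exists>c. \<forall>j\<in>cells ys. \<forall>i\<in>cells xs. \<forall>z\<in>open_cell ys xs j i.
    (v \<circ> prod.swap) z = (\<Sum>a\<le>k. \<Sum>b\<le>k. c j i a b * fst z ^ a * snd z ^ b)"
  proof (intro exI[of _ "\<lambda>j i b a. c i j a b"] ballI)
    fix i j z assume z: "j \<in> cells ys" "i \<in> cells xs" "z \<in> open_cell ys xs j i"
    then have "prod.swap z \<in> open_cell xs ys i j" by (auto simp: interior_cell)
    then have "v (prod.swap z) = (\<Sum>a\<le>k. \<Sum>b\<le>k. c i j a b * snd z ^ a * fst z ^ b)"
      using c z(1,2) by (simp add: prod.swap_def)
    also have "\<dots> = (\<Sum>b\<le>k. \<Sum>a\<le>k. c i j a b * snd z ^ a * fst z ^ b)" by (rule sum.swap)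
    finally show "(v \<circ> prod.swap) z = (\<Sum>b\<le>k. \<Sum>a\<le>k. c i j a b * fst z ^ b * snd z ^ a)" by (simp add: mult_ac)
  qed
qed

context dg_basis
begin

abbreviation form_x :: "(real \<times> real \<Rightarrow> real) \<Rightarrow> (real \<times> real \<Rightarrow> real) \<Rightarrow> real \<Rightarrow> real" where
  "form_x \<equiv> dg_total xs ys"

definition form_y :: "(real \<times> real \<Rightarrow> real) \<Rightarrow> (real \<times> real \<Rightarrow> real) \<Rightarrow> real \<Rightarrow> real" where
  "form_y v w \<alpha> = dg_total ys xs (v \<circ> prod.swap) (w \<circ> prod.swap) \<alpha>"

lemma form_x_expansion:
  assumes "v \<in> Vh xs ys k" "w \<in> Vh xs ys k"
  shows "form_x v w \<alpha> = (\<Sum>l<n. L2_inner xs ys v (e l) * form_x (e l) w \<alpha>)"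
  by (rule dg_total_linear[OF mesh assms(2) _ expansion[OF assms(1)]]) (simp add: e_Vh)

lemma form_y_expansion:
  assumes v: "v \<in> Vh xs ys k" "w \<in> Vh xs ys k"
  shows "form_y v w \<alpha> = (\<Sum>l<n. L2_inner xs ys v (e l) * form_y (e l) w \<alpha>)"
  unfolding form_y_def
proof (rule dg_total_linear[OF mesh(2,1) Vh_swap[OF v(2)], where e="\<lambda>l. e l \<circ> prod.swap"])
  show "agree ys xs (v \<circ> prod.swap) (\<lambda>z. \<Sum>l<n. L2_inner xs ys v (e l) * (e l \<circ> prod.swap) z)"
    using expansion[OF v(1)] by (auto simp: agree_def interior_cell)
qed (simp add: Vh_swap e_Vh)

lemma form_x_eq: "form_x v w \<alpha> = (\<Sum>p\<in>cells xs \<times> cells ys. LINT y:cell ys (snd p)|lebesgue. dg_form_x xs (fst p) v w \<alpha> y)"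
  unfolding dg_total_def sum.cartesian_product' fst_conv snd_conv by (rule sum.swap)

lemma form_y_eq: "form_y v w \<alpha> = (\<Sum>p\<in>cells xs \<times> cells ys. LINT x:cell xs (fst p)|lebesgue. dg_form_y ys (snd p) v w \<alpha> x)"
  by (simp add: form_y_def dg_total_def sum.cartesian_product' dg_form_x_def dg_form_y_def)

lemma form_x_skew: "v \<in> Vh xs ys k \<Longrightarrow> w \<in> Vh xs ys k \<Longrightarrow> form_x w v (- \<alpha>) = - form_x v w \<alpha>"
  by (rule dg_total_skew[OF mesh])

lemma form_y_skew: "v \<in> Vh xs ys k \<Longrightarrow> w \<in> Vh xs ys k \<Longrightarrow> form_y w v (- \<alpha>) = - form_y v w \<alpha>"
  unfolding form_y_def by (rule dg_total_skew[OF mesh(2,1)]) (rule Vh_swap, assumption)+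

lemma cells_inner:
  assumes "piecewise_continuous xs ys v" "l < n"
  shows "(\<Sum>p\<in>cells xs \<times> cells ys. cell_inner xs ys (fst p) (snd p) v (e l)) = L2_inner xs ys v (e l)"
  using L2_inner_eq_sum_cells[OF mesh assms(1) Vh_piecewise_continuous[OF e_Vh[OF assms(2)]]]
  by (simp add: sum.cartesian_product')

text \<open>Bessel's inequality for the coefficients, the growth bound integrated over the
  rectangle, and Parseval's identity for the solution. The product of the constant 1 with itself is
  the area of the rectangle, which the constant term of the growth bound brings in.\<close>

lemma projected_growth:
  assumes h: "piecewise_continuous xs ys f" "piecewise_continuous xs ys g" "piecewise_continuous xs ys r"
    and v: "u \<in> Vh xs ys k" "v \<in> Vh xs ys k" "w \<in> Vh xs ys k"
    and le: "\<And>z. z \<in> rectangle xs ys \<Longrightarrow> \<bar>f z\<bar> + \<bar>g z\<bar> + \<bar>r z\<bar> \<le> C * (1 + \<bar>u z\<bar> + \<bar>v z\<bar> + \<bar>w z\<bar>)"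
  shows "(\<Sum>l<n. (L2_inner xs ys f (e l))\<^sup>2) + (\<Sum>l<n. (L2_inner xs ys g (e l))\<^sup>2) + (\<Sum>l<n. (L2_inner xs ys r (e l))\<^sup>2) \<le>
    4 * C\<^sup>2 * (1 + L2_inner xs ys (\<lambda>_. 1) (\<lambda>_. 1)) * (1 + ((\<Sum>l<n. (L2_inner xs ys u (e l))\<^sup>2) +
      (\<Sum>l<n. (L2_inner xs ys v (e l))\<^sup>2) + (\<Sum>l<n. (L2_inner xs ys w (e l))\<^sup>2)))"
proof -
  have i: "set_integrable lebesgue (rectangle xs ys) (\<lambda>z. q z * q z)" if "piecewise_continuous xs ys q" for q
    by (intro set_integrable_rectangle mesh piecewise_continuous_mult that)
  note iv = i[OF Vh_piecewise_continuous[OF v(1)]] i[OF Vh_piecewise_continuous[OF v(2)]] i[OF Vh_piecewise_continuous[OF v(3)]]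
  note i1 = i[OF piecewise_continuous_const[of xs ys 1]]
  have "L2_inner xs ys f f + L2_inner xs ys g g + L2_inner xs ys r r = (LINT z:rectangle xs ys|lebesgue. f z * f z + g z * g z + r z * r z)"
    unfolding L2_inner_def by (simp only: set_integral_add i h)
  also have "\<dots> \<le> (LINT z:rectangle xs ys|lebesgue. 4 * C\<^sup>2 * (1 * 1 + u z * u z + v z * v z + w z * w z))"
    by (rule set_integral_mono) (intro set_integral_add set_integrable_mult_right i h iv i1 linear_growth_square le; assumption)+
  also have "\<dots> = 4 * C\<^sup>2 * (L2_inner xs ys (\<lambda>_. 1) (\<lambda>_. 1) + L2_inner xs ys u u + L2_inner xs ys v v + L2_inner xs ys w w)"
    by (subst set_integral_mult_right) (simp only: L2_inner_def set_integral_add iv i1)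
  also have "\<dots> \<le> 4 * C\<^sup>2 * ((1 + L2_inner xs ys (\<lambda>_. 1) (\<lambda>_. 1)) * (1 + (L2_inner xs ys u u + L2_inner xs ys v v + L2_inner xs ys w w)))"
    using L2_inner_nonneg[of xs ys "\<lambda>_. 1"] L2_inner_nonneg[of xs ys u] L2_inner_nonneg[of xs ys v] L2_inner_nonneg[of xs ys w]
    by (intro mult_left_mono) (simp_all add: algebra_simps)
  finally show ?thesis
    using bessel[OF h(1)] bessel[OF h(2)] bessel[OF h(3)]
    by (simp add: parseval[OF v(1), symmetric] parseval[OF v(2), symmetric] parseval[OF v(3), symmetric] L2_norm_square mult.assoc)
qed

end

text \<open>The coordinates of the solution are \<open>X (c, l) = \<langle>u\<^sub>c, e\<^sub>l\<rangle>\<close> with \<open>u\<^sub>0, u\<^sub>1, u\<^sub>2 = E, S, T\<close>.  They are cut off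
  at negative times, about which nothing is known.\<close>

theorem theorem3p4:
  fixes M :: "'w measure" and F :: "real \<Rightarrow> 'w measure" and W :: "real \<Rightarrow> 'w \<Rightarrow> real"
    and xs ys :: "real list" and k :: nat and \<alpha>1 \<alpha>2 C :: real
    and f g r :: "real \<times> real \<Rightarrow> real \<Rightarrow> real \<times> real \<times> real \<Rightarrow> real"
    and E S T :: "real \<Rightarrow> 'w \<Rightarrow> real \<times> real \<Rightarrow> real"
    and E0 S0 T0 :: "real \<times> real \<Rightarrow> real"
  assumes "prob_space M"
    and "filtration (space M) F" and "\<forall>t. sets (F t) \<subseteq> sets M"
    and "brownian_motion M F W"
    and "mesh xs" and "mesh ys"
    and smooth: "\<forall>c\<in>{f, g, r}.
        smooth_on (rectangle xs ys \<times> {0..} \<times> UNIV) (\<lambda>(z, t, u). c z t u)"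
    and lipschitz: "\<forall>z\<in>rectangle xs ys. \<forall>t\<ge>0. \<forall>u1 u2.
        \<bar>f z t u1 - f z t u2\<bar> + \<bar>g z t u1 - g z t u2\<bar> + \<bar>r z t u1 - r z t u2\<bar> \<le> C * norm (u1 - u2)"
    and growth: "\<forall>z\<in>rectangle xs ys. \<forall>t\<ge>0. \<forall>e s \<theta>.
        \<bar>f z t (e, s, \<theta>)\<bar> + \<bar>g z t (e, s, \<theta>)\<bar> + \<bar>r z t (e, s, \<theta>)\<bar>
          \<le> C * (1 + \<bar>e\<bar> + \<bar>s\<bar> + \<bar>\<theta>\<bar>)"
    and "Vh_process M F xs ys k E" and "Vh_process M F xs ys k S" and "Vh_process M F xs ys k T"
    and "E0 \<in> Vh xs ys k" and "S0 \<in> Vh xs ys k" and "T0 \<in> Vh xs ys k"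
    and initial: "AE \<omega> in M. E 0 \<omega> = E0 \<and> S 0 \<omega> = S0 \<and> T 0 \<omega> = T0"
    and scheme_E: "\<forall>\<phi>\<in>Vh xs ys k. \<forall>i\<in>cells xs. \<forall>j\<in>cells ys. ito_differential M F W
        (\<lambda>t \<omega>. cell_inner xs ys i j (E t \<omega>) \<phi>)
        (\<lambda>t \<omega>. - (LINT y:cell ys j|lebesgue. dg_form_x xs i (T t \<omega>) \<phi> \<alpha>1 y)
                + (LINT x:cell xs i|lebesgue. dg_form_y ys j (S t \<omega>) \<phi> (- \<alpha>2) x))
        (\<lambda>t \<omega>. cell_inner xs ys i j (along f E S T t \<omega>) \<phi>)"
    and scheme_S: "\<forall>\<psi>\<in>Vh xs ys k. \<forall>i\<in>cells xs. \<forall>j\<in>cells ys. ito_differential M F W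
        (\<lambda>t \<omega>. cell_inner xs ys i j (S t \<omega>) \<psi>)
        (\<lambda>t \<omega>. LINT x:cell xs i|lebesgue. dg_form_y ys j (E t \<omega>) \<psi> \<alpha>2 x)
        (\<lambda>t \<omega>. cell_inner xs ys i j (along g E S T t \<omega>) \<psi>)"
    and scheme_T: "\<forall>\<phi>\<in>Vh xs ys k. \<forall>i\<in>cells xs. \<forall>j\<in>cells ys. ito_differential M F W
        (\<lambda>t \<omega>. cell_inner xs ys i j (T t \<omega>) \<phi>)
        (\<lambda>t \<omega>. - (LINT y:cell ys j|lebesgue. dg_form_x xs i (E t \<omega>) \<phi> (- \<alpha>1) y))
        (\<lambda>t \<omega>. cell_inner xs ys i j (along r E S T t \<omega>) \<phi>)"
  defines "energy \<equiv> \<lambda>t \<omega>.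
      (L2_norm xs ys (E t \<omega>))\<^sup>2 + (L2_norm xs ys (S t \<omega>))\<^sup>2 + (L2_norm xs ys (T t \<omega>))\<^sup>2"
    and "noise \<equiv> \<lambda>\<tau> \<omega>.
      (L2_norm xs ys (L2_proj xs ys k (along f E S T \<tau> \<omega>)))\<^sup>2
      + (L2_norm xs ys (L2_proj xs ys k (along g E S T \<tau> \<omega>)))\<^sup>2
      + (L2_norm xs ys (L2_proj xs ys k (along r E S T \<tau> \<omega>)))\<^sup>2"
  shows "\<forall>t\<ge>0.
      integrable M (energy t) \<and>
      (\<forall>\<tau>\<in>{0..t}. integrable M (noise \<tau>)) \<and>
      set_integrable lborel {0..t} (\<lambda>\<tau>. LINT \<omega>|M. noise \<tau> \<omega>) \<and>
      (LINT \<omega>|M. energy t \<omega>) =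
        (L2_norm xs ys E0)\<^sup>2 + (L2_norm xs ys S0)\<^sup>2 + (L2_norm xs ys T0)\<^sup>2
        + (LINT \<tau>:{0..t}|lborel. LINT \<omega>|M. noise \<tau> \<omega>)"
proof (intro allI impI)
  fix t :: real assume t: "0 \<le> t"
  interpret brownian M F W using assms(1-4) by (simp add: brownian_def brownian_axioms_def)
  note m = assms(5,6)
  obtain n e where on: "orthonormal_family xs ys k n e"
    and ex: "\<forall>v\<in>Vh xs ys k. agree xs ys v (\<lambda>z. \<Sum>l<n. L2_inner xs ys v (e l) * e l z)"
    using Vh_orthonormal_basis[OF m] by blast
  interpret dg_basis xs ys k n e using m on ex by unfold_locales auto
  define U where "U c = (if c = 0 then E else if c = 1 then S else T)" for c :: nat
  define G where "G c = (if c = 0 then f else if c = 1 then g else r)" for c :: nat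
  define U0 where "U0 c = (if c = 0 then E0 else if c = 1 then S0 else T0)" for c :: nat
  define A where "A = cells xs \<times> cells ys"
  \<comment> \<open>The cell drifts of the three equations under one index, so that one summation
    over the cells treats all components.\<close>
  define D where "D c \<phi> p u w = (if c = 0 then
      - (LINT y:cell ys (snd p)|lebesgue. dg_form_x xs (fst p) (T u w) \<phi> \<alpha>1 y)
      + (LINT x:cell xs (fst p)|lebesgue. dg_form_y ys (snd p) (S u w) \<phi> (- \<alpha>2) x)
    else if c = 1 then LINT x:cell xs (fst p)|lebesgue. dg_form_y ys (snd p) (E u w) \<phi> \<alpha>2 x
    else - (LINT y:cell ys (snd p)|lebesgue. dg_form_x xs (fst p) (E u w) \<phi> (- \<alpha>1) y))" for c :: nat and \<phi> p u w
  \<comment> \<open>The basis function of the unknown is the first argument of a form, the test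
    function the second. Transposing a pair of entries exchanges the arguments and flips the sign of
    the flux parameter; this is where the opposite fluxes of the scheme give antisymmetry.\<close>
  define a where "a = (\<lambda>(c :: nat, l) (c' :: nat, j). if c = 0 \<and> c' = 1 then form_y (e j) (e l) (- \<alpha>2)
    else if c = 0 \<and> c' = 2 then - form_x (e j) (e l) \<alpha>1 else if c = 1 \<and> c' = 0 then form_y (e j) (e l) \<alpha>2
    else if c = 2 \<and> c' = 0 then - form_x (e j) (e l) (- \<alpha>1) else 0)"
  define I where "I = {..<3 :: nat} \<times> {..<n}"
  define X where "X p u w = indicator {0..} u * L2_inner xs ys (U (fst p) u w) (e (snd p))" for p u w
  \<comment> \<open>Written as a sum over cells, as \<open>ito_differential_sum\<close> delivers it;
    at nonnegative times it is the L2 product with a basis function.\<close>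
  define H where "H p u w = (\<Sum>q\<in>A. indicator {0..} u * cell_inner xs ys (fst q) (snd q) (along (G (fst p)) E S T u w) (e (snd p)))" for p u w
  define x0 where "x0 p = L2_inner xs ys (U0 (fst p)) (e (snd p))" for p
  define K where "K = 4 * C\<^sup>2 * (1 + L2_inner xs ys (\<lambda>_. 1) (\<lambda>_. 1))"
  have sum_I: "(\<Sum>p\<in>I. h p) = (\<Sum>l<n. h (0, l)) + (\<Sum>l<n. h (1, l)) + (\<Sum>l<n. h (2, l))" for h :: "_ \<Rightarrow> real"
    by (simp add: I_def sum.cartesian_product' numeral_3_eq_3 numeral_2_eq_2)
  have finA: "finite A" by (simp add: A_def cells_def)
  have UV: "U c u w \<in> Vh xs ys k" and U_adapted: "\<phi> \<in> Vh xs ys k \<Longrightarrow> measurable_adapted M F (\<lambda>u w. L2_inner xs ys (U c u w) \<phi>)"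
    if "0 \<le> u" "w \<in> space M" for c u w \<phi>
    using assms(10-12) that by (auto simp: Vh_process_def U_def)
  have ESTV: "E u w \<in> Vh xs ys k" "S u w \<in> Vh xs ys k" "T u w \<in> Vh xs ys k" if "0 \<le> u" "w \<in> space M" for u w
    using UV[OF that, of 0] UV[OF that, of 1] UV[OF that, of 2] by (simp_all add: U_def)
  have G_pc: "piecewise_continuous xs ys (along (G c) E S T u w)" if "0 \<le> u" "w \<in> space M" for c u w
    by (rule along_piecewise_continuous[OF m _ that(1)])
      (use smooth ESTV[OF that, THEN Vh_piecewise_continuous] in \<open>auto simp: G_def\<close>)
  have H_eq: "H p u w = L2_inner xs ys (along (G (fst p)) E S T u w) (e (snd p))" if "p \<in> I" "0 \<le> u" "w \<in> space M" for p u w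
    using cells_inner[OF G_pc[OF that(2,3)], of "snd p" "fst p"] that by (auto simp: H_def A_def I_def)
  have X_eq: "X p u w = L2_inner xs ys (U (fst p) u w) (e (snd p))" if "0 \<le> u" for p u w using that by (simp add: X_def)
  have X_sum: "(\<Sum>q\<in>A. cell_inner xs ys (fst q) (snd q) (U (fst p) u w) (e (snd p))) = X p u w"
    if "p \<in> I" "0 \<le> u" "w \<in> space M" for p u w
    using cells_inner[OF Vh_piecewise_continuous[OF UV[OF that(2,3)]], of "snd p" "fst p"] that by (auto simp: X_def A_def I_def)
  \<comment> \<open>Summed over the cells the drift is a global form, linear in the solution;
    expanding the solution in the basis produces the matrix \<open>a\<close>.\<close>
  have D_sum: "(\<Sum>q\<in>A. D (fst p) (e (snd p)) q u w) = (\<Sum>q\<in>I. a p q * X q u w)"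
    if p: "p \<in> I" and u: "0 \<le> u" "w \<in> space M" for p u w
  proof -
    have l: "e (snd p) \<in> Vh xs ys k" using p by (auto simp: I_def intro: e_Vh)
    have "fst p = 0 \<or> fst p = 1 \<or> fst p = 2" using p by (auto simp: I_def)
    moreover obtain c l where "p = (c, l)" by (cases p)
    ultimately show ?thesis
      using form_x_expansion[OF _ l, of "T u w" \<alpha>1] form_x_expansion[OF _ l, of "E u w" "- \<alpha>1"]
        form_y_expansion[OF _ l, of "S u w" "- \<alpha>2"] form_y_expansion[OF _ l, of "E u w" \<alpha>2] ESTV[OF u]
      by (auto simp: sum_I a_def D_def X_eq[OF u(1)] U_def sum_subtractf sum_negf form_x_eq[folded A_def, symmetric]
        form_y_eq[folded A_def, symmetric] mult.commute)
  qed
  have ito: "ito_differential M F W (\<lambda>u w. cell_inner xs ys (fst q) (snd q) (U (fst p) u w) (e (snd p))) (D (fst p) (e (snd p)) q)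
      (\<lambda>u w. cell_inner xs ys (fst q) (snd q) (along (G (fst p)) E S T u w) (e (snd p)))" if "p \<in> I" "q \<in> A" for p q
  proof -
    have l: "e (snd p) \<in> Vh xs ys k" and q: "fst q \<in> cells xs" "snd q \<in> cells ys" using that by (auto simp: I_def A_def intro: e_Vh)
    have "fst p = 0 \<or> fst p = 1 \<or> fst p = 2" using that by (auto simp: I_def)
    then show ?thesis
      using scheme_E[rule_format, OF l q] scheme_S[rule_format, OF l q] scheme_T[rule_format, OF l q]
      by (elim disjE) (simp_all add: U_def G_def D_def[abs_def])
  qed
  have sums: "square_integrable_on 0 s (H p)" "AE w in M. set_integrable lborel {0..s} (\<lambda>u. \<Sum>q\<in>A. D (fst p) (e (snd p)) q u w)"
    "\<exists>J. ito_limit (H p) s J \<and> (AE w in M. (\<Sum>q\<in>A. cell_inner xs ys (fst q) (snd q) (U (fst p) s w) (e (snd p))) =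
      (\<Sum>q\<in>A. cell_inner xs ys (fst q) (snd q) (U (fst p) 0 w) (e (snd p))) + (LBINT u:{0..s}. \<Sum>q\<in>A. D (fst p) (e (snd p)) q u w) + J w)"
    if p: "p \<in> I" and s: "0 \<le> s" for p s
    using ito_differential_sum[where Y="\<lambda>q u w. cell_inner xs ys (fst q) (snd q) (U (fst p) u w) (e (snd p))", OF finA ito[OF p] s]
    by (simp_all add: H_def[abs_def])
  have initial': "AE w in M. \<forall>p\<in>I. X p 0 w = x0 p"
    using initial by eventually_elim (simp add: X_def x0_def U_def U0_def)
  have cs: "conservative_system M F W I X H x0 a K"
    unfolding conservative_system_def conservative_system_axioms_def
  proof (intro conjI allI impI)
    show "brownian M F W" by unfold_locales
    show "finite I" by (simp add: I_def)
    show "jointly_measurable M (X p)" if "p \<in> I" for p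
    proof -
      \<comment> \<open>Any sample point serves: \<open>U_adapted\<close> was recorded under the
        premise of a given one, although its conclusion does not mention it.\<close>
      obtain w where "w \<in> space M" using not_empty by blast
      moreover have "e (snd p) \<in> Vh xs ys k" using that by (auto simp: I_def intro: e_Vh)
      ultimately show ?thesis
        unfolding X_def[abs_def] by (intro jointly_measurable_of_adapted[of M F] U_adapted[OF order_refl])
    qed
    show "X p s \<in> borel_measurable (F s)" if "p \<in> I" "0 \<le> s" for p s
    proof -
      obtain w where "w \<in> space M" using not_empty by blast
      moreover have "e (snd p) \<in> Vh xs ys k" using that by (auto simp: I_def intro: e_Vh)
      ultimately show ?thesis
        using U_adapted[OF order_refl, of w "e (snd p)" "fst p"] that(2) by (simp add: X_def[abs_def] measurable_adapted_def)
    qed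
    show "square_integrable_on 0 s (H p)" if "p \<in> I" "0 \<le> s" for p s
      by (rule sums(1)[OF that])
    show "(\<Sum>p\<in>I. X p s w * (\<Sum>q\<in>I. a p q * X q s w)) = 0" for s w
    proof (rule antisymmetric_form)
      fix p q assume "p \<in> I" "q \<in> I"
      then show "a q p = - a p q"
        using form_x_skew[OF e_Vh e_Vh, of "snd p" "snd q" \<alpha>1] form_x_skew[OF e_Vh e_Vh, of "snd q" "snd p" \<alpha>1]
          form_y_skew[OF e_Vh e_Vh, of "snd p" "snd q" \<alpha>2] form_y_skew[OF e_Vh e_Vh, of "snd q" "snd p" \<alpha>2]
        by (auto simp: a_def I_def split: prod.splits)
    qed
    show "AE w in M. set_integrable lborel {0..s} (\<lambda>u. \<Sum>q\<in>I. a p q * X q u w)" if p: "p \<in> I" and s: "0 \<le> s" for p s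
      using sums(2)[OF p s] AE_space
    proof eventually_elim
      case (elim w)
      have "set_integrable lborel {0..s} (\<lambda>u. \<Sum>q\<in>A. D (fst p) (e (snd p)) q u w) = set_integrable lborel {0..s} (\<lambda>u. \<Sum>q\<in>I. a p q * X q u w)"
        by (rule set_integrable_cong) (use D_sum[OF p _ elim(2)] in auto)
      then show ?case using elim(1) by simp
    qed
    show "\<exists>J. ito_limit (H p) s J \<and> (AE w in M. X p s w = x0 p + (LBINT u:{0..s}. \<Sum>q\<in>I. a p q * X q u w) + J w)"
      if p: "p \<in> I" and s: "0 \<le> s" for p s
    proof -
      obtain J where J: "ito_limit (H p) s J" and eq: "AE w in M. (\<Sum>q\<in>A. cell_inner xs ys (fst q) (snd q) (U (fst p) s w) (e (snd p))) =
          (\<Sum>q\<in>A. cell_inner xs ys (fst q) (snd q) (U (fst p) 0 w) (e (snd p))) + (LBINT u:{0..s}. \<Sum>q\<in>A. D (fst p) (e (snd p)) q u w) + J w"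
        using sums(3)[OF p s] by blast
      have "AE w in M. X p s w = x0 p + (LBINT u:{0..s}. \<Sum>q\<in>I. a p q * X q u w) + J w"
        using eq initial' AE_space
      proof eventually_elim
        case (elim w)
        have "(LBINT u:{0..s}. \<Sum>q\<in>A. D (fst p) (e (snd p)) q u w) = (LBINT u:{0..s}. \<Sum>q\<in>I. a p q * X q u w)"
          by (rule set_lebesgue_integral_cong) (use D_sum[OF p _ elim(3)] in auto)
        then show ?case using elim(1,2) p s by (simp add: X_sum[OF p _ elim(3)])
      qed
      then show ?thesis using J by blast
    qed
    show "(\<Sum>p\<in>I. (H p s w)\<^sup>2) \<le> K * (1 + (\<Sum>p\<in>I. (X p s w)\<^sup>2))" if s: "0 \<le> s" "w \<in> space M" for s w
    proof -
      have "(\<Sum>p\<in>I. (H p s w)\<^sup>2) = (\<Sum>p\<in>I. (L2_inner xs ys (along (G (fst p)) E S T s w) (e (snd p)))\<^sup>2)"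
        by (rule sum.cong[OF refl]) (simp add: H_eq[OF _ s])
      moreover have "(\<Sum>p\<in>I. (X p s w)\<^sup>2) = (\<Sum>p\<in>I. (L2_inner xs ys (U (fst p) s w) (e (snd p)))\<^sup>2)"
        by (simp add: X_eq[OF s(1)])
      ultimately show ?thesis
        unfolding K_def sum_I fst_conv snd_conv
        using projected_growth[OF G_pc[OF s, of 0] G_pc[OF s, of 1] G_pc[OF s, of 2] UV[OF s, of 0] UV[OF s, of 1] UV[OF s, of 2], of C] growth s(1)
        by (simp add: G_def U_def along_def)
    qed
    show "0 \<le> K" using L2_inner_nonneg[of xs ys "\<lambda>_. 1"] by (simp add: K_def)
  qed
  have en: "conservative_system.energy I X u w = energy u w" if "0 \<le> u" "w \<in> space M" for u w
    using ESTV[OF that, THEN parseval] by (simp add: conservative_system.energy_def[OF cs] energy_def sum_I X_eq[OF that(1)] U_def)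
  have no: "conservative_system.noise I H u w = noise u w" if "0 \<le> u" "w \<in> space M" for u w
  proof -
    have "conservative_system.noise I H u w = (\<Sum>p\<in>I. (L2_inner xs ys (along (G (fst p)) E S T u w) (e (snd p)))\<^sup>2)"
      unfolding conservative_system.noise_def[OF cs] by (rule sum.cong[OF refl]) (simp add: H_eq[OF _ that])
    then show ?thesis
      using L2_norm_projection[OF G_pc[OF that, of 0]] L2_norm_projection[OF G_pc[OF that, of 1]] L2_norm_projection[OF G_pc[OF that, of 2]]
      by (simp add: noise_def sum_I G_def)
  qed
  note eb = conservative_system.energy_balance[OF cs initial']
  have ni: "integrable M (noise u)" if "0 \<le> u" for u
    using eb(2)[OF that] by (subst (asm) Bochner_Integration.integrable_cong[OF refl no[OF that]])
  have En: "\<E> (conservative_system.noise I H u) = \<E> (noise u)" if "0 \<le> u" for u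
    by (rule Bochner_Integration.integral_cong[OF refl no[OF that]])
  have "set_integrable lborel {0..t} (\<lambda>u. \<E> (noise u))"
    using eb(3)[OF t] by (subst (asm) set_integrable_cong[OF refl refl, of _ _ "\<lambda>u. \<E> (noise u)"]) (auto simp: En)
  moreover have "(LBINT u:{0..t}. \<E> (conservative_system.noise I H u)) = (LBINT u:{0..t}. \<E> (noise u))"
    by (rule set_lebesgue_integral_cong) (auto simp: En)
  moreover have "integrable M (energy t)"
    using eb(1)[OF t] by (subst (asm) Bochner_Integration.integrable_cong[OF refl en[OF t]])
  moreover have "\<E> (conservative_system.energy I X t) = \<E> (energy t)"
    by (rule Bochner_Integration.integral_cong[OF refl en[OF t]])
  moreover have "(\<Sum>p\<in>I. (x0 p)\<^sup>2) = (L2_norm xs ys E0)\<^sup>2 + (L2_norm xs ys S0)\<^sup>2 + (L2_norm xs ys T0)\<^sup>2"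
    using assms(13-15) by (simp add: sum_I x0_def U0_def parseval)
  ultimately show "integrable M (energy t) \<and> (\<forall>\<tau>\<in>{0..t}. integrable M (noise \<tau>)) \<and>
      set_integrable lborel {0..t} (\<lambda>\<tau>. LINT w|M. noise \<tau> w) \<and>
      (LINT w|M. energy t w) = (L2_norm xs ys E0)\<^sup>2 + (L2_norm xs ys S0)\<^sup>2 + (L2_norm xs ys T0)\<^sup>2
        + (LINT \<tau>:{0..t}|lborel. LINT w|M. noise \<tau> w)"
    using eb(4)[OF t] ni by simp
qed

end
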